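(* For any $\epsilon>0$, the fluid show-all inventory problem $\max_{c\in\mathcal F}\mathcal R(c)$ under the consider-fit-then-choose (CFTC) model with adjacent-size substitution (all defined in the context) can be approximated within a factor $\frac12-\epsilon$ of optimal; that is, there is an algorithm that outputs $\tilde c\in\mathcal F$ with $\mathcal R(\tilde c)\ge(\frac12-\epsilon)\max_{c\in\mathcal F}\mathcal R(c)$. The running time of this algorithm is $$O\!\left(m\cdot\left(\frac{n\,\mathcal C\,\Delta}{\epsilon^2}\right)^{O\left(\frac{1}{\epsilon^2}\log\Delta\right)}\right),\qquad \Delta=\frac{\max_i w_i}{\min_i w_i}.$$
   Context: CFTC model with adjacent-size substitution. There are bases $\mathcal N=\{1,\dots,n\}$ and ordered sizes $\mathcal S=\{1,\dots,m\}$; base $i$ can be offered only in sizes in a given subset $\mathcal S_i\subseteq\mathcal S$. The product universe is $\mathcal U=\{(i,s): i\in\mathcal N,\ s\in\mathcal S_i\}$; every product of base $i$ has revenue $r_i\ge0$ (independent of size). There is a finite set $\mathcal G$ of customer types; type $g$ arrives with probability $\mu_g\ge0$ ($\sum_g\mu_g=1$) and is identified with a triple $(s_g,\tau_g,\ell_g)\in\mathcal S\times\{\uparrow,\downarrow\}\times\{0,1\}$ (preferred size, direction of size substitution, maximum size deviation). Base weights $w_i>0$ are common to all types; each type has fit-discount factors $\beta_{0,g}\ge\beta_{1,g}\ge\cdots\ge\beta_{m-1,g}>0$. Given an assortment $A\subseteq\mathcal U$, a type-$g$ customer considers, for each base $i$, at most one size: if $\tau_g=\uparrow$, the smallest $s\in[s_g,s_g+\ell_g]$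 with $(i,s)\in A$; if $\tau_g=\downarrow$, the largest $s\in[s_g-\ell_g,s_g]$ with $(i,s)\in A$; if there is none, base $i$ is not considered. $C_g(A)$ is the set of considered products. With $w_{i,s,g}=w_i\beta_{|s-s_g|,g}$, a type-$g$ customer buys $(i,s)\in C_g(A)$ with probability $\pi_g((i,s),A)=w_{i,s,g}/\bigl(1+\sum_{(j,\sigma)\in C_g(A)}w_{j,\sigma,g}\bigr)$, and buys products outside $C_g(A)$ with probability $0$. Put $\pi((i,s),A)=\sum_g\mu_g\pi_g((i,s),A)$. Fluid show-all process. $\mathcal C\in\mathbb Z_+$ is the capacity, $T$ the horizon length, and $\mathcal F=\{c\in\mathbb Z_+^{n\times m}:\|c\|_1\le\mathcal C\}$ (with $c_{i,s}=0$ for $(i,s)\notin\mathcal U$). Starting from inventory $c$, at every moment of the continuous horizon $[0,T]$ the displayed assortment $A$ is the set of all products with positive remaining inventory, and the inventory of each $(i,s)\in A$ is consumed at rate $\pi((i,s),A)$; when a product's inventory reaches zero it leaves the displayed assortment. Let $x_{(i,s)}(c)$ be the total amount of product $(i,s)$ consumed over $[0,T]$, and $\mathcal R(c)=\sum_{(i,s)\in\mathcal U}r_i\,x_{(i,s)}(c)$.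
   Formalization: In the running-time bound, log Δ is read as log max(2, Δ) and the capacity C as max(1, C), because literally the bound would be O(m) at Δ = 1 (too little time to read n revenues) and zero at C = 0. *)

theory Defs
  imports "HOL-Analysis.Analysis"
begin

section \<open>CFTC instances with adjacent-size substitution\<close>

datatype direction = Up | Down

text \<open>A product is a pair (base, size); a customer type is a triple (preferred size, direction of
  substitution, maximum size deviation).\<close>

type_synonym product = "nat \<times> nat"
type_synonym ctype = "nat \<times> direction \<times> nat"

record cftc =
  nbases   :: nat
  nsizes   :: nat
  capacity :: nat
  horizon  :: real
  offered  :: "nat \<Rightarrow> nat set"
  revenue  :: "nat \<Rightarrow> real"
  types    :: "ctype set"
  arrival  :: "ctype \<Rightarrow> real"
  weight   :: "nat \<Rightarrow> real"
  fit      :: "nat \<Rightarrow> ctype \<Rightarrow> real"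

definition cftc_instance :: "cftc \<Rightarrow> bool" where
  "cftc_instance I \<longleftrightarrow>
     1 \<le> nbases I \<and> 1 \<le> nsizes I \<and> 0 \<le> horizon I \<and>
     (\<forall>i\<in>{1..nbases I}. offered I i \<subseteq> {1..nsizes I} \<and> 0 \<le> revenue I i \<and> 0 < weight I i) \<and>
     types I \<subseteq> {1..nsizes I} \<times> UNIV \<times> {0, 1} \<and>
     (\<forall>g\<in>types I. 0 \<le> arrival I g) \<and> (\<Sum>g\<in>types I. arrival I g) = 1 \<and>
     (\<forall>g\<in>types I. (\<forall>k<nsizes I. 0 < fit I k g) \<and>
                  (\<forall>k. Suc k < nsizes I \<longrightarrow> fit I (Suc k) g \<le> fit I k g))"

definition universe :: "cftc \<Rightarrow> product set" where
  "universe I = (SIGMA i:{1..nbases I}. offered I i)"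

definition weight_ratio :: "cftc \<Rightarrow> real" where
  "weight_ratio I = Max (weight I ` {1..nbases I}) / Min (weight I ` {1..nbases I})"

section \<open>Consider-fit-then-choose\<close>

text \<open>Truncated subtraction is harmless in the downward window: size 0 does not occur in the
  universe.\<close>

fun considered :: "ctype \<Rightarrow> product set \<Rightarrow> product set" where
  "considered (sg, Up, l) A =
     {(i, s). s \<in> {sg..sg + l} \<and> (i, s) \<in> A \<and> (\<forall>s'\<in>{sg..sg + l}. (i, s') \<in> A \<longrightarrow> s \<le> s')}"
| "considered (sg, Down, l) A =
     {(i, s). s \<in> {sg - l..sg} \<and> (i, s) \<in> A \<and> (\<forall>s'\<in>{sg - l..sg}. (i, s') \<in> A \<longrightarrow> s' \<le> s)}"

definition pref_weight :: "cftc \<Rightarrow> ctype \<Rightarrow> product \<Rightarrow> real" where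
  "pref_weight I g p = weight I (fst p) * fit I (nat \<bar>int (snd p) - int (fst g)\<bar>) g"

definition type_choice_prob :: "cftc \<Rightarrow> ctype \<Rightarrow> product \<Rightarrow> product set \<Rightarrow> real" where
  "type_choice_prob I g p A =
     (if p \<in> considered g A
      then pref_weight I g p / (1 + (\<Sum>q\<in>considered g A. pref_weight I g q)) else 0)"

definition choice_prob :: "cftc \<Rightarrow> product \<Rightarrow> product set \<Rightarrow> real" where
  "choice_prob I p A = (\<Sum>g\<in>types I. arrival I g * type_choice_prob I g p A)"

section \<open>The fluid show-all process\<close>

definition displayed :: "cftc \<Rightarrow> (product \<Rightarrow> real) \<Rightarrow> product set" where
  "displayed I z = {p \<in> universe I. 0 < z p}"

text \<open>\<open>y t p\<close> is the inventory of product \<open>p\<close> remaining at time \<open>t\<close>, started from \<open>z\<close>.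
  Consumption at rate \<^const>\<open>choice_prob\<close> is expressed in integrated form, since the rates jump
  whenever a product is depleted; a product that is not displayed has rate 0.\<close>

definition fluid_path ::
    "cftc \<Rightarrow> real \<Rightarrow> (product \<Rightarrow> real) \<Rightarrow> (real \<Rightarrow> product \<Rightarrow> real) \<Rightarrow> bool" where
  "fluid_path I T z y \<longleftrightarrow>
     (\<forall>p\<in>universe I. \<forall>t\<in>{0..T}.
        ((\<lambda>u. choice_prob I p (displayed I (y u))) has_integral (z p - y t p)) {0..t})"

text \<open>The description is proper by \<open>fluid_path_exists\<close> and \<open>fluid_path_unique\<close> below.\<close>

definition consumption :: "cftc \<Rightarrow> (product \<Rightarrow> nat) \<Rightarrow> product \<Rightarrow> real" where
  "consumption I c p =
     (THE x. \<exists>y. fluid_path I (horizon I) (\<lambda>q. real (c q)) y \<and> x = real (c p) - y (horizon I) p)"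

definition fluid_revenue :: "cftc \<Rightarrow> (product \<Rightarrow> nat) \<Rightarrow> real" where
  "fluid_revenue I c = (\<Sum>p\<in>universe I. revenue I (fst p) * consumption I c p)"

definition feasible :: "cftc \<Rightarrow> (product \<Rightarrow> nat) set" where
  "feasible I = {c. (\<forall>p. p \<notin> universe I \<longrightarrow> c p = 0) \<and> (\<Sum>p\<in>universe I. c p) \<le> capacity I}"

section \<open>Well-definedness of the process and of the optimum\<close>

lemma finite_universe:
  assumes "cftc_instance I" shows "finite (universe I)"
proof -
  have "finite (offered I i)" if "i \<in> {1..nbases I}" for i
  proof (rule finite_subset)
    show "offered I i \<subseteq> {1..nsizes I}"
      using assms that unfolding cftc_instance_def by blast
  qed simp
  thus ?thesis unfolding universe_def by (intro finite_SigmaI) simp_all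
qed

lemma considered_subset: "considered g A \<subseteq> A"
  by (cases "(g, A)" rule: considered.cases) auto

lemma considered_deviation:
  assumes "cftc_instance I" "g \<in> types I" "A \<subseteq> universe I" "q \<in> considered g A"
  shows "nat \<bar>int (snd q) - int (fst g)\<bar> < nsizes I"
proof -
  obtain i s where q: "q = (i, s)" by (cases q)
  have "q \<in> universe I" using assms considered_subset by blast
  hence "s \<in> {1..nsizes I}"
    using assms(1) unfolding universe_def cftc_instance_def q by blast
  moreover have "fst g \<in> {1..nsizes I}" using assms(1,2) by (auto simp: cftc_instance_def)
  ultimately show ?thesis by (auto simp: q)
qed

lemma pref_weight_pos:
  assumes "cftc_instance I" "g \<in> types I" "A \<subseteq> universe I" "q \<in> considered g A"
  shows "0 < pref_weight I g q"
proof -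
  have "q \<in> universe I" using assms considered_subset by blast
  hence "0 < weight I (fst q)" using assms(1) by (auto simp: universe_def cftc_instance_def)
  moreover have "0 < fit I (nat \<bar>int (snd q) - int (fst g)\<bar>) g"
    using considered_deviation[OF assms] assms(1,2) by (auto simp: cftc_instance_def)
  ultimately show ?thesis by (simp add: pref_weight_def)
qed

lemma choice_prob_nonneg:
  assumes "cftc_instance I" "A \<subseteq> universe I"
  shows "0 \<le> choice_prob I p A"
proof -
  have "0 \<le> type_choice_prob I g p A" if g: "g \<in> types I" for g
  proof -
    have "0 \<le> (\<Sum>q\<in>considered g A. pref_weight I g q)"
      by (intro sum_nonneg) (use pref_weight_pos[OF assms(1) g assms(2)] in force)
    thus ?thesis using pref_weight_pos[OF assms(1) g assms(2), of p]
      by (auto simp: type_choice_prob_def)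
  qed
  moreover have "0 \<le> arrival I g" if "g \<in> types I" for g
    using assms(1) that by (simp add: cftc_instance_def)
  ultimately show ?thesis unfolding choice_prob_def by (intro sum_nonneg mult_nonneg_nonneg)
qed

lemma choice_prob_outside: "p \<notin> A \<Longrightarrow> choice_prob I p A = 0"
proof -
  assume "p \<notin> A"
  hence "p \<notin> considered g A" for g using considered_subset by blast
  thus ?thesis by (simp add: choice_prob_def type_choice_prob_def)
qed

text \<open>Up to \<open>d\<close> no product of the initial assortment runs out, and the path is linear.\<close>

definition no_depletion :: "cftc \<Rightarrow> (product \<Rightarrow> real) \<Rightarrow> real \<Rightarrow> bool" where
  "no_depletion I z d \<longleftrightarrow>
     (\<forall>p\<in>displayed I z. \<forall>t. 0 \<le> t \<and> t < d \<longrightarrow> 0 < z p - t * choice_prob I p (displayed I z))"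

lemma fluid_path_linear:
  assumes I: "cftc_instance I" and y: "fluid_path I T z y" and nd: "no_depletion I z d"
    and p: "p \<in> universe I" and t: "0 \<le> t" "t \<le> d" "t \<le> T"
  shows "y t p = z p - t * choice_prob I p (displayed I z)"
proof -
  define A where "A = displayed I z"
  let ?f = "\<lambda>q u. choice_prob I q (displayed I (y u))"
  have hi: "(?f q has_integral (z q - y v q)) {0..v}" if "q \<in> universe I" "0 \<le> v" "v \<le> T" for q v
    using y that by (auto simp: fluid_path_def)
  have nonneg: "0 \<le> ?f q u" for q u
    by (rule choice_prob_nonneg[OF I]) (auto simp: displayed_def)
  have le: "y v q \<le> z q" if "q \<in> universe I" "0 \<le> v" "v \<le> T" for q v
    using has_integral_nonneg[OF hi[OF that] nonneg] by simp
  have sub: "displayed I (y u) \<subseteq> A" if "0 \<le> u" "u \<le> T" for u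
    using le[of _ u] that by (force simp: A_def displayed_def)
  have cont: "continuous_on {0..T} (\<lambda>v. y v q)" if q: "q \<in> universe I" for q
  proof (cases "0 \<le> T")
    case True
    have "continuous_on {0..T} (\<lambda>v. z q - integral {0..v} (?f q))"
      by (intro continuous_intros indefinite_integral_continuous_1)
         (use hi[OF q True] in \<open>auto intro: has_integral_integrable\<close>)
    moreover have "z q - integral {0..v} (?f q) = y v q" if "v \<in> {0..T}" for v
      using integral_unique[OF hi[OF q, of v]] that by auto
    ultimately show ?thesis by (rule continuous_on_eq)
  qed auto
  have lin: "y v q = z q - v * choice_prob I q A"
    if q: "q \<in> universe I" and v: "0 \<le> v" "v \<le> T" and *: "\<And>u. 0 \<le> u \<Longrightarrow> u < v \<Longrightarrow> displayed I (y u) = A"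
    for q v
  proof -
    have "((\<lambda>u. choice_prob I q A) has_integral (z q - y v q)) {0..v}"
      by (rule has_integral_spike_finite[OF _ _ hi[OF q v], of "{v}"]) (use * in auto)
    moreover have "((\<lambda>u. choice_prob I q A) has_integral (v * choice_prob I q A)) {0..v}"
      using has_integral_const_real[of "choice_prob I q A" 0 v] v by simp
    ultimately show ?thesis by (auto dest: has_integral_unique)
  qed
  have eq: "displayed I (y u) = A" if u: "0 \<le> u" "u < min d T" for u
  proof (rule ccontr)
    assume "displayed I (y u) \<noteq> A"
    define K where "K = (\<Union>q\<in>A. {v \<in> {0..T}. y v q \<le> 0})"
    have AU: "A \<subseteq> universe I" by (auto simp: A_def displayed_def)
    have out: "v \<in> K" if "0 \<le> v" "v \<le> T" "displayed I (y v) \<noteq> A" for v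
      using sub[of v] that AU by (force simp: K_def displayed_def)
    have "finite A" using AU finite_universe[OF I] finite_subset by blast
    moreover have "compact {v \<in> {0..T}. y v q \<le> 0}" if "q \<in> A" for q
    proof -
      have "closedin (top_of_set {0..T}) ({0..T} \<inter> (\<lambda>v. y v q) -` {..0})"
        by (intro continuous_closedin_preimage cont) (use that AU in auto)
      moreover have "{0..T} \<inter> (\<lambda>v. y v q) -` {..0} = {v \<in> {0..T}. y v q \<le> 0}" by auto
      ultimately show ?thesis using closedin_compact[OF compact_Icc] by metis
    qed
    ultimately have "compact K" unfolding K_def by (intro compact_UN) auto
    moreover have uK: "u \<in> K" using out[of u] u \<open>displayed I (y u) \<noteq> A\<close> by auto
    ultimately obtain v where v: "v \<in> K" "\<And>w. w \<in> K \<Longrightarrow> v \<le> w"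
      using compact_attains_inf[of K] by blast
    then obtain q where q: "q \<in> A" "0 \<le> v" "v \<le> T" "y v q \<le> 0" by (auto simp: K_def)
    have "y v q = z q - v * choice_prob I q A"
    proof (rule lin)
      show "displayed I (y w) = A" if "0 \<le> w" "w < v" for w
        using out[of w] v(2)[of w] that q by force
    qed (use q AU in auto)
    moreover have "v < d" using v(2)[OF uK] u by simp
    ultimately show False using nd q by (force simp: no_depletion_def A_def)
  qed
  show ?thesis using lin[of p t] p t eq by (simp add: A_def)
qed

lemma first_depletion:
  assumes I: "cftc_instance I" and T: "0 \<le> T"
  obtains d where "0 \<le> d" "d \<le> T" "no_depletion I z d"
    "d = T \<or> displayed I (\<lambda>p. z p - d * choice_prob I p (displayed I z)) \<subset> displayed I z"
proof -
  define A where "A = displayed I z"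
  define \<rho> where "\<rho> = (\<lambda>p. choice_prob I p A)"
  define D where "D = (\<lambda>p. z p / \<rho> p) ` {p \<in> A. 0 < \<rho> p}"
  define d where "d = Min (insert T D)"
  have AU: "A \<subseteq> universe I" by (auto simp: A_def displayed_def)
  have \<rho>: "0 \<le> \<rho> p" for p unfolding \<rho>_def by (rule choice_prob_nonneg[OF I AU])
  have zpos: "0 < z p" if "p \<in> A" for p using that by (simp add: A_def displayed_def)
  have fin: "finite (insert T D)"
    using finite_subset[OF AU finite_universe[OF I]] by (simp add: D_def)
  have d0: "0 \<le> d" unfolding d_def using fin T zpos by (subst Min_ge_iff) (auto simp: D_def less_imp_le)
  have dT: "d \<le> T" unfolding d_def using fin by (intro Min_le) auto
  have nd: "no_depletion I z d"
    unfolding no_depletion_def A_def[symmetric] \<rho>_def[symmetric]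
  proof (intro ballI allI impI)
    fix p t assume p: "p \<in> A" and t: "0 \<le> t \<and> t < d"
    have "0 < z p - t * \<rho> p"
    proof (cases "0 < \<rho> p")
      case True
      have "d \<le> z p / \<rho> p" unfolding d_def using fin p True by (intro Min_le) (auto simp: D_def)
      hence "t < z p / \<rho> p" using t by linarith
      thus ?thesis using True by (simp add: pos_less_divide_eq)
    next
      case False
      thus ?thesis using \<rho>[of p] zpos[OF p] by (simp add: order_antisym not_less)
    qed
    thus "0 < z p - t * choice_prob I p A" by (simp add: \<rho>_def)
  qed
  have "displayed I (\<lambda>p. z p - d * \<rho> p) \<subset> A" if "d \<noteq> T"
  proof -
    have "d \<in> insert T D" unfolding d_def using fin by (intro Min_in) auto
    hence "d \<in> D" using that by simp
    then obtain q where q: "q \<in> A" "0 < \<rho> q" "d = z q / \<rho> q" by (auto simp: D_def)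
    hence "q \<notin> displayed I (\<lambda>p. z p - d * \<rho> p)" by (simp add: displayed_def)
    moreover have "p \<in> A" if "p \<in> displayed I (\<lambda>p. z p - d * \<rho> p)" for p
      using that mult_nonneg_nonneg[OF d0 \<rho>[of p]] by (auto simp: displayed_def A_def)
    ultimately show ?thesis using q(1) by blast
  qed
  thus ?thesis using that[OF d0 dT nd] by (auto simp: \<rho>_def A_def)
qed

lemma fluid_path_restart:
  assumes I: "cftc_instance I" and y: "fluid_path I T z y" and d: "0 \<le> d" "d \<le> T"
  shows "fluid_path I (T - d) (y d) (\<lambda>t. y (d + t))"
  unfolding fluid_path_def
proof (intro ballI)
  fix p t assume p: "p \<in> universe I" and t: "t \<in> {0..T - d}"
  let ?f = "\<lambda>u. choice_prob I p (displayed I (y u))"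
  have h: "(?f has_integral (z p - y v p)) {0..v}" if "0 \<le> v" "v \<le> T" for v
    using y p that by (auto simp: fluid_path_def)
  have "?f integrable_on {d..d + t}"
    using integrable_on_subinterval[OF has_integral_integrable[OF h[of "d + t"]], of d "d + t"] t d by auto
  then obtain J where J: "(?f has_integral J) {d..d + t}" by blast
  have "(?f has_integral (z p - y d p + J)) {0..d + t}"
    by (rule has_integral_combine[OF _ _ h J]) (use t d in auto)
  hence "J = y d p - y (d + t) p" using has_integral_unique[OF h[of "d + t"]] t d by force
  hence "(?f has_integral (y d p - y (d + t) p)) {d..d + t}" using J by simp
  moreover have "{d..d + t} = {0 + d..t + d}" by (simp add: add.commute)
  ultimately show "((\<lambda>u. choice_prob I p (displayed I (y (d + u)))) has_integral
      (y d p - y (d + t) p)) {0..t}"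
    by (simp only: has_integral_shift_Icc_real[symmetric] o_def)
qed

theorem fluid_path_unique:
  assumes I: "cftc_instance I" and T: "0 \<le> T"
    and y: "fluid_path I T z y" and y': "fluid_path I T z y'"
    and p: "p \<in> universe I"
  shows "y T p = y' T p"
  using T y y'
proof (induction "card (displayed I z)" arbitrary: z T y y' rule: less_induct)
  case less
  define A where "A = displayed I z"
  obtain d where d: "0 \<le> d" "d \<le> T" "no_depletion I z d"
    "d = T \<or> displayed I (\<lambda>p. z p - d * choice_prob I p A) \<subset> A"
    using first_depletion[OF I less.prems(1)] unfolding A_def by metis
  have at_d: "y d q = z q - d * choice_prob I q A" "y' d q = z q - d * choice_prob I q A"
    if "q \<in> universe I" for q
    using fluid_path_linear[OF I less.prems(2) d(3) that d(1) order_refl d(2)]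
      fluid_path_linear[OF I less.prems(3) d(3) that d(1) order_refl d(2)] by (simp_all add: A_def)
  show ?case
  proof (cases "d = T")
    case True
    thus ?thesis using at_d[OF p] by simp
  next
    case False
    have disp: "displayed I (y d) = displayed I (\<lambda>p. z p - d * choice_prob I p A)"
      using at_d by (auto simp: displayed_def)
    have "finite A"
      unfolding A_def displayed_def by (rule finite_subset[OF _ finite_universe[OF I]]) auto
    hence card: "card (displayed I (y d)) < card (displayed I z)"
      using psubset_card_mono[of A "displayed I (y d)"] d(4) False disp by (simp add: A_def)
    have "fluid_path I (T - d) (y' d) (\<lambda>t. y' (d + t))"
      by (rule fluid_path_restart[OF I less.prems(3) d(1,2)])
    hence "fluid_path I (T - d) (y d) (\<lambda>t. y' (d + t))"
      using at_d by (simp add: fluid_path_def)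
    from less.hyps[OF card _ fluid_path_restart[OF I less.prems(2) d(1,2)] this] d(2)
    show ?thesis by simp
  qed
qed

theorem fluid_path_exists:
  assumes I: "cftc_instance I" and T: "0 \<le> T"
  shows "\<exists>y. fluid_path I T z y"
  using T
proof (induction "card (displayed I z)" arbitrary: z T rule: less_induct)
  case less
  define A where "A = displayed I z"
  have AU: "A \<subseteq> universe I" by (auto simp: A_def displayed_def)
  obtain d where d: "0 \<le> d" "d \<le> T" "no_depletion I z d"
    "d = T \<or> displayed I (\<lambda>p. z p - d * choice_prob I p A) \<subset> A"
    using first_depletion[OF I less.prems(1)] unfolding A_def by metis
  define l where "l = (\<lambda>t p. z p - t * choice_prob I p A)"
  have disp: "displayed I (l u) = A" if "0 \<le> u" "u < d" for u
  proof
    show "A \<subseteq> displayed I (l u)"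
      using d(3)[unfolded no_depletion_def, folded A_def] that AU
      by (auto simp: l_def displayed_def)
    show "displayed I (l u) \<subseteq> A"
    proof
      fix p assume "p \<in> displayed I (l u)"
      moreover have "0 \<le> u * choice_prob I p A"
        using that(1) choice_prob_nonneg[OF I AU] by simp
      ultimately show "p \<in> A" by (auto simp: l_def displayed_def A_def)
    qed
  qed
  have lin: "((\<lambda>u. choice_prob I p (displayed I (y u))) has_integral (z p - l t p)) {0..t}"
    if "0 \<le> t" "t \<le> d" "\<And>u. 0 \<le> u \<Longrightarrow> u < d \<Longrightarrow> y u = l u" for p t y
  proof (rule has_integral_spike_finite[of "{d}"])
    show "((\<lambda>u. choice_prob I p A) has_integral (z p - l t p)) {0..t}"
      using has_integral_const_real[of "choice_prob I p A" 0 t] that by (simp add: l_def)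
  qed (use that disp in auto)
  show ?case
  proof (cases "d = T")
    case True
    hence "fluid_path I T z l" using lin[of _ l] by (simp add: fluid_path_def)
    thus ?thesis by blast
  next
    case False
    have "finite A" using AU finite_universe[OF I] by (rule finite_subset)
    hence "card (displayed I (l d)) < card (displayed I z)"
      using psubset_card_mono[of A "displayed I (l d)"] d(4) False by (simp add: A_def l_def)
    then obtain y' where y': "fluid_path I (T - d) (l d) y'"
      using less.hyps[of "l d" "T - d"] d(2) by auto
    define y where "y = (\<lambda>t. if t < d then l t else y' (t - d))"
    have y'0: "y' 0 p = l d p" if "p \<in> universe I" for p
    proof -
      have "((\<lambda>u. choice_prob I p (displayed I (y' u))) has_integral (l d p - y' 0 p)) {0..0}"
        using y'[unfolded fluid_path_def, rule_format, OF that, of 0] d(2) by simp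
      moreover have "((\<lambda>u. choice_prob I p (displayed I (y' u))) has_integral 0) {0..0}"
        by (simp add: has_integral_refl)
      ultimately have "l d p - y' 0 p = 0" by (rule has_integral_unique)
      thus ?thesis by simp
    qed
    have "fluid_path I T z y"
      unfolding fluid_path_def
    proof (intro ballI)
      fix p t assume p: "p \<in> universe I" and t: "t \<in> {0..T}"
      let ?f = "\<lambda>u. choice_prob I p (displayed I (y u))"
      show "(?f has_integral (z p - y t p)) {0..t}"
      proof (cases "t < d")
        case True
        thus ?thesis using lin[of t y p] t by (simp add: y_def)
      next
        case False
        have 1: "(?f has_integral (z p - l d p)) {0..d}"
          using lin[of d y p] d(1) by (simp add: y_def)
        have "((?f \<circ> ((+) d)) has_integral (l d p - y' (t - d) p)) {0..t - d}"
        proof (rule has_integral_eq)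
          show "((\<lambda>u. choice_prob I p (displayed I (y' u))) has_integral (l d p - y' (t - d) p))
                  {0..t - d}"
            using y' p t False by (auto simp: fluid_path_def)
        qed (simp add: y_def)
        hence 2: "(?f has_integral (l d p - y' (t - d) p)) {d..t}"
          by (simp add: has_integral_shift_Icc_real)
        have "(?f has_integral ((z p - l d p) + (l d p - y' (t - d) p))) {0..t}"
          by (rule has_integral_combine[OF d(1) _ 1 2]) (use False in simp)
        thus ?thesis using False by (simp add: y_def)
      qed
    qed
    thus ?thesis by blast
  qed
qed

lemma consumption_eq:
  assumes "cftc_instance I" "fluid_path I (horizon I) (\<lambda>q. real (c q)) y" "p \<in> universe I"
  shows "consumption I c p = real (c p) - y (horizon I) p"
  unfolding consumption_def
proof (rule the_equality)
  have "0 \<le> horizon I" using assms(1) by (simp add: cftc_instance_def)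
  thus "x = real (c p) - y (horizon I) p"
    if "\<exists>y. fluid_path I (horizon I) (\<lambda>q. real (c q)) y \<and> x = real (c p) - y (horizon I) p" for x
    using that fluid_path_unique[OF assms(1) _ _ assms(2,3)] by auto
qed (use assms(2) in blast)

lemma finite_feasible:
  assumes "cftc_instance I" shows "finite (feasible I)"
proof (rule finite_subset)
  have "c p \<le> capacity I" if "c \<in> feasible I" "p \<in> universe I" for c p
  proof -
    have "c p \<le> (\<Sum>q\<in>universe I. c q)"
      by (rule member_le_sum[OF that(2) _ finite_universe[OF assms]]) simp
    also have "\<dots> \<le> capacity I" using that(1) by (simp add: feasible_def)
    finally show ?thesis .
  qed
  thus "feasible I \<subseteq> {c. \<forall>p. (p \<in> universe I \<longrightarrow> c p \<in> {0..capacity I}) \<and> (p \<notin> universe I \<longrightarrow> c p = 0)}"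
    by (simp add: feasible_def subset_iff)
  show "finite {c. \<forall>p. (p \<in> universe I \<longrightarrow> c p \<in> {0..capacity I}) \<and> (p \<notin> universe I \<longrightarrow> c p = 0)}"
    by (rule finite_set_of_finite_funs[OF finite_universe[OF assms]]) simp
qed

lemma feasible_nonempty: "feasible I \<noteq> {}"
proof -
  have "(\<lambda>_. 0) \<in> feasible I" by (simp add: feasible_def)
  thus ?thesis by blast
qed

section \<open>Algorithms and their running time\<close>

text \<open>
  Programs of a uniform real RAM. Real arithmetic is exact, with field operations and comparison
  at unit cost. Natural numbers (counters, addresses, stock levels) only have addition and
  truncated subtraction, because unit-cost multiplication of natural numbers is an unreasonably
  strong operation; nor is there any rounding of reals to integers. Natural number literals are the
  only constants of a program. Cells are addressed by a literal array name and a computed index.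
  The instance and the accuracy \<open>\<epsilon>\<close> are read-only and accessed entry by entry.\<close>

datatype nexp =
    NLit nat
  | NCell nat nexp
  | NAdd nexp nexp
  | NSub nexp nexp
  | NBases
  | NSizes
  | NCapacity

datatype rexp =
    ROfNat nexp
  | RCell nat nexp
  | RAdd rexp rexp
  | RSub rexp rexp
  | RMul rexp rexp
  | RDiv rexp rexp
  | REps
  | RHorizon
  | RRevenue nexp
  | RWeight nexp
  | RArrival nexp direction nexp
  | RFit nexp nexp direction nexp

datatype bexp =
    NLess nexp nexp
  | RLess rexp rexp
  | BOffered nexp nexp
  | BType nexp direction nexp
  | BNot bexp
  | BAnd bexp bexp

datatype com =
    Skip
  | NStore nat nexp nexp
  | RStore nat nexp rexp
  | SetStock nexp nexp nexp
  | Seq com com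
  | Cond bexp com com
  | While bexp com

record state =
  ncells :: "nat \<Rightarrow> nat \<Rightarrow> nat"
  rcells :: "nat \<Rightarrow> nat \<Rightarrow> real"
  stock  :: "product \<Rightarrow> nat"

definition init_state :: state where
  "init_state = \<lparr>ncells = (\<lambda>_ _. 0), rcells = (\<lambda>_ _. 0), stock = (\<lambda>_. 0)\<rparr>"

fun nval :: "cftc \<Rightarrow> state \<Rightarrow> nexp \<Rightarrow> nat" where
  "nval I \<sigma> (NLit k) = k"
| "nval I \<sigma> (NCell a e) = ncells \<sigma> a (nval I \<sigma> e)"
| "nval I \<sigma> (NAdd e f) = nval I \<sigma> e + nval I \<sigma> f"
| "nval I \<sigma> (NSub e f) = nval I \<sigma> e - nval I \<sigma> f"
| "nval I \<sigma> NBases = nbases I"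
| "nval I \<sigma> NSizes = nsizes I"
| "nval I \<sigma> NCapacity = capacity I"

fun rval :: "cftc \<Rightarrow> real \<Rightarrow> state \<Rightarrow> rexp \<Rightarrow> real" where
  "rval I \<epsilon> \<sigma> (ROfNat e) = real (nval I \<sigma> e)"
| "rval I \<epsilon> \<sigma> (RCell a e) = rcells \<sigma> a (nval I \<sigma> e)"
| "rval I \<epsilon> \<sigma> (RAdd e f) = rval I \<epsilon> \<sigma> e + rval I \<epsilon> \<sigma> f"
| "rval I \<epsilon> \<sigma> (RSub e f) = rval I \<epsilon> \<sigma> e - rval I \<epsilon> \<sigma> f"
| "rval I \<epsilon> \<sigma> (RMul e f) = rval I \<epsilon> \<sigma> e * rval I \<epsilon> \<sigma> f"
| "rval I \<epsilon> \<sigma> (RDiv e f) = rval I \<epsilon> \<sigma> e / rval I \<epsilon> \<sigma> f"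
| "rval I \<epsilon> \<sigma> REps = \<epsilon>"
| "rval I \<epsilon> \<sigma> RHorizon = horizon I"
| "rval I \<epsilon> \<sigma> (RRevenue i) = revenue I (nval I \<sigma> i)"
| "rval I \<epsilon> \<sigma> (RWeight i) = weight I (nval I \<sigma> i)"
| "rval I \<epsilon> \<sigma> (RArrival s d l) = arrival I (nval I \<sigma> s, d, nval I \<sigma> l)"
| "rval I \<epsilon> \<sigma> (RFit k s d l) = fit I (nval I \<sigma> k) (nval I \<sigma> s, d, nval I \<sigma> l)"

fun bval :: "cftc \<Rightarrow> real \<Rightarrow> state \<Rightarrow> bexp \<Rightarrow> bool" where
  "bval I \<epsilon> \<sigma> (NLess e f) \<longleftrightarrow> nval I \<sigma> e < nval I \<sigma> f"
| "bval I \<epsilon> \<sigma> (RLess e f) \<longleftrightarrow> rval I \<epsilon> \<sigma> e < rval I \<epsilon> \<sigma> f"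
| "bval I \<epsilon> \<sigma> (BOffered i s) \<longleftrightarrow> nval I \<sigma> s \<in> offered I (nval I \<sigma> i)"
| "bval I \<epsilon> \<sigma> (BType s d l) \<longleftrightarrow> (nval I \<sigma> s, d, nval I \<sigma> l) \<in> types I"
| "bval I \<epsilon> \<sigma> (BNot b) \<longleftrightarrow> \<not> bval I \<epsilon> \<sigma> b"
| "bval I \<epsilon> \<sigma> (BAnd b c) \<longleftrightarrow> bval I \<epsilon> \<sigma> b \<and> bval I \<epsilon> \<sigma> c"

text \<open>\<open>run I \<epsilon> P \<sigma> t \<sigma>'\<close>: started in \<open>\<sigma>\<close>, program \<open>P\<close> halts in \<open>\<sigma>'\<close> after \<open>t\<close> steps. Every assignment
  and every test counts as one step. As a program is a fixed text, a step comprises a number of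
  operations that is bounded independently of the input.\<close>

inductive run :: "cftc \<Rightarrow> real \<Rightarrow> com \<Rightarrow> state \<Rightarrow> nat \<Rightarrow> state \<Rightarrow> bool" for I \<epsilon> where
  "run I \<epsilon> Skip \<sigma> 1 \<sigma>"
| "run I \<epsilon> (NStore a e f) \<sigma> 1
     (\<sigma>\<lparr>ncells := (ncells \<sigma>)(a := (ncells \<sigma> a)(nval I \<sigma> e := nval I \<sigma> f))\<rparr>)"
| "run I \<epsilon> (RStore a e f) \<sigma> 1
     (\<sigma>\<lparr>rcells := (rcells \<sigma>)(a := (rcells \<sigma> a)(nval I \<sigma> e := rval I \<epsilon> \<sigma> f))\<rparr>)"
| "run I \<epsilon> (SetStock i s e) \<sigma> 1
     (\<sigma>\<lparr>stock := (stock \<sigma>)((nval I \<sigma> i, nval I \<sigma> s) := nval I \<sigma> e)\<rparr>)"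
| "run I \<epsilon> P \<sigma> t \<sigma>' \<Longrightarrow> run I \<epsilon> Q \<sigma>' t' \<sigma>'' \<Longrightarrow> run I \<epsilon> (Seq P Q) \<sigma> (t + t') \<sigma>''"
| "bval I \<epsilon> \<sigma> b \<Longrightarrow> run I \<epsilon> P \<sigma> t \<sigma>' \<Longrightarrow> run I \<epsilon> (Cond b P Q) \<sigma> (Suc t) \<sigma>'"
| "\<not> bval I \<epsilon> \<sigma> b \<Longrightarrow> run I \<epsilon> Q \<sigma> t \<sigma>' \<Longrightarrow> run I \<epsilon> (Cond b P Q) \<sigma> (Suc t) \<sigma>'"
| "\<not> bval I \<epsilon> \<sigma> b \<Longrightarrow> run I \<epsilon> (While b P) \<sigma> 1 \<sigma>"
| "bval I \<epsilon> \<sigma> b \<Longrightarrow> run I \<epsilon> P \<sigma> t \<sigma>' \<Longrightarrow> run I \<epsilon> (While b P) \<sigma>' t' \<sigma>'' \<Longrightarrow>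
     run I \<epsilon> (While b P) \<sigma> (Suc (t + t')) \<sigma>''"

text \<open>
  The bound \<open>m (n C \<Delta> / \<epsilon>\<^sup>2) ^ (K log \<Delta> / \<epsilon>\<^sup>2)\<close>, where \<open>K\<close> is the constant hidden in the exponent.
  As usual inside O-notation, the logarithm is bounded away from zero: for \<open>\<Delta> = 1\<close> the exponent
  would vanish otherwise, although the \<open>n\<close> revenues must at least be read. Likewise the
  capacity 0 is treated as 1, so that the base is not zero.\<close>

definition time_bound :: "real \<Rightarrow> cftc \<Rightarrow> real \<Rightarrow> real" where
  "time_bound K I \<epsilon> =
     real (nsizes I) *
     (real (nbases I) * real (max 1 (capacity I)) * weight_ratio I / \<epsilon>\<^sup>2)
       powr (K * (1 / \<epsilon>\<^sup>2 * ln (max 2 (weight_ratio I))))"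

end

theory Submission
  imports Defs
begin

text \<open>
  Other sizes on display only slow down the sales of a size. Hence stocking only the odd or only the
  even sizes loses at most half of the revenue, and then every customer considers a single size, so
  that the sizes do not interact. For one size, change the
  clock so that base \<open>i\<close> is sold at speed \<open>w\<^sub>i\<close> while it lasts: after clock time \<open>\<tau>\<close> it has sold
  \<open>min c\<^sub>i (w\<^sub>i \<tau>)\<close>, and real time is the integral of \<open>1 / \<phi> W\<close>, where \<open>W\<close> is the total weight of the
  bases still in stock and \<open>\<phi> W = \<Sum> a\<^sub>k / (1 + b\<^sub>k W)\<close> sums over the at most six types that may buy
  the size. As \<open>1 / \<phi>\<close> is concave, tangents bound the real time from above by a sum of prices of the
  individual bases, and what remains is a knapsack problem with one time budget and one capacity.
  A good choice of tangents depends on the optimal decreasing path \<open>W\<close> only up to factors \<open>1 + \<delta>\<close>;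
  it is a monotone staircase on a geometric grid, coded by \<open>O(log (n C \<Delta>) / \<epsilon>)\<close> bits, and all codes are
  tried. The slack that the tangents and the rounding of prices need is obtained by shortening the
  horizon, which costs a factor \<open>1 - O(\<epsilon>)\<close>.
\<close>

section \<open>Selling a single size\<close>

text \<open>The obstacle is the coupling within a size: the time a base needs depends on the live
  weight of all the others, so that revenue is not additive over bases. Tangents decouple them, and
  the two directions of the proof are asymmetric. Any tangent bounds the concave function from
  above, so a plan priced with any code truly reaches the end of its staircase within the horizon;
  only for the optimal plan must some code be nearly tight. Coarse levels suffice for this, since W
  * \<phi> W is the total sales rate and increases with W: replacing W by (1 + \<delta>) W raises 1
  / \<phi> by at most this factor. Error budget, with \<epsilon> = 16 \<delta>: (1 + \<delta>)^2 (1
  - 3 \<delta>) <= 1 - \<delta>, so cutting the horizon to (1 - 3 \<delta>) T pays for levels and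
  stretching and leaves \<delta> T for rounding prices. The cut costs at most a fraction 14 \<delta>
  of the revenue, stopping at the end of the staircase a factor 1 + \<delta>. As
  \<open>reach\<close> is polynomial in n C \<Delta>, there are (n C \<Delta> / \<epsilon>^2)^O(1 /
  \<epsilon>) codes, within the claimed exponent.\<close>

definition choice_rate :: "(nat \<Rightarrow> real) \<Rightarrow> (nat \<Rightarrow> real) \<Rightarrow> real \<Rightarrow> real" where
  "choice_rate a b W = (\<Sum>k<6. a k / (1 + b k * W))"

text \<open>The tangent of \<open>1 / choice_rate a b\<close> at \<open>V\<close> is \<open>W \<mapsto> intercept a b V + slope a b V * W\<close>.\<close>

definition slope :: "(nat \<Rightarrow> real) \<Rightarrow> (nat \<Rightarrow> real) \<Rightarrow> real \<Rightarrow> real" where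
  "slope a b V = (\<Sum>k<6. a k * b k / (1 + b k * V)\<^sup>2) / (choice_rate a b V)\<^sup>2"

definition intercept :: "(nat \<Rightarrow> real) \<Rightarrow> (nat \<Rightarrow> real) \<Rightarrow> real \<Rightarrow> real" where
  "intercept a b V = (\<Sum>k<6. a k / (1 + b k * V)\<^sup>2) / (choice_rate a b V)\<^sup>2"

text \<open>The strict inequality lets a base leave the display at the moment its stock is used up,
  as in \<open>displayed\<close>. Stocks are real here, since durations are also taken of the
  inventory left in the middle of a fluid path.\<close>

definition live_weight :: "nat set \<Rightarrow> (nat \<Rightarrow> real) \<Rightarrow> (nat \<Rightarrow> real) \<Rightarrow> real \<Rightarrow> real" where
  "live_weight X w c \<theta> = (\<Sum>i\<in>X. if w i * \<theta> < c i then w i else 0)"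

definition duration ::
    "nat set \<Rightarrow> (nat \<Rightarrow> real) \<Rightarrow> (nat \<Rightarrow> real) \<Rightarrow> (nat \<Rightarrow> real) \<Rightarrow> (nat \<Rightarrow> real) \<Rightarrow> real \<Rightarrow> real" where
  "duration X w a b c \<tau> = integral {0..\<tau>} (\<lambda>\<theta>. 1 / choice_rate a b (live_weight X w c \<theta>))"

text \<open>A bit string codes a staircase: \<open>False\<close> uses the tangent at \<open>V\<close> on the cell from \<open>lo\<close> to \<open>hi\<close> and
  moves on to the next cell of a geometric grid, \<open>True\<close> lowers \<open>V\<close> by a factor \<open>1 + d\<close>.\<close>

fun walk_const :: "(nat \<Rightarrow> real) \<Rightarrow> (nat \<Rightarrow> real) \<Rightarrow> real \<Rightarrow> bool list \<Rightarrow> real \<Rightarrow> real \<Rightarrow> real \<Rightarrow> real" where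
  "walk_const a b d [] lo hi V = 0"
| "walk_const a b d (False # bs) lo hi V =
     intercept a b V * (hi - lo) + walk_const a b d bs hi (hi * (1 + d)) V"
| "walk_const a b d (True # bs) lo hi V = walk_const a b d bs lo hi (V / (1 + d))"

fun walk_price ::
    "(nat \<Rightarrow> real) \<Rightarrow> (nat \<Rightarrow> real) \<Rightarrow> real \<Rightarrow> bool list \<Rightarrow> real \<Rightarrow> real \<Rightarrow> real \<Rightarrow> real \<Rightarrow> real" where
  "walk_price a b d [] lo hi V x = 0"
| "walk_price a b d (False # bs) lo hi V x =
     slope a b V * (min hi x - min lo x) + walk_price a b d bs hi (hi * (1 + d)) V x"
| "walk_price a b d (True # bs) lo hi V x = walk_price a b d bs lo hi (V / (1 + d)) x"

text \<open>End of the last cell closed by a \<open>False\<close> bit. Tangents are prescribed up to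
  here, so sales are credited up to this clock time only.\<close>

fun walk_end :: "real \<Rightarrow> bool list \<Rightarrow> real \<Rightarrow> real \<Rightarrow> real" where
  "walk_end d [] lo hi = lo"
| "walk_end d (False # bs) lo hi = walk_end d bs hi (hi * (1 + d))"
| "walk_end d (True # bs) lo hi = walk_end d bs lo hi"

section \<open>Integrals of monotone functions and step functions\<close>

lemma integrable_antimono:
  fixes f :: "real \<Rightarrow> real"
  assumes "\<And>x y. u \<le> x \<Longrightarrow> x \<le> y \<Longrightarrow> y \<le> v \<Longrightarrow> f y \<le> f x"
  shows "f integrable_on {u..v}"
proof -
  have "(\<lambda>x. - f x) integrable_on {u..v}"
    by (rule integrable_on_mono_on) (use assms in \<open>auto simp: mono_on_def\<close>)
  thus ?thesis using integrable_neg_iff by blast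
qed

text \<open>Used with \<open>x\<close> the clock time at which a base sells out: the base
  contributes its weight before \<open>x\<close> and nothing afterwards. The minima cover the cases
  where \<open>x\<close> lies outside the interval.\<close>

lemma has_integral_step:
  fixes k x lo hi :: real
  assumes "lo \<le> hi"
  shows "((\<lambda>\<theta>. if \<theta> < x then k else 0) has_integral k * (min hi x - min lo x)) {lo..hi}"
proof (cases "lo \<le> x \<and> x \<le> hi")
  case True
  have 1: "((\<lambda>\<theta>. if \<theta> < x then k else 0) has_integral k * (x - lo)) {lo..x}"
    by (rule has_integral_spike_finite[of "{x}" _ _ "\<lambda>_. k"])
       (use True has_integral_const_real[of k lo x] in \<open>auto simp: mult.commute\<close>)
  have 2: "((\<lambda>\<theta>. if \<theta> < x then k else 0) has_integral 0) {x..hi}"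
    by (rule has_integral_eq[of _ "\<lambda>_. 0"]) auto
  have "min hi x = x" "min lo x = lo" using True by auto
  hence eq: "k * (x - lo) + 0 = k * (min hi x - min lo x)" by simp
  show ?thesis
    using has_integral_combine[OF conjunct1[OF True] conjunct2[OF True] 1 2] unfolding eq .
next
  case False
  hence "x < lo \<or> hi < x" by auto
  thus ?thesis
  proof
    assume "x < lo"
    hence eq: "k * (min hi x - min lo x) = 0" using assms by simp
    show ?thesis unfolding eq by (rule has_integral_eq[of _ "\<lambda>_. 0"]) (use \<open>x < lo\<close> in auto)
  next
    assume "hi < x"
    hence eq: "k * (min hi x - min lo x) = k * (hi - lo)" using assms by simp
    have "((\<lambda>\<theta>. k) has_integral k * (hi - lo)) {lo..hi}"
      using has_integral_const_real[of k lo hi] assms by (simp add: mult.commute)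
    thus ?thesis unfolding eq
      by (rule has_integral_eq[of _ "\<lambda>_. k", rotated]) (use \<open>hi < x\<close> in auto)
  qed
qed

lemma walk_end_ge: "0 \<le> lo \<Longrightarrow> lo \<le> hi \<Longrightarrow> 0 \<le> d \<Longrightarrow> lo \<le> walk_end d bs lo hi"
proof (induction d bs lo hi rule: walk_end.induct)
  case (2 d bs lo hi)
  have "hi \<le> hi * (1 + d)" using 2 by (simp add: algebra_simps)
  with 2 show ?case by simp
qed auto

text \<open>Some \<open>a k\<close> must be positive for the rate not to vanish. All
  \<open>b k\<close> are positive, including those of absent types, which are represented by
  \<open>a k = 0\<close>; thus no denominator vanishes.\<close>

locale single_size =
  fixes X :: "nat set" and w a b :: "nat \<Rightarrow> real"
  assumes fin: "finite X" and w_pos: "i \<in> X \<Longrightarrow> 0 < w i"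
    and a_nonneg: "k < 6 \<Longrightarrow> 0 \<le> a k" and b_pos: "k < 6 \<Longrightarrow> 0 < b k"
    and live: "\<exists>k<6. 0 < a k"
begin

abbreviation "rate \<equiv> choice_rate a b"
abbreviation "pace W \<equiv> 1 / choice_rate a b W"
abbreviation "lw \<equiv> live_weight X w"
abbreviation "dur \<equiv> duration X w a b"

lemma den_pos: "k < 6 \<Longrightarrow> 0 \<le> W \<Longrightarrow> 0 < 1 + b k * W"
  using b_pos[of k] by (simp add: add_pos_nonneg less_imp_le)

section \<open>The concave function \<open>pace\<close> and its tangents\<close>

lemma rate_pos:
  assumes "0 \<le> W" shows "0 < rate W"
proof -
  obtain k where k: "k < 6" "0 < a k" using live by blast
  show ?thesis unfolding choice_rate_def
  proof (rule sum_pos2[of _ k])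
    show "0 < a k / (1 + b k * W)" using k den_pos[OF k(1) assms] by simp
    show "0 \<le> a i / (1 + b i * W)" if "i \<in> {..<6}" for i
      using that a_nonneg[of i] den_pos[of i W] assms by simp
  qed (use k in auto)
qed

lemma rate_antimono:
  assumes "0 \<le> W" "W \<le> W'" shows "rate W' \<le> rate W"
  unfolding choice_rate_def
proof (rule sum_mono)
  fix k assume "k \<in> {..<(6::nat)}"
  hence k: "k < 6" by simp
  have "b k * W \<le> b k * W'" using assms b_pos[OF k] by (simp add: mult_left_mono)
  thus "a k / (1 + b k * W') \<le> a k / (1 + b k * W)"
    using den_pos[OF k assms(1)] a_nonneg[OF k] by (intro divide_left_mono mult_pos_pos) auto
qed

text \<open>W * \<open>rate\<close> W is the total rate of sales at live weight W. Each summand W /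
  (1 + b W) increases in W: a larger display loses fewer customers to the no-purchase
  option.\<close>

lemma throughput_mono:
  assumes "0 \<le> W" "W \<le> W'" shows "W * rate W \<le> W' * rate W'"
  unfolding choice_rate_def sum_distrib_left
proof (rule sum_mono)
  fix k assume "k \<in> {..<(6::nat)}"
  hence k: "k < 6" by simp
  have p: "0 < 1 + b k * W" "0 < 1 + b k * W'" using den_pos[OF k] assms by auto
  have "W / (1 + b k * W) \<le> W' / (1 + b k * W')"
    using p assms by (simp add: divide_simps algebra_simps)
  from mult_left_mono[OF this a_nonneg[OF k]]
  show "W * (a k / (1 + b k * W)) \<le> W' * (a k / (1 + b k * W'))" by (simp add: mult.commute)
qed

lemma pace_pos: "0 \<le> W \<Longrightarrow> 0 < pace W"
  using rate_pos by simp

lemma pace_mono: "0 \<le> W \<Longrightarrow> W \<le> W' \<Longrightarrow> pace W \<le> pace W'"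
  using rate_antimono[of W W'] rate_pos[of W'] rate_pos[of W] by (intro divide_left_mono) auto

text \<open>W / \<open>pace\<close> W is the total sales rate, which increases; so
  \<open>pace\<close> grows at most in proportion to W.\<close>

lemma pace_scale:
  assumes "0 < W" "W \<le> W'" "W' \<le> q * W" shows "pace W' \<le> q * pace W"
proof -
  have "W * rate W \<le> W' * rate W'" using throughput_mono[of W W'] assms by simp
  also have "\<dots> \<le> q * W * rate W'"
    using mult_right_mono[OF assms(3), of "rate W'"] rate_pos[of W'] assms by simp
  also have "\<dots> = W * (q * rate W')" by simp
  finally have "rate W \<le> q * rate W'" using assms(1) by (simp only: mult_le_cancel_left_pos)
  thus ?thesis using rate_pos[of W] rate_pos[of W'] assms by (simp add: divide_simps mult.commute)
qed

text \<open>After multiplication by the squared rate the tangent is a single sum over the types, and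
  it is the second factor in the Cauchy-Schwarz inequality below.\<close>

lemma tangent_scaled:
  assumes "0 \<le> V"
  shows "(intercept a b V + slope a b V * W) * (rate V)\<^sup>2 =
    (\<Sum>k<6. a k * (1 + b k * W) / (1 + b k * V)\<^sup>2)"
proof -
  have "intercept a b V * (rate V)\<^sup>2 = (\<Sum>k<6. a k / (1 + b k * V)\<^sup>2)"
    and "slope a b V * (rate V)\<^sup>2 = (\<Sum>k<6. a k * b k / (1 + b k * V)\<^sup>2)"
    using rate_pos[OF assms] by (simp_all add: intercept_def slope_def)
  moreover have "(intercept a b V + slope a b V * W) * (rate V)\<^sup>2 =
      intercept a b V * (rate V)\<^sup>2 + slope a b V * (rate V)\<^sup>2 * W"
    by (simp add: algebra_simps)
  ultimately have "(intercept a b V + slope a b V * W) * (rate V)\<^sup>2 =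
      (\<Sum>k<6. a k / (1 + b k * V)\<^sup>2) + (\<Sum>k<6. a k * b k / (1 + b k * V)\<^sup>2) * W"
    by simp
  also have "\<dots> = (\<Sum>k<6. a k * (1 + b k * W) / (1 + b k * V)\<^sup>2)"
    unfolding sum_distrib_right sum.distrib[symmetric]
    by (rule sum.cong) (simp_all add: add_divide_distrib distrib_left mult.assoc)
  finally show ?thesis .
qed

text \<open>Concavity of 1 / \<open>rate\<close> without derivatives: a / (1 + b V) is the product
  of the square roots of a / (1 + b W) and a (1 + b W) / (1 + b V)^2, and Cauchy-Schwarz applies to
  the sum over the types.\<close>

lemma tangent:
  assumes "0 \<le> V" "0 \<le> W"
  shows "pace W \<le> intercept a b V + slope a b V * W"
proof -
  define f where "f = (\<lambda>k. sqrt (a k / (1 + b k * W)))"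
  define g where "g = (\<lambda>k. sqrt (a k * (1 + b k * W)) / (1 + b k * V))"
  have fg: "f k * g k = a k / (1 + b k * V)" if k: "k < 6" for k
  proof -
    have p: "0 < 1 + b k * W" using den_pos[OF k assms(2)] .
    have "sqrt (a k / (1 + b k * W)) * sqrt (a k * (1 + b k * W)) = sqrt (a k * a k)"
      using p by (simp add: real_sqrt_mult[symmetric])
    thus ?thesis using a_nonneg[OF k] by (simp add: f_def g_def)
  qed
  have f2: "(f k)\<^sup>2 = a k / (1 + b k * W)" if k: "k < 6" for k
    using a_nonneg[OF k] den_pos[OF k assms(2)] by (simp add: f_def)
  have g2: "(g k)\<^sup>2 = a k * (1 + b k * W) / (1 + b k * V)\<^sup>2" if k: "k < 6" for k
    using a_nonneg[OF k] den_pos[OF k assms(2)] by (simp add: g_def power_divide)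
  have "(\<Sum>k<6. f k * g k)\<^sup>2 \<le> (\<Sum>k<6. (f k)\<^sup>2) * (\<Sum>k<6. (g k)\<^sup>2)"
    by (rule Cauchy_Schwarz_ineq_sum)
  hence "(rate V)\<^sup>2 \<le> rate W * (\<Sum>k<6. a k * (1 + b k * W) / (1 + b k * V)\<^sup>2)"
    using fg f2 g2 by (simp add: choice_rate_def)
  also have "(\<Sum>k<6. a k * (1 + b k * W) / (1 + b k * V)\<^sup>2) =
      (intercept a b V + slope a b V * W) * (rate V)\<^sup>2"
    by (rule tangent_scaled[OF assms(1), symmetric])
  finally have "1 \<le> rate W * (intercept a b V + slope a b V * W)"
    using rate_pos[OF assms(1)] by (simp add: mult.assoc[symmetric])
  thus ?thesis using rate_pos[OF assms(2)] by (simp add: divide_simps mult.commute)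
qed

lemma tangent_eq:
  assumes "0 \<le> V" shows "intercept a b V + slope a b V * V = pace V"
proof -
  have "(intercept a b V + slope a b V * V) * (rate V)\<^sup>2 =
      (\<Sum>k<6. a k * (1 + b k * V) / (1 + b k * V)\<^sup>2)"
    by (rule tangent_scaled[OF assms])
  also have "\<dots> = rate V" unfolding choice_rate_def
    by (rule sum.cong) (use den_pos[OF _ assms] in \<open>auto simp: power2_eq_square\<close>)
  finally show ?thesis using rate_pos[OF assms] by (simp add: divide_simps power2_eq_square)
qed

lemma slope_nonneg: "0 \<le> slope a b V"
  unfolding slope_def using a_nonneg b_pos
  by (intro divide_nonneg_nonneg sum_nonneg mult_nonneg_nonneg) (auto simp: less_imp_le)

lemma intercept_nonneg: "0 \<le> intercept a b V"
  unfolding intercept_def using a_nonneg by (intro divide_nonneg_nonneg sum_nonneg) auto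

lemma walk_const_nonneg: "0 \<le> lo \<Longrightarrow> lo \<le> hi \<Longrightarrow> 0 \<le> d \<Longrightarrow> 0 \<le> walk_const a b d bs lo hi V"
proof (induction bs arbitrary: lo hi V)
  case (Cons bit bs)
  have "hi \<le> hi * (1 + d)" using Cons.prems by (simp add: algebra_simps)
  moreover have "0 \<le> intercept a b V * (hi - lo)"
    using Cons.prems intercept_nonneg by (intro mult_nonneg_nonneg) auto
  ultimately show ?case using Cons.IH[of hi "hi * (1 + d)" V] Cons.IH[of lo hi "V / (1 + d)"] Cons.prems
    by (cases bit) auto
qed simp

lemma walk_price_nonneg: "0 \<le> lo \<Longrightarrow> lo \<le> hi \<Longrightarrow> 0 \<le> d \<Longrightarrow> 0 \<le> walk_price a b d bs lo hi V x"
proof (induction bs arbitrary: lo hi V)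
  case (Cons bit bs)
  have "hi \<le> hi * (1 + d)" using Cons.prems by (simp add: algebra_simps)
  moreover have "0 \<le> slope a b V * (min hi x - min lo x)"
    using Cons.prems slope_nonneg by (intro mult_nonneg_nonneg) auto
  ultimately show ?case using Cons.IH[of hi "hi * (1 + d)" V] Cons.IH[of lo hi "V / (1 + d)"] Cons.prems
    by (cases bit) auto
qed simp

section \<open>Live weight and duration\<close>

lemma lw_nonneg: "0 \<le> lw c \<theta>"
  unfolding live_weight_def by (rule sum_nonneg) (use w_pos in \<open>auto simp: less_imp_le\<close>)

lemma lw_antimono: "\<theta> \<le> \<theta>' \<Longrightarrow> lw c \<theta>' \<le> lw c \<theta>"
  unfolding live_weight_def
proof (rule sum_mono)
  fix i assume "\<theta> \<le> \<theta>'" "i \<in> X"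
  hence "w i * \<theta> \<le> w i * \<theta>'" "0 < w i" using w_pos by (auto simp: mult_left_mono less_imp_le)
  moreover from this(1) have "w i * \<theta> < c i" if "w i * \<theta>' < c i" using that by linarith
  ultimately show "(if w i * \<theta>' < c i then w i else 0) \<le> (if w i * \<theta> < c i then w i else 0)"
    by simp
qed

lemma lw_mono: "(\<And>i. i \<in> X \<Longrightarrow> w i * \<theta> < c i \<Longrightarrow> w i * \<theta>' < c' i) \<Longrightarrow> lw c \<theta> \<le> lw c' \<theta>'"
  unfolding live_weight_def by (rule sum_mono) (use w_pos in \<open>auto simp: less_imp_le\<close>)

lemma pace_integrable: "(\<lambda>\<theta>. pace (lw c \<theta>)) integrable_on {u..v}"
  by (rule integrable_antimono) (intro pace_mono lw_nonneg lw_antimono)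

lemma pace_stretched_integrable:
  "0 \<le> q \<Longrightarrow> (\<lambda>\<theta>. pace (lw c (p + \<theta> * q))) integrable_on {u..v}"
  by (rule integrable_antimono) (intro pace_mono lw_nonneg lw_antimono add_left_mono mult_right_mono)

text \<open>Multiplying the weights into the minima turns the sum into the amount sold between the
  clock times \<open>lo\<close> and \<open>hi\<close>.\<close>

lemma lw_has_integral:
  assumes "lo \<le> hi"
  shows "(lw c has_integral (\<Sum>i\<in>X. w i * (min hi (c i / w i) - min lo (c i / w i)))) {lo..hi}"
proof -
  have "((\<lambda>\<theta>. \<Sum>i\<in>X. if w i * \<theta> < c i then w i else 0) has_integral
      (\<Sum>i\<in>X. w i * (min hi (c i / w i) - min lo (c i / w i)))) {lo..hi}"
  proof (rule has_integral_sum[OF fin])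
    fix i assume i: "i \<in> X"
    have "(w i * \<theta> < c i) = (\<theta> < c i / w i)" for \<theta>
      using w_pos[OF i] by (simp add: pos_less_divide_eq mult.commute)
    thus "((\<lambda>\<theta>. if w i * \<theta> < c i then w i else 0) has_integral
        w i * (min hi (c i / w i) - min lo (c i / w i))) {lo..hi}"
      using has_integral_step[OF assms, of "c i / w i" "w i"] by simp
  qed
  thus ?thesis by (simp add: live_weight_def[abs_def])
qed

lemma duration_mono:
  assumes "0 \<le> \<tau>" "\<tau> \<le> \<tau>'" shows "dur c \<tau> \<le> dur c \<tau>'"
  unfolding duration_def
  by (rule integral_subset_le)
     (use assms pace_integrable pace_pos lw_nonneg in \<open>auto simp: less_imp_le\<close>)

lemma duration_combine:
  assumes "0 \<le> u" "u \<le> v"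
  shows "dur c v = dur c u + integral {u..v} (\<lambda>\<theta>. pace (lw c \<theta>))"
  unfolding duration_def
  using Henstock_Kurzweil_Integration.integral_combine[OF assms pace_integrable] by simp

lemma duration_strict:
  assumes "0 \<le> \<tau>" "\<tau> < \<tau>'" shows "dur c \<tau> < dur c \<tau>'"
proof -
  have "pace (lw c \<tau>') * (\<tau>' - \<tau>) \<le> integral {\<tau>..\<tau>'} (\<lambda>\<theta>. pace (lw c \<theta>))"
  proof -
    have "integral {\<tau>..\<tau>'} (\<lambda>\<theta>. pace (lw c \<tau>')) \<le> integral {\<tau>..\<tau>'} (\<lambda>\<theta>. pace (lw c \<theta>))"
      by (rule integral_le) (auto intro!: pace_integrable pace_mono lw_nonneg lw_antimono)
    thus ?thesis using assms by (simp add: mult.commute)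
  qed
  moreover have "0 < pace (lw c \<tau>') * (\<tau>' - \<tau>)"
    using assms pace_pos[OF lw_nonneg] by (intro mult_pos_pos) auto
  ultimately show ?thesis using duration_combine[of \<tau> \<tau>' c] assms by simp
qed

text \<open>The tangent at \<open>V\<close> bounds the concave function \<open>pace\<close> from above, whatever \<open>V\<close> is; hence
  every bit string yields a valid upper bound on the duration that is additive over products.\<close>

lemma walk_sound:
  assumes "0 \<le> lo" "lo \<le> hi" "0 \<le> V" "0 \<le> d"
  shows "integral {lo..walk_end d bs lo hi} (\<lambda>\<theta>. pace (lw c \<theta>)) \<le>
    walk_const a b d bs lo hi V + (\<Sum>i\<in>X. w i * walk_price a b d bs lo hi V (c i / w i))"
  using assms
proof (induction bs arbitrary: lo hi V)
  case (Cons bit bs)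
  show ?case
  proof (cases bit)
    case True
    thus ?thesis using Cons.IH[of lo hi "V / (1 + d)"] Cons.prems by simp
  next
    case False
    have hi: "hi \<le> hi * (1 + d)" using Cons.prems by (simp add: algebra_simps)
    have "((\<lambda>\<theta>. intercept a b V + slope a b V * lw c \<theta>) has_integral intercept a b V * (hi - lo) +
        slope a b V * (\<Sum>i\<in>X. w i * (min hi (c i / w i) - min lo (c i / w i)))) {lo..hi}"
      using has_integral_add[OF has_integral_const_real[of "intercept a b V" lo hi]
          has_integral_mult_right[OF lw_has_integral[OF Cons.prems(2), of c], of "slope a b V"]]
        Cons.prems by (simp add: mult.commute)
    from has_integral_le[OF integrable_integral[OF pace_integrable] this, of c]
    have 1: "integral {lo..hi} (\<lambda>\<theta>. pace (lw c \<theta>)) \<le> intercept a b V * (hi - lo) +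
        slope a b V * (\<Sum>i\<in>X. w i * (min hi (c i / w i) - min lo (c i / w i)))"
      using tangent[OF Cons.prems(3) lw_nonneg] by blast
    have 2: "integral {hi..walk_end d bs hi (hi * (1 + d))} (\<lambda>\<theta>. pace (lw c \<theta>)) \<le>
        walk_const a b d bs hi (hi * (1 + d)) V +
        (\<Sum>i\<in>X. w i * walk_price a b d bs hi (hi * (1 + d)) V (c i / w i))"
      using Cons.IH[of hi "hi * (1 + d)" V] Cons.prems hi by simp
    have "integral {lo..walk_end d bs hi (hi * (1 + d))} (\<lambda>\<theta>. pace (lw c \<theta>)) =
        integral {lo..hi} (\<lambda>\<theta>. pace (lw c \<theta>)) +
        integral {hi..walk_end d bs hi (hi * (1 + d))} (\<lambda>\<theta>. pace (lw c \<theta>))"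
      using Henstock_Kurzweil_Integration.integral_combine[OF Cons.prems(2) _ pace_integrable]
        walk_end_ge[of hi "hi * (1 + d)" d bs] Cons.prems hi by simp
    thus ?thesis using 1 2 False
      by (simp add: distrib_left sum.distrib sum_distrib_left mult.left_commute)
  qed
qed simp

lemma walk_True:
  "walk_const a b d (replicate j True @ bs) lo hi V = walk_const a b d bs lo hi (V / (1 + d) ^ j)"
  "walk_price a b d (replicate j True @ bs) lo hi V x = walk_price a b d bs lo hi (V / (1 + d) ^ j) x"
  "walk_end d (replicate j True @ bs) lo hi = walk_end d bs lo hi"
  by (induction j arbitrary: V) (simp_all add: divide_divide_eq_left)

text \<open>Trailing \<open>True\<close> bits lower a level that no cell uses, so a short code can
  be extended to the fixed length of the search.\<close>

lemma walk_pad: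
  "walk_const a b d (bs @ replicate j True) lo hi V = walk_const a b d bs lo hi V"
  "walk_price a b d (bs @ replicate j True) lo hi V x = walk_price a b d bs lo hi V x"
  "walk_end d (bs @ replicate j True) lo hi = walk_end d bs lo hi"
proof -
  have nil: "walk_const a b d (replicate j True) lo hi V = 0"
    "walk_price a b d (replicate j True) lo hi V x = 0"
    "walk_end d (replicate j True) lo hi = lo" for lo hi V
    using walk_True[of d j "[]"] by simp_all
  show "walk_const a b d (bs @ replicate j True) lo hi V = walk_const a b d bs lo hi V"
    by (induction bs arbitrary: lo hi V) (use nil in \<open>auto split: bool.splits\<close>,
        metis (full_types) walk_const.simps(2,3))
  show "walk_price a b d (bs @ replicate j True) lo hi V x = walk_price a b d bs lo hi V x"
    by (induction bs arbitrary: lo hi V) (use nil in \<open>auto split: bool.splits\<close>,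
        metis (full_types) walk_price.simps(2,3))
  show "walk_end d (bs @ replicate j True) lo hi = walk_end d bs lo hi"
    by (induction bs arbitrary: lo hi V) (use nil in \<open>auto split: bool.splits\<close>,
        metis (full_types) walk_end.simps(2,3))
qed

lemma tangent_level:
  fixes d V W :: real
  assumes d: "0 < d" and W: "0 < W" "W \<le> V"
  obtains j :: nat where "W \<le> V / (1 + d) ^ j" "V / (1 + d) ^ j \<le> (1 + d) * W"
proof -
  have ex: "\<exists>j. V / (1 + d) ^ j \<le> (1 + d) * W"
  proof -
    obtain j where "V / W < (1 + d) ^ j" using real_arch_pow[of "1 + d" "V / W"] d by auto
    hence "V < W * (1 + d) ^ j" using W by (simp add: divide_simps mult.commute)
    also have "\<dots> \<le> (1 + d) * W * (1 + d) ^ j" using d W by simp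
    finally show ?thesis using d by (intro exI[of _ j]) (simp add: divide_simps)
  qed
  \<comment> \<open>For the least such exponent the preceding level exceeds (1 + d) W, and one more
    division by 1 + d stays above W.\<close>
  define j where "j = (LEAST j. V / (1 + d) ^ j \<le> (1 + d) * W)"
  have 1: "V / (1 + d) ^ j \<le> (1 + d) * W" unfolding j_def by (rule LeastI_ex[OF ex])
  have "W \<le> V / (1 + d) ^ j"
  proof (cases j)
    case 0
    thus ?thesis using W by simp
  next
    case (Suc j')
    hence "\<not> V / (1 + d) ^ j' \<le> (1 + d) * W" using not_less_Least[of j' "\<lambda>j. V / (1 + d) ^ j \<le> (1 + d) * W"] by (simp add: j_def)
    hence "(1 + d) * W < (1 + d) * (V / (1 + d) ^ j)" using Suc d by simp
    thus ?thesis using d by (simp only: mult_less_cancel_left_pos)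
  qed
  with 1 that show ?thesis by blast
qed

section \<open>Existence of a good staircase\<close>

text \<open>Choosing on every cell the tangent at a level just above the live weight at the start of the
  cell costs a factor \<open>1 + d\<close> for the tangent, and stretching the path by another \<open>1 + d\<close> absorbs
  the decrease of the live weight within the cell.\<close>

lemma walk_exists_aux:
  assumes d: "0 < d" and wlo: "0 < wlo" "\<And>\<theta>. \<theta> < \<tau> \<Longrightarrow> wlo \<le> lw c \<theta>"
  assumes "\<tau> < hi * (1 + d) ^ K" "0 \<le> lo" "lo < hi" "lo \<le> \<tau>" "hi \<le> (1 + d) * \<tau>"
    "lw c lo \<le> V" "wlo \<le> V"
    "hi = (1 + d) * lo \<or> (lo = 0 \<and> hi \<le> \<tau> \<and> (\<forall>\<theta><hi. lw c 0 \<le> lw c \<theta>))"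
  shows "\<exists>bs. (1 + d) ^ length bs \<le> V / wlo * ((1 + d) * \<tau> / hi) \<and>
     walk_end d bs lo hi \<le> \<tau> \<and> \<tau> \<le> (1 + d) * walk_end d bs lo hi \<and>
     walk_const a b d bs lo hi V + (\<Sum>i\<in>X. w i * walk_price a b d bs lo hi V (c i / w i)) \<le>
     (1 + d) * integral {lo..walk_end d bs lo hi} (\<lambda>\<theta>. pace (lw c (\<theta> / (1 + d))))"
  using assms(4-)
proof (induction K arbitrary: lo hi V)
  \<comment> \<open>Here \<tau> < \<open>hi\<close>, which excludes the second alternative of the
    last hypothesis; so \<open>hi = (1 + d) * lo\<close>, and the empty code already reaches \<tau>
    up to the factor 1 + d.\<close>
  case (0 lo hi V)
  have "0 < hi" using 0 by simp
  have "1 \<le> V / wlo" using 0 wlo(1) by simp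
  moreover have "1 \<le> (1 + d) * \<tau> / hi" unfolding le_divide_eq_1_pos[OF \<open>0 < hi\<close>] by (rule 0)
  ultimately have "1 \<le> V / wlo" "1 \<le> (1 + d) * \<tau> / hi" by blast+
  from mult_mono[OF this order_trans[OF zero_le_one this(1)] zero_le_one]
  have "1 \<le> V / wlo * ((1 + d) * \<tau> / hi)" by (simp only: mult_1)
  thus ?case using 0 by (intro exI[of _ "[]"]) (auto simp: mult.commute)
next
  case (Suc K lo hi V)
  show ?case
  proof (cases "hi \<le> \<tau>")
    case False
    have "0 < hi" using Suc.prems by simp
    have "1 \<le> V / wlo" using Suc.prems wlo(1) by simp
    moreover have "1 \<le> (1 + d) * \<tau> / hi"
      unfolding le_divide_eq_1_pos[OF \<open>0 < hi\<close>] by (rule Suc.prems)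
    ultimately have "1 \<le> V / wlo" "1 \<le> (1 + d) * \<tau> / hi" by blast+
    from mult_mono[OF this order_trans[OF zero_le_one this(1)] zero_le_one]
    have "1 \<le> V / wlo * ((1 + d) * \<tau> / hi)" by (simp only: mult_1)
    thus ?thesis using Suc.prems False by (intro exI[of _ "[]"]) (auto simp: mult.commute)
  next
    case True
    have lo: "lo < \<tau>" using True Suc.prems by simp
    have W0: "0 < lw c lo" using wlo(1) wlo(2)[OF lo] by simp
    obtain j where j: "lw c lo \<le> V / (1 + d) ^ j" "V / (1 + d) ^ j \<le> (1 + d) * lw c lo"
      using tangent_level[OF d W0 Suc.prems(6)] .
    define V' where "V' = V / (1 + d) ^ j"
    have V': "lw c lo \<le> V'" "V' \<le> (1 + d) * lw c lo" "0 < V'" using j W0 by (auto simp: V'_def)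
    have hi0: "0 < hi" using Suc.prems by simp
    have "\<tau> < hi * (1 + d) * (1 + d) ^ K" using Suc.prems(1) by (simp add: mult.assoc)
    moreover have "hi < hi * (1 + d)" using hi0 d by simp
    moreover have "lw c hi \<le> V'" using lw_antimono[of lo hi c] Suc.prems V' by simp
    moreover have "wlo \<le> V'" using wlo(2)[OF lo] V' by simp
    moreover have "hi * (1 + d) \<le> (1 + d) * \<tau>" using True d by (simp add: mult.commute)
    ultimately obtain bs where bs:
      "(1 + d) ^ length bs \<le> V' / wlo * ((1 + d) * \<tau> / (hi * (1 + d)))"
      "walk_end d bs hi (hi * (1 + d)) \<le> \<tau>" "\<tau> \<le> (1 + d) * walk_end d bs hi (hi * (1 + d))"
      "walk_const a b d bs hi (hi * (1 + d)) V' +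
        (\<Sum>i\<in>X. w i * walk_price a b d bs hi (hi * (1 + d)) V' (c i / w i)) \<le>
       (1 + d) * integral {hi..walk_end d bs hi (hi * (1 + d))} (\<lambda>\<theta>. pace (lw c (\<theta> / (1 + d))))"
      using Suc.IH[of "hi * (1 + d)" hi V'] hi0 True by (auto simp: mult.commute)
    let ?bs = "replicate j True @ False # bs"
    let ?E = "walk_end d bs hi (hi * (1 + d))"
    have E: "hi \<le> ?E" using walk_end_ge[of hi "hi * (1 + d)" d bs] hi0 d by simp
    \<comment> \<open>The right-hand side V / \<open>wlo\<close> * ((1 + d) * \<tau> /
      \<open>hi\<close>) is a potential: a \<open>True\<close> bit divides V by 1 + d, a
      \<open>False\<close> bit multiplies \<open>hi\<close> by 1 + d, so each bit lowers it by
      exactly this factor.\<close>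
    have "(1 + d) ^ length ?bs = (1 + d) ^ j * (1 + d) * (1 + d) ^ length bs"
      by (simp add: power_add mult_ac)
    also have "\<dots> \<le> (1 + d) ^ j * (1 + d) * (V' / wlo * ((1 + d) * \<tau> / (hi * (1 + d))))"
      using bs(1) d by (intro mult_left_mono) auto
    also have "\<dots> = V / wlo * ((1 + d) * \<tau> / hi)"
      using d hi0 wlo by (simp add: V'_def divide_simps)
    finally have len: "(1 + d) ^ length ?bs \<le> V / wlo * ((1 + d) * \<tau> / hi)" .
    \<comment> \<open>The path is read at \<theta> / (1 + d), which on a geometric cell is not later
      than \<open>lo\<close>. The first cell starts at 0 and is not geometric; there no live weight
      is lost before \<open>hi\<close>, and \<theta> / (1 + d) < \<open>hi\<close>.\<close>
    have stretch: "lw c lo \<le> lw c (\<theta> / (1 + d))" if "\<theta> \<in> {lo..hi}" for \<theta>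
    proof -
      from Suc.prems(8) show ?thesis
      proof
        assume "hi = (1 + d) * lo"
        hence "\<theta> / (1 + d) \<le> lo" using that d by (simp add: divide_simps mult.commute)
        thus ?thesis by (rule lw_antimono)
      next
        assume A: "lo = 0 \<and> hi \<le> \<tau> \<and> (\<forall>\<theta><hi. lw c 0 \<le> lw c \<theta>)"
        have "\<theta> < hi * (1 + d)" using that mult_pos_pos[OF hi0 d] unfolding distrib_left by auto
        hence "\<theta> / (1 + d) < hi" using d by (simp add: divide_simps)
        thus ?thesis using A by simp
      qed
    qed
    have cell: "intercept a b V' * (hi - lo) +
        slope a b V' * (\<Sum>i\<in>X. w i * (min hi (c i / w i) - min lo (c i / w i))) \<le>
        (1 + d) * integral {lo..hi} (\<lambda>\<theta>. pace (lw c (\<theta> / (1 + d))))"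
    proof -
      have 1: "((\<lambda>\<theta>. intercept a b V' + slope a b V' * lw c \<theta>) has_integral intercept a b V' * (hi - lo) +
          slope a b V' * (\<Sum>i\<in>X. w i * (min hi (c i / w i) - min lo (c i / w i)))) {lo..hi}"
        using has_integral_add[OF has_integral_const_real[of "intercept a b V'" lo hi]
            has_integral_mult_right[OF lw_has_integral[of lo hi c], of "slope a b V'"]]
          Suc.prems by (simp add: mult.commute)
      have int: "(\<lambda>\<theta>. pace (lw c (\<theta> / (1 + d)))) integrable_on {lo..hi}"
        using pace_stretched_integrable[of "1 / (1 + d)" c 0 lo hi] d by simp
      have 2: "((\<lambda>\<theta>. (1 + d) * pace (lw c (\<theta> / (1 + d)))) has_integral
          (1 + d) * integral {lo..hi} (\<lambda>\<theta>. pace (lw c (\<theta> / (1 + d))))) {lo..hi}"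
        by (rule has_integral_mult_right[OF integrable_integral[OF int]])
      show ?thesis
      proof (rule has_integral_le[OF 1 2])
        fix \<theta> assume t: "\<theta> \<in> {lo..hi}"
        \<comment> \<open>The live weight on the cell is at most \<open>V'\<close>, and the tangent
          is nondecreasing, so it stays below its value at the point of contact.\<close>
        have "slope a b V' * lw c \<theta> \<le> slope a b V' * V'"
          using lw_antimono[of lo \<theta> c] t V' slope_nonneg by (intro mult_left_mono) auto
        hence "intercept a b V' + slope a b V' * lw c \<theta> \<le> pace V'" using tangent_eq[of V'] V' by simp
        also have "\<dots> \<le> (1 + d) * pace (lw c lo)" by (rule pace_scale[OF W0 V'(1,2)])
        also have "\<dots> \<le> (1 + d) * pace (lw c (\<theta> / (1 + d)))"
          using pace_mono[OF lw_nonneg stretch[OF t]] d by (intro mult_left_mono) auto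
        finally show "intercept a b V' + slope a b V' * lw c \<theta> \<le> (1 + d) * pace (lw c (\<theta> / (1 + d)))" .
      qed
    qed
    have split: "integral {lo..?E} (\<lambda>\<theta>. pace (lw c (\<theta> / (1 + d)))) =
        integral {lo..hi} (\<lambda>\<theta>. pace (lw c (\<theta> / (1 + d)))) +
        integral {hi..?E} (\<lambda>\<theta>. pace (lw c (\<theta> / (1 + d))))"
      using Henstock_Kurzweil_Integration.integral_combine[of lo hi ?E
          "\<lambda>\<theta>. pace (lw c (\<theta> / (1 + d)))"]
        pace_stretched_integrable[of "1 / (1 + d)" c 0 lo ?E] d E Suc.prems by simp
    have c1: "walk_const a b d ?bs lo hi V =
        intercept a b V' * (hi - lo) + walk_const a b d bs hi (hi * (1 + d)) V'"
      unfolding walk_True V'_def by simp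
    have c2: "(\<Sum>i\<in>X. w i * walk_price a b d ?bs lo hi V (c i / w i)) =
        slope a b V' * (\<Sum>i\<in>X. w i * (min hi (c i / w i) - min lo (c i / w i))) +
        (\<Sum>i\<in>X. w i * walk_price a b d bs hi (hi * (1 + d)) V' (c i / w i))"
      unfolding walk_True V'_def[symmetric]
      by (simp add: distrib_left sum.distrib sum_distrib_left mult.left_commute)
    have c3: "walk_end d ?bs lo hi = ?E" unfolding walk_True by simp
    show ?thesis
    proof (intro exI[of _ ?bs] conjI)
      show "(1 + d) ^ length ?bs \<le> V / wlo * ((1 + d) * \<tau> / hi)" by (rule len)
      show "walk_end d ?bs lo hi \<le> \<tau>" "\<tau> \<le> (1 + d) * walk_end d ?bs lo hi"
        unfolding c3 using bs(2,3) by blast+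
      show "walk_const a b d ?bs lo hi V + (\<Sum>i\<in>X. w i * walk_price a b d ?bs lo hi V (c i / w i)) \<le>
          (1 + d) * integral {lo..walk_end d ?bs lo hi} (\<lambda>\<theta>. pace (lw c (\<theta> / (1 + d))))"
        unfolding c1 c2 c3 split using cell bs(4) by (simp add: distrib_left)
    qed
  qed
qed

text \<open>One factor 1 + d comes from the levels, the other from substituting \<theta> / (1 + d)
  for \<theta> in the integral over the stretched path. The code is padded to exactly
  \<open>B\<close> bits.\<close>

lemma walk_exists:
  assumes d: "0 < d" and wlo: "0 < wlo" "\<And>\<theta>. \<theta> < \<tau> \<Longrightarrow> wlo \<le> lw c \<theta>"
    and hi: "0 < hi" "hi \<le> \<tau>" "\<And>\<theta>. \<theta> < hi \<Longrightarrow> lw c 0 \<le> lw c \<theta>" and V: "lw c 0 \<le> V"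
    and B: "V / wlo * ((1 + d) * \<tau> / hi) \<le> (1 + d) ^ B"
  shows "\<exists>bs. length bs = B \<and> \<tau> \<le> (1 + d) * walk_end d bs 0 hi \<and>
     walk_const a b d bs 0 hi V + (\<Sum>i\<in>X. w i * walk_price a b d bs 0 hi V (c i / w i)) \<le>
     (1 + d)\<^sup>2 * dur c \<tau>"
proof -
  obtain K where "\<tau> / hi < (1 + d) ^ K" using real_arch_pow[of "1 + d" "\<tau> / hi"] d by auto
  hence K: "\<tau> < hi * (1 + d) ^ K" using hi by (simp add: divide_simps mult.commute)
  have wV: "wlo \<le> V" using wlo(2)[of 0] hi V by simp
  obtain bs where bs: "(1 + d) ^ length bs \<le> V / wlo * ((1 + d) * \<tau> / hi)"
    "walk_end d bs 0 hi \<le> \<tau>" "\<tau> \<le> (1 + d) * walk_end d bs 0 hi"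
    "walk_const a b d bs 0 hi V + (\<Sum>i\<in>X. w i * walk_price a b d bs 0 hi V (c i / w i)) \<le>
     (1 + d) * integral {0..walk_end d bs 0 hi} (\<lambda>\<theta>. pace (lw c (\<theta> / (1 + d))))"
  proof (rule exE[OF walk_exists_aux[OF d wlo K, of 0 V]])
    show "hi \<le> (1 + d) * \<tau>" using hi d mult_right_mono[of 1 "1 + d" \<tau>] by linarith
  qed (use hi V wV in auto)
  let ?E = "walk_end d bs 0 hi"
  have E: "0 \<le> ?E" using walk_end_ge[of 0 hi d bs] hi d by simp
  have stretched: "((\<lambda>\<theta>. pace (lw c (\<theta> / (1 + d)))) has_integral (1 + d) * dur c (?E / (1 + d))) {0..?E}"
  proof -
    have "((\<lambda>\<theta>. pace (lw c \<theta>)) has_integral dur c (?E / (1 + d))) {0..?E / (1 + d)}"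
      unfolding duration_def by (rule integrable_integral[OF pace_integrable])
    from has_integral_stretch_real[OF this, of "1 / (1 + d)"] d E
    show ?thesis by (simp add: mult.commute image_mult_atLeastAtMost_if')
  qed
  have "dur c (?E / (1 + d)) \<le> dur c \<tau>"
  proof (rule duration_mono)
    have "0 \<le> \<tau> * d" using d hi by simp
    hence "?E \<le> \<tau> * (1 + d)" using bs(2) by (simp add: distrib_left)
    thus "?E / (1 + d) \<le> \<tau>" using d by (simp add: divide_simps)
  qed (use E d in auto)
  hence "(1 + d) * integral {0..?E} (\<lambda>\<theta>. pace (lw c (\<theta> / (1 + d)))) \<le> (1 + d)\<^sup>2 * dur c \<tau>"
    using integral_unique[OF stretched] d by (simp add: power2_eq_square mult.assoc)
  moreover have "length bs \<le> B"
    using order_trans[OF bs(1) B] d by (simp add: power_increasing_iff)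
  ultimately show ?thesis using bs(3,4)
    by (intro exI[of _ "bs @ replicate (B - length bs) True"]) (simp add: walk_pad)
qed

section \<open>Shortening the horizon\<close>

text \<open>Shortening the horizon by a fraction \<open>\<eta>\<close> costs only \<open>O(\<eta>)\<close>: if the last stretch of the path
  earned much more than its share, then selling only the products of that stretch, scaled up by
  \<open>M = (1 - \<eta>) / \<eta>\<close>, would be better. Since the total rate of sales decreases along the path, the
  scaled stock respects the capacity. Stocks that are less than 1 after scaling cannot be rounded
  down: such a product either sold out, so that the loss is small compared to its sales before, or it
  did not, and then a single unit lasts long enough.\<close>

lemma duration_scaled_tail:
  assumes M: "0 < M" and \<theta>: "0 \<le> \<theta>0" "\<theta>0 \<le> \<tau>"
    and le: "\<And>i \<theta>. i \<in> X \<Longrightarrow> 0 \<le> \<theta> \<Longrightarrow> \<theta> < M * (\<tau> - \<theta>0) \<Longrightarrow> w i * \<theta> < c' i \<Longrightarrow>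
      w i * (\<theta>0 + \<theta> / M) < c i"
  shows "dur c' (M * (\<tau> - \<theta>0)) \<le> M * (dur c \<tau> - dur c \<theta>0)"
proof -
  let ?L = "M * (\<tau> - \<theta>0)"
  have L: "0 \<le> ?L" using M \<theta> by simp
  have "((\<lambda>\<theta>. pace (lw c \<theta>)) has_integral (dur c \<tau> - dur c \<theta>0)) {0 + \<theta>0..(\<tau> - \<theta>0) + \<theta>0}"
    using duration_combine[OF \<theta>, of c] integrable_integral[OF pace_integrable, of c \<theta>0 \<tau>] by simp
  hence sh: "((\<lambda>\<theta>. pace (lw c (\<theta> + \<theta>0))) has_integral (dur c \<tau> - dur c \<theta>0)) {0..\<tau> - \<theta>0}"
    using has_integral_shift_real_ivl[of "\<lambda>\<theta>. pace (lw c \<theta>)" _ \<theta>0 \<tau> \<theta>0] by simp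
  have img: "(\<lambda>x. x / (1 / M)) ` {0..\<tau> - \<theta>0} = {0..?L}"
    using M \<theta> by (simp add: image_mult_atLeastAtMost_if' mult.commute)
  have 1: "((\<lambda>\<theta>. pace (lw c (\<theta>0 + \<theta> / M))) has_integral M * (dur c \<tau> - dur c \<theta>0)) {0..?L}"
    using has_integral_stretch_real[OF sh, of "1 / M", unfolded img] M by (simp add: add.commute)
  have 2: "((\<lambda>\<theta>. pace (lw c' \<theta>)) has_integral dur c' ?L) {0..?L}"
    unfolding duration_def by (rule integrable_integral[OF pace_integrable])
  show ?thesis
  proof (rule has_integral_le[OF has_integral_spike_finite[of "{?L}", OF _ _ 2] 1])
    show "(if \<theta> = ?L then 0 else pace (lw c' \<theta>)) \<le> pace (lw c (\<theta>0 + \<theta> / M))" if "\<theta> \<in> {0..?L}" for \<theta>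
    proof (cases "\<theta> = ?L")
      case True
      thus ?thesis using pace_pos[OF lw_nonneg, of c "\<theta>0 + \<theta> / M"] by simp
    next
      case False
      hence "lw c' \<theta> \<le> lw c (\<theta>0 + \<theta> / M)" using that by (intro lw_mono le) auto
      thus ?thesis using False pace_mono[OF lw_nonneg] by simp
    qed
  qed auto
qed

lemma shorter_horizon:
  fixes c :: "nat \<Rightarrow> nat" and r :: "nat \<Rightarrow> real"
  assumes \<eta>: "0 < \<eta>" "\<eta> < 1" and T: "0 \<le> T" and r: "\<And>i. i \<in> X \<Longrightarrow> 0 \<le> r i"
    and \<tau>: "0 \<le> \<tau>" and G: "dur (\<lambda>i. real (c i)) \<tau> \<le> T"
  defines "M \<equiv> (1 - \<eta>) / \<eta>"
  shows "\<exists>c' \<tau>'. sum c' X \<le> sum c X \<and> 0 \<le> \<tau>' \<and> dur (\<lambda>i. real (c' i)) \<tau>' \<le> (1 - \<eta>) * T \<and>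
    (1 - 4 / M) * (\<Sum>i\<in>X. r i * min (real (c i)) (w i * \<tau>)) \<le> (\<Sum>i\<in>X. r i * min (real (c' i)) (w i * \<tau>'))"
proof (cases "dur (\<lambda>i. real (c i)) \<tau> \<le> (1 - \<eta>) * T")
  case True
  have "(1 - 4 / M) * (\<Sum>i\<in>X. r i * min (real (c i)) (w i * \<tau>)) \<le>
      1 * (\<Sum>i\<in>X. r i * min (real (c i)) (w i * \<tau>))"
    by (rule mult_right_mono) (use \<eta> r \<tau> w_pos in \<open>auto simp: M_def less_imp_le intro!: sum_nonneg\<close>)
  thus ?thesis using True \<tau> by (intro exI[of _ c] exI[of _ \<tau>]) simp
next
  case False
  let ?c = "\<lambda>i. real (c i)"
  have M: "0 < M" using \<eta> by (simp add: M_def)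
  have "continuous_on {0..\<tau>} (dur ?c)"
    unfolding duration_def by (rule indefinite_integral_continuous_1[OF pace_integrable])
  moreover have "dur ?c 0 = 0" by (simp add: duration_def)
  moreover have "0 \<le> (1 - \<eta>) * T" using \<eta> T by simp
  \<comment> \<open>\<theta>0 is the clock time at which the shortened horizon ends;
    \<open>x\<close> below is what is sold after it.\<close>
  ultimately obtain \<theta>0 where \<theta>0: "0 \<le> \<theta>0" "\<theta>0 \<le> \<tau>" "dur ?c \<theta>0 = (1 - \<eta>) * T"
    using IVT'[of "dur ?c" 0 "(1 - \<eta>) * T" \<tau>] False \<tau> by auto
  define x where "x = (\<lambda>i. min (?c i) (w i * \<tau>) - min (?c i) (w i * \<theta>0))"
  have x0: "0 \<le> x i" if "i \<in> X" for i
    using mult_left_mono[OF \<theta>0(2), of "w i"] w_pos[OF that] unfolding x_def by linarith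
  have xle: "x i \<le> w i * (\<tau> - \<theta>0)" if "i \<in> X" for i
    using mult_left_mono[OF \<theta>0(2), of "w i"] w_pos[OF that]
    unfolding x_def right_diff_distrib by linarith
  have tail: "dur ?c \<tau> - dur ?c \<theta>0 \<le> \<eta> * T" using G \<theta>0(3) by (simp add: algebra_simps)
  have Mtail: "M * (dur ?c \<tau> - dur ?c \<theta>0) \<le> (1 - \<eta>) * T"
    using mult_left_mono[OF tail, of M] M \<eta> by (simp add: M_def)
  have lw_int: "(lw ?c has_integral (\<Sum>i\<in>X. min (?c i) (w i * hi) - min (?c i) (w i * lo))) {lo..hi}"
    if "lo \<le> hi" for lo hi
  proof -
    have "w i * (min hi (?c i / w i) - min lo (?c i / w i)) = min (?c i) (w i * hi) - min (?c i) (w i * lo)"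
      if "i \<in> X" for i
      using w_pos[OF that] by (simp add: min_mult_distrib_left right_diff_distrib min.commute)
    thus ?thesis using lw_has_integral[OF that, of ?c] by simp
  qed
  \<comment> \<open>The sales rate never increases along the path, and at \<theta>0 it is \<kappa>.
    So the tail, of real length at most \<eta> T, sells at most \<kappa> \<eta> T, while the part
    before, of length (1 - \<eta>) T, sells at least \<kappa> (1 - \<eta>) T. \<open>M\<close> is
    the ratio of the two lengths.\<close>
  have Mx: "M * sum x X \<le> real (sum c X)"
  proof -
    define \<kappa> where "\<kappa> = lw ?c \<theta>0 * rate (lw ?c \<theta>0)"
    have \<kappa>: "0 \<le> \<kappa>" unfolding \<kappa>_def using lw_nonneg rate_pos[OF lw_nonneg] by (simp add: less_imp_le)
    have eq: "lw ?c \<theta> = lw ?c \<theta> * rate (lw ?c \<theta>) * pace (lw ?c \<theta>)" for \<theta>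
      using rate_pos[OF lw_nonneg, of ?c \<theta>] by simp
    have "sum x X \<le> \<kappa> * (dur ?c \<tau> - dur ?c \<theta>0)"
    proof (rule has_integral_le)
      show "(lw ?c has_integral sum x X) {\<theta>0..\<tau>}" using lw_int[OF \<theta>0(2)] by (simp add: x_def)
      have "((\<lambda>\<theta>. pace (lw ?c \<theta>)) has_integral (dur ?c \<tau> - dur ?c \<theta>0)) {\<theta>0..\<tau>}"
        using duration_combine[OF \<theta>0(1,2), of ?c] integrable_integral[OF pace_integrable, of ?c \<theta>0 \<tau>]
        by simp
      thus "((\<lambda>\<theta>. \<kappa> * pace (lw ?c \<theta>)) has_integral \<kappa> * (dur ?c \<tau> - dur ?c \<theta>0)) {\<theta>0..\<tau>}"
        by (rule has_integral_mult_right)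
      show "lw ?c \<theta> \<le> \<kappa> * pace (lw ?c \<theta>)" if "\<theta> \<in> {\<theta>0..\<tau>}" for \<theta>
        by (subst eq, unfold \<kappa>_def)
           (use that pace_pos[OF lw_nonneg, of ?c \<theta>] in
             \<open>intro mult_right_mono throughput_mono lw_antimono lw_nonneg; simp\<close>)
    qed
    also have "\<dots> \<le> \<kappa> * (\<eta> * T)" using tail \<kappa> by (rule mult_left_mono)
    finally have 1: "M * sum x X \<le> \<kappa> * ((1 - \<eta>) * T)"
      using M \<eta> mult_left_mono[of "sum x X" "\<kappa> * (\<eta> * T)" M] by (simp add: M_def mult.left_commute)
    have "\<kappa> * dur ?c \<theta>0 \<le> (\<Sum>i\<in>X. min (?c i) (w i * \<theta>0) - min (?c i) (w i * 0))"
    proof (rule has_integral_le)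
      show "(lw ?c has_integral (\<Sum>i\<in>X. min (?c i) (w i * \<theta>0) - min (?c i) (w i * 0))) {0..\<theta>0}"
        by (rule lw_int[OF \<theta>0(1)])
      show "((\<lambda>\<theta>. \<kappa> * pace (lw ?c \<theta>)) has_integral \<kappa> * dur ?c \<theta>0) {0..\<theta>0}"
        unfolding duration_def by (intro has_integral_mult_right integrable_integral pace_integrable)
      show "\<kappa> * pace (lw ?c \<theta>) \<le> lw ?c \<theta>" if "\<theta> \<in> {0..\<theta>0}" for \<theta>
        by (subst (2) eq, unfold \<kappa>_def)
           (use that pace_pos[OF lw_nonneg, of ?c \<theta>] in
             \<open>intro mult_right_mono throughput_mono lw_antimono lw_nonneg; simp\<close>)
    qed
    also have "\<dots> \<le> (\<Sum>i\<in>X. ?c i)" by (rule sum_mono) simp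
    finally show ?thesis using 1 \<theta>0(3) by simp
  qed
  define R where "R = (\<Sum>i\<in>X. r i * min (?c i) (w i * \<tau>))"
  have R0: "0 \<le> R" unfolding R_def using r \<tau> w_pos by (auto simp: less_imp_le intro!: sum_nonneg)
  \<comment> \<open>On \<open>A\<close> rounding the scaled sales down loses at most half. A product
    of \<open>A'\<close> has sold out, and if it had any stock, its scaled tail is below one unit
    and hence below its stock. For a product of \<open>A''\<close> a single unit covers the scaled
    sales, which are below 1.\<close>
  define A where "A = {i \<in> X. 1 \<le> M * x i}"
  define A' where "A' = {i \<in> X. M * x i < 1 \<and> ?c i \<le> w i * \<tau>}"
  define A'' where "A'' = {i \<in> X. M * x i < 1 \<and> w i * \<tau> < ?c i}"
  have finA: "finite A" "finite A'" "finite A''" using fin by (auto simp: A_def A'_def A''_def)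
  define L where "L = M * (\<tau> - \<theta>0)"
  have L0: "0 \<le> L" using M \<theta>0 by (simp add: L_def)
  define c1 where "c1 = (\<lambda>i. if i \<in> A then nat \<lfloor>M * x i\<rfloor> else 0)"
  define c2 where "c2 = (\<lambda>i. if i \<in> A'' then 1 else 0 :: nat)"
  have c1_le: "real (c1 i) \<le> M * x i" if "i \<in> X" for i
    using x0[OF that] M by (auto simp: c1_def)
  have cap1: "sum c1 X \<le> sum c X"
  proof -
    have "real (sum c1 X) \<le> M * sum x X"
      unfolding of_nat_sum sum_distrib_left by (rule sum_mono) (rule c1_le)
    hence "real (sum c1 X) \<le> real (sum c X)" using Mx by simp
    thus ?thesis by (simp only: of_nat_le_iff)
  qed
  \<comment> \<open>A product of \<open>A''\<close> is not exhausted at \<tau>, so it had at least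
    one unit.\<close>
  have cap2: "sum c2 X \<le> sum c X"
  proof (rule sum_mono)
    fix i assume i: "i \<in> X"
    have "0 \<le> w i * \<tau>" using w_pos[OF i] \<tau> by simp
    thus "c2 i \<le> c i" by (auto simp: c2_def A''_def)
  qed
  have dur1: "dur (\<lambda>i. real (c1 i)) L \<le> (1 - \<eta>) * T" unfolding L_def
  proof (rule order_trans[OF duration_scaled_tail[OF M \<theta>0(1,2), where c = ?c] Mtail])
    fix i \<theta> assume i: "i \<in> X" and \<theta>: "0 \<le> \<theta>" "\<theta> < M * (\<tau> - \<theta>0)" "w i * \<theta> < real (c1 i)"
    have "w i * \<theta> < M * x i" using c1_le[OF i] \<theta> by simp
    hence "w i * (\<theta> / M) < x i" using M by (simp add: divide_simps mult.commute)
    moreover have "0 \<le> w i * (\<theta> / M)" using w_pos[OF i] \<theta> M by simp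
    ultimately show "w i * (\<theta>0 + \<theta> / M) < ?c i" unfolding x_def distrib_left by linarith
  qed
  have dur2: "dur (\<lambda>i. real (c2 i)) L \<le> (1 - \<eta>) * T" unfolding L_def
  proof (rule order_trans[OF duration_scaled_tail[OF M \<theta>0(1,2), where c = ?c] Mtail])
    fix i \<theta> assume i: "i \<in> X" and \<theta>: "0 \<le> \<theta>" "\<theta> < M * (\<tau> - \<theta>0)" "w i * \<theta> < real (c2 i)"
    have "0 \<le> w i * \<theta>" using w_pos[OF i] \<theta> by simp
    hence "w i * \<tau> < ?c i" using \<theta>(3) by (auto simp: c2_def A''_def split: if_splits)
    moreover have "\<theta>0 + \<theta> / M \<le> \<tau>" using \<theta>(2) M by (simp add: divide_simps algebra_simps)
    hence "w i * (\<theta>0 + \<theta> / M) \<le> w i * \<tau>" using w_pos[OF i] by (intro mult_left_mono) auto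
    ultimately show "w i * (\<theta>0 + \<theta> / M) < ?c i" by linarith
  qed
  let ?val = "\<lambda>c' \<tau>'. \<Sum>i\<in>X. r i * min (real (c' i)) (w i * \<tau>')"
  have val1: "M / 2 * (\<Sum>i\<in>A. r i * x i) \<le> ?val c1 L"
  proof -
    have "M / 2 * (\<Sum>i\<in>A. r i * x i) \<le> (\<Sum>i\<in>A. r i * min (real (c1 i)) (w i * L))"
      unfolding sum_distrib_left
    proof (rule sum_mono)
      fix i assume i: "i \<in> A"
      hence iX: "i \<in> X" and Mxi: "1 \<le> M * x i" by (auto simp: A_def)
      have "1 \<le> \<lfloor>M * x i\<rfloor>" using Mxi by (simp add: le_floor_iff)
      hence "M * x i / 2 \<le> real_of_int \<lfloor>M * x i\<rfloor>" by linarith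
      hence "M * x i / 2 \<le> real (c1 i)" using i Mxi by (simp add: c1_def)
      moreover have "M * x i \<le> w i * L"
        using mult_left_mono[OF xle[OF iX], of M] M by (simp add: L_def mult.left_commute)
      hence "M * x i / 2 \<le> w i * L" using Mxi by simp
      ultimately have "r i * (M * x i / 2) \<le> r i * min (real (c1 i)) (w i * L)"
        using r[OF iX] by (intro mult_left_mono) auto
      thus "M / 2 * (r i * x i) \<le> r i * min (real (c1 i)) (w i * L)" by (simp add: mult_ac)
    qed
    also have "\<dots> \<le> ?val c1 L"
      by (rule sum_mono2[OF fin]) (use r w_pos L0 in \<open>auto simp: A_def less_imp_le\<close>)
    finally show ?thesis .
  qed
  have val2: "M * (\<Sum>i\<in>A''. r i * x i) \<le> ?val c2 L"
  proof -
    have "M * (\<Sum>i\<in>A''. r i * x i) \<le> (\<Sum>i\<in>A''. r i * min (real (c2 i)) (w i * L))"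
      unfolding sum_distrib_left
    proof (rule sum_mono)
      fix i assume i: "i \<in> A''"
      hence iX: "i \<in> X" and Mxi: "M * x i < 1" by (auto simp: A''_def)
      have "M * x i \<le> w i * L"
        using mult_left_mono[OF xle[OF iX], of M] M by (simp add: L_def mult.left_commute)
      hence "r i * (M * x i) \<le> r i * min (real (c2 i)) (w i * L)"
        using r[OF iX] Mxi i by (intro mult_left_mono) (auto simp: c2_def)
      thus "M * (r i * x i) \<le> r i * min (real (c2 i)) (w i * L)" by (simp add: mult_ac)
    qed
    also have "\<dots> \<le> ?val c2 L"
      by (rule sum_mono2[OF fin]) (use r w_pos L0 in \<open>auto simp: A''_def less_imp_le\<close>)
    finally show ?thesis .
  qed
  have val3: "M * (\<Sum>i\<in>A'. r i * x i) \<le> R"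
  proof -
    have "M * (\<Sum>i\<in>A'. r i * x i) \<le> (\<Sum>i\<in>A'. r i * min (?c i) (w i * \<tau>))"
      unfolding sum_distrib_left
    proof (rule sum_mono)
      fix i assume i: "i \<in> A'"
      hence iX: "i \<in> X" and Mxi: "M * x i < 1" "?c i \<le> w i * \<tau>" by (auto simp: A'_def)
      have "M * x i \<le> ?c i"
      proof (cases "c i = 0")
        case True
        hence "x i = 0" using w_pos[OF iX] \<theta>0 \<tau> by (simp add: x_def)
        thus ?thesis by simp
      next
        case False
        hence "1 \<le> ?c i" by simp
        thus ?thesis using Mxi by linarith
      qed
      hence "r i * (M * x i) \<le> r i * min (?c i) (w i * \<tau>)"
        using r[OF iX] Mxi by (intro mult_left_mono) auto
      thus "M * (r i * x i) \<le> r i * min (?c i) (w i * \<tau>)" by (simp add: mult_ac)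
    qed
    also have "\<dots> \<le> R" unfolding R_def
      by (rule sum_mono2[OF fin]) (use r w_pos \<tau> in \<open>auto simp: A'_def less_imp_le\<close>)
    finally show ?thesis .
  qed
  have split: "R = ?val c \<theta>0 + ((\<Sum>i\<in>A. r i * x i) + (\<Sum>i\<in>A'. r i * x i) + (\<Sum>i\<in>A''. r i * x i))"
  proof -
    have "R = ?val c \<theta>0 + (\<Sum>i\<in>X. r i * x i)"
      unfolding R_def sum.distrib[symmetric] by (rule sum.cong) (simp_all add: x_def right_diff_distrib)
    also have "X = A \<union> (A' \<union> A'')" by (auto simp: A_def A'_def A''_def)
    hence "(\<Sum>i\<in>X. r i * x i) = (\<Sum>i\<in>A \<union> (A' \<union> A''). r i * x i)" by (rule arg_cong)
    also have "\<dots> = (\<Sum>i\<in>A. r i * x i) + ((\<Sum>i\<in>A'. r i * x i) + (\<Sum>i\<in>A''. r i * x i))"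
    proof -
      have d1: "A \<inter> (A' \<union> A'') = {}" and d2: "A' \<inter> A'' = {}" by (auto simp: A_def A'_def A''_def)
      show ?thesis using finA by (simp add: sum.union_disjoint[OF _ _ d1] sum.union_disjoint[OF _ _ d2])
    qed
    finally show ?thesis by simp
  qed
  define v where "v = (1 - 4 / M) * R"
  \<comment> \<open>The constant 4 is 2 + 1 + 1: if all three plans earned less than
    \<open>v\<close>, then \<open>M\<close> times the tail revenue would be below 2 \<open>v\<close>
    on \<open>A\<close>, below \<open>v\<close> on \<open>A''\<close> and at most \<open>R\<close>
    on \<open>A'\<close>.\<close>
  have "v \<le> ?val c \<theta>0 \<or> v \<le> ?val c1 L \<or> v \<le> ?val c2 L"
  proof (rule ccontr)
    assume "\<not> ?thesis"
    hence lt: "?val c \<theta>0 < v" "?val c1 L < v" "?val c2 L < v" by auto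
    have "M / 2 * (\<Sum>i\<in>A. r i * x i) < v" "M * (\<Sum>i\<in>A''. r i * x i) < v"
      using val1 val2 lt by linarith+
    hence "M * R < M * v + 2 * v + R + v"
      using val3 mult_strict_left_mono[OF lt(1) M] unfolding split by (simp add: distrib_left)
    also have "\<dots> = M * R - 12 / M * R" unfolding v_def using M by (simp add: field_simps)
    finally show False using R0 M by (simp add: divide_less_0_iff mult_less_0_iff)
  qed
  thus ?thesis
  proof (elim disjE)
    assume "v \<le> ?val c \<theta>0"
    thus ?thesis unfolding v_def R_def by (intro exI[of _ c] exI[of _ \<theta>0]) (use \<theta>0 in simp)
  next
    assume "v \<le> ?val c1 L"
    thus ?thesis unfolding v_def R_def
      by (intro exI[of _ c1] exI[of _ L] conjI cap1 L0 dur1)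
  next
    assume "v \<le> ?val c2 L"
    thus ?thesis unfolding v_def R_def
      by (intro exI[of _ c2] exI[of _ L] conjI cap2 L0 dur2)
  qed
qed

section \<open>Splitting and bounding durations\<close>

lemma duration_shift_le:
  assumes "0 \<le> u" "0 \<le> \<tau>"
    and le: "\<And>i \<theta>. i \<in> X \<Longrightarrow> 0 \<le> \<theta> \<Longrightarrow> w i * (\<theta> + u) < z i \<Longrightarrow> w i * \<theta> < z' i"
  shows "dur z (u + \<tau>) \<le> dur z u + dur z' \<tau>"
proof -
  have "((\<lambda>\<theta>. pace (lw z \<theta>)) has_integral (dur z (u + \<tau>) - dur z u)) {u..u + \<tau>}"
    using duration_combine[of u "u + \<tau>" z] assms integrable_integral[OF pace_integrable, of z u "u + \<tau>"]
    by simp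
  hence 1: "((\<lambda>\<theta>. pace (lw z (\<theta> + u))) has_integral (dur z (u + \<tau>) - dur z u)) {0..\<tau>}"
    using has_integral_shift_real_ivl[of "\<lambda>\<theta>. pace (lw z \<theta>)" _ u "u + \<tau>" u] by simp
  have 2: "((\<lambda>\<theta>. pace (lw z' \<theta>)) has_integral dur z' \<tau>) {0..\<tau>}"
    unfolding duration_def by (rule integrable_integral[OF pace_integrable])
  have "dur z (u + \<tau>) - dur z u \<le> dur z' \<tau>"
    by (rule has_integral_le[OF 1 2]) (intro pace_mono lw_nonneg lw_mono le; simp)
  thus ?thesis by simp
qed

text \<open>Here and in \<open>duration_shift_le\<close>, \<open>z'\<close> is the inventory left at
  clock time \<open>u\<close>. The two inequalities are kept apart because a fluid path sells in
  general at most, and with one parity on display exactly, what the clock prescribes.\<close>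

lemma duration_shift_ge:
  assumes "0 \<le> u" "0 \<le> \<tau>"
    and le: "\<And>i \<theta>. i \<in> X \<Longrightarrow> 0 \<le> \<theta> \<Longrightarrow> w i * \<theta> < z' i \<Longrightarrow> w i * (\<theta> + u) < z i"
  shows "dur z u + dur z' \<tau> \<le> dur z (u + \<tau>)"
proof -
  have "((\<lambda>\<theta>. pace (lw z \<theta>)) has_integral (dur z (u + \<tau>) - dur z u)) {u..u + \<tau>}"
    using duration_combine[of u "u + \<tau>" z] assms integrable_integral[OF pace_integrable, of z u "u + \<tau>"]
    by simp
  hence 1: "((\<lambda>\<theta>. pace (lw z (\<theta> + u))) has_integral (dur z (u + \<tau>) - dur z u)) {0..\<tau>}"
    using has_integral_shift_real_ivl[of "\<lambda>\<theta>. pace (lw z \<theta>)" _ u "u + \<tau>" u] by simp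
  have 2: "((\<lambda>\<theta>. pace (lw z' \<theta>)) has_integral dur z' \<tau>) {0..\<tau>}"
    unfolding duration_def by (rule integrable_integral[OF pace_integrable])
  have "dur z' \<tau> \<le> dur z (u + \<tau>) - dur z u"
    by (rule has_integral_le[OF 2 1]) (intro pace_mono lw_nonneg lw_mono le; simp)
  thus ?thesis by simp
qed

lemma duration_le_const:
  assumes "0 \<le> \<tau>" "0 \<le> W" "\<And>\<theta>. 0 \<le> \<theta> \<Longrightarrow> \<theta> < \<tau> \<Longrightarrow> lw z \<theta> \<le> W"
  shows "dur z \<tau> \<le> \<tau> * pace W"
proof -
  have 1: "((\<lambda>\<theta>. pace (lw z \<theta>)) has_integral dur z \<tau>) {0..\<tau>}"
    unfolding duration_def by (rule integrable_integral[OF pace_integrable])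
  have 2: "((\<lambda>\<theta>. pace W) has_integral \<tau> * pace W) {0..\<tau>}"
    using has_integral_const_real[of "pace W" 0 \<tau>] assms by simp
  show ?thesis
  proof (rule has_integral_le[OF has_integral_spike_finite[of "{\<tau>}", OF _ _ 1] 2])
    show "(if \<theta> = \<tau> then 0 else pace (lw z \<theta>)) \<le> pace W" if "\<theta> \<in> {0..\<tau>}" for \<theta>
      using that pace_mono[OF lw_nonneg assms(3), of \<theta>] pace_pos[OF assms(2)] by auto
  qed auto
qed

text \<open>The bound is required before \<tau> only, since a base may run out exactly at \<tau>;
  hence the integrand is altered at this one point.\<close>

lemma duration_ge_const:
  assumes "0 \<le> \<tau>" "0 \<le> W" "\<And>\<theta>. 0 \<le> \<theta> \<Longrightarrow> \<theta> < \<tau> \<Longrightarrow> W \<le> lw z \<theta>"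
  shows "\<tau> * pace W \<le> dur z \<tau>"
proof -
  have 1: "((\<lambda>\<theta>. pace (lw z \<theta>)) has_integral dur z \<tau>) {0..\<tau>}"
    unfolding duration_def by (rule integrable_integral[OF pace_integrable])
  have 2: "((\<lambda>\<theta>. pace W) has_integral \<tau> * pace W) {0..\<tau>}"
    using has_integral_const_real[of "pace W" 0 \<tau>] assms by simp
  show ?thesis
  proof (rule has_integral_le[OF has_integral_spike_finite[of "{\<tau>}", OF _ _ 2] 1])
    show "(if \<theta> = \<tau> then 0 else pace W) \<le> pace (lw z \<theta>)" if "\<theta> \<in> {0..\<tau>}" for \<theta>
      using that pace_mono[OF assms(2) assms(3), of \<theta>] pace_pos[OF lw_nonneg] by (auto simp: less_imp_le)
  qed auto
qed

end

section \<open>The fluid process, size by size\<close>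

text \<open>The six customer types that may buy size \<open>s\<close>, in the order of \<open>near_type\<close>, and the deviation
  at which they buy it.\<close>

definition near_type :: "nat \<Rightarrow> nat \<Rightarrow> ctype" where
  "near_type s k = [(s, Up, 0), (s, Down, 0), (s, Up, 1), (s, Down, 1), (s - 1, Up, 1), (s + 1, Down, 1)] ! k"

definition near_dev :: "nat \<Rightarrow> nat" where
  "near_dev k = (if k < 4 then 0 else 1)"

text \<open>With \<mu> the arrival probability and \<beta> the fit factor, a = \<mu> \<beta> and b =
  \<beta>, so a / (1 + b W) is the demand of the type per unit of base weight. Absent types get a =
  0 here and b = 1 in \<open>type_b\<close>. For s = 1 the fifth candidate has preferred size 0 and
  is absent.\<close>

definition type_a :: "cftc \<Rightarrow> nat \<Rightarrow> nat \<Rightarrow> real" where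
  "type_a I s k = (if near_type s k \<in> types I
     then arrival I (near_type s k) * fit I (near_dev k) (near_type s k) else 0)"

definition type_b :: "cftc \<Rightarrow> nat \<Rightarrow> nat \<Rightarrow> real" where
  "type_b I s k = (if near_type s k \<in> types I then fit I (near_dev k) (near_type s k) else 1)"

definition bases_of :: "cftc \<Rightarrow> nat \<Rightarrow> nat set" where
  "bases_of I s = {i \<in> {1..nbases I}. s \<in> offered I i}"

text \<open>Without a potential buyer the rate is 0, and its reciprocal 1 / 0 = 0 would give a
  meaningless duration. Such sizes earn nothing and are set aside.\<close>

definition live_size :: "cftc \<Rightarrow> nat \<Rightarrow> bool" where
  "live_size I s \<longleftrightarrow> (\<exists>k<6. 0 < type_a I s k)"

abbreviation size_rate :: "cftc \<Rightarrow> nat \<Rightarrow> real \<Rightarrow> real" where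
  "size_rate I s \<equiv> choice_rate (type_a I s) (type_b I s)"

abbreviation size_duration :: "cftc \<Rightarrow> nat \<Rightarrow> (nat \<Rightarrow> real) \<Rightarrow> real \<Rightarrow> real" where
  "size_duration I s \<equiv> duration (bases_of I s) (weight I) (type_a I s) (type_b I s)"

definition shown_weight :: "cftc \<Rightarrow> product set \<Rightarrow> nat \<Rightarrow> real" where
  "shown_weight I A s = (\<Sum>j | (j, s) \<in> A. weight I j)"

lemma less_6_cases:
  assumes "k < (6::nat)"
  obtains "k = 0" | "k = 1" | "k = 2" | "k = 3" | "k = 4" | "k = 5"
  using assms by force

lemma near_type_simps:
  "near_type s 0 = (s, Up, 0)" "near_type s (Suc 0) = (s, Down, 0)" "near_type s 2 = (s, Up, 1)"
  "near_type s 3 = (s, Down, 1)" "near_type s 4 = (s - 1, Up, 1)" "near_type s 5 = (s + 1, Down, 1)"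
  by (simp_all add: near_type_def numeral_eq_Suc)

lemma inj_near_type: "1 \<le> s \<Longrightarrow> inj_on (near_type s) {..<6}"
  by (rule inj_onI) (auto elim!: less_6_cases simp: near_type_simps)

lemma mem_universe: "(i, s) \<in> universe I \<longleftrightarrow> i \<in> bases_of I s"
  by (auto simp: universe_def bases_of_def)

lemma universe_size:
  assumes "cftc_instance I" "p \<in> universe I" shows "snd p \<in> {1..nsizes I}"
proof -
  obtain i s where p: "p = (i, s)" by (cases p)
  have "i \<in> {1..nbases I}" "s \<in> offered I i" using assms(2) by (auto simp: universe_def p)
  moreover have "offered I i \<subseteq> {1..nsizes I}" using assms(1) calculation by (simp add: cftc_instance_def)
  ultimately show ?thesis by (auto simp: p)
qed

lemma finite_bases_of: "finite (bases_of I s)"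
  by (simp add: bases_of_def)

lemma weight_bases_pos: "cftc_instance I \<Longrightarrow> i \<in> bases_of I s \<Longrightarrow> 0 < weight I i"
  by (auto simp: cftc_instance_def bases_of_def)

lemma revenue_bases_nonneg: "cftc_instance I \<Longrightarrow> i \<in> bases_of I s \<Longrightarrow> 0 \<le> revenue I i"
  by (auto simp: cftc_instance_def bases_of_def)

lemma considered_near:
  assumes I: "cftc_instance I" and g: "g \<in> types I" and c: "(i, s) \<in> considered g A"
  shows "g \<in> near_type s ` {..<6}"
proof -
  obtain sg dir l where gg: "g = (sg, dir, l)" by (cases g)
  have sl: "1 \<le> sg" "l = 0 \<or> l = 1" using I g by (auto simp: cftc_instance_def gg)
  have "g = near_type s 0 \<or> g = near_type s (Suc 0) \<or> g = near_type s 2 \<or> g = near_type s 3 \<or>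
      g = near_type s 4 \<or> g = near_type s 5"
    using c sl unfolding gg near_type_simps by (cases dir) auto
  thus ?thesis by (elim disjE) auto
qed

lemma near_fit:
  assumes I: "cftc_instance I" and k: "k < 6" and g: "near_type s k \<in> types I" and s: "s \<in> {1..nsizes I}"
  shows "0 < fit I (near_dev k) (near_type s k)" "fit I (near_dev k) (near_type s k) \<le> fit I 0 (near_type s k)"
    "nat \<bar>int s - int (fst (near_type s k))\<bar> = near_dev k"
proof -
  have pos: "0 < fit I j (near_type s k)" if "j < nsizes I" for j
    using I g that by (simp add: cftc_instance_def)
  have dec: "fit I (Suc j) (near_type s k) \<le> fit I j (near_type s k)" if "Suc j < nsizes I" for j
    using I g that by (simp add: cftc_instance_def)
  have "fst (near_type s k) \<in> {1..nsizes I}" using I g by (auto simp: cftc_instance_def)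
  \<comment> \<open>Deviation 1 occurs only between two different sizes of the instance; then there
    are at least two sizes, and the assumptions on \<open>fit\<close> extend to index 1.\<close>
  hence dev: "near_dev k < nsizes I" using k s by (auto elim!: less_6_cases simp: near_type_simps near_dev_def)
  show "0 < fit I (near_dev k) (near_type s k)" by (rule pos[OF dev])
  show "fit I (near_dev k) (near_type s k) \<le> fit I 0 (near_type s k)"
    using dec[of 0] dev by (auto simp: near_dev_def)
  show "nat \<bar>int s - int (fst (near_type s k))\<bar> = near_dev k"
    using k s by (auto elim!: less_6_cases simp: near_type_simps near_dev_def)
qed

lemma type_ab:
  assumes "cftc_instance I" "s \<in> {1..nsizes I}" "k < 6"
  shows "0 \<le> type_a I s k" "0 < type_b I s k"
  using near_fit[OF assms(1,3) _ assms(2)] assms(1)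
  by (auto simp: type_a_def type_b_def cftc_instance_def less_imp_le)

lemma single_size_live:
  assumes "cftc_instance I" "s \<in> {1..nsizes I}" "live_size I s"
  shows "single_size (bases_of I s) (weight I) (type_a I s) (type_b I s)"
  by standard (use type_ab[OF assms(1,2)] assms(3) weight_bases_pos[OF assms(1)] finite_bases_of in
      \<open>auto simp: live_size_def\<close>)

section \<open>Choice probabilities of the products of one size\<close>

lemma choice_prob_near:
  assumes I: "cftc_instance I" and s: "1 \<le> s"
  shows "choice_prob I (i, s) A = (\<Sum>k<6. if near_type s k \<in> types I
    then arrival I (near_type s k) * type_choice_prob I (near_type s k) (i, s) A else 0)"
proof -
  have "(\<Sum>g\<in>types I. arrival I g) = 1" using I by (simp add: cftc_instance_def)
  hence fin: "finite (types I)" by (cases "finite (types I)") auto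
  let ?f = "\<lambda>g. arrival I g * type_choice_prob I g (i, s) A"
  have "choice_prob I (i, s) A = (\<Sum>g\<in>types I \<inter> near_type s ` {..<6}. ?f g)"
    unfolding choice_prob_def
    by (rule sum.mono_neutral_right[OF fin])
       (use considered_near[OF I] in \<open>auto simp: type_choice_prob_def\<close>)
  also have "\<dots> = (\<Sum>g\<in>near_type s ` {..<6}. if g \<in> types I then ?f g else 0)"
    by (rule sum.mono_neutral_cong_left) auto
  also have "\<dots> = (\<Sum>k<6. if near_type s k \<in> types I then ?f (near_type s k) else 0)"
    by (subst sum.reindex[OF inj_near_type[OF s]]) simp
  finally show ?thesis .
qed

text \<open>A base shown in size \<open>s\<close> is considered by each near type in some size: in
  \<open>s\<close> itself or in the preferred size, where the fit factor is at least as large. Hence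
  other sizes on display can only enlarge the denominator of the choice probability.\<close>

lemma considered_weight_ge:
  assumes I: "cftc_instance I" and k: "k < 6" and g: "near_type s k \<in> types I"
    and s: "s \<in> {1..nsizes I}" and A: "A \<subseteq> universe I"
  shows "fit I (near_dev k) (near_type s k) * shown_weight I A s \<le>
    (\<Sum>q\<in>considered (near_type s k) A. pref_weight I (near_type s k) q)"
proof -
  let ?g = "near_type s k" let ?J = "{j. (j, s) \<in> A}"
  have finA: "finite A" using A finite_universe[OF I] by (rule finite_subset)
  have "\<exists>\<sigma>. (j, \<sigma>) \<in> considered ?g A \<and> (nat \<bar>int \<sigma> - int (fst ?g)\<bar> = near_dev k \<or>
      nat \<bar>int \<sigma> - int (fst ?g)\<bar> = 0)" if j: "j \<in> ?J" for j
  proof (cases "k < 4")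
    case True
    hence "k = 0 \<or> k = 1 \<or> k = 2 \<or> k = 3" by auto
    hence "(j, s) \<in> considered ?g A" using j by (auto simp: near_type_simps)
    thus ?thesis using near_fit(3)[OF I k g s] by auto
  next
    case False
    hence k45: "k = 4 \<or> k = 5" using k by auto
    let ?s' = "fst ?g"
    have ns: "{s - 1..s - 1 + 1} = {s - 1, s}" "{s + 1 - 1..s + 1} = {s, s + 1}" using s by auto
    show ?thesis
    proof (cases "(j, ?s') \<in> A")
      case True
      hence "(j, ?s') \<in> considered ?g A" using k45 by (auto simp: near_type_simps)
      thus ?thesis by auto
    next
      case False
      hence "(j, s) \<in> considered ?g A" using k45 j ns by (auto simp: near_type_simps)
      thus ?thesis using near_fit(3)[OF I k g s] by auto
    qed
  qed
  then obtain \<sigma> where \<sigma>: "\<And>j. j \<in> ?J \<Longrightarrow> (j, \<sigma> j) \<in> considered ?g A"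
    "\<And>j. j \<in> ?J \<Longrightarrow> nat \<bar>int (\<sigma> j) - int (fst ?g)\<bar> = near_dev k \<or> nat \<bar>int (\<sigma> j) - int (fst ?g)\<bar> = 0"
    by metis
  have "fit I (near_dev k) ?g * shown_weight I A s \<le> (\<Sum>j\<in>?J. pref_weight I ?g (j, \<sigma> j))"
    unfolding shown_weight_def sum_distrib_left
  proof (rule sum_mono)
    fix j assume j: "j \<in> ?J"
    hence "0 < weight I j" using A I by (auto simp: universe_def cftc_instance_def)
    moreover have "fit I (near_dev k) ?g \<le> fit I (nat \<bar>int (\<sigma> j) - int (fst ?g)\<bar>) ?g"
      using \<sigma>(2)[OF j] near_fit(2)[OF I k g s] by auto
    ultimately show "fit I (near_dev k) ?g * weight I j \<le> pref_weight I ?g (j, \<sigma> j)"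
      by (simp add: pref_weight_def mult.commute)
  qed
  also have "\<dots> = (\<Sum>q\<in>(\<lambda>j. (j, \<sigma> j)) ` ?J. pref_weight I ?g q)"
    by (subst sum.reindex) (auto simp: inj_on_def)
  also have "\<dots> \<le> (\<Sum>q\<in>considered ?g A. pref_weight I ?g q)"
  proof (rule sum_mono2)
    show "finite (considered ?g A)" using finite_subset[OF considered_subset finA] .
    show "(\<lambda>j. (j, \<sigma> j)) ` ?J \<subseteq> considered ?g A" using \<sigma>(1) by auto
  qed (use pref_weight_pos[OF I g A] in \<open>auto simp: less_imp_le\<close>)
  finally show ?thesis .
qed

lemma shown_weight_nonneg:
  assumes "cftc_instance I" "A \<subseteq> universe I" shows "0 \<le> shown_weight I A s"
  unfolding shown_weight_def
  by (rule sum_nonneg) (use assms in \<open>auto simp: universe_def cftc_instance_def less_imp_le\<close>)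

text \<open>This is where other sizes are seen to slow down sales. For a product on display the
  bound is attained when only one parity is shown, see \<open>choice_prob_parity\<close>.\<close>

lemma choice_prob_le:
  assumes I: "cftc_instance I" and A: "A \<subseteq> universe I" and s: "s \<in> {1..nsizes I}" and i: "i \<in> bases_of I s"
  shows "choice_prob I (i, s) A \<le> weight I i * size_rate I s (shown_weight I A s)"
proof -
  have s1: "1 \<le> s" using s by simp
  have w: "0 < weight I i" using I i by (rule weight_bases_pos)
  show ?thesis unfolding choice_prob_near[OF I s1] choice_rate_def sum_distrib_left
  proof (rule sum_mono)
    fix k assume "k \<in> {..<(6::nat)}"
    hence k: "k < 6" by simp
    let ?g = "near_type s k" let ?W = "shown_weight I A s"
    have nn: "0 \<le> type_a I s k / (1 + type_b I s k * ?W)"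
      using type_ab[OF I s k] shown_weight_nonneg[OF I A] by (simp add: less_imp_le)
    show "(if ?g \<in> types I then arrival I ?g * type_choice_prob I ?g (i, s) A else 0) \<le>
        weight I i * (type_a I s k / (1 + type_b I s k * ?W))"
    proof (cases "?g \<in> types I \<and> (i, s) \<in> considered ?g A")
      case False
      hence "(if ?g \<in> types I then arrival I ?g * type_choice_prob I ?g (i, s) A else 0) = 0"
        by (auto simp: type_choice_prob_def)
      thus ?thesis using mult_nonneg_nonneg[OF less_imp_le[OF w] nn] by simp
    next
      case True
      hence g: "?g \<in> types I" by simp
      have f: "0 < fit I (near_dev k) ?g" by (rule near_fit(1)[OF I k g s])
      have mu: "0 \<le> arrival I ?g" using I g by (simp add: cftc_instance_def)
      let ?D = "\<Sum>q\<in>considered ?g A. pref_weight I ?g q"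
      have tcp: "type_choice_prob I ?g (i, s) A = weight I i * fit I (near_dev k) ?g / (1 + ?D)"
        using True near_fit(3)[OF I k g s] by (simp add: type_choice_prob_def pref_weight_def)
      have "0 \<le> fit I (near_dev k) ?g * ?W" using f shown_weight_nonneg[OF I A] by simp
      hence "type_choice_prob I ?g (i, s) A \<le>
          weight I i * fit I (near_dev k) ?g / (1 + fit I (near_dev k) ?g * ?W)"
        unfolding tcp using considered_weight_ge[OF I k g s A] f w
        by (intro divide_left_mono mult_pos_pos) (auto intro: add_pos_nonneg order_trans)
      from mult_left_mono[OF this mu] show ?thesis using g by (simp add: type_a_def type_b_def mult_ac)
    qed
  qed
qed

text \<open>The windows of these types contain \<open>s\<close> and at most one neighbour, which has
  the other parity and is therefore not shown.\<close>

lemma considered_parity: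
  assumes s: "1 \<le> s" and k: "k < 6" and par: "\<And>p. p \<in> A \<Longrightarrow> even (snd p + s)"
  shows "considered (near_type s k) A = {p \<in> A. snd p = s}"
proof -
  have no: "(i, s - 1) \<notin> A" "(i, s + 1) \<notin> A" for i
    using par[of "(i, s - 1)"] par[of "(i, s + 1)"] s by auto
  have ns: "{s..s + 0} = {s}" "{s..s + 1} = {s, s + 1}" "{s - 0..s} = {s}" "{s - 1..s} = {s - 1, s}"
    "{s - 1..s - 1 + 1} = {s - 1, s}" "{s + 1 - 1..s + 1} = {s, s + 1}" using s by auto
  have d: "considered (near_type s 0) A = {(i, s') \<in> A. s' = s}"
    "considered (near_type s (Suc 0)) A = {(i, s') \<in> A. s' = s}"
    "considered (near_type s 2) A = {(i, s') \<in> A. s' = s}"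
    "considered (near_type s 3) A = {(i, s') \<in> A. s' = s}"
    "considered (near_type s 4) A = {(i, s') \<in> A. s' = s}"
    "considered (near_type s 5) A = {(i, s') \<in> A. s' = s}"
    unfolding near_type_simps considered.simps ns using no by blast+
  have "{(i, s') \<in> A. s' = s} = {p \<in> A. snd p = s}" by auto
  with k d show ?thesis by (auto elim!: less_6_cases)
qed

lemma choice_prob_parity:
  assumes I: "cftc_instance I" and A: "A \<subseteq> universe I" and s: "s \<in> {1..nsizes I}"
    and par: "\<And>p. p \<in> A \<Longrightarrow> even (snd p + s)" and i: "(i, s) \<in> A"
  shows "choice_prob I (i, s) A = weight I i * size_rate I s (shown_weight I A s)"
proof -
  have s1: "1 \<le> s" using s by simp
  show ?thesis unfolding choice_prob_near[OF I s1] choice_rate_def sum_distrib_left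
  proof (rule sum.cong[OF refl])
    fix k assume "k \<in> {..<(6::nat)}"
    hence k: "k < 6" by simp
    let ?g = "near_type s k" let ?W = "shown_weight I A s"
    have cons: "considered ?g A = {p \<in> A. snd p = s}"
      by (rule considered_parity[OF s1 k]) (rule par)
    have "(\<Sum>q\<in>considered ?g A. pref_weight I ?g q) = fit I (near_dev k) ?g * ?W" if g: "?g \<in> types I"
    proof -
      have "(\<Sum>q\<in>considered ?g A. pref_weight I ?g q) =
          (\<Sum>q\<in>(\<lambda>j. (j, s)) ` {j. (j, s) \<in> A}. pref_weight I ?g q)"
        unfolding cons by (rule sum.cong) auto
      also have "\<dots> = (\<Sum>j | (j, s) \<in> A. fit I (near_dev k) ?g * weight I j)"
        by (subst sum.reindex) (auto simp: inj_on_def pref_weight_def near_fit(3)[OF I k g s] mult.commute)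
      finally show ?thesis by (simp add: shown_weight_def sum_distrib_left)
    qed
    thus "(if ?g \<in> types I then arrival I ?g * type_choice_prob I ?g (i, s) A else 0) =
        weight I i * (type_a I s k / (1 + type_b I s k * ?W))"
      using i near_fit(3)[OF I k _ s]
      by (auto simp: type_choice_prob_def cons type_a_def type_b_def pref_weight_def mult_ac)
  qed
qed

lemma choice_prob_dead:
  assumes I: "cftc_instance I" and s: "s \<in> {1..nsizes I}" and dead: "\<not> live_size I s"
    and A: "A \<subseteq> universe I" and i: "i \<in> bases_of I s"
  shows "choice_prob I (i, s) A = 0"
proof -
  have "type_a I s k = 0" if "k < 6" for k
    using dead type_ab(1)[OF I s that] that by (force simp: live_size_def)
  hence "size_rate I s W = 0" for W by (simp add: choice_rate_def)
  thus ?thesis using choice_prob_le[OF I A s i] choice_prob_nonneg[OF I A, of "(i, s)"] by simp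
qed

text \<open>One phase up to the first depletion. The number of displayed products drops unless the
  horizon is reached, which drives the inductions below.\<close>

lemma fluid_step:
  assumes I: "cftc_instance I" and T: "0 \<le> T" and y: "fluid_path I T z y"
  obtains d where "0 \<le> d" "d \<le> T" "no_depletion I z d"
    "\<And>p. p \<in> universe I \<Longrightarrow> y d p = z p - d * choice_prob I p (displayed I z)"
    "fluid_path I (T - d) (y d) (\<lambda>t. y (d + t))"
    "d = T \<or> card (displayed I (y d)) < card (displayed I z)"
    "displayed I (y d) \<subseteq> displayed I z"
proof -
  obtain d where d: "0 \<le> d" "d \<le> T" "no_depletion I z d"
    "d = T \<or> displayed I (\<lambda>p. z p - d * choice_prob I p (displayed I z)) \<subset> displayed I z"
    using first_depletion[OF I T] by metis
  have yd: "y d p = z p - d * choice_prob I p (displayed I z)" if "p \<in> universe I" for p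
    using fluid_path_linear[OF I y d(3) that d(1) order_refl d(2)] .
  have disp: "displayed I (y d) = displayed I (\<lambda>p. z p - d * choice_prob I p (displayed I z))"
    using yd by (auto simp: displayed_def)
  have "finite (displayed I z)"
    by (rule finite_subset[OF _ finite_universe[OF I]]) (auto simp: displayed_def)
  hence card: "d = T \<or> card (displayed I (y d)) < card (displayed I z)"
    using d(4) unfolding disp by (metis psubset_card_mono)
  have "displayed I (y d) \<subseteq> displayed I z"
  proof
    fix p assume p: "p \<in> displayed I (y d)"
    have "0 \<le> d * choice_prob I p (displayed I z)"
      using d(1) choice_prob_nonneg[OF I, of "displayed I z" p] by (auto simp: displayed_def)
    moreover have "p \<in> universe I" "0 < y d p" using p by (auto simp: displayed_def)
    ultimately show "p \<in> displayed I z" using yd[of p] by (simp add: displayed_def)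
  qed
  with that d(1-3) yd fluid_path_restart[OF I y d(1,2)] card show ?thesis by blast
qed

lemma fluid_decreasing:
  assumes I: "cftc_instance I" and T: "0 \<le> T" and y: "fluid_path I T z y" and p: "p \<in> universe I"
  shows "y T p \<le> z p"
proof -
  have "((\<lambda>u. choice_prob I p (displayed I (y u))) has_integral (z p - y T p)) {0..T}"
    using y p T by (simp add: fluid_path_def)
  moreover have "0 \<le> choice_prob I p (displayed I (y u))" for u
    by (rule choice_prob_nonneg[OF I]) (auto simp: displayed_def)
  ultimately have "0 \<le> z p - y T p" by (rule has_integral_nonneg)
  thus ?thesis by simp
qed

lemma fluid_nonneg:
  assumes I: "cftc_instance I" and T: "0 \<le> T" and y: "fluid_path I T z y" and p: "p \<in> universe I"
    and z: "0 \<le> z p"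
  shows "0 \<le> y T p"
  using T y z
proof (induction "card (displayed I z)" arbitrary: z T y rule: less_induct)
  case less
  obtain d where d: "0 \<le> d" "d \<le> T" "no_depletion I z d"
    "\<And>p. p \<in> universe I \<Longrightarrow> y d p = z p - d * choice_prob I p (displayed I z)"
    "fluid_path I (T - d) (y d) (\<lambda>t. y (d + t))"
    "d = T \<or> card (displayed I (y d)) < card (displayed I z)"
    by (rule fluid_step[OF I less.prems(1,2)], rule that)
  let ?c = "choice_prob I p (displayed I z)"
  have c: "0 \<le> ?c" by (rule choice_prob_nonneg[OF I]) (auto simp: displayed_def)
  have yd: "0 \<le> y d p"
  proof (rule ccontr)
    assume "\<not> 0 \<le> y d p"
    hence neg: "z p < d * ?c" using d(4)[OF p] by simp
    hence pos: "0 < d * ?c" using less.prems(3) by simp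
    hence c0: "0 < ?c" using d(1) c by (auto simp: zero_less_mult_iff)
    hence "p \<in> displayed I z" using choice_prob_outside[of p "displayed I z" I] by auto
    \<comment> \<open>The linear path would hit zero at time \<open>z p / ?c\<close>, inside the
      phase.\<close>
    moreover have "z p / ?c < d" using neg c0 by (simp add: divide_simps)
    moreover have "0 \<le> z p / ?c" using less.prems(3) c by simp
    ultimately have "0 < z p - z p / ?c * ?c" using d(3) unfolding no_depletion_def by blast
    thus False using c0 by simp
  qed
  show ?case
  proof (cases "d = T")
    case False
    hence "card (displayed I (y d)) < card (displayed I z)" using d(6) by simp
    from less.hyps[OF this _ d(5) yd] d(2) show ?thesis by simp
  qed (use yd in simp)
qed

lemma shown_weight_live:
  assumes I: "cftc_instance I" and s: "s \<in> {1..nsizes I}"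
  shows "shown_weight I (displayed I z) s = live_weight (bases_of I s) (weight I) (\<lambda>i. z (i, s)) 0"
  unfolding shown_weight_def live_weight_def
  by (rule sum.mono_neutral_cong_left) (auto simp: displayed_def mem_universe finite_bases_of)

text \<open>In a phase of length d the clock of size \<open>s\<close> advances by d *
  \<open>rate\<close> W, the speed it would have if size \<open>s\<close> were shown alone. Real
  sales are at most that, so at least as much is left as the clock assumes, and the duration of the
  combined path is at most the sum over the phases.\<close>

lemma fluid_upper:
  assumes I: "cftc_instance I" and T: "0 \<le> T" and y: "fluid_path I T z y"
    and s: "s \<in> {1..nsizes I}" and live: "live_size I s"
  shows "\<exists>\<tau>\<ge>0. size_duration I s (\<lambda>i. z (i, s)) \<tau> \<le> T \<and>
    (\<forall>i\<in>bases_of I s. z (i, s) - y T (i, s) \<le> weight I i * \<tau>)"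
proof -
  interpret single_size "bases_of I s" "weight I" "type_a I s" "type_b I s"
    by (rule single_size_live[OF I s live])
  show ?thesis using T y
  proof (induction "card (displayed I z)" arbitrary: z T y rule: less_induct)
    case less
    obtain d where d: "0 \<le> d" "d \<le> T" "no_depletion I z d"
      "\<And>p. p \<in> universe I \<Longrightarrow> y d p = z p - d * choice_prob I p (displayed I z)"
      "fluid_path I (T - d) (y d) (\<lambda>t. y (d + t))"
      "d = T \<or> card (displayed I (y d)) < card (displayed I z)"
      by (rule fluid_step[OF I less.prems(1,2)], rule that)
    define W where "W = lw (\<lambda>i. z (i, s)) 0"
    have W: "0 \<le> W" unfolding W_def by (rule lw_nonneg)
    have shown: "shown_weight I (displayed I z) s = W" unfolding W_def by (rule shown_weight_live[OF I s])
    let ?u = "d * rate W"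
    have u: "0 \<le> ?u" using d(1) rate_pos[OF W] by simp
    have sold: "z (i, s) - y d (i, s) \<le> weight I i * ?u" if i: "i \<in> bases_of I s" for i
    proof -
      have "choice_prob I (i, s) (displayed I z) \<le> weight I i * rate W"
        using choice_prob_le[OF I _ s i, of "displayed I z"] unfolding shown
        by (auto simp: displayed_def)
      from mult_left_mono[OF this d(1)] show ?thesis using d(4)[of "(i, s)"] i
        by (simp add: mem_universe mult.left_commute)
    qed
    have "dur (\<lambda>i. z (i, s)) ?u \<le> ?u * pace W"
      by (rule duration_le_const[OF u W]) (unfold W_def, rule lw_antimono)
    hence dur_u: "dur (\<lambda>i. z (i, s)) ?u \<le> d" using rate_pos[OF W] by simp
    show ?case
    proof (cases "d = T")
      case True
      thus ?thesis using u dur_u sold by (intro exI[of _ ?u]) auto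
    next
      case False
      hence "card (displayed I (y d)) < card (displayed I z)" using d(6) by simp
      from less.hyps[OF this _ d(5)] d(2)
      obtain \<tau> where \<tau>: "0 \<le> \<tau>" "dur (\<lambda>i. y d (i, s)) \<tau> \<le> T - d"
        "\<And>i. i \<in> bases_of I s \<Longrightarrow> y d (i, s) - y T (i, s) \<le> weight I i * \<tau>" by auto
      have "dur (\<lambda>i. z (i, s)) (?u + \<tau>) \<le> dur (\<lambda>i. z (i, s)) ?u + dur (\<lambda>i. y d (i, s)) \<tau>"
      proof (rule duration_shift_le[OF u \<tau>(1)])
        fix i \<theta> assume "i \<in> bases_of I s" "weight I i * (\<theta> + ?u) < z (i, s)"
        thus "weight I i * \<theta> < y d (i, s)" using sold[of i] by (simp add: distrib_left)
      qed
      hence "dur (\<lambda>i. z (i, s)) (?u + \<tau>) \<le> T" using dur_u \<tau>(2) by simp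
      moreover have "z (i, s) - y T (i, s) \<le> weight I i * (?u + \<tau>)" if "i \<in> bases_of I s" for i
        using sold[OF that] \<tau>(3)[OF that] by (simp add: distrib_left)
      ultimately show ?thesis using u \<tau>(1) by (intro exI[of _ "?u + \<tau>"]) auto
    qed
  qed
qed

text \<open>With one parity on display the clock agrees with the path phase by phase; a product that
  is depleted has sold its whole stock, hence the minimum.\<close>

lemma fluid_lower:
  assumes I: "cftc_instance I" and T: "0 \<le> T" and y: "fluid_path I T z y"
    and s: "s \<in> {1..nsizes I}" and live: "live_size I s"
    and par: "\<And>p. p \<in> displayed I z \<Longrightarrow> even (snd p + s)"
    and \<tau>: "0 \<le> \<tau>" "size_duration I s (\<lambda>i. z (i, s)) \<tau> \<le> T" and i: "i \<in> bases_of I s"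
  shows "min (z (i, s)) (weight I i * \<tau>) \<le> z (i, s) - y T (i, s)"
proof -
  interpret single_size "bases_of I s" "weight I" "type_a I s" "type_b I s"
    by (rule single_size_live[OF I s live])
  have w: "0 < weight I i" by (rule weight_bases_pos[OF I i])
  show ?thesis using T y par \<tau>
  proof (induction "card (displayed I z)" arbitrary: z T y \<tau> rule: less_induct)
    case less
    obtain d where d: "0 \<le> d" "d \<le> T" "no_depletion I z d"
      "\<And>p. p \<in> universe I \<Longrightarrow> y d p = z p - d * choice_prob I p (displayed I z)"
      "fluid_path I (T - d) (y d) (\<lambda>t. y (d + t))"
      "d = T \<or> card (displayed I (y d)) < card (displayed I z)" "displayed I (y d) \<subseteq> displayed I z"
      by (rule fluid_step[OF I less.prems(1,2)], rule that)
    define W where "W = lw (\<lambda>i. z (i, s)) 0"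
    have W: "0 \<le> W" unfolding W_def by (rule lw_nonneg)
    have shown: "shown_weight I (displayed I z) s = W" unfolding W_def by (rule shown_weight_live[OF I s])
    let ?u = "d * rate W"
    have u: "0 \<le> ?u" using d(1) rate_pos[OF W] by simp
    have AU: "displayed I z \<subseteq> universe I" by (auto simp: displayed_def)
    have cp: "choice_prob I (j, s) (displayed I z) = weight I j * rate W" if "(j, s) \<in> displayed I z" for j
      unfolding shown[symmetric] by (rule choice_prob_parity[OF I AU s]) (use less.prems(3) that in auto)
    have yd: "y d (j, s) = (if (j, s) \<in> displayed I z then z (j, s) - weight I j * ?u else z (j, s))"
      if "j \<in> bases_of I s" for j
      using d(4)[of "(j, s)"] that cp[of j] choice_prob_outside[of "(j, s)" "displayed I z" I]
      by (simp add: mem_universe mult.left_commute)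
    have notshown: "z (j, s) \<le> 0" if "j \<in> bases_of I s" "(j, s) \<notin> displayed I z" for j
      using that by (auto simp: displayed_def mem_universe)
    have restdec: "y T (i, s) \<le> y d (i, s)"
      using fluid_decreasing[OF I _ d(5), of "(i, s)"] d(2) i by (simp add: mem_universe)
    have alldec: "y T (i, s) \<le> z (i, s)"
      using fluid_decreasing[OF I less.prems(1,2), of "(i, s)"] i by (simp add: mem_universe)
    show ?case
    proof (cases "(i, s) \<in> displayed I z")
      case False
      thus ?thesis using notshown[OF i] alldec by auto
    next
      case True
      hence ydi: "y d (i, s) = z (i, s) - weight I i * ?u" using yd[OF i] by simp
      show ?thesis
      proof (cases "\<tau> \<le> ?u")
        case True
        have "weight I i * \<tau> \<le> weight I i * ?u" using True w by simp
        thus ?thesis using ydi restdec by simp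
      next
        case gt: False
        have "?u * pace W \<le> dur (\<lambda>i. z (i, s)) ?u"
        proof (rule duration_ge_const[OF u W])
          fix \<theta> assume \<theta>: "0 \<le> \<theta>" "\<theta> < ?u"
          show "W \<le> lw (\<lambda>i. z (i, s)) \<theta>" unfolding W_def
          proof (rule lw_mono)
            fix j assume j: "j \<in> bases_of I s" "weight I j * 0 < z (j, s)"
            hence js: "(j, s) \<in> displayed I z" by (simp add: displayed_def mem_universe)
            have "\<theta> / rate W < d" "0 \<le> \<theta> / rate W"
              using \<theta> rate_pos[OF W] by (simp_all add: divide_simps)
            hence "0 < z (j, s) - \<theta> / rate W * choice_prob I (j, s) (displayed I z)"
              using d(3) js unfolding no_depletion_def by blast
            thus "weight I j * \<theta> < z (j, s)" using cp[OF js] rate_pos[OF W] by (simp add: mult.commute)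
          qed
        qed
        hence dur_u: "d \<le> dur (\<lambda>i. z (i, s)) ?u" using rate_pos[OF W] by simp
        \<comment> \<open>If the phase reached the horizon, clock time \<open>?u\<close> < \<tau>
          would already have duration at least T, against strict monotonicity.\<close>
        have "d \<noteq> T"
          using duration_strict[OF u, of \<tau> "\<lambda>i. z (i, s)"] gt dur_u less.prems(5) by auto
        hence card: "card (displayed I (y d)) < card (displayed I z)" using d(6) by simp
        have par': "even (snd p + s)" if "p \<in> displayed I (y d)" for p
          using less.prems(3) d(7) that by blast
        have "dur (\<lambda>i. z (i, s)) ?u + dur (\<lambda>i. y d (i, s)) (\<tau> - ?u) \<le> dur (\<lambda>i. z (i, s)) (?u + (\<tau> - ?u))"
        proof (rule duration_shift_ge[OF u])
          fix j \<theta> assume j: "j \<in> bases_of I s" "0 \<le> \<theta>" "weight I j * \<theta> < y d (j, s)"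
          have "0 \<le> weight I j * \<theta>" using weight_bases_pos[OF I j(1)] j(2) by simp
          thus "weight I j * (\<theta> + ?u) < z (j, s)"
            using yd[OF j(1)] j(3) notshown[OF j(1)] by (auto simp: distrib_left split: if_splits)
        qed (use gt in simp)
        hence "dur (\<lambda>i. y d (i, s)) (\<tau> - ?u) \<le> T - d" using dur_u less.prems(5) by simp
        from less.hyps[OF card _ d(5) par' _ this] gt d(2)
        have "min (y d (i, s)) (weight I i * (\<tau> - ?u)) \<le> y d (i, s) - y T (i, s)" by simp
        moreover have "weight I i * (\<tau> - ?u) = weight I i * \<tau> - weight I i * ?u"
          by (rule right_diff_distrib)
        ultimately show ?thesis unfolding ydi by linarith
      qed
    qed
  qed
qed

lemma sum_universe:
  assumes "cftc_instance I"
  shows "(\<Sum>p\<in>universe I. f p) = (\<Sum>s=1..nsizes I. \<Sum>i\<in>bases_of I s. f (i, s))"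
proof -
  have "(\<Sum>s=1..nsizes I. \<Sum>i\<in>bases_of I s. f (i, s)) =
      (\<Sum>(s, i)\<in>(SIGMA s:{1..nsizes I}. bases_of I s). f (i, s))"
    by (rule sum.Sigma) (auto simp: finite_bases_of)
  also have "\<dots> = (\<Sum>p\<in>universe I. f p)"
    by (rule sum.reindex_bij_witness[of _ "\<lambda>(i, s). (s, i)" "\<lambda>(s, i). (i, s)"])
       (use universe_size[OF assms] in \<open>auto simp: mem_universe\<close>)
  finally show ?thesis by simp
qed

definition size_value :: "cftc \<Rightarrow> nat \<Rightarrow> (nat \<Rightarrow> nat) \<Rightarrow> real \<Rightarrow> real" where
  "size_value I s c \<tau> = (\<Sum>i\<in>bases_of I s. revenue I i * min (real (c i)) (weight I i * \<tau>))"

text \<open>Every size gets a clock of its own. The competition between the sizes is ignored, which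
  makes the sum an upper bound.\<close>

lemma fluid_revenue_le:
  assumes I: "cftc_instance I"
  obtains \<tau> where "\<And>s. 0 \<le> \<tau> s"
    "\<And>s. s \<in> {1..nsizes I} \<Longrightarrow> live_size I s \<Longrightarrow> size_duration I s (\<lambda>i. real (c (i, s))) (\<tau> s) \<le> horizon I"
    "fluid_revenue I c \<le>
       (\<Sum>s=1..nsizes I. if live_size I s then size_value I s (\<lambda>i. c (i, s)) (\<tau> s) else 0)"
proof -
  let ?T = "horizon I"
  have T: "0 \<le> ?T" using I by (simp add: cftc_instance_def)
  obtain y where y: "fluid_path I ?T (\<lambda>q. real (c q)) y" using fluid_path_exists[OF I T] by blast
  have "\<exists>\<tau>\<ge>0. live_size I s \<longrightarrow> s \<in> {1..nsizes I} \<longrightarrow> size_duration I s (\<lambda>i. real (c (i, s))) \<tau> \<le> ?T \<and>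
      (\<forall>i\<in>bases_of I s. real (c (i, s)) - y ?T (i, s) \<le> weight I i * \<tau>)" for s
    using fluid_upper[OF I T y, of s] by fastforce
  then obtain \<tau> where \<tau>: "\<And>s. 0 \<le> \<tau> s"
    "\<And>s. live_size I s \<Longrightarrow> s \<in> {1..nsizes I} \<Longrightarrow> size_duration I s (\<lambda>i. real (c (i, s))) (\<tau> s) \<le> ?T"
    "\<And>s i. live_size I s \<Longrightarrow> s \<in> {1..nsizes I} \<Longrightarrow> i \<in> bases_of I s \<Longrightarrow>
      real (c (i, s)) - y ?T (i, s) \<le> weight I i * \<tau> s" by metis
  have cons: "consumption I c p = real (c p) - y ?T p" if "p \<in> universe I" for p
    by (rule consumption_eq[OF I y that])
  have "fluid_revenue I c =
      (\<Sum>s=1..nsizes I. \<Sum>i\<in>bases_of I s. revenue I i * (real (c (i, s)) - y ?T (i, s)))"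
    unfolding fluid_revenue_def sum_universe[OF I] using cons by (simp add: mem_universe)
  also have "\<dots> \<le> (\<Sum>s=1..nsizes I. if live_size I s then size_value I s (\<lambda>i. c (i, s)) (\<tau> s) else 0)"
  proof (rule sum_mono)
    fix s assume s: "s \<in> {1..nsizes I}"
    show "(\<Sum>i\<in>bases_of I s. revenue I i * (real (c (i, s)) - y ?T (i, s))) \<le>
        (if live_size I s then size_value I s (\<lambda>i. c (i, s)) (\<tau> s) else 0)"
    proof (cases "live_size I s")
      case True
      have "revenue I i * (real (c (i, s)) - y ?T (i, s)) \<le>
          revenue I i * min (real (c (i, s))) (weight I i * \<tau> s)" if i: "i \<in> bases_of I s" for i
      proof -
        have "0 \<le> y ?T (i, s)" using fluid_nonneg[OF I T y, of "(i, s)"] i by (simp add: mem_universe)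
        thus ?thesis using \<tau>(3)[OF True s i] revenue_bases_nonneg[OF I i] by (intro mult_left_mono) auto
      qed
      thus ?thesis using True by (simp add: size_value_def sum_mono)
    next
      case False
      have "real (c (i, s)) - y ?T (i, s) = 0" if i: "i \<in> bases_of I s" for i
      proof -
        have "((\<lambda>u. choice_prob I (i, s) (displayed I (y u))) has_integral
            (real (c (i, s)) - y ?T (i, s))) {0..?T}"
          using y i T by (simp add: fluid_path_def mem_universe)
        moreover have "choice_prob I (i, s) (displayed I (y u)) = 0" for u
          by (rule choice_prob_dead[OF I s False _ i]) (auto simp: displayed_def)
        ultimately show ?thesis by simp
      qed
      thus ?thesis using False by simp
    qed
  qed
  finally show ?thesis using that[of \<tau>] \<tau> by blast
qed

text \<open>When only sizes of one parity are stocked, every customer considers a single size, and the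
  sizes do not interact.\<close>

lemma fluid_revenue_ge:
  assumes I: "cftc_instance I" and par: "\<And>p. 0 < c p \<Longrightarrow> even (snd p + s0)"
    and v: "\<And>s. s \<in> {1..nsizes I} \<Longrightarrow> v s \<le> 0 \<or> (even (s + s0) \<and> live_size I s \<and>
      (\<exists>\<tau>\<ge>0. size_duration I s (\<lambda>i. real (c (i, s))) \<tau> \<le> horizon I \<and>
        v s \<le> size_value I s (\<lambda>i. c (i, s)) \<tau>))"
  shows "(\<Sum>s=1..nsizes I. v s) \<le> fluid_revenue I c"
proof -
  let ?T = "horizon I"
  have T: "0 \<le> ?T" using I by (simp add: cftc_instance_def)
  obtain y where y: "fluid_path I ?T (\<lambda>q. real (c q)) y" using fluid_path_exists[OF I T] by blast
  have cons: "consumption I c p = real (c p) - y ?T p" if "p \<in> universe I" for p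
    by (rule consumption_eq[OF I y that])
  have "(\<Sum>s=1..nsizes I. v s) \<le>
      (\<Sum>s=1..nsizes I. \<Sum>i\<in>bases_of I s. revenue I i * (real (c (i, s)) - y ?T (i, s)))"
  proof (rule sum_mono)
    fix s assume s: "s \<in> {1..nsizes I}"
    from v[OF s] show "v s \<le> (\<Sum>i\<in>bases_of I s. revenue I i * (real (c (i, s)) - y ?T (i, s)))"
    proof (elim disjE conjE exE)
      assume "v s \<le> 0"
      moreover have "0 \<le> (\<Sum>i\<in>bases_of I s. revenue I i * (real (c (i, s)) - y ?T (i, s)))"
        using fluid_decreasing[OF I T y] revenue_bases_nonneg[OF I]
        by (intro sum_nonneg mult_nonneg_nonneg) (auto simp: mem_universe)
      ultimately show ?thesis by linarith
    next
      fix \<tau> assume e: "even (s + s0)" and l: "live_size I s" and \<tau>: "0 \<le> \<tau>"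
        "size_duration I s (\<lambda>i. real (c (i, s))) \<tau> \<le> ?T" "v s \<le> size_value I s (\<lambda>i. c (i, s)) \<tau>"
      have par': "even (snd p + s)" if "p \<in> displayed I (\<lambda>q. real (c q))" for p
        using par[of p] that e by (auto simp: displayed_def)
      have "size_value I s (\<lambda>i. c (i, s)) \<tau> \<le>
          (\<Sum>i\<in>bases_of I s. revenue I i * (real (c (i, s)) - y ?T (i, s)))"
        unfolding size_value_def
        using fluid_lower[OF I T y s l par' \<tau>(1,2)] revenue_bases_nonneg[OF I]
        by (intro sum_mono mult_left_mono) auto
      thus ?thesis using \<tau>(3) by linarith
    qed
  qed
  also have "\<dots> = fluid_revenue I c"
    unfolding fluid_revenue_def sum_universe[OF I] using cons by (simp add: mem_universe)
  finally show ?thesis .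
qed

section \<open>Total correctness with time bounds\<close>

definition does :: "cftc \<Rightarrow> real \<Rightarrow> com \<Rightarrow> state \<Rightarrow> nat \<Rightarrow> (state \<Rightarrow> bool) \<Rightarrow> bool" where
  "does I \<epsilon> P \<sigma> n Q \<longleftrightarrow> (\<exists>t \<sigma>'. run I \<epsilon> P \<sigma> t \<sigma>' \<and> t \<le> n \<and> Q \<sigma>')"

fun nwrites :: "com \<Rightarrow> nat set" where
  "nwrites (NStore a e f) = {a}"
| "nwrites (Seq P Q) = nwrites P \<union> nwrites Q"
| "nwrites (Cond b P Q) = nwrites P \<union> nwrites Q"
| "nwrites (While b P) = nwrites P"
| "nwrites _ = {}"

fun rwrites :: "com \<Rightarrow> nat set" where
  "rwrites (RStore a e f) = {a}"
| "rwrites (Seq P Q) = rwrites P \<union> rwrites Q"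
| "rwrites (Cond b P Q) = rwrites P \<union> rwrites Q"
| "rwrites (While b P) = rwrites P"
| "rwrites _ = {}"

fun swrites :: "com \<Rightarrow> bool" where
  "swrites (SetStock i s e) = True"
| "swrites (Seq P Q) \<longleftrightarrow> swrites P \<or> swrites Q"
| "swrites (Cond b P Q) \<longleftrightarrow> swrites P \<or> swrites Q"
| "swrites (While b P) \<longleftrightarrow> swrites P"
| "swrites _ = False"

text \<open>Read off the text of the program; it spares the loop invariants all arrays that the loop
  body does not assign.\<close>

definition frame :: "com \<Rightarrow> state \<Rightarrow> state \<Rightarrow> bool" where
  "frame P \<sigma> \<sigma>' \<longleftrightarrow> (\<forall>a. a \<notin> nwrites P \<longrightarrow> ncells \<sigma>' a = ncells \<sigma> a) \<and>
     (\<forall>a. a \<notin> rwrites P \<longrightarrow> rcells \<sigma>' a = rcells \<sigma> a) \<and> (\<not> swrites P \<longrightarrow> stock \<sigma>' = stock \<sigma>)"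

lemma run_frame: "run I \<epsilon> P \<sigma> t \<sigma>' \<Longrightarrow> frame P \<sigma> \<sigma>'"
  by (induction rule: run.induct) (auto simp: frame_def)

lemma frame_refl: "frame P \<sigma> \<sigma>"
  by (simp add: frame_def)

lemma frame_trans: "frame P \<sigma> \<sigma>' \<Longrightarrow> frame P \<sigma>' \<sigma>'' \<Longrightarrow> frame P \<sigma> \<sigma>''"
  by (simp add: frame_def)

lemma frame_ncells: "frame P \<sigma> \<sigma>' \<Longrightarrow> a \<notin> nwrites P \<Longrightarrow> ncells \<sigma>' a = ncells \<sigma> a"
  by (simp add: frame_def)

lemma frame_rcells: "frame P \<sigma> \<sigma>' \<Longrightarrow> a \<notin> rwrites P \<Longrightarrow> rcells \<sigma>' a = rcells \<sigma> a"
  by (simp add: frame_def)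

lemma frame_stock: "frame P \<sigma> \<sigma>' \<Longrightarrow> \<not> swrites P \<Longrightarrow> stock \<sigma>' = stock \<sigma>"
  by (simp add: frame_def)

inductive_cases run_SkipE: "run I \<epsilon> Skip \<sigma> t \<sigma>'"
inductive_cases run_NStoreE: "run I \<epsilon> (NStore a e f) \<sigma> t \<sigma>'"
inductive_cases run_RStoreE: "run I \<epsilon> (RStore a e f) \<sigma> t \<sigma>'"
inductive_cases run_SetStockE: "run I \<epsilon> (SetStock a e f) \<sigma> t \<sigma>'"
inductive_cases run_SeqE: "run I \<epsilon> (Seq P Q) \<sigma> t \<sigma>'"
inductive_cases run_CondE: "run I \<epsilon> (Cond b P Q) \<sigma> t \<sigma>'"

lemma run_prim:
  "run I \<epsilon> Skip \<sigma> t \<sigma>' \<longleftrightarrow> t = 1 \<and> \<sigma>' = \<sigma>"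
  "run I \<epsilon> (NStore a e f) \<sigma> t \<sigma>' \<longleftrightarrow> t = 1 \<and>
     \<sigma>' = \<sigma>\<lparr>ncells := (ncells \<sigma>)(a := (ncells \<sigma> a)(nval I \<sigma> e := nval I \<sigma> f))\<rparr>"
  "run I \<epsilon> (RStore a e g) \<sigma> t \<sigma>' \<longleftrightarrow> t = 1 \<and>
     \<sigma>' = \<sigma>\<lparr>rcells := (rcells \<sigma>)(a := (rcells \<sigma> a)(nval I \<sigma> e := rval I \<epsilon> \<sigma> g))\<rparr>"
  "run I \<epsilon> (SetStock i s f) \<sigma> t \<sigma>' \<longleftrightarrow> t = 1 \<and>
     \<sigma>' = \<sigma>\<lparr>stock := (stock \<sigma>)((nval I \<sigma> i, nval I \<sigma> s) := nval I \<sigma> f)\<rparr>"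
proof -
  show "run I \<epsilon> Skip \<sigma> t \<sigma>' \<longleftrightarrow> t = 1 \<and> \<sigma>' = \<sigma>"
    by (auto elim: run_SkipE intro: run.intros(1)[simplified])
  show "run I \<epsilon> (NStore a e f) \<sigma> t \<sigma>' \<longleftrightarrow> t = 1 \<and>
     \<sigma>' = \<sigma>\<lparr>ncells := (ncells \<sigma>)(a := (ncells \<sigma> a)(nval I \<sigma> e := nval I \<sigma> f))\<rparr>"
    by (auto elim: run_NStoreE intro: run.intros(2)[simplified])
  show "run I \<epsilon> (RStore a e g) \<sigma> t \<sigma>' \<longleftrightarrow> t = 1 \<and>
     \<sigma>' = \<sigma>\<lparr>rcells := (rcells \<sigma>)(a := (rcells \<sigma> a)(nval I \<sigma> e := rval I \<epsilon> \<sigma> g))\<rparr>"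
    by (auto elim: run_RStoreE intro: run.intros(3)[simplified])
  show "run I \<epsilon> (SetStock i s f) \<sigma> t \<sigma>' \<longleftrightarrow> t = 1 \<and>
     \<sigma>' = \<sigma>\<lparr>stock := (stock \<sigma>)((nval I \<sigma> i, nval I \<sigma> s) := nval I \<sigma> f)\<rparr>"
    by (auto elim: run_SetStockE intro: run.intros(4)[simplified])
qed

lemma run_Cond:
  "run I \<epsilon> (Cond b P Q) \<sigma> t \<sigma>' \<longleftrightarrow>
     (\<exists>k. t = Suc k \<and> run I \<epsilon> (if bval I \<epsilon> \<sigma> b then P else Q) \<sigma> k \<sigma>')"
  by (cases "bval I \<epsilon> \<sigma> b") (auto elim!: run_CondE intro: run.intros(6,7))

lemma run_Seq:
  "run I \<epsilon> (Seq P Q) \<sigma> t \<sigma>' \<longleftrightarrow>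
     (\<exists>t1 t2 \<sigma>1. t = t1 + t2 \<and> run I \<epsilon> P \<sigma> t1 \<sigma>1 \<and> run I \<epsilon> Q \<sigma>1 t2 \<sigma>')"
  by (rule iffI, erule run_SeqE, blast, elim exE conjE, hypsubst, rule run.intros)

lemma does_Suc:
  assumes "\<And>t \<sigma>'. run I \<epsilon> P \<sigma> t \<sigma>' \<longleftrightarrow> (\<exists>k. t = Suc k \<and> run I \<epsilon> R \<sigma>1 k \<sigma>')"
  shows "does I \<epsilon> P \<sigma> n Q \<longleftrightarrow> 1 \<le> n \<and> does I \<epsilon> R \<sigma>1 (n - 1) Q"
proof
  assume "does I \<epsilon> P \<sigma> n Q"
  then obtain k \<sigma>' where "run I \<epsilon> R \<sigma>1 k \<sigma>'" "Suc k \<le> n" "Q \<sigma>'"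
    unfolding does_def assms by blast
  moreover from this(2) have "1 \<le> n" "k \<le> n - 1" by auto
  ultimately show "1 \<le> n \<and> does I \<epsilon> R \<sigma>1 (n - 1) Q" unfolding does_def by blast
next
  assume n: "1 \<le> n \<and> does I \<epsilon> R \<sigma>1 (n - 1) Q"
  then obtain k \<sigma>' where k: "run I \<epsilon> R \<sigma>1 k \<sigma>'" "k \<le> n - 1" "Q \<sigma>'"
    unfolding does_def by blast
  hence "Suc k \<le> n" using n by auto
  thus "does I \<epsilon> P \<sigma> n Q" unfolding does_def assms using k by blast
qed

text \<open>As rewrite rules, these and the following equivalences execute straight-line code and
  conditionals symbolically, counting down the step bound.\<close>

lemma does_prim [simp]:
  "does I \<epsilon> Skip \<sigma> n Q \<longleftrightarrow> 1 \<le> n \<and> Q \<sigma>"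
  "does I \<epsilon> (NStore a e f) \<sigma> n Q \<longleftrightarrow> 1 \<le> n \<and>
     Q (\<sigma>\<lparr>ncells := (ncells \<sigma>)(a := (ncells \<sigma> a)(nval I \<sigma> e := nval I \<sigma> f))\<rparr>)"
  "does I \<epsilon> (RStore a e g) \<sigma> n Q \<longleftrightarrow> 1 \<le> n \<and>
     Q (\<sigma>\<lparr>rcells := (rcells \<sigma>)(a := (rcells \<sigma> a)(nval I \<sigma> e := rval I \<epsilon> \<sigma> g))\<rparr>)"
  "does I \<epsilon> (SetStock i s f) \<sigma> n Q \<longleftrightarrow> 1 \<le> n \<and>
     Q (\<sigma>\<lparr>stock := (stock \<sigma>)((nval I \<sigma> i, nval I \<sigma> s) := nval I \<sigma> f)\<rparr>)"
  unfolding does_def run_prim by blast+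

lemma does_Cond [simp]:
  "does I \<epsilon> (Cond b P R) \<sigma> n Q \<longleftrightarrow> 1 \<le> n \<and>
     (if bval I \<epsilon> \<sigma> b then does I \<epsilon> P \<sigma> (n - 1) Q else does I \<epsilon> R \<sigma> (n - 1) Q)"
  by (cases "bval I \<epsilon> \<sigma> b") (simp_all add: does_Suc[OF run_Cond])

lemma does_Seq_prim [simp]:
  "does I \<epsilon> (Seq Skip R) \<sigma> n Q \<longleftrightarrow> 1 \<le> n \<and> does I \<epsilon> R \<sigma> (n - 1) Q"
  "does I \<epsilon> (Seq (NStore a e f) R) \<sigma> n Q \<longleftrightarrow> 1 \<le> n \<and> does I \<epsilon> R
     (\<sigma>\<lparr>ncells := (ncells \<sigma>)(a := (ncells \<sigma> a)(nval I \<sigma> e := nval I \<sigma> f))\<rparr>) (n - 1) Q"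
  "does I \<epsilon> (Seq (RStore a e g) R) \<sigma> n Q \<longleftrightarrow> 1 \<le> n \<and> does I \<epsilon> R
     (\<sigma>\<lparr>rcells := (rcells \<sigma>)(a := (rcells \<sigma> a)(nval I \<sigma> e := rval I \<epsilon> \<sigma> g))\<rparr>) (n - 1) Q"
  "does I \<epsilon> (Seq (SetStock i s f) R) \<sigma> n Q \<longleftrightarrow> 1 \<le> n \<and> does I \<epsilon> R
     (\<sigma>\<lparr>stock := (stock \<sigma>)((nval I \<sigma> i, nval I \<sigma> s) := nval I \<sigma> f)\<rparr>) (n - 1) Q"
  by (rule does_Suc, unfold run_Seq run_prim, force)+

lemma does_Cond_Seq [simp]:
  "does I \<epsilon> (Seq (Cond b P P') R) \<sigma> n Q \<longleftrightarrow> 1 \<le> n \<and>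
     (if bval I \<epsilon> \<sigma> b then does I \<epsilon> (Seq P R) \<sigma> (n - 1) Q else does I \<epsilon> (Seq P' R) \<sigma> (n - 1) Q)"
proof -
  have "run I \<epsilon> (Seq (Cond b P P') R) \<sigma> t \<sigma>' \<longleftrightarrow>
      (\<exists>k. t = Suc k \<and> run I \<epsilon> (Seq (if bval I \<epsilon> \<sigma> b then P else P') R) \<sigma> k \<sigma>')" for t \<sigma>'
    unfolding run_Seq run_Cond by (metis add_Suc)
  from does_Suc[OF this] show ?thesis by (cases "bval I \<epsilon> \<sigma> b") simp_all
qed

lemma does_Seq_assoc [simp]:
  "does I \<epsilon> (Seq (Seq P Q) R) \<sigma> n S \<longleftrightarrow> does I \<epsilon> (Seq P (Seq Q R)) \<sigma> n S"
proof -
  have "run I \<epsilon> (Seq (Seq P Q) R) \<sigma> t \<sigma>' \<longleftrightarrow> run I \<epsilon> (Seq P (Seq Q R)) \<sigma> t \<sigma>'" for t \<sigma>'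
  proof
    assume "run I \<epsilon> (Seq (Seq P Q) R) \<sigma> t \<sigma>'"
    then obtain t1 t2 t3 \<sigma>1 \<sigma>2 where "t = t1 + t2 + t3" "run I \<epsilon> P \<sigma> t1 \<sigma>1" "run I \<epsilon> Q \<sigma>1 t2 \<sigma>2"
      "run I \<epsilon> R \<sigma>2 t3 \<sigma>'" by (auto simp: run_Seq)
    thus "run I \<epsilon> (Seq P (Seq Q R)) \<sigma> t \<sigma>'" unfolding run_Seq
      by (intro exI[of _ t1] exI[of _ "t2 + t3"] exI[of _ \<sigma>1]) auto
  next
    assume "run I \<epsilon> (Seq P (Seq Q R)) \<sigma> t \<sigma>'"
    then obtain t1 t2 t3 \<sigma>1 \<sigma>2 where "t = t1 + (t2 + t3)" "run I \<epsilon> P \<sigma> t1 \<sigma>1" "run I \<epsilon> Q \<sigma>1 t2 \<sigma>2"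
      "run I \<epsilon> R \<sigma>2 t3 \<sigma>'" by (auto simp: run_Seq)
    thus "run I \<epsilon> (Seq (Seq P Q) R) \<sigma> t \<sigma>'" unfolding run_Seq
      by (intro exI[of _ "t1 + t2"] exI[of _ t3] exI[of _ \<sigma>2]) auto
  qed
  thus ?thesis by (simp add: does_def)
qed

lemma does_mono:
  assumes "does I \<epsilon> P \<sigma> n Q" "n \<le> n'" "\<And>\<sigma>'. frame P \<sigma> \<sigma>' \<Longrightarrow> Q \<sigma>' \<Longrightarrow> Q' \<sigma>'"
  shows "does I \<epsilon> P \<sigma> n' Q'"
  using assms run_frame unfolding does_def by (meson order_trans)

lemma does_Seq:
  assumes "does I \<epsilon> P \<sigma> k M" "\<And>\<sigma>'. frame P \<sigma> \<sigma>' \<Longrightarrow> M \<sigma>' \<Longrightarrow> does I \<epsilon> R \<sigma>' j Q" "k + j \<le> n"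
  shows "does I \<epsilon> (Seq P R) \<sigma> n Q"
proof -
  obtain t \<sigma>' where 1: "run I \<epsilon> P \<sigma> t \<sigma>'" "t \<le> k" "M \<sigma>'" using assms(1) by (auto simp: does_def)
  obtain t' \<sigma>'' where 2: "run I \<epsilon> R \<sigma>' t' \<sigma>''" "t' \<le> j" "Q \<sigma>''"
    using assms(2)[OF run_frame[OF 1(1)] 1(3)] by (auto simp: does_def)
  have "run I \<epsilon> (Seq P R) \<sigma> (t + t') \<sigma>''" by (rule run.intros(5)[OF 1(1) 2(1)])
  thus ?thesis using 1 2 assms(3) unfolding does_def by (intro exI[of _ "t + t'"] exI[of _ \<sigma>'']) auto
qed

lemma does_exact:
  assumes "does I \<epsilon> P \<sigma> k (\<lambda>\<sigma>'. \<sigma>' = \<tau>)" "does I \<epsilon> R \<tau> j Q" "k + j \<le> n"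
  shows "does I \<epsilon> (Seq P R) \<sigma> n Q"
  by (rule does_Seq[OF assms(1) _ assms(3)]) (use assms(2) in simp)

text \<open>The index of the invariant counts iterations: at most \<open>N\<close> of them, each
  with \<open>c\<close> steps for the body and one for the test, plus the final failing test. The
  frame relates every intermediate state to the initial one.\<close>

lemma does_While:
  assumes "Inv 0 \<sigma>"
    and "\<And>k \<sigma>'. Inv k \<sigma>' \<Longrightarrow> k \<le> N \<Longrightarrow> frame P \<sigma> \<sigma>' \<Longrightarrow> bval I \<epsilon> \<sigma>' b \<Longrightarrow> k < N \<and> does I \<epsilon> P \<sigma>' c (Inv (Suc k))"
    and "N * (c + 1) + 1 \<le> n"
  shows "does I \<epsilon> (While b P) \<sigma> n (\<lambda>\<sigma>'. \<exists>k\<le>N. Inv k \<sigma>' \<and> \<not> bval I \<epsilon> \<sigma>' b)"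
proof -
  \<comment> \<open>Induction on the number \<open>j\<close> of iterations that may remain.\<close>
  have "\<exists>t \<sigma>'. run I \<epsilon> (While b P) \<sigma>1 t \<sigma>' \<and> t \<le> j * (c + 1) + 1 \<and> (\<exists>k\<le>N. Inv k \<sigma>' \<and> \<not> bval I \<epsilon> \<sigma>' b)"
    if "Inv (N - j) \<sigma>1" "j \<le> N" "frame P \<sigma> \<sigma>1" for j \<sigma>1
    using that
  proof (induction j arbitrary: \<sigma>1)
    case 0
    hence "\<not> bval I \<epsilon> \<sigma>1 b" using assms(2)[of N \<sigma>1] by auto
    thus ?case using 0 by (intro exI[of _ 1] exI[of _ \<sigma>1]) (auto simp del: One_nat_def intro: run.intros)
  next
    case (Suc j)
    show ?case
    proof (cases "bval I \<epsilon> \<sigma>1 b")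
      case False
      thus ?thesis using Suc.prems
        by (intro exI[of _ 1] exI[of _ \<sigma>1]) (auto simp del: One_nat_def intro: run.intros intro!: exI[of _ "N - Suc j"])
    next
      case True
      obtain t \<sigma>2 where 2: "run I \<epsilon> P \<sigma>1 t \<sigma>2" "t \<le> c" "Inv (N - j) \<sigma>2"
        using assms(2)[OF Suc.prems(1) _ Suc.prems(3) True] Suc.prems(2)
        by (auto simp: does_def Suc_diff_Suc)
      obtain t' \<sigma>3 where 3: "run I \<epsilon> (While b P) \<sigma>2 t' \<sigma>3" "t' \<le> j * (c + 1) + 1"
        "\<exists>k\<le>N. Inv k \<sigma>3 \<and> \<not> bval I \<epsilon> \<sigma>3 b"
        using Suc.IH[OF 2(3) _ frame_trans[OF Suc.prems(3) run_frame[OF 2(1)]]] Suc.prems(2) by auto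
      have "run I \<epsilon> (While b P) \<sigma>1 (Suc (t + t')) \<sigma>3" by (rule run.intros(9)[OF True 2(1) 3(1)])
      moreover have "Suc (t + t') \<le> Suc j * (c + 1) + 1" using 2(2) 3(2) by simp
      ultimately show ?thesis using 3(3) by blast
    qed
  qed
  from this[of N \<sigma>] show ?thesis using assms(1,3) frame_refl unfolding does_def
    by (metis diff_self_eq_0 order_refl order_trans)
qed

lemma does_loop:
  assumes "Inv 0 \<sigma>"
    and "\<And>k \<sigma>'. Inv k \<sigma>' \<Longrightarrow> k \<le> N \<Longrightarrow> frame P \<sigma> \<sigma>' \<Longrightarrow> bval I \<epsilon> \<sigma>' b \<Longrightarrow> k < N \<and> does I \<epsilon> P \<sigma>' c (Inv (Suc k))"
    and "N * (c + 1) + 1 \<le> n"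
    and "\<And>k \<sigma>'. Inv k \<sigma>' \<Longrightarrow> k \<le> N \<Longrightarrow> frame P \<sigma> \<sigma>' \<Longrightarrow> \<not> bval I \<epsilon> \<sigma>' b \<Longrightarrow> Q \<sigma>'"
  shows "does I \<epsilon> (While b P) \<sigma> n Q"
  by (rule does_mono[OF does_While[where Inv = Inv, OF assms(1,2,3)] order_refl])
     (use assms(4) in \<open>auto simp: frame_def\<close>)

section \<open>Program variables and expressions\<close>

text \<open>A scalar variable is entry 0 of an array of its own.\<close>

abbreviation (input) NV :: "nat \<Rightarrow> nexp" where "NV a \<equiv> NCell a (NLit 0)"
abbreviation (input) RV :: "nat \<Rightarrow> rexp" where "RV a \<equiv> RCell a (NLit 0)"
abbreviation (input) NSet :: "nat \<Rightarrow> nexp \<Rightarrow> com" where "NSet a e \<equiv> NStore a (NLit 0) e"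
abbreviation (input) RSet :: "nat \<Rightarrow> rexp \<Rightarrow> com" where "RSet a e \<equiv> RStore a (NLit 0) e"
abbreviation (input) RNum :: "nat \<Rightarrow> rexp" where "RNum k \<equiv> ROfNat (NLit k)"

abbreviation (input) seq (infixr \<open>;;\<close> 60) where "P ;; Q \<equiv> Seq P Q"

abbreviation (input) "rWmin \<equiv> 0 :: nat"
abbreviation (input) "rWmax \<equiv> 1 :: nat"
abbreviation (input) "rD \<equiv> 2 :: nat"
abbreviation (input) "rCodes \<equiv> 3 :: nat"
abbreviation (input) "rReach \<equiv> 4 :: nat"
abbreviation (input) "rA \<equiv> 5 :: nat"
abbreviation (input) "rB \<equiv> 6 :: nat"
abbreviation (input) "rFirst \<equiv> 7 :: nat"
abbreviation (input) "rQ \<equiv> 8 :: nat"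
abbreviation (input) "rRem \<equiv> 9 :: nat"
abbreviation (input) "rPow \<equiv> 10 :: nat"
abbreviation (input) "rLo \<equiv> 11 :: nat"
abbreviation (input) "rHi \<equiv> 12 :: nat"
abbreviation (input) "rV \<equiv> 13 :: nat"
abbreviation (input) "rConst \<equiv> 14 :: nat"
abbreviation (input) "rPrice \<equiv> 15 :: nat"
abbreviation (input) "rX \<equiv> 16 :: nat"
abbreviation (input) "rUnit \<equiv> 17 :: nat"
abbreviation (input) "rGain \<equiv> 18 :: nat"
abbreviation (input) "rTab \<equiv> 19 :: nat"
abbreviation (input) "rOld \<equiv> 20 :: nat"
abbreviation (input) "rMid \<equiv> 21 :: nat"
abbreviation (input) "rNew \<equiv> 22 :: nat"

abbreviation (input) "nS \<equiv> 0 :: nat"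
abbreviation (input) "nI \<equiv> 1 :: nat"
abbreviation (input) "nV \<equiv> 2 :: nat"
abbreviation (input) "nK \<equiv> 3 :: nat"
abbreviation (input) "nU \<equiv> 4 :: nat"
abbreviation (input) "nN \<equiv> 5 :: nat"
abbreviation (input) "nCost \<equiv> 6 :: nat"
abbreviation (input) "nRow \<equiv> 7 :: nat"
abbreviation (input) "nTab \<equiv> 8 :: nat"
abbreviation (input) "nOld \<equiv> 9 :: nat"
abbreviation (input) "nMid \<equiv> 10 :: nat"
abbreviation (input) "nNew \<equiv> 11 :: nat"
abbreviation (input) "nFree \<equiv> 12 :: nat"
abbreviation (input) "nBase \<equiv> 13 :: nat"
abbreviation (input) "nSize \<equiv> 14 :: nat"
abbreviation (input) "nAmount \<equiv> 15 :: nat"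
abbreviation (input) "nNext \<equiv> 16 :: nat"
abbreviation (input) "nPtr \<equiv> 17 :: nat"

fun rsum :: "(nat \<Rightarrow> rexp) \<Rightarrow> nat list \<Rightarrow> rexp" where
  "rsum f [] = RNum 0"
| "rsum f (k # ks) = RAdd (f k) (rsum f ks)"

lemma rval_rsum: "rval I \<epsilon> \<sigma> (rsum f ks) = (\<Sum>k\<leftarrow>ks. rval I \<epsilon> \<sigma> (f k))"
  by (induction ks) simp_all

definition rate_exp :: "rexp \<Rightarrow> rexp" where
  "rate_exp e = rsum (\<lambda>k. RDiv (RCell rA (NLit k)) (RAdd (RNum 1) (RMul (RCell rB (NLit k)) e))) [0..<6]"

definition slope_exp :: "rexp \<Rightarrow> rexp" where
  "slope_exp e = RDiv (rsum (\<lambda>k. RDiv (RMul (RCell rA (NLit k)) (RCell rB (NLit k)))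
      (RMul (RAdd (RNum 1) (RMul (RCell rB (NLit k)) e)) (RAdd (RNum 1) (RMul (RCell rB (NLit k)) e)))) [0..<6])
    (RMul (rate_exp e) (rate_exp e))"

definition intercept_exp :: "rexp \<Rightarrow> rexp" where
  "intercept_exp e = RDiv (rsum (\<lambda>k. RDiv (RCell rA (NLit k))
      (RMul (RAdd (RNum 1) (RMul (RCell rB (NLit k)) e)) (RAdd (RNum 1) (RMul (RCell rB (NLit k)) e)))) [0..<6])
    (RMul (rate_exp e) (rate_exp e))"

lemma sum_upt: "(\<Sum>k\<leftarrow>[0..<6]. f k) = (\<Sum>k<6. f k :: real)"
  by (simp add: interv_sum_list_conv_sum_set_nat atLeast0LessThan)

lemma rval_exp [simp]:
  "rval I \<epsilon> \<sigma> (rate_exp e) = choice_rate (rcells \<sigma> rA) (rcells \<sigma> rB) (rval I \<epsilon> \<sigma> e)"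
  "rval I \<epsilon> \<sigma> (slope_exp e) = slope (rcells \<sigma> rA) (rcells \<sigma> rB) (rval I \<epsilon> \<sigma> e)"
  "rval I \<epsilon> \<sigma> (intercept_exp e) = intercept (rcells \<sigma> rA) (rcells \<sigma> rB) (rval I \<epsilon> \<sigma> e)"
  by (simp_all add: rate_exp_def slope_exp_def intercept_exp_def rval_rsum sum_upt choice_rate_def
      slope_def intercept_def power2_eq_square del: upt_rec_numeral)

text \<open>Most significant bit first, so that the bits are read off by comparing a remainder with
  decreasing powers of two, without integer division.\<close>

fun bits :: "nat \<Rightarrow> nat \<Rightarrow> bool list" where
  "bits 0 q = []"
| "bits (Suc k) q = (if q < 2 ^ k then False # bits k q else True # bits k (q - 2 ^ k))"

lemma bits_surj: "\<exists>q<2 ^ length bs. bits (length bs) q = bs"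
proof (induction bs)
  case (Cons bit bs)
  then obtain q where q: "q < 2 ^ length bs" "bits (length bs) q = bs" by blast
  show ?case
    by (rule exI[of _ "if bit then q + 2 ^ length bs else q"]) (use q in auto)
qed simp

text \<open>Code, power of two and remainder are kept as reals, which can be halved, whereas
  naturals can only be added and subtracted. The price depends on the argument \<open>rX\<close>, so
  the code is decoded anew for every stock level.\<close>

definition decode :: com where
  "decode =
     RSet rRem (RV rQ) ;; RSet rPow (RV rCodes) ;; RSet rLo (RNum 0) ;; RSet rHi (RV rFirst) ;;
     RSet rV (RMul (ROfNat NBases) (RV rWmax)) ;; RSet rConst (RNum 0) ;; RSet rPrice (RNum 0) ;;
     While (RLess (RNum 1) (RV rPow))
       (RSet rPow (RDiv (RV rPow) (RNum 2)) ;;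
        Cond (RLess (RV rRem) (RV rPow))
          (RSet rConst (RAdd (RV rConst) (RMul (intercept_exp (RV rV)) (RSub (RV rHi) (RV rLo)))) ;;
           Cond (RLess (RV rX) (RV rLo)) Skip
             (Cond (RLess (RV rX) (RV rHi))
               (RSet rPrice (RAdd (RV rPrice) (RMul (slope_exp (RV rV)) (RSub (RV rX) (RV rLo)))))
               (RSet rPrice (RAdd (RV rPrice) (RMul (slope_exp (RV rV)) (RSub (RV rHi) (RV rLo)))))) ;;
           RSet rLo (RV rHi) ;;
           RSet rHi (RMul (RV rHi) (RAdd (RNum 1) (RV rD))))
          (RSet rRem (RSub (RV rRem) (RV rPow)) ;;
           RSet rV (RDiv (RV rV) (RAdd (RNum 1) (RV rD)))))"

lemma decode_correct:
  assumes codes: "rcells \<sigma> rCodes 0 = 2 ^ B" and Q: "rcells \<sigma> rQ 0 = real q" "q < 2 ^ B"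
    and hi: "0 \<le> rcells \<sigma> rFirst 0" and d: "0 \<le> rcells \<sigma> rD 0"
  shows "does I \<epsilon> decode \<sigma> (9 * B + 8) (\<lambda>\<sigma>'. 
     rcells \<sigma>' rConst 0 = walk_const (rcells \<sigma> rA) (rcells \<sigma> rB) (rcells \<sigma> rD 0) (bits B q) 0
       (rcells \<sigma> rFirst 0) (real (nbases I) * rcells \<sigma> rWmax 0) \<and>
     rcells \<sigma>' rPrice 0 = walk_price (rcells \<sigma> rA) (rcells \<sigma> rB) (rcells \<sigma> rD 0) (bits B q) 0
       (rcells \<sigma> rFirst 0) (real (nbases I) * rcells \<sigma> rWmax 0) (rcells \<sigma> rX 0) \<and>
     rcells \<sigma>' rLo 0 = walk_end (rcells \<sigma> rD 0) (bits B q) 0 (rcells \<sigma> rFirst 0))"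
proof -
  define a b d x where "a = rcells \<sigma> rA" and "b = rcells \<sigma> rB" and "d = rcells \<sigma> rD 0" and "x = rcells \<sigma> rX 0"
  define V0 where "V0 = real (nbases I) * rcells \<sigma> rWmax 0"
  define WC WP where "WC = walk_const a b d (bits B q) 0 (rcells \<sigma> rFirst 0) V0"
    and "WP = walk_price a b d (bits B q) 0 (rcells \<sigma> rFirst 0) V0 x"
  define E where "E = walk_end d (bits B q) 0 (rcells \<sigma> rFirst 0)"
  \<comment> \<open>What has been accumulated plus the contribution of the bits still to be read is
    the final value.\<close>
  define Inv where "Inv = (\<lambda>k (\<sigma>' :: state). k \<le> B \<and> rcells \<sigma>' rPow 0 = 2 ^ (B - k) \<and> (\<exists>q'.
    rcells \<sigma>' rRem 0 = real q' \<and> q' < 2 ^ (B - k) \<and>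
    0 \<le> rcells \<sigma>' rLo 0 \<and> rcells \<sigma>' rLo 0 \<le> rcells \<sigma>' rHi 0 \<and>
    rcells \<sigma>' rConst 0 + walk_const a b d (bits (B - k) q') (rcells \<sigma>' rLo 0) (rcells \<sigma>' rHi 0) (rcells \<sigma>' rV 0) =
      WC \<and>
    rcells \<sigma>' rPrice 0 + walk_price a b d (bits (B - k) q') (rcells \<sigma>' rLo 0) (rcells \<sigma>' rHi 0) (rcells \<sigma>' rV 0) x =
      WP \<and>
    walk_end d (bits (B - k) q') (rcells \<sigma>' rLo 0) (rcells \<sigma>' rHi 0) = E))"
  show ?thesis
    unfolding decode_def
    apply (simp add: hi)
    apply (rule does_loop[where Inv = Inv and N = B and c = 8])
    subgoal using codes Q hi d by (auto simp: Inv_def WC_def WP_def V0_def a_def b_def d_def x_def E_def)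
    subgoal premises p for k \<sigma>'
    proof -
      have fr: "rcells \<sigma>' 5 = a" "rcells \<sigma>' 6 = b" "rcells \<sigma>' 2 0 = d" "rcells \<sigma>' 16 0 = x"
        using frame_rcells[OF p(3)] by (simp_all add: a_def b_def d_def x_def)
      obtain q' where q': "rcells \<sigma>' rRem 0 = real q'" "q' < 2 ^ (B - k)"
        and lo: "0 \<le> rcells \<sigma>' rLo 0" "rcells \<sigma>' rLo 0 \<le> rcells \<sigma>' rHi 0"
        and w: "rcells \<sigma>' rConst 0 + walk_const a b d (bits (B - k) q') (rcells \<sigma>' rLo 0) (rcells \<sigma>' rHi 0) (rcells \<sigma>' rV 0) =
            WC"
          "rcells \<sigma>' rPrice 0 + walk_price a b d (bits (B - k) q') (rcells \<sigma>' rLo 0) (rcells \<sigma>' rHi 0) (rcells \<sigma>' rV 0) x =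
            WP"
          "walk_end d (bits (B - k) q') (rcells \<sigma>' rLo 0) (rcells \<sigma>' rHi 0) = E"
        using p(1) by (auto simp: Inv_def)
      have pow: "rcells \<sigma>' rPow 0 = 2 ^ (B - k)" and kB: "k \<le> B" using p(1) by (auto simp: Inv_def)
      have k: "k < B" using p(4) pow kB by (cases "k = B") auto
      then obtain j where j: "B - k = Suc j" "B - Suc k = j" by (metis Suc_diff_Suc)
      have hi': "rcells \<sigma>' rHi 0 \<le> rcells \<sigma>' rHi 0 * (1 + d)" "0 \<le> rcells \<sigma>' rHi 0"
        using lo d by (auto simp: d_def distrib_left)
      have lt: "real q' < 2 ^ j \<longleftrightarrow> q' < 2 ^ j" by (metis of_nat_less_iff of_nat_numeral of_nat_power)
      have sub: "q' - 2 ^ j < 2 ^ j" using q'(2) j(1) by auto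
      show ?thesis
        using k q' lo w pow j hi' sub unfolding Inv_def
        by (auto simp: fr lt of_nat_diff min_def not_less simp del: bits.simps(1) split: if_splits
            intro!: exI[of _ q'] exI[of _ "q' - 2 ^ j"])
    qed
     apply simp
    subgoal premises p for k \<sigma>'
    proof -
      have k: "Inv k \<sigma>'" "\<not> 1 < rcells \<sigma>' rPow 0" using p(1,4) by auto
      hence "\<not> (1 :: real) < 2 ^ (B - k)" by (simp add: Inv_def)
      hence "B - k = 0" by (metis not_gr0 one_less_numeral_iff one_less_power semiring_norm(76))
      thus ?thesis using k(1) by (auto simp: Inv_def WC_def WP_def V0_def E_def a_def b_def d_def x_def)
    qed
    done
qed

section \<open>Stock plans as linked lists\<close>

text \<open>\<open>nx p < p\<close> makes the lists acyclic and keeps them valid when nodes are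
  appended at higher addresses. The condition on \<open>f\<close> forbids repeated products, so
  writing out a list never overwrites an entry, and its length is the number of stocked
  products.\<close>

inductive plan :: "(nat \<Rightarrow> nat) \<Rightarrow> (nat \<Rightarrow> nat) \<Rightarrow> (nat \<Rightarrow> nat) \<Rightarrow> (nat \<Rightarrow> nat) \<Rightarrow> nat \<Rightarrow> (product \<Rightarrow> nat) \<Rightarrow> bool"
  for nb ns na nx where
  plan_nil: "plan nb ns na nx 0 (\<lambda>_. 0)"
| plan_cons: "0 < p \<Longrightarrow> nx p < p \<Longrightarrow> plan nb ns na nx (nx p) f \<Longrightarrow> f (nb p, ns p) = 0 \<Longrightarrow> 0 < na p \<Longrightarrow>
    plan nb ns na nx p (f((nb p, ns p) := na p))"

lemma plan_agree:
  assumes "plan nb ns na nx p f" "p < m"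
    "\<And>j. j < m \<Longrightarrow> nb' j = nb j \<and> ns' j = ns j \<and> na' j = na j \<and> nx' j = nx j"
  shows "plan nb' ns' na' nx' p f"
  using assms(1,2)
proof induction
  case plan_nil
  show ?case by (rule plan.plan_nil)
next
  case (plan_cons p f)
  have eq: "nb' p = nb p" "ns' p = ns p" "na' p = na p" "nx' p = nx p"
    using assms(3)[of p] plan_cons.prems by auto
  have "plan nb' ns' na' nx' p (f((nb' p, ns' p) := na' p))"
    by (rule plan.plan_cons) (use plan_cons eq in auto)
  thus ?case unfolding eq .
qed

text \<open>Nodes are only ever appended, at \<open>nFree\<close>, so that the plans in a table can share tails; the
  address 0 is the empty plan.\<close>

definition holds :: "state \<Rightarrow> nat \<Rightarrow> (product \<Rightarrow> nat) \<Rightarrow> bool" where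
  "holds \<sigma> p f \<longleftrightarrow> p < ncells \<sigma> nFree 0 \<and>
     plan (ncells \<sigma> nBase) (ncells \<sigma> nSize) (ncells \<sigma> nAmount) (ncells \<sigma> nNext) p f"

definition extends :: "state \<Rightarrow> state \<Rightarrow> bool" where
  "extends \<sigma> \<sigma>' \<longleftrightarrow> ncells \<sigma> nFree 0 \<le> ncells \<sigma>' nFree 0 \<and> (\<forall>j<ncells \<sigma> nFree 0.
     ncells \<sigma>' nBase j = ncells \<sigma> nBase j \<and> ncells \<sigma>' nSize j = ncells \<sigma> nSize j \<and>
     ncells \<sigma>' nAmount j = ncells \<sigma> nAmount j \<and> ncells \<sigma>' nNext j = ncells \<sigma> nNext j)"

lemma extends_refl: "extends \<sigma> \<sigma>"
  by (simp add: extends_def)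

lemma extends_trans: "extends \<sigma> \<sigma>' \<Longrightarrow> extends \<sigma>' \<sigma>'' \<Longrightarrow> extends \<sigma> \<sigma>''"
  by (auto simp: extends_def)

lemma holds_extends: "holds \<sigma> p f \<Longrightarrow> extends \<sigma> \<sigma>' \<Longrightarrow> holds \<sigma>' p f"
  unfolding holds_def extends_def using plan_agree[of _ _ _ _ p f "ncells \<sigma> nFree 0"] by fastforce

lemma extends_frame:
  assumes "frame P \<sigma> \<sigma>'" "nwrites P \<inter> {nFree, nBase, nSize, nAmount, nNext} = {}"
  shows "extends \<sigma> \<sigma>'"
  using frame_ncells[OF assms(1)] assms(2) by (auto simp: extends_def)

section \<open>The knapsack table\<close>

text \<open>Costs above \<open>N\<close> are all unaffordable; cutting them off at \<open>N + 1\<close> bounds the time to compute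
  them.\<close>

definition units :: "real \<Rightarrow> nat \<Rightarrow> real \<Rightarrow> nat" where
  "units u N p = (LEAST e. N < e \<or> p \<le> real e * u)"

text \<open>In the absence of rounding, a price is converted to ticks by counting up; the gain of a
  stock level is what is sold until the end of the staircase.\<close>

definition price_loop :: com where
  "price_loop =
     NSet nV (NLit 0) ;;
     While (NLess (NV nV) NCapacity)
       (NSet nV (NAdd (NV nV) (NLit 1)) ;;
        RSet rX (RDiv (ROfNat (NV nV)) (RWeight (NV nI))) ;;
        decode ;;
        NStore nCost (NV nV) (NLit 0) ;;
        While (BAnd (BNot (NLess (NV nN) (NCell nCost (NV nV))))
                    (RLess (RMul (ROfNat (NCell nCost (NV nV))) (RV rUnit)) (RMul (RWeight (NV nI)) (RV rPrice))))
          (NStore nCost (NV nV) (NAdd (NCell nCost (NV nV)) (NLit 1))) ;;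
        Cond (RLess (ROfNat (NV nV)) (RMul (RWeight (NV nI)) (RV rLo)))
          (RStore rGain (NV nV) (RMul (RRevenue (NV nI)) (ROfNat (NV nV))))
          (RStore rGain (NV nV) (RMul (RRevenue (NV nI)) (RMul (RWeight (NV nI)) (RV rLo)))))"

definition code_const :: "cftc \<Rightarrow> state \<Rightarrow> nat \<Rightarrow> nat \<Rightarrow> real" where
  "code_const I \<sigma> B q = walk_const (rcells \<sigma> rA) (rcells \<sigma> rB) (rcells \<sigma> rD 0) (bits B q) 0
     (rcells \<sigma> rFirst 0) (real (nbases I) * rcells \<sigma> rWmax 0)"

definition code_price :: "cftc \<Rightarrow> state \<Rightarrow> nat \<Rightarrow> nat \<Rightarrow> real \<Rightarrow> real" where
  "code_price I \<sigma> B q x = walk_price (rcells \<sigma> rA) (rcells \<sigma> rB) (rcells \<sigma> rD 0) (bits B q) 0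
     (rcells \<sigma> rFirst 0) (real (nbases I) * rcells \<sigma> rWmax 0) x"

definition code_end :: "state \<Rightarrow> nat \<Rightarrow> nat \<Rightarrow> real" where
  "code_end \<sigma> B q = walk_end (rcells \<sigma> rD 0) (bits B q) 0 (rcells \<sigma> rFirst 0)"

definition code_ok :: "state \<Rightarrow> nat \<Rightarrow> nat \<Rightarrow> bool" where
  "code_ok \<sigma> B q \<longleftrightarrow> rcells \<sigma> rCodes 0 = 2 ^ B \<and> rcells \<sigma> rQ 0 = real q \<and> q < 2 ^ B \<and>
     0 \<le> rcells \<sigma> rFirst 0 \<and> 0 \<le> rcells \<sigma> rD 0"

lemma decode_code:
  assumes "code_ok \<sigma> B q"
  shows "does I \<epsilon> decode \<sigma> (9 * B + 8) (\<lambda>\<sigma>'. rcells \<sigma>' rConst 0 = code_const I \<sigma> B q \<and>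
     rcells \<sigma>' rPrice 0 = code_price I \<sigma> B q (rcells \<sigma> rX 0) \<and> rcells \<sigma>' rLo 0 = code_end \<sigma> B q)"
  using decode_correct[of \<sigma> B q I \<epsilon>] assms
  unfolding code_ok_def code_const_def code_price_def code_end_def by blast

lemma writes_decode [simp]: "nwrites decode = {}"
  "rwrites decode = {rRem, rPow, rLo, rHi, rV, rConst, rPrice}" "\<not> swrites decode"
  by (auto simp: decode_def)

lemma price_loop_correct:
  assumes ok: "code_ok \<sigma> B q" and I: "ncells \<sigma> nI 0 = i" and N: "ncells \<sigma> nN 0 = N"
  shows "does I \<epsilon> price_loop \<sigma> (capacity I * (9 * B + 2 * N + 18) + 2) (\<lambda>\<sigma>'. \<forall>v. 1 \<le> v \<longrightarrow> v \<le> capacity I \<longrightarrow>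
     ncells \<sigma>' nCost v = units (rcells \<sigma> rUnit 0) N (weight I i * code_price I \<sigma> B q (real v / weight I i)) \<and>
     rcells \<sigma>' rGain v = revenue I i * min (real v) (weight I i * code_end \<sigma> B q))"
proof -
  define cost where "cost = (\<lambda>v. units (rcells \<sigma> rUnit 0) N (weight I i * code_price I \<sigma> B q (real v / weight I i)))"
  define gain where "gain = (\<lambda>v. revenue I i * min (real v) (weight I i * code_end \<sigma> B q))"
  define Inv where "Inv = (\<lambda>k (\<sigma>' :: state). ncells \<sigma>' nV 0 = k \<and>
    (\<forall>v. 1 \<le> v \<longrightarrow> v \<le> k \<longrightarrow> ncells \<sigma>' nCost v = cost v \<and> rcells \<sigma>' rGain v = gain v))"
  show ?thesis unfolding price_loop_def
    apply simp
    apply (rule does_loop[where Inv = Inv and N = "capacity I" and c = "9 * B + 2 * N + 17"])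
    subgoal by (simp add: Inv_def)
    subgoal premises p for k \<sigma>'
    proof -
      let ?v = "Suc k"
      have k: "k < capacity I" "ncells \<sigma>' nV 0 = k" using p(1,4) by (auto simp: Inv_def)
      have fr: "rcells \<sigma>' a = rcells \<sigma> a" if "a \<in> {rA, rB, rD, rFirst, rWmax, rCodes, rQ, rUnit}" for a
        using frame_rcells[OF p(3), of a] that by auto
      have frn: "ncells \<sigma>' nI 0 = i" "ncells \<sigma>' nN 0 = N"
        using frame_ncells[OF p(3), of nI] frame_ncells[OF p(3), of nN] I N by simp_all
      let ?\<sigma>1 = "\<sigma>'\<lparr>ncells := (ncells \<sigma>')(nV := (ncells \<sigma>' nV)(0 := Suc k)),
        rcells := (rcells \<sigma>')(rX := (rcells \<sigma>' rX)(0 := real ?v / weight I i))\<rparr>"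
      have ok1: "code_ok ?\<sigma>1 B q" using ok fr by (simp add: code_ok_def)
      have code1: "code_price I ?\<sigma>1 B q = code_price I \<sigma> B q" "code_end ?\<sigma>1 B q = code_end \<sigma> B q"
        using fr[of rA] fr[of rB] fr[of rD] fr[of rFirst] fr[of rWmax]
        by (simp_all add: code_price_def[abs_def] code_end_def)
      show ?thesis
      proof (intro conjI k(1))
        show "does I \<epsilon> (NStore 2 (NLit 0) (NAdd (NCell 2 (NLit 0)) (NLit (Suc 0))) ;;
          RStore 16 (NLit 0) (RDiv (ROfNat (NCell 2 (NLit 0))) (RWeight (NCell (Suc 0) (NLit 0)))) ;;
          decode ;;
          NStore 6 (NCell 2 (NLit 0)) (NLit 0) ;;
          While (BAnd (BNot (NLess (NCell 5 (NLit 0)) (NCell 6 (NCell 2 (NLit 0)))))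
             (RLess (RMul (ROfNat (NCell 6 (NCell 2 (NLit 0)))) (RCell 17 (NLit 0)))
                    (RMul (RWeight (NCell (Suc 0) (NLit 0))) (RCell 15 (NLit 0)))))
           (NStore 6 (NCell 2 (NLit 0)) (NAdd (NCell 6 (NCell 2 (NLit 0))) (NLit (Suc 0)))) ;;
          Cond (RLess (ROfNat (NCell 2 (NLit 0))) (RMul (RWeight (NCell (Suc 0) (NLit 0))) (RCell 11 (NLit 0))))
           (RStore 18 (NCell 2 (NLit 0)) (RMul (RRevenue (NCell (Suc 0) (NLit 0))) (ROfNat (NCell 2 (NLit 0)))))
           (RStore 18 (NCell 2 (NLit 0))
             (RMul (RRevenue (NCell (Suc 0) (NLit 0))) (RMul (RWeight (NCell (Suc 0) (NLit 0))) (RCell 11 (NLit 0))))))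
          \<sigma>' (9 * B + 2 * N + 17) (Inv (Suc k))"
          apply (simp add: k(2) frn[simplified] del: of_nat_Suc)
          apply (rule does_Seq[OF decode_code[OF ok1], where j = "2 * N + 7"])
          subgoal premises d for \<sigma>2
          proof -
            have f2: "ncells \<sigma>2 = (ncells \<sigma>')(nV := (ncells \<sigma>' nV)(0 := Suc k))"
              using frame_ncells[OF d(1)] by (auto simp: fun_eq_iff)
            have g2: "rcells \<sigma>2 rUnit 0 = rcells \<sigma> rUnit 0" "rcells \<sigma>2 rGain = rcells \<sigma>' rGain"
              using frame_rcells[OF d(1), of rUnit] frame_rcells[OF d(1), of rGain] fr[of rUnit] by simp_all
            have pr: "rcells \<sigma>2 rPrice 0 = code_price I \<sigma> B q (real ?v / weight I i)"
              "rcells \<sigma>2 rLo 0 = code_end \<sigma> B q"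
              using d(2) code1 by simp_all
            let ?p = "weight I i * code_price I \<sigma> B q (real ?v / weight I i)"
            define Inv2 where "Inv2 = (\<lambda>e (\<sigma>3 :: state). ncells \<sigma>3 nCost = (ncells \<sigma>' nCost)(?v := e) \<and>
              (\<forall>e'<e. \<not> (N < e' \<or> ?p \<le> real e' * rcells \<sigma> rUnit 0)))"
            show ?thesis
              apply (simp add: f2 frn[simplified])
              \<comment> \<open>Thanks to the cut-off there are at most \<open>N + 1\<close>
                increments, at two steps each, plus the last test.\<close>
              apply (rule does_Seq[where k = "2 * (N + 1) + 1" and j = 2 and
                    M = "\<lambda>\<sigma>3. ncells \<sigma>3 nCost = (ncells \<sigma>' nCost)(?v := cost ?v)"])
                apply (rule does_loop[where Inv = Inv2 and N = "N + 1" and c = 1])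
              subgoal by (simp add: Inv2_def)
              subgoal premises l for e \<sigma>3
              proof -
                have n3: "ncells \<sigma>3 nV 0 = Suc k" "ncells \<sigma>3 nI 0 = i" "ncells \<sigma>3 nN 0 = N"
                  using frame_ncells[OF l(3), of nV] frame_ncells[OF l(3), of nI] frame_ncells[OF l(3), of nN] frn
                  by simp_all
                have r3: "rcells \<sigma>3 = rcells \<sigma>2" using frame_rcells[OF l(3)] by (auto simp: fun_eq_iff)
                have e: "ncells \<sigma>3 6 (Suc k) = e" using l(1) by (simp add: Inv2_def)
                show ?thesis using l(1,4) n3 e
                  by (auto simp: Inv2_def r3 g2[simplified] pr[simplified] less_Suc_eq)
              qed
              subgoal by simp
              subgoal premises l for e \<sigma>3
              proof -
                have n3: "ncells \<sigma>3 nV 0 = Suc k" "ncells \<sigma>3 nI 0 = i" "ncells \<sigma>3 nN 0 = N"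
                  using frame_ncells[OF l(3), of nV] frame_ncells[OF l(3), of nI] frame_ncells[OF l(3), of nN] frn
                  by simp_all
                have r3: "rcells \<sigma>3 = rcells \<sigma>2" using frame_rcells[OF l(3)] by (auto simp: fun_eq_iff)
                have e: "ncells \<sigma>3 6 (Suc k) = e" using l(1) by (simp add: Inv2_def)
                have "N < e \<or> ?p \<le> real e * rcells \<sigma> rUnit 0"
                  using l(4) n3 e by (auto simp: r3 g2[simplified] pr[simplified] not_less)
                moreover have "\<forall>e'<e. \<not> (N < e' \<or> ?p \<le> real e' * rcells \<sigma> rUnit 0)"
                  using l(1) by (simp add: Inv2_def)
                ultimately have "cost ?v = e" unfolding cost_def units_def
                  by (intro Least_equality) (metis, metis not_le)
                thus ?thesis using l(1) by (simp add: Inv2_def)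
              qed
              subgoal premises l for \<sigma>3
              proof -
                have n3: "ncells \<sigma>3 nV 0 = Suc k" "ncells \<sigma>3 nI 0 = i"
                  using frame_ncells[OF l(1), of nV] frame_ncells[OF l(1), of nI] frn by simp_all
                have r3: "rcells \<sigma>3 = rcells \<sigma>2" using frame_rcells[OF l(1)] by (auto simp: fun_eq_iff)
                show ?thesis using p(1) n3 l(2)
                  by (auto simp: Inv_def r3 g2[simplified] pr[simplified] gain_def le_Suc_eq)
              qed
              subgoal by simp
              done
          qed
          subgoal by simp
          done
      qed
    qed
    subgoal by simp
    subgoal for k \<sigma>' by (auto simp: Inv_def gain_def cost_def)
    done
qed

lemma units_le: "p \<le> real e * u \<Longrightarrow> units u N p \<le> e"
  unfolding units_def by (rule Least_le) simp

lemma units_covers: "units u N p \<le> N \<Longrightarrow> p \<le> real (units u N p) * u"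
proof -
  assume "units u N p \<le> N"
  moreover have "N < units u N p \<or> p \<le> real (units u N p) * u"
    unfolding units_def by (rule LeastI[of _ "Suc N"]) simp
  ultimately show ?thesis by simp
qed

text \<open>Row-major order with \<open>N + 1\<close> budgets for each capacity. As naturals cannot
  be multiplied, the program tabulates the row offsets in \<open>nRow\<close> by repeated
  addition.\<close>

definition cell :: "nat \<Rightarrow> nat \<Rightarrow> nat \<Rightarrow> nat" where
  "cell N \<kappa> u = \<kappa> * (N + 1) + u"

lemma cell_inj: "u \<le> N \<Longrightarrow> u' \<le> N \<Longrightarrow> cell N \<kappa> u = cell N \<kappa>' u' \<longleftrightarrow> \<kappa> = \<kappa>' \<and> u = u'"
proof
  assume u: "u \<le> N" "u' \<le> N" "cell N \<kappa> u = cell N \<kappa>' u'"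
  have "cell N k v div (N + 1) = k" if "v \<le> N" for k v
    unfolding cell_def using div_mult_self3[of "N + 1" k v] that by (simp del: div_mult_self3)
  from this[OF u(1), of \<kappa>] this[OF u(2), of \<kappa>'] have "\<kappa> = \<kappa>'" using u(3) by simp
  thus "\<kappa> = \<kappa>' \<and> u = u'" using u(3) by (auto simp: cell_def)
qed simp

text \<open>Each entry is justified in two ways: its plan realises the stored value
  (\<open>Snd\<close>), and the value is at least that of every competitor (\<open>Cmp\<close>).
  Both stay abstract, so that the table code is verified apart from the meaning of plans.\<close>

definition labelled :: "nat \<Rightarrow> (nat \<Rightarrow> nat \<Rightarrow> real \<Rightarrow> (product \<Rightarrow> nat) \<Rightarrow> bool) \<Rightarrow> (nat \<Rightarrow> nat \<Rightarrow> real \<Rightarrow> bool) \<Rightarrow>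
    nat \<Rightarrow> nat \<Rightarrow> state \<Rightarrow> bool" where
  "labelled N Snd Cmp \<kappa> u \<sigma> \<longleftrightarrow>
     (\<exists>f. holds \<sigma> (ncells \<sigma> nTab (cell N \<kappa> u)) f \<and> Snd \<kappa> u (rcells \<sigma> rTab (cell N \<kappa> u)) f) \<and>
     Cmp \<kappa> u (rcells \<sigma> rTab (cell N \<kappa> u))"

definition tab_change :: "nat set \<Rightarrow> state \<Rightarrow> state \<Rightarrow> bool" where
  "tab_change D \<sigma> \<sigma>' \<longleftrightarrow> extends \<sigma> \<sigma>' \<and>
     (\<forall>j. j \<notin> D \<longrightarrow> rcells \<sigma>' rTab j = rcells \<sigma> rTab j \<and> ncells \<sigma>' nTab j = ncells \<sigma> nTab j)"

lemma tab_change_trans: "tab_change D \<sigma> \<sigma>' \<Longrightarrow> tab_change D' \<sigma>' \<sigma>'' \<Longrightarrow> tab_change (D \<union> D') \<sigma> \<sigma>''"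
  by (auto simp: tab_change_def intro: extends_trans)

lemma tab_change_mono: "tab_change D \<sigma> \<sigma>' \<Longrightarrow> D \<subseteq> D' \<Longrightarrow> tab_change D' \<sigma> \<sigma>'"
  by (auto simp: tab_change_def)

lemma labelled_tab_change:
  "labelled N Snd Cmp \<kappa> u \<sigma> \<Longrightarrow> tab_change D \<sigma> \<sigma>' \<Longrightarrow> cell N \<kappa> u \<notin> D \<Longrightarrow> labelled N Snd Cmp \<kappa> u \<sigma>'"
  unfolding labelled_def tab_change_def using holds_extends by metis

abbreviation (input) "dst \<equiv> NAdd (NCell nRow (NV nK)) (NV nU)"
abbreviation (input) "src \<equiv> NAdd (NCell nRow (NSub (NV nK) (NV nV))) (NSub (NV nU) (NCell nCost (NV nV)))"

text \<open>If the cost exceeds the budget, truncated subtraction makes \<open>src\<close> point to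
  budget 0; the first half of the test discards this case.\<close>

definition relax :: com where
  "relax =
     NSet nV (NAdd (NV nV) (NLit 1)) ;;
     Cond (BAnd (BNot (NLess (NV nU) (NCell nCost (NV nV))))
                (RLess (RCell rTab dst) (RAdd (RCell rTab src) (RCell rGain (NV nV)))))
       (RStore rTab dst (RAdd (RCell rTab src) (RCell rGain (NV nV))) ;;
        NStore nBase (NV nFree) (NV nI) ;;
        NStore nSize (NV nFree) (NV nS) ;;
        NStore nAmount (NV nFree) (NV nV) ;;
        NStore nNext (NV nFree) (NCell nTab src) ;;
        NStore nTab dst (NV nFree) ;;
        NSet nFree (NAdd (NV nFree) (NLit 1)))
       Skip"

definition relax_loop :: com where
  "relax_loop = NSet nV (NLit 0) ;; While (NLess (NV nV) (NV nK)) relax"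

definition knapsack :: com where
  "knapsack =
     NSet nK (NAdd NCapacity (NLit 1)) ;;
     While (NLess (NLit 0) (NV nK))
       (NSet nK (NSub (NV nK) (NLit 1)) ;;
        NSet nU (NLit 0) ;;
        While (NLess (NV nU) (NAdd (NV nN) (NLit 1)))
          (relax_loop ;;
           NSet nU (NAdd (NV nU) (NLit 1))))"

text \<open>\<open>Snd\<close> speaks about plans before the current base, \<open>Snd'\<close> about
  those that may include it. The source has smaller capacity than the target, so it is still of the
  first kind; the new plan is one node in front of the source plan.\<close>

lemma relax_step:
  assumes \<sigma>: "ncells \<sigma> nK 0 = \<kappa>" "ncells \<sigma> nU 0 = u" "ncells \<sigma> nI 0 = i" "ncells \<sigma> nS 0 = s" "ncells \<sigma> nV 0 = v"
    and row: "\<And>k. k \<le> \<kappa> \<Longrightarrow> ncells \<sigma> nRow k = k * (N + 1)" and uN: "u \<le> N" and v: "v < \<kappa>"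
    and cost: "ncells \<sigma> nCost (Suc v) = cost" and gain: "rcells \<sigma> rGain (Suc v) = gain"
    and lab: "labelled N Snd Cmp (\<kappa> - Suc v) (u - cost) \<sigma>"
    and cur: "holds \<sigma> (ncells \<sigma> nTab (cell N \<kappa> u)) g" "Snd' \<kappa> u (rcells \<sigma> rTab (cell N \<kappa> u)) g"
    and snd: "\<And>x f. cost \<le> u \<Longrightarrow> Snd (\<kappa> - Suc v) (u - cost) x f \<Longrightarrow>
      f (i, s) = 0 \<and> Snd' \<kappa> u (x + gain) (f((i, s) := Suc v))"
  shows "does I \<epsilon> relax \<sigma> 9 (\<lambda>\<sigma>'. ncells \<sigma>' nV 0 = Suc v \<and> tab_change {cell N \<kappa> u} \<sigma> \<sigma>' \<and>
      (\<exists>f. holds \<sigma>' (ncells \<sigma>' nTab (cell N \<kappa> u)) f \<and> Snd' \<kappa> u (rcells \<sigma>' rTab (cell N \<kappa> u)) f) \<and>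
      rcells \<sigma> rTab (cell N \<kappa> u) \<le> rcells \<sigma>' rTab (cell N \<kappa> u) \<and>
      (cost \<le> u \<longrightarrow> (\<exists>x. Cmp (\<kappa> - Suc v) (u - cost) x \<and> x + gain \<le> rcells \<sigma>' rTab (cell N \<kappa> u))))"
proof -
  define D S where "D = cell N \<kappa> u" and "S = cell N (\<kappa> - Suc v) (u - cost)"
  have idx: "ncells \<sigma> 7 \<kappa> + u = D" "ncells \<sigma> 7 (\<kappa> - Suc v) + (u - cost) = S"
    using row[of \<kappa>] row[of "\<kappa> - Suc v"] by (simp_all add: D_def S_def cell_def)
  obtain f where f: "holds \<sigma> (ncells \<sigma> nTab S) f" "Snd (\<kappa> - Suc v) (u - cost) (rcells \<sigma> rTab S) f"
    "Cmp (\<kappa> - Suc v) (u - cost) (rcells \<sigma> rTab S)"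
    using lab by (auto simp: labelled_def S_def)
  show ?thesis
  proof (cases "cost \<le> u \<and> rcells \<sigma> rTab D < rcells \<sigma> rTab S + gain")
    case False
    define \<sigma>1 where "\<sigma>1 = \<sigma>\<lparr>ncells := (ncells \<sigma>)(nV := (ncells \<sigma> nV)(0 := Suc v))\<rparr>"
    have ext: "extends \<sigma> \<sigma>1" by (simp add: extends_def \<sigma>1_def)
    have "tab_change {D} \<sigma> \<sigma>1" using ext by (simp add: tab_change_def \<sigma>1_def)
    moreover have "holds \<sigma>1 (ncells \<sigma>1 nTab D) g"
      using holds_extends[OF cur(1) ext] by (simp add: \<sigma>1_def D_def)
    ultimately show ?thesis using False cur f(3)
      unfolding relax_def D_def[symmetric] S_def[symmetric]
      by (auto simp: \<sigma>[simplified] cost[simplified] gain[simplified] idx \<sigma>1_def not_less not_le D_def[symmetric])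
  next
    case True
    define F where "F = ncells \<sigma> nFree 0"
    define \<sigma>1 where "\<sigma>1 = \<sigma>\<lparr>ncells := (ncells \<sigma>)(nV := (ncells \<sigma> nV)(0 := Suc v),
      nBase := (ncells \<sigma> nBase)(F := i), nSize := (ncells \<sigma> nSize)(F := s),
      nAmount := (ncells \<sigma> nAmount)(F := Suc v), nNext := (ncells \<sigma> nNext)(F := ncells \<sigma> nTab S),
      nTab := (ncells \<sigma> nTab)(D := F), nFree := (ncells \<sigma> nFree)(0 := Suc F)),
      rcells := (rcells \<sigma>)(rTab := (rcells \<sigma> rTab)(D := rcells \<sigma> rTab S + gain))\<rparr>"
    have ext: "extends \<sigma> \<sigma>1" by (simp add: extends_def \<sigma>1_def F_def)
    have tc: "tab_change {D} \<sigma> \<sigma>1" using ext by (simp add: tab_change_def \<sigma>1_def)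
    have new: "f (i, s) = 0" "Snd' \<kappa> u (rcells \<sigma> rTab S + gain) (f((i, s) := Suc v))"
      using snd[OF conjunct1[OF True] f(2)] by auto
    have "holds \<sigma>1 (ncells \<sigma> nTab S) f" by (rule holds_extends[OF f(1) ext])
    moreover have lt: "ncells \<sigma> nTab S < F" using f(1) by (simp add: holds_def F_def)
    ultimately have "plan (ncells \<sigma>1 nBase) (ncells \<sigma>1 nSize) (ncells \<sigma>1 nAmount) (ncells \<sigma>1 nNext) F
        (f((ncells \<sigma>1 nBase F, ncells \<sigma>1 nSize F) := ncells \<sigma>1 nAmount F))"
      using new(1) by (intro plan.plan_cons) (auto simp: holds_def \<sigma>1_def)
    hence h: "holds \<sigma>1 F (f((i, s) := Suc v))" by (simp add: holds_def \<sigma>1_def)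
    have run: "does I \<epsilon> relax \<sigma> 9 (\<lambda>\<sigma>'. \<sigma>' = \<sigma>1)"
      unfolding relax_def using True
      by (simp add: \<sigma>[simplified] cost[simplified] gain[simplified] idx \<sigma>1_def not_less F_def fun_upd_twist)
    show ?thesis
    proof (rule does_mono[OF run order_refl])
      fix \<sigma>' assume "\<sigma>' = \<sigma>1"
      thus "ncells \<sigma>' nV 0 = Suc v \<and> tab_change {cell N \<kappa> u} \<sigma> \<sigma>' \<and>
        (\<exists>f. holds \<sigma>' (ncells \<sigma>' nTab (cell N \<kappa> u)) f \<and> Snd' \<kappa> u (rcells \<sigma>' rTab (cell N \<kappa> u)) f) \<and>
        rcells \<sigma> rTab (cell N \<kappa> u) \<le> rcells \<sigma>' rTab (cell N \<kappa> u) \<and>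
        (cost \<le> u \<longrightarrow> (\<exists>x. Cmp (\<kappa> - Suc v) (u - cost) x \<and> x + gain \<le> rcells \<sigma>' rTab (cell N \<kappa> u)))"
        unfolding D_def[symmetric] using tc h new(2) True f(3)
        by (auto simp: \<sigma>1_def intro!: exI[of _ "f((i, s) := Suc v)"])
    qed
  qed
qed

lemma writes_relax [simp]: "nwrites relax = {nV, nBase, nSize, nAmount, nNext, nTab, nFree}"
  "rwrites relax = {rTab}" "\<not> swrites relax"
  by (auto simp: relax_def)

lemma writes_relax_loop [simp]: "nwrites relax_loop = {nV, nBase, nSize, nAmount, nNext, nTab, nFree}"
  "rwrites relax_loop = {rTab}" "\<not> swrites relax_loop"
  by (auto simp: relax_loop_def)

text \<open>In row \<kappa> only the entry to be updated is assumed to be old: the smaller budgets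
  of this row have been overwritten already.\<close>

lemma relax_loop_correct:
  assumes \<sigma>: "ncells \<sigma> nK 0 = \<kappa>" "ncells \<sigma> nU 0 = u" "ncells \<sigma> nI 0 = i" "ncells \<sigma> nS 0 = s"
    and row: "\<And>k. k \<le> \<kappa> \<Longrightarrow> ncells \<sigma> nRow k = k * (N + 1)" and uN: "u \<le> N"
    and cost: "\<And>v. 1 \<le> v \<Longrightarrow> v \<le> \<kappa> \<Longrightarrow> ncells \<sigma> nCost v = cost v"
    and gain: "\<And>v. 1 \<le> v \<Longrightarrow> v \<le> \<kappa> \<Longrightarrow> rcells \<sigma> rGain v = gain v"
    and lab: "\<And>k u. k \<le> \<kappa> \<Longrightarrow> u \<le> N \<Longrightarrow> (k = \<kappa> \<Longrightarrow> u = ncells \<sigma> nU 0) \<Longrightarrow> labelled N Snd Cmp k u \<sigma>"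
    and keep: "\<And>x f. Snd \<kappa> u x f \<Longrightarrow> Snd' \<kappa> u x f"
    and snd: "\<And>x f v. 1 \<le> v \<Longrightarrow> v \<le> \<kappa> \<Longrightarrow> cost v \<le> u \<Longrightarrow> Snd (\<kappa> - v) (u - cost v) x f \<Longrightarrow>
      f (i, s) = 0 \<and> Snd' \<kappa> u (x + gain v) (f((i, s) := v))"
    and cmp: "\<And>x0 y. Cmp \<kappa> u x0 \<Longrightarrow> x0 \<le> y \<Longrightarrow> (\<And>v. 1 \<le> v \<Longrightarrow> v \<le> \<kappa> \<Longrightarrow> cost v \<le> u \<Longrightarrow>
      \<exists>x. Cmp (\<kappa> - v) (u - cost v) x \<and> x + gain v \<le> y) \<Longrightarrow> Cmp' \<kappa> u y"
  shows "does I \<epsilon> relax_loop \<sigma> (10 * \<kappa> + 2)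
    (\<lambda>\<sigma>'. labelled N Snd' Cmp' \<kappa> u \<sigma>' \<and> tab_change {cell N \<kappa> u} \<sigma> \<sigma>')"
proof -
  define D where "D = cell N \<kappa> u"
  have lab0: "labelled N Snd Cmp \<kappa> u \<sigma>" by (rule lab) (use uN \<sigma> in auto)
  define x0 where "x0 = rcells \<sigma> rTab D"
  define Inv where "Inv = (\<lambda>v (\<sigma>' :: state). ncells \<sigma>' nV 0 = v \<and> tab_change {D} \<sigma> \<sigma>' \<and>
    (\<exists>f. holds \<sigma>' (ncells \<sigma>' nTab D) f \<and> Snd' \<kappa> u (rcells \<sigma>' rTab D) f) \<and> x0 \<le> rcells \<sigma>' rTab D \<and>
    (\<forall>v'. 1 \<le> v' \<longrightarrow> v' \<le> v \<longrightarrow> cost v' \<le> u \<longrightarrow>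
      (\<exists>x. Cmp (\<kappa> - v') (u - cost v') x \<and> x + gain v' \<le> rcells \<sigma>' rTab D)))"
  show ?thesis unfolding relax_loop_def
    apply (simp del: does_Cond)
    apply (rule does_loop[where Inv = Inv and N = \<kappa> and c = 9])
    subgoal
    proof -
      let ?\<sigma>1 = "\<sigma>\<lparr>ncells := (ncells \<sigma>)(nV := (ncells \<sigma> nV)(0 := 0))\<rparr>"
      have ext: "extends \<sigma> ?\<sigma>1" by (simp add: extends_def)
      obtain f where "holds \<sigma> (ncells \<sigma> nTab D) f" "Snd \<kappa> u x0 f"
        using lab0 by (auto simp: labelled_def D_def x0_def)
      with holds_extends[OF this(1) ext] keep ext show ?thesis
        by (auto simp: Inv_def tab_change_def x0_def)
    qed
    subgoal premises p for v \<sigma>'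
    proof -
      let ?\<sigma>1 = "\<sigma>\<lparr>ncells := (ncells \<sigma>)(nV := (ncells \<sigma> nV)(0 := 0))\<rparr>"
      have fr: "ncells \<sigma>' a = ncells \<sigma> a" if "a \<in> {nK, nU, nI, nS, nRow, nCost}" for a
        using frame_ncells[OF p(3), of a] that by auto
      have frg: "rcells \<sigma>' rGain = rcells \<sigma> rGain" using frame_rcells[OF p(3), of rGain] by simp
      have v: "v < \<kappa>" "ncells \<sigma>' nV 0 = v"
        using p(1,4) fr[of nK] \<sigma> by (auto simp: Inv_def)
      have tc: "tab_change {D} \<sigma> \<sigma>'" using p(1) by (simp add: Inv_def)
      obtain f0 where f0: "holds \<sigma>' (ncells \<sigma>' nTab D) f0" "Snd' \<kappa> u (rcells \<sigma>' rTab D) f0"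
        using p(1) by (auto simp: Inv_def)
      have lab': "labelled N Snd Cmp (\<kappa> - Suc v) (u - cost (Suc v)) \<sigma>'"
      proof (rule labelled_tab_change[OF lab tc])
        show "cell N (\<kappa> - Suc v) (u - cost (Suc v)) \<notin> {D}" unfolding D_def using v uN by (simp add: cell_inj)
      qed (use v uN in auto)
      show ?thesis
      proof (intro conjI v(1) does_mono[OF relax_step[where \<sigma> = \<sigma>' and \<kappa> = \<kappa> and u = u and v = v and N = N and
            cost = "cost (Suc v)" and gain = "gain (Suc v)" and i = i and s = s and
            Snd = Snd and Snd' = Snd' and Cmp = Cmp and g = f0]] order_refl)
        fix \<sigma>2
        assume *: "ncells \<sigma>2 nV 0 = Suc v \<and> tab_change {cell N \<kappa> u} \<sigma>' \<sigma>2 \<and>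
          (\<exists>f. holds \<sigma>2 (ncells \<sigma>2 nTab (cell N \<kappa> u)) f \<and> Snd' \<kappa> u (rcells \<sigma>2 rTab (cell N \<kappa> u)) f) \<and>
          rcells \<sigma>' rTab (cell N \<kappa> u) \<le> rcells \<sigma>2 rTab (cell N \<kappa> u) \<and>
          (cost (Suc v) \<le> u \<longrightarrow> (\<exists>x. Cmp (\<kappa> - Suc v) (u - cost (Suc v)) x \<and>
            x + gain (Suc v) \<le> rcells \<sigma>2 rTab (cell N \<kappa> u)))"
        have "tab_change {D} \<sigma> \<sigma>2" using tab_change_trans[OF tc, of "{D}" \<sigma>2] * by (simp add: D_def)
        moreover have "\<exists>x. Cmp (\<kappa> - v') (u - cost v') x \<and> x + gain v' \<le> rcells \<sigma>2 rTab D"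
          if "1 \<le> v'" "v' \<le> Suc v" "cost v' \<le> u" for v'
        proof (cases "v' = Suc v")
          case False
          hence "v' \<le> v" using that by simp
          with p(1) that(1,3) obtain x where "Cmp (\<kappa> - v') (u - cost v') x" "x + gain v' \<le> rcells \<sigma>' rTab D"
            unfolding Inv_def by blast
          thus ?thesis using * by (auto simp: D_def)
        qed (use that * D_def in auto)
        ultimately show "Inv (Suc v) \<sigma>2" using p(1) * unfolding Inv_def D_def by (auto intro: order_trans)
      qed (use v \<sigma> fr frg row uN cost gain lab' f0 snd[of "Suc v"] in \<open>auto simp: D_def\<close>)
    qed
    subgoal by simp
    subgoal premises p for v \<sigma>'
    proof -
      have "ncells \<sigma>' nK 0 = \<kappa>" using frame_ncells[OF p(3), of nK] \<sigma> by simp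
      hence v: "v = \<kappa>" using p(1,2,4) by (auto simp: Inv_def)
      have "Cmp' \<kappa> u (rcells \<sigma>' rTab D)"
      proof (rule cmp)
        show "Cmp \<kappa> u x0" using lab0 by (simp add: labelled_def x0_def D_def)
      qed (use p(1) v in \<open>auto simp: Inv_def\<close>)
      thus ?thesis using p(1) by (auto simp: Inv_def labelled_def D_def)
    qed
    done
qed

lemma writes_knapsack [simp]: "nwrites knapsack = {nK, nU, nV, nBase, nSize, nAmount, nNext, nTab, nFree}"
  "rwrites knapsack = {rTab}" "\<not> swrites knapsack"
  by (auto simp: knapsack_def)

text \<open>The table is updated in place: capacities are processed in decreasing order, so that the entries
  read, which have smaller capacity, are still those of the previous base.\<close>

lemma knapsack_correct:
  assumes \<sigma>: "ncells \<sigma> nI 0 = i" "ncells \<sigma> nS 0 = s" "ncells \<sigma> nN 0 = N" "C = capacity I"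
    and row: "\<And>k. k \<le> C \<Longrightarrow> ncells \<sigma> nRow k = k * (N + 1)"
    and cost: "\<And>v. 1 \<le> v \<Longrightarrow> v \<le> C \<Longrightarrow> ncells \<sigma> nCost v = cost v"
    and gain: "\<And>v. 1 \<le> v \<Longrightarrow> v \<le> C \<Longrightarrow> rcells \<sigma> rGain v = gain v"
    and lab: "\<And>k u. k \<le> C \<Longrightarrow> u \<le> N \<Longrightarrow> labelled N Snd Cmp k u \<sigma>"
    and keep: "\<And>k u x f. k \<le> C \<Longrightarrow> Snd k u x f \<Longrightarrow> Snd' k u x f"
    and snd: "\<And>k u x f v. k \<le> C \<Longrightarrow> 1 \<le> v \<Longrightarrow> v \<le> k \<Longrightarrow> u \<le> N \<Longrightarrow> cost v \<le> u \<Longrightarrow>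
      Snd (k - v) (u - cost v) x f \<Longrightarrow> f (i, s) = 0 \<and> Snd' k u (x + gain v) (f((i, s) := v))"
    and cmp: "\<And>k u x0 y. k \<le> C \<Longrightarrow> u \<le> N \<Longrightarrow> Cmp k u x0 \<Longrightarrow> x0 \<le> y \<Longrightarrow>
      (\<And>v. 1 \<le> v \<Longrightarrow> v \<le> k \<Longrightarrow> cost v \<le> u \<Longrightarrow> \<exists>x. Cmp (k - v) (u - cost v) x \<and> x + gain v \<le> y) \<Longrightarrow>
      Cmp' k u y"
  shows "does I \<epsilon> knapsack \<sigma> ((C + 1) * ((N + 1) * (10 * C + 4) + 4) + 2)
    (\<lambda>\<sigma>'. (\<forall>k\<le>C. \<forall>u\<le>N. labelled N Snd' Cmp' k u \<sigma>') \<and> extends \<sigma> \<sigma>')"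
proof -
  define Inv where "Inv = (\<lambda>j (\<sigma>' :: state). ncells \<sigma>' nK 0 = C + 1 - j \<and>
    tab_change {cell N k u | k u. C + 1 - j \<le> k \<and> u \<le> N} \<sigma> \<sigma>' \<and>
    (\<forall>k\<le>C. C + 1 - j \<le> k \<longrightarrow> (\<forall>u\<le>N. labelled N Snd' Cmp' k u \<sigma>')))"
  show ?thesis unfolding knapsack_def
    apply (simp del: does_Cond)
    apply (rule does_loop[where Inv = Inv and N = "C + 1" and c = "(N + 1) * (10 * C + 4) + 3"])
    subgoal using \<sigma>(4) by (auto simp: Inv_def tab_change_def extends_def)
    subgoal premises p for j \<sigma>1
    proof -
      have fr: "ncells \<sigma>1 a = ncells \<sigma> a" if "a \<in> {nN, nI, nS, nRow, nCost}" for a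
        using frame_ncells[OF p(3), of a] that by auto
      have frg: "rcells \<sigma>1 rGain = rcells \<sigma> rGain" using frame_rcells[OF p(3), of rGain] by simp
      have j: "j < C + 1" "ncells \<sigma>1 nK 0 = C + 1 - j" using p(1,4) by (auto simp: Inv_def)
      define k where "k = C - j"
      have k: "k \<le> C" "C + 1 - j = Suc k" "C + 1 - Suc j = k" using j by (auto simp: k_def)
      have tc1: "tab_change {cell N k' u | k' u. Suc k \<le> k' \<and> u \<le> N} \<sigma> \<sigma>1"
        and new1: "\<And>k' u. k' \<le> C \<Longrightarrow> Suc k \<le> k' \<Longrightarrow> u \<le> N \<Longrightarrow> labelled N Snd' Cmp' k' u \<sigma>1"
        using p(1) k(2) by (auto simp: Inv_def)
      define \<sigma>2 where "\<sigma>2 = \<sigma>1\<lparr>ncells := (ncells \<sigma>1)(nK := (ncells \<sigma>1 nK)(0 := k), nU := (ncells \<sigma>1 nU)(0 := 0))\<rparr>"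
      have tc12: "tab_change {} \<sigma>1 \<sigma>2" by (simp add: tab_change_def extends_def \<sigma>2_def)
      define Inv2 where "Inv2 = (\<lambda>u (\<sigma>' :: state). ncells \<sigma>' nU 0 = u \<and>
        tab_change {cell N k u' | u'. u' < u \<and> u' \<le> N} \<sigma>2 \<sigma>' \<and>
        (\<forall>u'\<le>N. u' < u \<longrightarrow> labelled N Snd' Cmp' k u' \<sigma>'))"
      have "does I \<epsilon> (While (NLess (NV nU) (NAdd (NV nN) (NLit 1))) (relax_loop ;; NSet nU (NAdd (NV nU) (NLit 1))))
          \<sigma>2 ((N + 1) * (10 * C + 4) + 1) (Inv (Suc j))"
        apply (rule does_loop[where Inv = Inv2 and N = "N + 1" and c = "10 * C + 3"])
        subgoal by (simp add: Inv2_def \<sigma>2_def tab_change_def extends_refl)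
        subgoal premises r for u \<sigma>3
        proof -
          have fr3: "ncells \<sigma>3 a = ncells \<sigma> a" if "a \<in> {nN, nI, nS, nRow, nCost}" for a
            using frame_ncells[OF r(3), of a] fr[of a] that by (auto simp: \<sigma>2_def)
          have frg3: "rcells \<sigma>3 rGain = rcells \<sigma> rGain"
            using frame_rcells[OF r(3), of rGain] frg by (simp add: \<sigma>2_def)
          have n3: "ncells \<sigma>3 nK 0 = k" using frame_ncells[OF r(3), of nK] by (simp add: \<sigma>2_def)
          have u: "u \<le> N" "ncells \<sigma>3 nU 0 = u" using r(1,4) fr3[of nN] \<sigma>(3) by (auto simp: Inv2_def)
          have tc3: "tab_change ({cell N k' u | k' u. Suc k \<le> k' \<and> u \<le> N} \<union> {cell N k u' | u'. u' < u \<and> u' \<le> N}) \<sigma> \<sigma>3"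
            using tab_change_trans[OF tab_change_trans[OF tc1 tc12]] r(1) by (simp add: Inv2_def)
          have old3: "labelled N Snd Cmp k' u' \<sigma>3" if "k' \<le> k" "u' \<le> N" "k' = k \<Longrightarrow> u \<le> u'" for k' u'
          proof (rule labelled_tab_change[OF lab tc3])
            show "cell N k' u' \<notin> {cell N k' u |k' u. Suc k \<le> k' \<and> u \<le> N} \<union> {cell N k u' |u'. u' < u \<and> u' \<le> N}"
              using that by (auto simp: cell_inj)
          qed (use that k in auto)
          have relax: "does I \<epsilon> relax_loop \<sigma>3 (10 * k + 2)
              (\<lambda>\<sigma>'. labelled N Snd' Cmp' k u \<sigma>' \<and> tab_change {cell N k u} \<sigma>3 \<sigma>')"
          proof (rule relax_loop_correct[where Snd = Snd and Cmp = Cmp and cost = cost and gain = gain and i = i and s = s])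
            show "labelled N Snd Cmp k' u' \<sigma>3"
              if "k' \<le> k" "u' \<le> N" "k' = k \<Longrightarrow> u' = ncells \<sigma>3 nU 0" for k' u'
              using that u by (intro old3) auto
          qed (use n3 u \<sigma> fr3 frg3 row cost gain keep snd cmp k in auto)
          show ?thesis
          proof (intro conjI)
            show "u < N + 1" using u by simp
            show "does I \<epsilon> (relax_loop ;; NSet nU (NAdd (NV nU) (NLit 1))) \<sigma>3 (10 * C + 3) (Inv2 (Suc u))"
            proof (rule does_Seq[OF relax, where j = 1])
              fix \<sigma>4 assume f4: "frame relax_loop \<sigma>3 \<sigma>4"
                and 4: "labelled N Snd' Cmp' k u \<sigma>4 \<and> tab_change {cell N k u} \<sigma>3 \<sigma>4"
              let ?\<sigma>5 = "\<sigma>4\<lparr>ncells := (ncells \<sigma>4)(nU := (ncells \<sigma>4 nU)(0 := Suc u))\<rparr>"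
              have tc45: "tab_change {} \<sigma>4 ?\<sigma>5" by (simp add: tab_change_def extends_def)
              have tc35: "tab_change {cell N k u} \<sigma>3 ?\<sigma>5" using tab_change_trans[OF conjunct2[OF 4] tc45] by simp
              have "tab_change ({cell N k u' | u'. u' < u \<and> u' \<le> N} \<union> {cell N k u}) \<sigma>2 ?\<sigma>5"
                using tab_change_trans[OF _ tc35] r(1) by (simp add: Inv2_def)
              hence "tab_change {cell N k u' | u'. u' < Suc u \<and> u' \<le> N} \<sigma>2 ?\<sigma>5"
                by (rule tab_change_mono) (use u in auto)
              moreover have "labelled N Snd' Cmp' k u' ?\<sigma>5" if "u' \<le> N" "u' < Suc u" for u'
              proof (cases "u' = u")
                case True
                thus ?thesis using labelled_tab_change[OF conjunct1[OF 4] tc45] by simp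
              next
                case False
                have "labelled N Snd' Cmp' k u' \<sigma>3" using r(1) that False by (auto simp: Inv2_def)
                thus ?thesis by (rule labelled_tab_change[OF _ tc35]) (use that False u in \<open>simp add: cell_inj\<close>)
              qed
              ultimately have "Inv2 (Suc u) ?\<sigma>5" by (simp add: Inv2_def)
              moreover have "ncells \<sigma>4 nU 0 = u" using frame_ncells[OF f4, of nU] u by simp
              ultimately show "does I \<epsilon> (NSet nU (NAdd (NV nU) (NLit 1))) \<sigma>4 1 (Inv2 (Suc u))" by simp
            qed (use k in simp)
          qed
        qed
        subgoal by simp
        subgoal premises r for u \<sigma>3
        proof -
          have "ncells \<sigma>3 nN 0 = N" "ncells \<sigma>3 nK 0 = k"
            using frame_ncells[OF r(3), of nN] frame_ncells[OF r(3), of nK] fr[of nN] \<sigma>(3) by (simp_all add: \<sigma>2_def)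
          hence u: "u = N + 1" using r(1,2,4) by (auto simp: Inv2_def)
          have tc23: "tab_change {cell N k u' | u'. u' \<le> N} \<sigma>2 \<sigma>3"
            using r(1) u by (auto simp: Inv2_def elim: tab_change_mono)
          have tc13: "tab_change {cell N k u' | u'. u' \<le> N} \<sigma>1 \<sigma>3"
            using tab_change_trans[OF tc12 tc23] by simp
          have "tab_change {cell N k' u | k' u. k \<le> k' \<and> u \<le> N} \<sigma> \<sigma>3"
            by (rule tab_change_mono[OF tab_change_trans[OF tc1 tc13]]) (blast dest: Suc_leD)
          moreover have "labelled N Snd' Cmp' k' u' \<sigma>3" if "k' \<le> C" "k \<le> k'" "u' \<le> N" for k' u'
          proof (cases "k' = k")
            case True
            thus ?thesis using r(1) u that by (auto simp: Inv2_def)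
          next
            case False
            show ?thesis by (rule labelled_tab_change[OF new1 tc13]) (use that False in \<open>auto simp: cell_inj\<close>)
          qed
          ultimately show ?thesis using \<open>ncells \<sigma>3 nK 0 = k\<close> k(3) by (simp add: Inv_def)
        qed
        done
      thus ?thesis using j k by (simp add: \<sigma>2_def Suc_diff_le)
    qed
    subgoal by (simp add: algebra_simps)
    subgoal premises p for j \<sigma>1
    proof -
      have "C + 1 - j = 0" using p(1,4) by (auto simp: Inv_def)
      thus ?thesis using p(1) by (auto simp: Inv_def tab_change_def)
    qed
    done
qed

text \<open>The arrays of the program agree with \<open>type_a\<close> and \<open>type_b\<close> on
  the first six entries only.\<close>

lemma walk_cong:
  assumes "\<And>k. k < 6 \<Longrightarrow> a k = a' k" "\<And>k. k < 6 \<Longrightarrow> b k = b' k"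
  shows "choice_rate a b = choice_rate a' b'" "walk_const a b d bs lo hi V = walk_const a' b' d bs lo hi V"
    "walk_price a b d bs lo hi V x = walk_price a' b' d bs lo hi V x"
proof -
  show rate: "choice_rate a b = choice_rate a' b'" using assms by (simp add: choice_rate_def fun_eq_iff)
  have "slope a b = slope a' b'" "intercept a b = intercept a' b'"
    using assms by (simp_all add: slope_def intercept_def rate fun_eq_iff)
  thus "walk_const a b d bs lo hi V = walk_const a' b' d bs lo hi V"
    "walk_price a b d bs lo hi V x = walk_price a' b' d bs lo hi V x"
    by (induction a b d bs lo hi V rule: walk_const.induct) simp_all
qed

section \<open>Sound plans and the knapsack recursion\<close>

text \<open>The non-degenerate inputs; on all others the program returns the empty stock.\<close>

locale algorithm =
  fixes I :: cftc and \<epsilon> :: real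
  assumes inst: "cftc_instance I" and eps: "0 < \<epsilon>" "\<epsilon> < 1 / 2"
    and horizon_pos: "0 < horizon I" and capacity_pos: "0 < capacity I"
begin

abbreviation "n \<equiv> nbases I"
abbreviation "m \<equiv> nsizes I"
abbreviation "C \<equiv> capacity I"
abbreviation "T \<equiv> horizon I"

definition "\<delta> = \<epsilon> / 16"
definition "wmin = Min (weight I ` {1..n})"
definition "wmax = Max (weight I ` {1..n})"
text \<open>Rounding up the price of each base to a multiple of \<open>tick\<close> wastes at most \<open>n * tick = \<delta> * T\<close>.\<close>

definition "tick = \<delta> * T / n"
text \<open>\<open>reach\<close> bounds the product of the ranges of the levels and of the grid of a staircase, so that \<open>B\<close>
  bits suffice.\<close>

definition "reach = 4 * real n * real n * real C * (wmax / wmin) * (wmax / wmin)"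
definition "B = (LEAST B. reach \<le> (1 + \<delta>) ^ B)"
text \<open>Length of the first cell. Before clock time 1 / \<open>wmax\<close> no stocked base can
  sell out, so the live weight is constant there; the second term keeps the real time of this cell
  at most T / 2 even if every base is stocked.\<close>

definition "first s = min (1 / wmax) (T / 2 * size_rate I s (real n * wmax))"
definition "sconst s q = walk_const (type_a I s) (type_b I s) \<delta> (bits B q) 0 (first s) (real n * wmax)"
definition "sprice s q x = walk_price (type_a I s) (type_b I s) \<delta> (bits B q) 0 (first s) (real n * wmax) x"
definition "send s q = walk_end \<delta> (bits B q) 0 (first s)"
text \<open>If \<open>sconst s q\<close> <= T, this is the number of whole ticks in the rest of the
  horizon, in a form that can be computed by counting.\<close>

definition "sbudget s q = (LEAST N. T < sconst s q + (real N + 1) * tick)"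
definition "cost s q i v = (if v = 0 then 0 else
  units tick (sbudget s q) (weight I i * sprice s q (real v / weight I i)))"
definition "gain s q i v = revenue I i * min (real v) (weight I i * send s q)"

lemma n_pos: "0 < n"
  using inst by (simp add: cftc_instance_def)

lemma base_weight_pos: "i \<in> {1..n} \<Longrightarrow> 0 < weight I i"
  using inst by (simp add: cftc_instance_def)

lemma weight_range:
  assumes "i \<in> {1..n}" shows "wmin \<le> weight I i" "weight I i \<le> wmax"
  using assms by (auto simp: wmin_def wmax_def)

lemma weights_pos: "0 < wmin" "wmin \<le> wmax" "0 < wmax"
proof -
  have "wmin \<in> weight I ` {1..n}" unfolding wmin_def using n_pos by (intro Min_in) auto
  then obtain i where "i \<in> {1..n}" "wmin = weight I i" by blast
  thus 1: "0 < wmin" using base_weight_pos by simp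
  show 2: "wmin \<le> wmax" using weight_range[of 1] n_pos by auto
  show "0 < wmax" using 1 2 by simp
qed

lemma \<delta>_pos: "0 < \<delta>" "\<delta> < 1 / 32"
  using eps by (auto simp: \<delta>_def)

lemma tick_pos: "0 < tick"
  using \<delta>_pos horizon_pos n_pos by (simp add: tick_def)

lemma reach_le: "reach \<le> (1 + \<delta>) ^ B"
proof -
  obtain j where "reach < (1 + \<delta>) ^ j" using real_arch_pow[of "1 + \<delta>" reach] \<delta>_pos by auto
  hence "reach \<le> (1 + \<delta>) ^ j" by simp
  thus ?thesis unfolding B_def by (rule LeastI)
qed

lemma size_rate_nonneg:
  assumes "s \<in> {1..m}" "0 \<le> W" shows "0 \<le> size_rate I s W"
  unfolding choice_rate_def using type_ab[OF inst assms(1)] assms(2)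
  by (intro sum_nonneg divide_nonneg_nonneg) (auto simp: less_imp_le)

lemma first_nonneg: "s \<in> {1..m} \<Longrightarrow> 0 \<le> first s"
  using size_rate_nonneg[of s "real n * wmax"] weights_pos horizon_pos by (simp add: first_def)

lemma send_nonneg: "s \<in> {1..m} \<Longrightarrow> 0 \<le> send s q"
  unfolding send_def by (rule walk_end_ge) (use first_nonneg \<delta>_pos in auto)

lemma gain_0: "s \<in> {1..m} \<Longrightarrow> i \<in> bases_of I s \<Longrightarrow> gain s q i 0 = 0"
  using send_nonneg[of s q] weight_bases_pos[OF inst, of i s] by (simp add: gain_def)

lemma cost_0: "cost s q i 0 = 0"
  by (simp add: cost_def)

text \<open>\<open>x\<close> is certified revenue: each size that counts has a clock time which it
  reaches within the horizon. Sizes are processed in increasing order, hence the strict bound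
  \<open>s\<close>; the common parity keeps them from interacting.\<close>

definition sound_plan :: "nat \<Rightarrow> nat \<Rightarrow> real \<Rightarrow> (product \<Rightarrow> nat) \<Rightarrow> bool" where
  "sound_plan s k x f \<longleftrightarrow> (\<forall>p. f p \<noteq> 0 \<longrightarrow> p \<in> universe I \<and> snd p < s \<and> even (snd p + s)) \<and>
     sum f (universe I) \<le> k \<and>
     (\<exists>v. x = (\<Sum>s'=1..m. v s') \<and> (\<forall>s'\<in>{1..m}. v s' = 0 \<or> (s' < s \<and> even (s' + s) \<and> live_size I s' \<and>
       (\<exists>\<tau>\<ge>0. size_duration I s' (\<lambda>i. real (f (i, s'))) \<tau> \<le> T \<and> v s' = size_value I s' (\<lambda>i. f (i, s')) \<tau>))))"

lemma sound_plan_zero: "sound_plan s k 0 (\<lambda>_. 0)"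
  unfolding sound_plan_def by (auto intro!: exI[of _ "\<lambda>_. 0"])

lemma sound_plan_later: "sound_plan s k x f \<Longrightarrow> sound_plan (s + 2) k x f"
  unfolding sound_plan_def by fastforce

text \<open>While size \<open>s\<close> is filled base by base under code \<open>q\<close>:
  \<open>f0\<close> is the finished part on smaller sizes, and size \<open>s\<close> uses bases up
  to \<open>i\<close>. Prices are charged to \<open>u\<close>, and revenue is credited up to clock
  time \<open>send s q\<close>.\<close>

definition sound_partial :: "nat \<Rightarrow> nat \<Rightarrow> nat \<Rightarrow> nat \<Rightarrow> nat \<Rightarrow> real \<Rightarrow> (product \<Rightarrow> nat) \<Rightarrow> bool" where
  "sound_partial s q i k u x f \<longleftrightarrow> (\<exists>f0 x0 k0. sound_plan s k0 x0 f0 \<and> (\<forall>p. snd p \<noteq> s \<longrightarrow> f p = f0 p) \<and>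
     (\<forall>j. f (j, s) \<noteq> 0 \<longrightarrow> j \<in> bases_of I s \<and> j \<le> i) \<and> k0 + (\<Sum>j\<in>bases_of I s. f (j, s)) \<le> k \<and>
     (\<Sum>j\<in>bases_of I s. cost s q j (f (j, s))) \<le> u \<and> x = x0 + (\<Sum>j\<in>bases_of I s. gain s q j (f (j, s))))"

text \<open>The competitors are arbitrary stocks of size \<open>s\<close> on bases up to
  \<open>i\<close>, combined with the value \<open>old\<close> that smaller sizes attain with the
  remaining capacity.\<close>

definition bounds_partial :: "nat \<Rightarrow> nat \<Rightarrow> nat \<Rightarrow> (nat \<Rightarrow> real) \<Rightarrow> nat \<Rightarrow> nat \<Rightarrow> real \<Rightarrow> bool" where
  "bounds_partial s q i old k u y \<longleftrightarrow> (\<forall>c. (\<forall>j. c j \<noteq> 0 \<longrightarrow> j \<in> bases_of I s \<and> j \<le> i) \<longrightarrow> sum c (bases_of I s) \<le> k \<longrightarrow>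
     (\<Sum>j\<in>bases_of I s. cost s q j (c j)) \<le> u \<longrightarrow>
     old (k - sum c (bases_of I s)) + (\<Sum>j\<in>bases_of I s. gain s q j (c j)) \<le> y)"

lemma sound_partial_0:
  assumes s: "s \<in> {1..m}" and g: "sound_plan s k x f" shows "sound_partial s q 0 k u x f"
proof -
  have "f (j, s) = 0" for j using g by (force simp: sound_plan_def)
  thus ?thesis unfolding sound_partial_def using g gain_0[OF s]
    by (intro exI[of _ f] exI[of _ x] exI[of _ k]) (simp add: cost_0)
qed

lemma sound_partial_mono: "sound_partial s q i k u x f \<Longrightarrow> sound_partial s q (Suc i) k u x f"
  unfolding sound_partial_def by (elim exE conjE, intro exI conjI) (assumption | blast intro: le_SucI)+

lemma sound_partial_step:
  assumes s: "s \<in> {1..m}" and i: "Suc i \<in> bases_of I s" and v: "v \<le> k" "cost s q (Suc i) v \<le> u"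
    and f: "sound_partial s q i (k - v) (u - cost s q (Suc i) v) x f"
  shows "f (Suc i, s) = 0 \<and> sound_partial s q (Suc i) k u (x + gain s q (Suc i) v) (f((Suc i, s) := v))"
proof -
  obtain f0 x0 k0 where f0: "sound_plan s k0 x0 f0" "\<forall>p. snd p \<noteq> s \<longrightarrow> f p = f0 p"
    "\<forall>j. f (j, s) \<noteq> 0 \<longrightarrow> j \<in> bases_of I s \<and> j \<le> i" "k0 + (\<Sum>j\<in>bases_of I s. f (j, s)) \<le> k - v"
    "(\<Sum>j\<in>bases_of I s. cost s q j (f (j, s))) \<le> u - cost s q (Suc i) v"
    "x = x0 + (\<Sum>j\<in>bases_of I s. gain s q j (f (j, s)))" using f by (auto simp: sound_partial_def)
  have z: "f (Suc i, s) = 0" using f0(3) by force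
  have upd: "(\<Sum>j\<in>bases_of I s. F j ((f((Suc i, s) := v)) (j, s))) = (\<Sum>j\<in>bases_of I s. F j (f (j, s))) + F (Suc i) v"
    if "F (Suc i) 0 = (0 :: 'b :: comm_monoid_add)" for F
  proof -
    have "(\<Sum>j\<in>bases_of I s - {Suc i}. F j ((f((Suc i, s) := v)) (j, s))) =
        (\<Sum>j\<in>bases_of I s - {Suc i}. F j (f (j, s)))" by (rule sum.cong) auto
    thus ?thesis using i z that
      by (simp add: sum.remove[OF finite_bases_of i] add.commute)
  qed
  show ?thesis unfolding sound_partial_def
  proof (intro conjI z exI[of _ f0] exI[of _ x0] exI[of _ k0])
    show "k0 + (\<Sum>j\<in>bases_of I s. (f((Suc i, s) := v)) (j, s)) \<le> k"
      using upd[of "\<lambda>j v. v"] f0(4) v by simp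
    show "(\<Sum>j\<in>bases_of I s. cost s q j ((f((Suc i, s) := v)) (j, s))) \<le> u"
      using upd[of "cost s q"] f0(5) v by (simp add: cost_0)
    show "x + gain s q (Suc i) v = x0 + (\<Sum>j\<in>bases_of I s. gain s q j ((f((Suc i, s) := v)) (j, s)))"
      using upd[of "gain s q"] f0(6) gain_0[OF s i] by simp
    show "\<forall>j. (f((Suc i, s) := v)) (j, s) \<noteq> 0 \<longrightarrow> j \<in> bases_of I s \<and> j \<le> Suc i"
    proof (intro allI impI)
      fix j assume "(f((Suc i, s) := v)) (j, s) \<noteq> 0"
      thus "j \<in> bases_of I s \<and> j \<le> Suc i" using f0(3)[rule_format, of j] i by (cases "j = Suc i") auto
    qed
  qed (use f0(1,2) in auto)
qed

lemma bounds_partial_0: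
  assumes s: "s \<in> {1..m}" and "old k \<le> y" shows "bounds_partial s q 0 old k u y"
  unfolding bounds_partial_def
proof (intro allI impI)
  fix c :: "nat \<Rightarrow> nat" assume "\<forall>j. c j \<noteq> 0 \<longrightarrow> j \<in> bases_of I s \<and> j \<le> 0"
  hence "c j = 0" for j by (force simp: bases_of_def)
  thus "old (k - sum c (bases_of I s)) + (\<Sum>j\<in>bases_of I s. gain s q j (c j)) \<le> y"
    using assms gain_0[OF s] by simp
qed

lemma bounds_partial_skip:
  assumes "Suc i \<notin> bases_of I s" "bounds_partial s q i old k u y" shows "bounds_partial s q (Suc i) old k u y"
  using assms unfolding bounds_partial_def by (metis le_Suc_eq)

lemma bounds_partial_step:
  assumes s: "s \<in> {1..m}" and i: "Suc i \<in> bases_of I s" and 0: "bounds_partial s q i old k u x0" "x0 \<le> y"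
    and step: "\<And>v. 1 \<le> v \<Longrightarrow> v \<le> k \<Longrightarrow> cost s q (Suc i) v \<le> u \<Longrightarrow>
      \<exists>x. bounds_partial s q i old (k - v) (u - cost s q (Suc i) v) x \<and> x + gain s q (Suc i) v \<le> y"
  shows "bounds_partial s q (Suc i) old k u y"
  unfolding bounds_partial_def
proof (intro allI impI)
  fix c :: "nat \<Rightarrow> nat"
  assume c: "\<forall>j. c j \<noteq> 0 \<longrightarrow> j \<in> bases_of I s \<and> j \<le> Suc i" "sum c (bases_of I s) \<le> k"
    "(\<Sum>j\<in>bases_of I s. cost s q j (c j)) \<le> u"
  show "old (k - sum c (bases_of I s)) + (\<Sum>j\<in>bases_of I s. gain s q j (c j)) \<le> y"
  proof (cases "c (Suc i) = 0")
    case True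
    hence "\<forall>j. c j \<noteq> 0 \<longrightarrow> j \<in> bases_of I s \<and> j \<le> i" using c(1) by (metis le_Suc_eq)
    thus ?thesis using 0 c(2,3) unfolding bounds_partial_def by (meson order_trans)
  next
    case False
    define v where "v = c (Suc i)"
    define c' where "c' = c(Suc i := 0)"
    have split: "(\<Sum>j\<in>bases_of I s. F j (c j)) = F (Suc i) v + (\<Sum>j\<in>bases_of I s. F j (c' j))"
      if "F (Suc i) 0 = (0 :: 'b :: comm_monoid_add)" for F
    proof -
      have "(\<Sum>j\<in>bases_of I s - {Suc i}. F j (c' j)) = (\<Sum>j\<in>bases_of I s - {Suc i}. F j (c j))"
        by (rule sum.cong) (auto simp: c'_def)
      thus ?thesis using that by (simp add: sum.remove[OF finite_bases_of i] c'_def v_def)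
    qed
    have sums: "sum c (bases_of I s) = v + sum c' (bases_of I s)"
      "(\<Sum>j\<in>bases_of I s. cost s q j (c j)) = cost s q (Suc i) v + (\<Sum>j\<in>bases_of I s. cost s q j (c' j))"
      "(\<Sum>j\<in>bases_of I s. gain s q j (c j)) = gain s q (Suc i) v + (\<Sum>j\<in>bases_of I s. gain s q j (c' j))"
      using split[of "\<lambda>j v. v"] split[of "cost s q"] split[of "gain s q"] gain_0[OF s i]
      by (simp_all add: cost_0)
    obtain x where x: "bounds_partial s q i old (k - v) (u - cost s q (Suc i) v) x" "x + gain s q (Suc i) v \<le> y"
      using step[of v] c(2,3) sums False by (auto simp: v_def)
    have "\<forall>j. c' j \<noteq> 0 \<longrightarrow> j \<in> bases_of I s \<and> j \<le> i" using c(1) by (auto simp: c'_def le_Suc_eq)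
    moreover have "sum c' (bases_of I s) \<le> k - v" "(\<Sum>j\<in>bases_of I s. cost s q j (c' j)) \<le> u - cost s q (Suc i) v"
      using c(2,3) sums by auto
    ultimately have "old (k - v - sum c' (bases_of I s)) + (\<Sum>j\<in>bases_of I s. gain s q j (c' j)) \<le> x"
      using x(1) unfolding bounds_partial_def by blast
    thus ?thesis using x(2) sums by simp
  qed
qed

text \<open>Rounded costs dominate the prices, and constant plus prices dominate the duration by
  \<open>walk_sound\<close>. So a plan within the budget reaches \<open>send s q\<close> before the
  horizon, whatever the code, and size \<open>s\<close> becomes certified.\<close>

lemma sound_partial_final:
  assumes s: "s \<in> {1..m}" and alive: "live_size I s"
    and budget: "sconst s q + real (sbudget s q) * tick \<le> T" and f: "sound_partial s q i k (sbudget s q) x f"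
  shows "sound_plan (s + 2) k x f"
proof -
  interpret single_size "bases_of I s" "weight I" "type_a I s" "type_b I s"
    by (rule single_size_live[OF inst s alive])
  obtain f0 x0 k0 where f0: "sound_plan s k0 x0 f0" "\<forall>p. snd p \<noteq> s \<longrightarrow> f p = f0 p"
    "\<forall>j. f (j, s) \<noteq> 0 \<longrightarrow> j \<in> bases_of I s \<and> j \<le> i" "k0 + (\<Sum>j\<in>bases_of I s. f (j, s)) \<le> k"
    "(\<Sum>j\<in>bases_of I s. cost s q j (f (j, s))) \<le> sbudget s q"
    "x = x0 + (\<Sum>j\<in>bases_of I s. gain s q j (f (j, s)))" using f by (auto simp: sound_partial_def)
  obtain v where v: "x0 = (\<Sum>s'=1..m. v s')" "\<forall>s'\<in>{1..m}. v s' = 0 \<or> (s' < s \<and> even (s' + s) \<and> live_size I s' \<and>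
       (\<exists>\<tau>\<ge>0. size_duration I s' (\<lambda>i. real (f0 (i, s'))) \<tau> \<le> T \<and> v s' = size_value I s' (\<lambda>i. f0 (i, s')) \<tau>))"
    and supp: "\<forall>p. f0 p \<noteq> 0 \<longrightarrow> p \<in> universe I \<and> snd p < s \<and> even (snd p + s)"
    and cap: "sum f0 (universe I) \<le> k0" using f0(1) unfolding sound_plan_def by blast
  have vs: "v s = 0" using v(2) s by auto
  have off: "f (j, s') = f0 (j, s')" if "s' \<noteq> s" for j s' using f0(2) that by simp
  have price_nonneg: "0 \<le> weight I j * sprice s q (real (f (j, s)) / weight I j)" if j: "j \<in> bases_of I s" for j
    using walk_price_nonneg[of 0 "first s" \<delta>] weight_bases_pos[OF inst j] first_nonneg[OF s] \<delta>_pos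
    by (simp add: sprice_def)
  have covered: "weight I j * sprice s q (real (f (j, s)) / weight I j) \<le> real (cost s q j (f (j, s))) * tick"
    if j: "j \<in> bases_of I s" for j
  proof (cases "f (j, s) = 0")
    case True
    \<comment> \<open>An empty stock is sold out at clock time 0, so it has no weight on any cell
      and its price is 0, matching its cost.\<close>
    have "walk_price (type_a I s) (type_b I s) d bs lo hi V 0 = 0" if "0 \<le> lo" "lo \<le> hi" "0 \<le> d" for d bs lo hi V
      using that
    proof (induction bs arbitrary: lo hi V)
      case (Cons bit bs)
      have "hi \<le> hi * (1 + d)" using Cons.prems by (simp add: algebra_simps)
      thus ?case using Cons.IH[of hi "hi * (1 + d)" V] Cons.IH[of lo hi "V / (1 + d)"] Cons.prems
        by (cases bit) auto
    qed simp
    thus ?thesis using True first_nonneg[OF s] \<delta>_pos by (simp add: sprice_def cost_0)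
  next
    case False
    \<comment> \<open>A cost within the budget is not a cut-off value of \<open>units\<close>, hence
      it does cover the price.\<close>
    have "cost s q j (f (j, s)) \<le> (\<Sum>j\<in>bases_of I s. cost s q j (f (j, s)))"
      by (rule member_le_sum[OF j _ finite_bases_of]) simp
    hence "cost s q j (f (j, s)) \<le> sbudget s q" using f0(5) by simp
    thus ?thesis using False units_covers[of tick "sbudget s q"] by (simp add: cost_def)
  qed
  have dur: "size_duration I s (\<lambda>i. real (f (i, s))) (send s q) \<le> T"
  proof -
    have "dur (\<lambda>i. real (f (i, s))) (send s q) \<le>
        sconst s q + (\<Sum>j\<in>bases_of I s. weight I j * sprice s q (real (f (j, s)) / weight I j))"
      unfolding duration_def send_def sconst_def sprice_def
      by (rule walk_sound) (use first_nonneg[OF s] weights_pos \<delta>_pos in auto)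
    also have "\<dots> \<le> sconst s q + real (\<Sum>j\<in>bases_of I s. cost s q j (f (j, s))) * tick"
      unfolding of_nat_sum sum_distrib_right by (intro add_left_mono sum_mono covered)
    also have "\<dots> \<le> sconst s q + real (sbudget s q) * tick"
      using f0(5) tick_pos by (intro add_left_mono mult_right_mono) (auto simp del: of_nat_sum)
    finally show ?thesis using budget by simp
  qed
  define g where "g = (\<Sum>j\<in>bases_of I s. gain s q j (f (j, s)))"
  have g: "g = size_value I s (\<lambda>i. f (i, s)) (send s q)" by (simp add: g_def size_value_def gain_def)
  show ?thesis unfolding sound_plan_def
  proof (intro conjI)
    show "\<forall>p. f p \<noteq> 0 \<longrightarrow> p \<in> universe I \<and> snd p < s + 2 \<and> even (snd p + (s + 2))"
    proof (intro allI impI)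
      fix p assume p: "f p \<noteq> 0"
      show "p \<in> universe I \<and> snd p < s + 2 \<and> even (snd p + (s + 2))"
      proof (cases "snd p = s")
        case True
        hence pp: "p = (fst p, s)" by (metis prod.collapse)
        hence "fst p \<in> bases_of I s" using f0(3) p by metis
        hence "p \<in> universe I" by (subst pp) (simp add: mem_universe)
        thus ?thesis using True by simp
      next
        case False
        hence "f0 p \<noteq> 0" using f0(2) p by metis
        hence "p \<in> universe I \<and> snd p < s \<and> even (snd p + s)" using supp by blast
        thus ?thesis by simp
      qed
    qed
    have "sum f (universe I) = (\<Sum>s'=1..m. \<Sum>i\<in>bases_of I s'. f (i, s'))" by (rule sum_universe[OF inst])
    also have "\<dots> = (\<Sum>i\<in>bases_of I s. f (i, s)) + (\<Sum>s'\<in>{1..m} - {s}. \<Sum>i\<in>bases_of I s'. f (i, s'))"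
      using s by (intro sum.remove) auto
    also have "(\<Sum>s'\<in>{1..m} - {s}. \<Sum>i\<in>bases_of I s'. f (i, s')) = (\<Sum>s'\<in>{1..m} - {s}. \<Sum>i\<in>bases_of I s'. f0 (i, s'))"
      using off by (intro sum.cong) auto
    also have "\<dots> \<le> (\<Sum>s'=1..m. \<Sum>i\<in>bases_of I s'. f0 (i, s'))" by (rule sum_mono2) auto
    also have "\<dots> = sum f0 (universe I)" by (rule sum_universe[OF inst, symmetric])
    finally show "sum f (universe I) \<le> k" using cap f0(4) by simp
    show "\<exists>v. x = sum v {1..m} \<and> (\<forall>s'\<in>{1..m}. v s' = 0 \<or> s' < s + 2 \<and> even (s' + (s + 2)) \<and> live_size I s' \<and>
        (\<exists>\<tau>\<ge>0. size_duration I s' (\<lambda>i. real (f (i, s'))) \<tau> \<le> T \<and> v s' = size_value I s' (\<lambda>i. f (i, s')) \<tau>))"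
    proof (intro exI[of _ "v(s := g)"] conjI ballI)
      have "sum (v(s := g)) {1..m} = g + sum (v(s := g)) ({1..m} - {s})"
        using s by (subst sum.remove[of _ s]) auto
      also have "sum (v(s := g)) ({1..m} - {s}) = sum v ({1..m} - {s})" by (rule sum.cong) auto
      also have "\<dots> = sum v {1..m}" using s vs by (subst (2) sum.remove[of _ s]) auto
      finally show "x = sum (v(s := g)) {1..m}" using f0(6) v(1) by (simp add: g_def)
      fix s' assume s': "s' \<in> {1..m}"
      show "(v(s := g)) s' = 0 \<or> s' < s + 2 \<and> even (s' + (s + 2)) \<and> live_size I s' \<and>
        (\<exists>\<tau>\<ge>0. size_duration I s' (\<lambda>i. real (f (i, s'))) \<tau> \<le> T \<and>
          (v(s := g)) s' = size_value I s' (\<lambda>i. f (i, s')) \<tau>)"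
      proof (cases "s' = s")
        case True
        thus ?thesis using alive dur g send_nonneg[OF s, of q] by auto
      next
        case False
        thus ?thesis using v(2) s' off[OF False] by auto
      qed
    qed
  qed
qed

end

section \<open>Trying all codes\<close>

text \<open>Before any base of the size is considered, every budget admits the plan that leaves this
  size empty.\<close>

definition fill_row :: com where
  "fill_row =
     NSet nU (NLit 0) ;;
     While (NLess (NV nU) (NAdd (NV nN) (NLit 1)))
       (RStore rTab dst (RCell rOld (NV nK)) ;;
        NStore nTab dst (NCell nOld (NV nK)) ;;
        NSet nU (NAdd (NV nU) (NLit 1)))"

definition fill_table :: com where
  "fill_table =
     NStore nRow (NLit 0) (NLit 0) ;;
     NSet nK (NLit 0) ;;
     While (NLess (NV nK) (NAdd NCapacity (NLit 1)))
       (fill_row ;;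
        NStore nRow (NAdd (NV nK) (NLit 1)) (NAdd (NCell nRow (NV nK)) (NAdd (NV nN) (NLit 1))) ;;
        NSet nK (NAdd (NV nK) (NLit 1)))"

lemma writes_fill [simp]: "nwrites fill_row = {nU, nTab}" "rwrites fill_row = {rTab}" "\<not> swrites fill_row"
  "nwrites fill_table = {nU, nTab, nRow, nK}" "rwrites fill_table = {rTab}" "\<not> swrites fill_table"
  by (auto simp: fill_row_def fill_table_def)

lemma fill_row_correct:
  assumes "ncells \<sigma> nK 0 = k" "ncells \<sigma> nN 0 = N" "ncells \<sigma> nRow k = k * (N + 1)"
  shows "does I \<epsilon> fill_row \<sigma> (4 * N + 6) (\<lambda>\<sigma>'.
    (\<forall>u\<le>N. rcells \<sigma>' rTab (cell N k u) = rcells \<sigma> rOld k \<and> ncells \<sigma>' nTab (cell N k u) = ncells \<sigma> nOld k) \<and>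
    (\<forall>k' u. k' \<noteq> k \<longrightarrow> u \<le> N \<longrightarrow> rcells \<sigma>' rTab (cell N k' u) = rcells \<sigma> rTab (cell N k' u) \<and>
      ncells \<sigma>' nTab (cell N k' u) = ncells \<sigma> nTab (cell N k' u)))"
proof -
  define Inv where "Inv = (\<lambda>u (\<sigma>' :: state). ncells \<sigma>' nU 0 = u \<and>
    (\<forall>u'\<le>N. u' < u \<longrightarrow> rcells \<sigma>' rTab (cell N k u') = rcells \<sigma> rOld k \<and> ncells \<sigma>' nTab (cell N k u') = ncells \<sigma> nOld k) \<and>
    (\<forall>k' u. k' \<noteq> k \<longrightarrow> u \<le> N \<longrightarrow> rcells \<sigma>' rTab (cell N k' u) = rcells \<sigma> rTab (cell N k' u) \<and>
      ncells \<sigma>' nTab (cell N k' u) = ncells \<sigma> nTab (cell N k' u)))"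
  show ?thesis unfolding fill_row_def
    apply simp
    apply (rule does_loop[where Inv = Inv and N = "N + 1" and c = 3])
    subgoal by (simp add: Inv_def)
    subgoal premises p for u \<sigma>'
    proof -
      have fr: "ncells \<sigma>' nK 0 = k" "ncells \<sigma>' nN 0 = N" "ncells \<sigma>' nRow k = k * (N + 1)"
        "ncells \<sigma>' nOld = ncells \<sigma> nOld" "rcells \<sigma>' rOld = rcells \<sigma> rOld"
        using frame_ncells[OF p(3), of nK] frame_ncells[OF p(3), of nN] frame_ncells[OF p(3), of nRow]
          frame_ncells[OF p(3), of nOld] frame_rcells[OF p(3), of rOld] assms by simp_all
      have u: "u \<le> N" "ncells \<sigma>' nU 0 = u" using p(1,4) fr by (auto simp: Inv_def)
      have c: "k * (N + 1) + u = cell N k u" by (simp add: cell_def)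
      show ?thesis using p(1) u
        by (simp add: fr[simplified] c[simplified] Inv_def cell_inj less_Suc_eq) linarith
    qed
    subgoal by simp
    subgoal premises p for u \<sigma>'
    proof -
      have "ncells \<sigma>' nN 0 = N" using frame_ncells[OF p(3), of nN] assms by simp
      hence "u = N + 1" using p(1,2,4) by (auto simp: Inv_def)
      thus ?thesis using p(1) by (auto simp: Inv_def)
    qed
    done
qed

lemma fill_table_correct:
  assumes N: "ncells \<sigma> nN 0 = N"
  shows "does I \<epsilon> fill_table \<sigma> ((capacity I + 1) * (4 * N + 9) + 3) (\<lambda>\<sigma>'. \<forall>k\<le>capacity I.
    ncells \<sigma>' nRow k = k * (N + 1) \<and>
    (\<forall>u\<le>N. rcells \<sigma>' rTab (cell N k u) = rcells \<sigma> rOld k \<and> ncells \<sigma>' nTab (cell N k u) = ncells \<sigma> nOld k))"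
proof -
  define Inv where "Inv = (\<lambda>k (\<sigma>' :: state). ncells \<sigma>' nK 0 = k \<and> (\<forall>k'\<le>k. ncells \<sigma>' nRow k' = k' * (N + 1)) \<and>
    (\<forall>k'<k. \<forall>u\<le>N. rcells \<sigma>' rTab (cell N k' u) = rcells \<sigma> rOld k' \<and> ncells \<sigma>' nTab (cell N k' u) = ncells \<sigma> nOld k'))"
  show ?thesis unfolding fill_table_def
    apply simp
    apply (rule does_loop[where Inv = Inv and N = "capacity I + 1" and c = "4 * N + 8"])
    subgoal by (simp add: Inv_def)
    subgoal premises p for k \<sigma>1
    proof -
      have fr: "ncells \<sigma>1 nN 0 = N" "ncells \<sigma>1 nOld = ncells \<sigma> nOld" "rcells \<sigma>1 rOld = rcells \<sigma> rOld"
        using frame_ncells[OF p(3), of nN] frame_ncells[OF p(3), of nOld] frame_rcells[OF p(3), of rOld] N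
        by simp_all
      have k: "k < capacity I + 1" "ncells \<sigma>1 nK 0 = k" "ncells \<sigma>1 nRow k = k * (N + 1)"
        using p(1,4) by (auto simp: Inv_def)
      show ?thesis
        apply (intro conjI k(1))
        apply (rule does_Seq[OF fill_row_correct[OF k(2) fr(1) k(3)], where j = 2])
        subgoal premises q for \<sigma>2
        proof -
          have f2: "ncells \<sigma>2 nRow = ncells \<sigma>1 nRow" "ncells \<sigma>2 nK 0 = k" "ncells \<sigma>2 nN 0 = N"
            using frame_ncells[OF q(1), of nRow] frame_ncells[OF q(1), of nK] frame_ncells[OF q(1), of nN] k fr
            by simp_all
          show ?thesis using p(1) q(2) k
            by (auto simp: f2[simplified] Inv_def fr[simplified] less_Suc_eq le_Suc_eq)
        qed
        subgoal by simp
        done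
    qed
    subgoal by simp
    subgoal for k \<sigma>1 by (auto simp: Inv_def)
    done
qed

text \<open>The full budget is enough, as \<open>bounds_partial\<close> at \<open>N\<close> covers
  all cheaper stocks. The maximum over the codes is kept.\<close>

definition collect :: com where
  "collect =
     NSet nK (NLit 0) ;;
     While (NLess (NV nK) (NAdd NCapacity (NLit 1)))
       (Cond (RLess (RCell rNew (NV nK)) (RCell rTab (NAdd (NCell nRow (NV nK)) (NV nN))))
          (RStore rNew (NV nK) (RCell rTab (NAdd (NCell nRow (NV nK)) (NV nN))) ;;
           NStore nNew (NV nK) (NCell nTab (NAdd (NCell nRow (NV nK)) (NV nN))))
          Skip ;;
        NSet nK (NAdd (NV nK) (NLit 1)))"

lemma writes_collect [simp]: "nwrites collect = {nK, nNew}" "rwrites collect = {rNew}" "\<not> swrites collect"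
  by (auto simp: collect_def)

lemma collect_correct:
  assumes N: "ncells \<sigma> nN 0 = N" and row: "\<And>k. k \<le> capacity I \<Longrightarrow> ncells \<sigma> nRow k = k * (N + 1)"
  shows "does I \<epsilon> collect \<sigma> ((capacity I + 1) * 6 + 2) (\<lambda>\<sigma>'. \<forall>k\<le>capacity I.
    (rcells \<sigma> rNew k < rcells \<sigma> rTab (cell N k N) \<and> rcells \<sigma>' rNew k = rcells \<sigma> rTab (cell N k N) \<and>
       ncells \<sigma>' nNew k = ncells \<sigma> nTab (cell N k N)) \<or>
    (rcells \<sigma> rTab (cell N k N) \<le> rcells \<sigma> rNew k \<and> rcells \<sigma>' rNew k = rcells \<sigma> rNew k \<and>
       ncells \<sigma>' nNew k = ncells \<sigma> nNew k))"
proof -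
  define P where "P = (\<lambda>k (\<sigma>' :: state).
    (rcells \<sigma> rNew k < rcells \<sigma> rTab (cell N k N) \<and> rcells \<sigma>' rNew k = rcells \<sigma> rTab (cell N k N) \<and>
       ncells \<sigma>' nNew k = ncells \<sigma> nTab (cell N k N)) \<or>
    (rcells \<sigma> rTab (cell N k N) \<le> rcells \<sigma> rNew k \<and> rcells \<sigma>' rNew k = rcells \<sigma> rNew k \<and>
       ncells \<sigma>' nNew k = ncells \<sigma> nNew k))"
  define Inv where "Inv = (\<lambda>k (\<sigma>' :: state). ncells \<sigma>' nK 0 = k \<and> (\<forall>k'<k. k' \<le> capacity I \<longrightarrow> P k' \<sigma>') \<and>
    (\<forall>k'\<ge>k. rcells \<sigma>' rNew k' = rcells \<sigma> rNew k' \<and> ncells \<sigma>' nNew k' = ncells \<sigma> nNew k'))"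
  show ?thesis unfolding collect_def
    apply simp
    apply (rule does_loop[where Inv = Inv and N = "capacity I + 1" and c = 5])
    subgoal by (simp add: Inv_def)
    subgoal premises p for k \<sigma>1
    proof -
      have fr: "ncells \<sigma>1 nN 0 = N" "ncells \<sigma>1 nTab = ncells \<sigma> nTab" "rcells \<sigma>1 rTab = rcells \<sigma> rTab"
        "ncells \<sigma>1 nRow = ncells \<sigma> nRow"
        using frame_ncells[OF p(3), of nN] frame_ncells[OF p(3), of nTab] frame_rcells[OF p(3), of rTab]
          frame_ncells[OF p(3), of nRow] N by simp_all
      have k: "k \<le> capacity I" "ncells \<sigma>1 nK 0 = k" using p(1,4) by (auto simp: Inv_def)
      have c: "ncells \<sigma> nRow k + N = cell N k N" using row[OF k(1)] by (simp add: cell_def)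
      show ?thesis using p(1) k
        by (auto simp: fr[simplified] c[simplified] Inv_def P_def less_Suc_eq not_less)
    qed
    subgoal by simp
    subgoal for k \<sigma>1 by (auto simp: Inv_def P_def)
    done
qed

definition price_bases :: com where
  "price_bases =
     NSet nI (NLit 0) ;;
     While (NLess (NV nI) NBases)
       (NSet nI (NAdd (NV nI) (NLit 1)) ;;
        Cond (BOffered (NV nI) (NV nS)) (price_loop ;; knapsack) Skip)"

lemma writes_price_loop [simp]: "nwrites price_loop = {nV, nCost}"
  "rwrites price_loop = {rX, rGain, rRem, rPow, rLo, rHi, rV, rConst, rPrice}" "\<not> swrites price_loop"
  by (auto simp: price_loop_def)

lemma writes_price_bases [simp]:
  "nwrites price_bases = {nI, nV, nCost, nK, nU, nBase, nSize, nAmount, nNext, nTab, nFree}"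
  "rwrites price_bases = {rX, rGain, rRem, rPow, rLo, rHi, rV, rConst, rPrice, rTab}" "\<not> swrites price_bases"
  by (auto simp: price_bases_def)

lemma code_ncells_update [simp]:
  "code_ok (\<sigma>\<lparr>ncells := x\<rparr>) B q = code_ok \<sigma> B q" "code_price I (\<sigma>\<lparr>ncells := x\<rparr>) B q = code_price I \<sigma> B q"
  "code_end (\<sigma>\<lparr>ncells := x\<rparr>) B q = code_end \<sigma> B q" "code_const I (\<sigma>\<lparr>ncells := x\<rparr>) B q = code_const I \<sigma> B q"
  by (simp_all add: code_ok_def code_price_def[abs_def] code_end_def code_const_def)

lemma frame_code_cells:
  assumes "frame P \<sigma> \<sigma>'" "rwrites P \<inter> {rA, rB, rD, rFirst, rWmax, rCodes, rQ} = {}"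
  shows "code_ok \<sigma>' B q = code_ok \<sigma> B q" "code_price I \<sigma>' B q = code_price I \<sigma> B q"
    "code_end \<sigma>' B q = code_end \<sigma> B q" "code_const I \<sigma>' B q = code_const I \<sigma> B q"
  using assms(2) frame_rcells[OF assms(1), of rA] frame_rcells[OF assms(1), of rB] frame_rcells[OF assms(1), of rD]
    frame_rcells[OF assms(1), of rFirst] frame_rcells[OF assms(1), of rWmax]
    frame_rcells[OF assms(1), of rCodes] frame_rcells[OF assms(1), of rQ]
  by (simp_all add: code_ok_def code_price_def[abs_def] code_end_def code_const_def)

text \<open>As for the table, \<open>Snd\<close> and \<open>Cmp\<close> are abstract, now as
  families indexed by the number of bases treated; \<open>sound_partial\<close> and
  \<open>bounds_partial\<close> will satisfy the step hypotheses.\<close>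

lemma price_bases_correct:
  assumes ok: "code_ok \<sigma> B q" and s: "ncells \<sigma> nS 0 = s" and N: "ncells \<sigma> nN 0 = N"
    and row: "\<And>k. k \<le> capacity I \<Longrightarrow> ncells \<sigma> nRow k = k * (N + 1)"
    and cost: "\<And>i v. 1 \<le> v \<Longrightarrow>
      cost i v = units (rcells \<sigma> rUnit 0) N (weight I i * code_price I \<sigma> B q (real v / weight I i))"
    and gain: "\<And>i v. gain i v = revenue I i * min (real v) (weight I i * code_end \<sigma> B q)"
    and lab: "\<And>k u. k \<le> capacity I \<Longrightarrow> u \<le> N \<Longrightarrow> labelled N (Snd 0) (Cmp 0) k u \<sigma>"
    and keep: "\<And>i k u x f. Snd i k u x f \<Longrightarrow> Snd (Suc i) k u x f"
    and skip: "\<And>i k u y. Suc i \<notin> bases_of I s \<Longrightarrow> Cmp i k u y \<Longrightarrow> Cmp (Suc i) k u y"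
    and snd: "\<And>i k u x f v. Suc i \<in> bases_of I s \<Longrightarrow> v \<le> k \<Longrightarrow> u \<le> N \<Longrightarrow> cost (Suc i) v \<le> u \<Longrightarrow>
      Snd i (k - v) (u - cost (Suc i) v) x f \<Longrightarrow>
      f (Suc i, s) = 0 \<and> Snd (Suc i) k u (x + gain (Suc i) v) (f((Suc i, s) := v))"
    and cmp: "\<And>i k u x0 y. Suc i \<in> bases_of I s \<Longrightarrow> u \<le> N \<Longrightarrow> Cmp i k u x0 \<Longrightarrow> x0 \<le> y \<Longrightarrow>
      (\<And>v. 1 \<le> v \<Longrightarrow> v \<le> k \<Longrightarrow> cost (Suc i) v \<le> u \<Longrightarrow>
         \<exists>x. Cmp i (k - v) (u - cost (Suc i) v) x \<and> x + gain (Suc i) v \<le> y) \<Longrightarrow> Cmp (Suc i) k u y"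
  shows "does I \<epsilon> price_bases \<sigma>
    (nbases I * (capacity I * (9 * B + 2 * N + 18) + 2 + ((capacity I + 1) * ((N + 1) * (10 * capacity I + 4) + 4) + 2) + 3) + 2)
    (\<lambda>\<sigma>'. (\<forall>k\<le>capacity I. \<forall>u\<le>N. labelled N (Snd (nbases I)) (Cmp (nbases I)) k u \<sigma>') \<and> extends \<sigma> \<sigma>')"
proof -
  let ?C = "capacity I"
  define Inv where "Inv = (\<lambda>i (\<sigma>' :: state). ncells \<sigma>' nI 0 = i \<and> extends \<sigma> \<sigma>' \<and>
    (\<forall>k\<le>?C. \<forall>u\<le>N. labelled N (Snd i) (Cmp i) k u \<sigma>'))"
  let ?c1 = "?C * (9 * B + 2 * N + 18) + 2" and ?c2 = "(?C + 1) * ((N + 1) * (10 * ?C + 4) + 4) + 2"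
  show ?thesis unfolding price_bases_def
    apply (simp del: does_Cond)
    apply (rule does_loop[where Inv = Inv and N = "nbases I" and c = "?c1 + ?c2 + 2"])
    subgoal
    proof -
      let ?\<sigma>1 = "\<sigma>\<lparr>ncells := (ncells \<sigma>)(nI := (ncells \<sigma> nI)(0 := 0))\<rparr>"
      have tc: "tab_change {} \<sigma> ?\<sigma>1" by (simp add: tab_change_def extends_def)
      show ?thesis using labelled_tab_change[OF lab tc] tc by (auto simp: Inv_def tab_change_def)
    qed
    subgoal premises p for i \<sigma>1
    proof -
      have i: "i < nbases I" "ncells \<sigma>1 nI 0 = i" using p(1,4) by (auto simp: Inv_def)
      have s1: "ncells \<sigma>1 nS 0 = s" using frame_ncells[OF p(3), of nS] s by simp
      define \<sigma>2 where "\<sigma>2 = \<sigma>1\<lparr>ncells := (ncells \<sigma>1)(nI := (ncells \<sigma>1 nI)(0 := Suc i))\<rparr>"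
      have n2: "ncells \<sigma>2 nI 0 = Suc i" "ncells \<sigma>2 nS 0 = s" "ncells \<sigma>2 nN 0 = N"
        "ncells \<sigma>2 nRow = ncells \<sigma> nRow" "rcells \<sigma>2 rUnit = rcells \<sigma> rUnit"
        using frame_ncells[OF p(3), of nN] frame_ncells[OF p(3), of nRow] frame_rcells[OF p(3), of rUnit] N s1
        by (simp_all add: \<sigma>2_def)
      have code1: "code_ok \<sigma>1 B q = code_ok \<sigma> B q" "code_price I \<sigma>1 B q = code_price I \<sigma> B q"
        "code_end \<sigma>1 B q = code_end \<sigma> B q"
        using frame_code_cells[OF p(3)] by simp_all
      have code2: "code_ok \<sigma>2 B q" "code_price I \<sigma>2 B q = code_price I \<sigma> B q" "code_end \<sigma>2 B q = code_end \<sigma> B q"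
        using ok code1 by (simp_all add: \<sigma>2_def)
      have tc12: "tab_change {} \<sigma>1 \<sigma>2" by (simp add: tab_change_def extends_def \<sigma>2_def)
      have lab2: "labelled N (Snd i) (Cmp i) k u \<sigma>2" if "k \<le> ?C" "u \<le> N" for k u
        by (rule labelled_tab_change[OF _ tc12]) (use p(1) that in \<open>auto simp: Inv_def\<close>)
      have ext2: "extends \<sigma> \<sigma>2" using p(1) tc12 by (auto simp: Inv_def tab_change_def intro: extends_trans)
      have main: "does I \<epsilon> (price_loop ;; knapsack) \<sigma>2 (?c1 + ?c2) (Inv (Suc i))" if b: "Suc i \<in> bases_of I s"
      proof (rule does_Seq[OF price_loop_correct[OF code2(1) n2(1,3)] _ order_refl])
        fix \<sigma>3 assume f3: "frame price_loop \<sigma>2 \<sigma>3" and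
          arr: "\<forall>v. 1 \<le> v \<longrightarrow> v \<le> ?C \<longrightarrow>
            ncells \<sigma>3 nCost v = units (rcells \<sigma>2 rUnit 0) N
              (weight I (Suc i) * code_price I \<sigma>2 B q (real v / weight I (Suc i))) \<and>
            rcells \<sigma>3 rGain v = revenue I (Suc i) * min (real v) (weight I (Suc i) * code_end \<sigma>2 B q)"
        have ext23: "extends \<sigma>2 \<sigma>3" by (rule extends_frame[OF f3]) simp
        have tc23: "tab_change {} \<sigma>2 \<sigma>3"
          using ext23 frame_ncells[OF f3, of nTab] frame_rcells[OF f3, of rTab] by (simp add: tab_change_def)
        have n3: "ncells \<sigma>3 nI 0 = Suc i" "ncells \<sigma>3 nS 0 = s" "ncells \<sigma>3 nN 0 = N" "ncells \<sigma>3 nRow = ncells \<sigma> nRow"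
          using frame_ncells[OF f3, of nI] frame_ncells[OF f3, of nS] frame_ncells[OF f3, of nN]
            frame_ncells[OF f3, of nRow] n2 by simp_all
        have "does I \<epsilon> knapsack \<sigma>3 ?c2
          (\<lambda>\<sigma>'. (\<forall>k\<le>?C. \<forall>u\<le>N. labelled N (Snd (Suc i)) (Cmp (Suc i)) k u \<sigma>') \<and> extends \<sigma>3 \<sigma>')"
        proof (rule knapsack_correct[where Snd = "Snd i" and Cmp = "Cmp i" and cost = "cost (Suc i)" and
              gain = "gain (Suc i)", OF n3(1-3) refl])
          show "labelled N (Snd i) (Cmp i) k u \<sigma>3" if "k \<le> ?C" "u \<le> N" for k u
            by (rule labelled_tab_change[OF lab2[OF that] tc23]) simp
          show "ncells \<sigma>3 nCost v = cost (Suc i) v" if "1 \<le> v" "v \<le> ?C" for v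
            using arr that cost[OF that(1), of "Suc i"] code2 n2 by simp
          show "rcells \<sigma>3 rGain v = gain (Suc i) v" if "1 \<le> v" "v \<le> ?C" for v
            using arr that gain[of "Suc i"] code2 by simp
          show "ncells \<sigma>3 nRow k = k * (N + 1)" if "k \<le> ?C" for k using n3(4) row[OF that] by simp
          show "f (Suc i, s) = 0 \<and> Snd (Suc i) k u (x + gain (Suc i) v) (f((Suc i, s) := v))"
            if "v \<le> k" "u \<le> N" "cost (Suc i) v \<le> u" "Snd i (k - v) (u - cost (Suc i) v) x f" for k u x f v
            by (rule snd[OF b that])
          show "Cmp (Suc i) k u y" if "u \<le> N" "Cmp i k u x0" "x0 \<le> y"
            "\<And>v. 1 \<le> v \<Longrightarrow> v \<le> k \<Longrightarrow> cost (Suc i) v \<le> u \<Longrightarrow>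
               \<exists>x. Cmp i (k - v) (u - cost (Suc i) v) x \<and> x + gain (Suc i) v \<le> y" for k u x0 y
            by (rule cmp[OF b that])
        qed (rule keep)
        thus "does I \<epsilon> knapsack \<sigma>3 ?c2 (Inv (Suc i))"
        proof (rule does_mono[OF _ order_refl])
          fix \<sigma>4 assume f4: "frame knapsack \<sigma>3 \<sigma>4" and
            "(\<forall>k\<le>?C. \<forall>u\<le>N. labelled N (Snd (Suc i)) (Cmp (Suc i)) k u \<sigma>4) \<and> extends \<sigma>3 \<sigma>4"
          moreover have "ncells \<sigma>4 nI 0 = Suc i" using frame_ncells[OF f4, of nI] n3 by simp
          ultimately show "Inv (Suc i) \<sigma>4" using extends_trans[OF extends_trans[OF ext2 ext23]]
            by (simp add: Inv_def)
        qed
      qed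
      have "Suc i \<in> bases_of I s \<longleftrightarrow> s \<in> offered I (Suc i)" using i by (auto simp: bases_of_def)
      moreover have "Inv (Suc i) \<sigma>2" if "Suc i \<notin> bases_of I s"
      proof -
        have "labelled N (Snd (Suc i)) (Cmp (Suc i)) k u \<sigma>2" if "k \<le> ?C" "u \<le> N" for k u
          using lab2[OF that] keep skip[OF \<open>Suc i \<notin> bases_of I s\<close>] unfolding labelled_def by blast
        thus ?thesis using ext2 n2 by (simp add: Inv_def)
      qed
      ultimately show ?thesis
        using i(1) main unfolding \<sigma>2_def
        by (cases "Suc i \<in> bases_of I s") (simp_all add: i(2)[simplified] s1[simplified])
    qed
    subgoal by simp
    subgoal premises p for i \<sigma>1
    proof -
      have "i = nbases I" using p(1,2,4) by (auto simp: Inv_def)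
      thus ?thesis using p(1) by (simp add: Inv_def)
    qed
    done
qed

section \<open>The budget of a code and the evaluation of one code\<close>

definition budget_loop :: com where
  "budget_loop =
     NSet nN (NLit 0) ;;
     While (BNot (RLess RHorizon (RAdd (RV rConst) (RMul (RAdd (ROfNat (NV nN)) (RNum 1)) (RV rUnit)))))
       (NSet nN (NAdd (NV nN) (NLit 1)))"

text \<open>A code whose constant alone exceeds the horizon leaves no budget and is passed
  over.\<close>

definition code_body :: com where
  "code_body =
     decode ;;
     Cond (RLess RHorizon (RV rConst)) Skip (budget_loop ;; fill_table ;; price_bases ;; collect) ;;
     RSet rQ (RAdd (RV rQ) (RNum 1))"

lemma writes_budget [simp]: "nwrites budget_loop = {nN}" "rwrites budget_loop = {}" "\<not> swrites budget_loop"
  by (auto simp: budget_loop_def)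

lemma writes_code [simp]: "nwrites code_body = {nN, nI, nV, nCost, nK, nU, nBase, nSize, nAmount, nNext, nTab, nFree, nRow, nNew}"
  "rwrites code_body = {rX, rGain, rRem, rPow, rLo, rHi, rV, rConst, rPrice, rTab, rNew, rQ}" "\<not> swrites code_body"
  by (auto simp: code_body_def)

lemma budget_correct:
  assumes u: "0 \<le> rcells \<sigma> rUnit 0" and M: "horizon I < rcells \<sigma> rConst 0 + (real M + 1) * rcells \<sigma> rUnit 0"
  shows "does I \<epsilon> budget_loop \<sigma> (2 * M + 2) (\<lambda>\<sigma>'.
    ncells \<sigma>' nN 0 = (LEAST N. horizon I < rcells \<sigma> rConst 0 + (real N + 1) * rcells \<sigma> rUnit 0))"
proof -
  let ?P = "\<lambda>N. horizon I < rcells \<sigma> rConst 0 + (real N + 1) * rcells \<sigma> rUnit 0"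
  define Inv where "Inv = (\<lambda>k (\<sigma>' :: state). ncells \<sigma>' nN 0 = k \<and> (\<forall>N<k. \<not> ?P N))"
  show ?thesis unfolding budget_loop_def
    apply simp
    apply (rule does_loop[where Inv = Inv and N = M and c = 1])
    subgoal by (simp add: Inv_def)
    subgoal premises p for k \<sigma>'
    proof -
      have r: "rcells \<sigma>' = rcells \<sigma>" using frame_rcells[OF p(3)] by (auto simp: fun_eq_iff)
      have k: "ncells \<sigma>' nN 0 = k" "\<not> ?P k" using p(1,4) by (auto simp: Inv_def r)
      have "k < M"
      proof (rule ccontr)
        assume "\<not> k < M"
        hence "(real M + 1) * rcells \<sigma> rUnit 0 \<le> (real k + 1) * rcells \<sigma> rUnit 0"
          using u by (intro mult_right_mono) auto
        thus False using M k(2) by linarith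
      qed
      thus ?thesis using p(1) k by (auto simp: Inv_def less_Suc_eq)
    qed
    subgoal by simp
    subgoal premises p for k \<sigma>'
    proof -
      have r: "rcells \<sigma>' = rcells \<sigma>" using frame_rcells[OF p(3)] by (auto simp: fun_eq_iff)
      have "ncells \<sigma>' nN 0 = k" "?P k" "\<forall>N<k. \<not> ?P N" using p(1,4) by (auto simp: Inv_def r)
      thus ?thesis using Least_equality[of ?P k] by (metis not_le)
    qed
    done
qed

context algorithm
begin

text \<open>T / \<open>tick\<close> = n / \<delta>, so this bounds the budget of every code that is
  not passed over.\<close>

definition "nmax = nat \<lfloor>real n / \<delta>\<rfloor>"

text \<open>These cells are fixed once per instance, and those in \<open>env\<close> once per size;
  none of them is written while the codes are tried.\<close>

definition genv :: "state \<Rightarrow> bool" where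
  "genv \<sigma> \<longleftrightarrow> rcells \<sigma> rD 0 = \<delta> \<and> rcells \<sigma> rWmax 0 = wmax \<and> rcells \<sigma> rUnit 0 = tick \<and> rcells \<sigma> rCodes 0 = 2 ^ B"

definition env :: "nat \<Rightarrow> state \<Rightarrow> bool" where
  "env s \<sigma> \<longleftrightarrow> genv \<sigma> \<and> rcells \<sigma> rFirst 0 = first s \<and> ncells \<sigma> nS 0 = s \<and>
     (\<forall>k<6. rcells \<sigma> rA k = type_a I s k \<and> rcells \<sigma> rB k = type_b I s k)"

lemma env_code:
  assumes "env s \<sigma>"
  shows "code_const I \<sigma> B q = sconst s q" "code_price I \<sigma> B q x = sprice s q x" "code_end \<sigma> B q = send s q"
  using assms walk_cong[of "rcells \<sigma> rA" "type_a I s" "rcells \<sigma> rB" "type_b I s"]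
  by (simp_all add: env_def genv_def code_const_def code_price_def code_end_def sconst_def sprice_def send_def)

lemma env_ok: "env s \<sigma> \<Longrightarrow> s \<in> {1..m} \<Longrightarrow> rcells \<sigma> rQ 0 = real q \<Longrightarrow> q < 2 ^ B \<Longrightarrow> code_ok \<sigma> B q"
  using first_nonneg[of s] \<delta>_pos by (simp add: env_def genv_def code_ok_def)

lemma env_frame:
  assumes "frame P \<sigma> \<sigma>'" "rwrites P \<inter> {rD, rWmax, rUnit, rCodes, rFirst, rA, rB} = {}" "nS \<notin> nwrites P"
  shows "env s \<sigma>' = env s \<sigma>"
  using assms(2,3) frame_rcells[OF assms(1), of rA] frame_rcells[OF assms(1), of rB] frame_rcells[OF assms(1), of rD]
    frame_rcells[OF assms(1), of rFirst] frame_rcells[OF assms(1), of rWmax] frame_rcells[OF assms(1), of rUnit]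
    frame_rcells[OF assms(1), of rCodes] frame_ncells[OF assms(1), of nS]
  by (simp add: env_def genv_def)

lemma sconst_nonneg:
  assumes s: "s \<in> {1..m}" and alive: "live_size I s" shows "0 \<le> sconst s q"
proof -
  interpret single_size "bases_of I s" "weight I" "type_a I s" "type_b I s"
    by (rule single_size_live[OF inst s alive])
  show ?thesis using walk_const_nonneg[of 0 "first s" \<delta>] first_nonneg[OF s] \<delta>_pos by (simp add: sconst_def)
qed

lemma nmax_tick: "T < (real nmax + 1) * tick"
proof -
  have "real n / \<delta> < real nmax + 1" using \<delta>_pos n_pos unfolding nmax_def by linarith
  hence "real n / \<delta> * tick < (real nmax + 1) * tick" using tick_pos by (rule mult_strict_right_mono)
  moreover have "real n / \<delta> * tick = T" using \<delta>_pos n_pos by (simp add: tick_def)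
  ultimately show ?thesis by simp
qed

lemma sbudget:
  assumes "0 \<le> sconst s q" "sconst s q \<le> T"
  shows "sbudget s q \<le> nmax" "sconst s q + real (sbudget s q) * tick \<le> T"
    "T < sconst s q + (real (sbudget s q) + 1) * tick"
proof -
  have ex: "T < sconst s q + (real nmax + 1) * tick" using nmax_tick assms by simp
  show "sbudget s q \<le> nmax" unfolding sbudget_def by (rule Least_le) (rule ex)
  show "T < sconst s q + (real (sbudget s q) + 1) * tick" unfolding sbudget_def by (rule LeastI) (rule ex)
  show "sconst s q + real (sbudget s q) * tick \<le> T"
  proof (cases "sbudget s q")
    case (Suc N)
    hence "\<not> T < sconst s q + (real N + 1) * tick"
      using not_less_Least[of N "\<lambda>N. T < sconst s q + (real N + 1) * tick"] by (simp add: sbudget_def)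
    thus ?thesis using Suc by (simp add: add.commute)
  qed (use assms in simp)
qed

definition labels_ok :: "nat \<Rightarrow> nat \<Rightarrow> nat \<Rightarrow> state \<Rightarrow> bool" where
  "labels_ok na ra s \<sigma> \<longleftrightarrow> (\<forall>k\<le>C. \<exists>f. holds \<sigma> (ncells \<sigma> na k) f \<and> sound_plan s k (rcells \<sigma> ra k) f)"

lemma labels_ok_extends:
  assumes "labels_ok na ra s \<sigma>" "extends \<sigma> \<sigma>'" "ncells \<sigma>' na' = ncells \<sigma> na" "rcells \<sigma>' ra' = rcells \<sigma> ra"
  shows "labels_ok na' ra' s \<sigma>'"
  using assms holds_extends unfolding labels_ok_def by metis

definition "t_table = (2 * nmax + 2) + (((C + 1) * (4 * nmax + 9) + 3) +
  ((n * (C * (9 * B + 2 * nmax + 18) + 2 + ((C + 1) * ((nmax + 1) * (10 * C + 4) + 4) + 2) + 3) + 2) +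
   ((C + 1) * 6 + 2)))"

lemma code_body_correct:
  assumes s: "s \<in> {1..m}" and alive: "live_size I s" and env: "env s \<sigma>"
    and q: "q < 2 ^ B" "rcells \<sigma> rQ 0 = real q"
    and old: "labels_ok nOld rOld s \<sigma>" and new: "labels_ok nNew rNew (s + 2) \<sigma>"
  shows "does I \<epsilon> code_body \<sigma> (9 * B + 8 + (t_table + 2)) (\<lambda>\<sigma>'. rcells \<sigma>' rQ 0 = real (Suc q) \<and> extends \<sigma> \<sigma>' \<and>
    labels_ok nNew rNew (s + 2) \<sigma>' \<and> (\<forall>k\<le>C. rcells \<sigma> rNew k \<le> rcells \<sigma>' rNew k) \<and>
    (sconst s q \<le> T \<longrightarrow> (\<forall>k\<le>C. bounds_partial s q n (rcells \<sigma> rOld) k (sbudget s q) (rcells \<sigma>' rNew k))))"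
    (is "does _ _ _ _ _ ?Q")
proof -
  have ok: "code_ok \<sigma> B q" by (rule env_ok[OF env s q(2,1)])
  have A0: "0 \<le> sconst s q" by (rule sconst_nonneg[OF s alive])
  let ?inc = "\<lambda>\<sigma>. \<sigma>\<lparr>rcells := (rcells \<sigma>)(rQ := (rcells \<sigma> rQ)(0 := rcells \<sigma> rQ 0 + 1))\<rparr>"
  show ?thesis unfolding code_body_def
  proof (rule does_Seq[OF decode_code[OF ok] _ order_refl])
    fix \<sigma>1 assume f1: "frame decode \<sigma> \<sigma>1"
      and d1: "rcells \<sigma>1 rConst 0 = code_const I \<sigma> B q \<and>
        rcells \<sigma>1 rPrice 0 = code_price I \<sigma> B q (rcells \<sigma> rX 0) \<and> rcells \<sigma>1 rLo 0 = code_end \<sigma> B q"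
    have c1: "rcells \<sigma>1 rConst 0 = sconst s q" using d1 env_code[OF env] by simp
    have env1: "env s \<sigma>1" using env_frame[OF f1] env by simp
    have n1: "ncells \<sigma>1 = ncells \<sigma>" using frame_ncells[OF f1] by (auto simp: fun_eq_iff)
    have r1: "rcells \<sigma>1 rQ 0 = real q" "rcells \<sigma>1 rOld = rcells \<sigma> rOld" "rcells \<sigma>1 rNew = rcells \<sigma> rNew"
      using frame_rcells[OF f1, of rQ] frame_rcells[OF f1, of rOld] frame_rcells[OF f1, of rNew] q by simp_all
    have ext1: "extends \<sigma> \<sigma>1" by (simp add: extends_def n1)
    have old1: "labels_ok nOld rOld s \<sigma>1" and new1: "labels_ok nNew rNew (s + 2) \<sigma>1"
      using labels_ok_extends[OF old ext1] labels_ok_extends[OF new ext1] n1 r1 by auto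
    let ?Rest = "\<lambda>\<sigma>'. rcells \<sigma>' rQ 0 = real q \<and> extends \<sigma> \<sigma>' \<and>
      labels_ok nNew rNew (s + 2) \<sigma>' \<and> (\<forall>k\<le>C. rcells \<sigma> rNew k \<le> rcells \<sigma>' rNew k) \<and>
      (sconst s q \<le> T \<longrightarrow> (\<forall>k\<le>C. bounds_partial s q n (rcells \<sigma> rOld) k (sbudget s q) (rcells \<sigma>' rNew k)))"
    have main: "does I \<epsilon> (budget_loop ;; fill_table ;; price_bases ;; collect)
        \<sigma>1 t_table ?Rest" if le: "sconst s q \<le> T"
    proof -
      define N where "N = sbudget s q"
      have N: "N \<le> nmax" "sconst s q + real N * tick \<le> T" using sbudget[OF A0 le] by (auto simp: N_def)
      have u1: "rcells \<sigma>1 rUnit 0 = tick" using env1 by (simp add: env_def genv_def)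
      have bud: "does I \<epsilon> budget_loop \<sigma>1 (2 * nmax + 2) (\<lambda>\<sigma>'. ncells \<sigma>' nN 0 = N)"
        using budget_correct[of \<sigma>1 I nmax \<epsilon>] c1 u1 tick_pos nmax_tick A0 by (simp add: N_def sbudget_def)
      let ?tf = "(C + 1) * (4 * nmax + 9) + 3"
      let ?tp = "n * (C * (9 * B + 2 * nmax + 18) + 2 + ((C + 1) * ((nmax + 1) * (10 * C + 4) + 4) + 2) + 3) + 2"
      let ?tc = "(C + 1) * 6 + 2"
      show ?thesis
      proof (rule does_Seq[OF bud, where j = "?tf + (?tp + ?tc)"])
        fix \<sigma>2 assume f2: "frame budget_loop \<sigma>1 \<sigma>2" and N2: "ncells \<sigma>2 nN 0 = N"
        have env2: "env s \<sigma>2" using env_frame[OF f2] env1 by simp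
        have r2: "rcells \<sigma>2 = rcells \<sigma>1" using frame_rcells[OF f2] by (auto simp: fun_eq_iff)
        have n2: "ncells \<sigma>2 nOld = ncells \<sigma> nOld" "ncells \<sigma>2 nNew = ncells \<sigma> nNew"
          using frame_ncells[OF f2, of nOld] frame_ncells[OF f2, of nNew] n1 by simp_all
        have ext2: "extends \<sigma> \<sigma>2" using extends_trans[OF ext1 extends_frame[OF f2]] by simp
        have fill: "does I \<epsilon> fill_table \<sigma>2 ?tf (\<lambda>\<sigma>'. \<forall>k\<le>C. ncells \<sigma>' nRow k = k * (N + 1) \<and>
          (\<forall>u\<le>N. rcells \<sigma>' rTab (cell N k u) = rcells \<sigma>2 rOld k \<and> ncells \<sigma>' nTab (cell N k u) = ncells \<sigma>2 nOld k))"
        proof (rule does_mono[OF fill_table_correct[OF N2]])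
          show "(C + 1) * (4 * N + 9) + 3 \<le> ?tf" using N(1) by (intro add_mono mult_le_mono) auto
        qed
        show "does I \<epsilon> (fill_table ;; price_bases ;; collect)
            \<sigma>2 (?tf + (?tp + ?tc)) ?Rest"
        proof (rule does_Seq[OF fill _ order_refl])
          fix \<sigma>3 assume f3: "frame fill_table \<sigma>2 \<sigma>3"
            and t3: "\<forall>k\<le>C. ncells \<sigma>3 nRow k = k * (N + 1) \<and>
              (\<forall>u\<le>N. rcells \<sigma>3 rTab (cell N k u) = rcells \<sigma>2 rOld k \<and> ncells \<sigma>3 nTab (cell N k u) = ncells \<sigma>2 nOld k)"
          have env3: "env s \<sigma>3" using env_frame[OF f3] env2 by simp
          have ext3: "extends \<sigma> \<sigma>3" using extends_trans[OF ext2 extends_frame[OF f3]] by simp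
          have n3: "ncells \<sigma>3 nN 0 = N" "ncells \<sigma>3 nS 0 = s" "ncells \<sigma>3 nNew = ncells \<sigma> nNew"
            using frame_ncells[OF f3, of nN] frame_ncells[OF f3, of nNew] N2 n2 env3 by (simp_all add: env_def)
          have r3: "rcells \<sigma>3 rQ 0 = real q" "rcells \<sigma>3 rNew = rcells \<sigma> rNew" "rcells \<sigma>3 rUnit 0 = tick"
            using frame_rcells[OF f3, of rQ] frame_rcells[OF f3, of rNew] r2 r1 env3 by (simp_all add: env_def genv_def)
          have ok3: "code_ok \<sigma>3 B q" by (rule env_ok[OF env3 s r3(1) q(1)])
          have lab3: "labelled N (sound_partial s q 0) (bounds_partial s q 0 (rcells \<sigma> rOld)) k u \<sigma>3" if ku: "k \<le> C" "u \<le> N" for k u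
          proof -
            obtain f where f: "holds \<sigma> (ncells \<sigma> nOld k) f" "sound_plan s k (rcells \<sigma> rOld k) f"
              using old ku(1) by (auto simp: labels_ok_def)
            have "holds \<sigma>3 (ncells \<sigma> nOld k) f" by (rule holds_extends[OF f(1) ext3])
            thus ?thesis unfolding labelled_def using t3 ku r2 r1 n2 sound_partial_0[OF s f(2)] bounds_partial_0[OF s] by auto
          qed
          have bases: "does I \<epsilon> price_bases \<sigma>3 ?tp
            (\<lambda>\<sigma>'. (\<forall>k\<le>C. \<forall>u\<le>N. labelled N (sound_partial s q n) (bounds_partial s q n (rcells \<sigma> rOld)) k u \<sigma>') \<and> extends \<sigma>3 \<sigma>')"
          proof (rule does_mono[OF price_bases_correct[OF ok3 n3(2) n3(1), where cost = "cost s q" and gain = "gain s q"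
                and Snd = "sound_partial s q" and Cmp = "\<lambda>i. bounds_partial s q i (rcells \<sigma> rOld)"]])
            show "n * (C * (9 * B + 2 * N + 18) + 2 + ((C + 1) * ((N + 1) * (10 * C + 4) + 4) + 2) + 3) + 2 \<le> ?tp"
              using N(1) by (intro add_mono mult_le_mono order_refl) auto
          qed (use t3 lab3 env_code[OF env3] r3 sound_partial_mono bounds_partial_skip sound_partial_step[OF s] bounds_partial_step[OF s] in
              \<open>auto simp: cost_def gain_def N_def\<close>)
          show "does I \<epsilon> (price_bases ;; collect) \<sigma>3 (?tp + ?tc) ?Rest"
          proof (rule does_Seq[OF bases _ order_refl])
            fix \<sigma>4 assume f4: "frame price_bases \<sigma>3 \<sigma>4" and
              l4: "(\<forall>k\<le>C. \<forall>u\<le>N. labelled N (sound_partial s q n) (bounds_partial s q n (rcells \<sigma> rOld)) k u \<sigma>4) \<and> extends \<sigma>3 \<sigma>4"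
            have ext4: "extends \<sigma> \<sigma>4" using extends_trans[OF ext3] l4 by simp
            have n4: "ncells \<sigma>4 nN 0 = N" "ncells \<sigma>4 nNew = ncells \<sigma> nNew" "ncells \<sigma>4 nRow = ncells \<sigma>3 nRow"
              using frame_ncells[OF f4, of nN] frame_ncells[OF f4, of nNew] frame_ncells[OF f4, of nRow] n3 by simp_all
            have r4: "rcells \<sigma>4 rQ 0 = real q" "rcells \<sigma>4 rNew = rcells \<sigma> rNew"
              using frame_rcells[OF f4, of rQ] frame_rcells[OF f4, of rNew] r3 by simp_all
            show "does I \<epsilon> collect \<sigma>4 ?tc ?Rest"
            proof (rule does_mono[OF collect_correct[OF n4(1)] order_refl])
              show "ncells \<sigma>4 nRow k = k * (N + 1)" if "k \<le> C" for k using t3 that n4 by simp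
              fix \<sigma>5 assume f5: "frame collect \<sigma>4 \<sigma>5" and c5: "\<forall>k\<le>C.
                (rcells \<sigma>4 rNew k < rcells \<sigma>4 rTab (cell N k N) \<and> rcells \<sigma>5 rNew k = rcells \<sigma>4 rTab (cell N k N) \<and>
                   ncells \<sigma>5 nNew k = ncells \<sigma>4 nTab (cell N k N)) \<or>
                (rcells \<sigma>4 rTab (cell N k N) \<le> rcells \<sigma>4 rNew k \<and> rcells \<sigma>5 rNew k = rcells \<sigma>4 rNew k \<and>
                   ncells \<sigma>5 nNew k = ncells \<sigma>4 nNew k)"
              have ext45: "extends \<sigma>4 \<sigma>5" by (rule extends_frame[OF f5]) simp
              have ext5: "extends \<sigma> \<sigma>5" by (rule extends_trans[OF ext4 ext45])
              have q5: "rcells \<sigma>5 rQ 0 = real q" using frame_rcells[OF f5, of rQ] r4 by simp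
              have lab5: "\<exists>f. holds \<sigma>5 (ncells \<sigma>5 nNew k) f \<and> sound_plan (s + 2) k (rcells \<sigma>5 rNew k) f" if k: "k \<le> C" for k
              proof -
                obtain f where f: "holds \<sigma>4 (ncells \<sigma>4 nTab (cell N k N)) f"
                  "sound_partial s q n k N (rcells \<sigma>4 rTab (cell N k N)) f"
                  using l4 k unfolding labelled_def by blast
                have g: "sound_plan (s + 2) k (rcells \<sigma>4 rTab (cell N k N)) f"
                  by (rule sound_partial_final[OF s alive]) (use N f(2) in \<open>auto simp: N_def\<close>)
                obtain f' where f': "holds \<sigma> (ncells \<sigma> nNew k) f'" "sound_plan (s + 2) k (rcells \<sigma> rNew k) f'"
                  using new k by (auto simp: labels_ok_def)
                show ?thesis
                  using c5[rule_format, OF k] holds_extends[OF f(1) ext45] g holds_extends[OF f'(1) ext5] f'(2) n4 r4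
                  by (elim disjE conjE) (auto simp del: One_nat_def)
              qed
              have mono5: "rcells \<sigma> rNew k \<le> rcells \<sigma>5 rNew k" if "k \<le> C" for k
                using c5[rule_format, OF that] r4 by auto
              have comp5: "bounds_partial s q n (rcells \<sigma> rOld) k (sbudget s q) (rcells \<sigma>5 rNew k)" if k: "k \<le> C" for k
              proof -
                have "bounds_partial s q n (rcells \<sigma> rOld) k N (rcells \<sigma>4 rTab (cell N k N))"
                  using l4 k unfolding labelled_def by blast
                moreover have "rcells \<sigma>4 rTab (cell N k N) \<le> rcells \<sigma>5 rNew k"
                  using c5[rule_format, OF k] by auto
                ultimately show ?thesis unfolding bounds_partial_def N_def[symmetric] by (meson order_trans)
              qed
              show "?Rest \<sigma>5" using ext5 q5 lab5 mono5 comp5 by (simp add: labels_ok_def)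
            qed
          qed
        qed
      qed (simp add: t_table_def)
    qed
    have skip: "?Q (?inc \<sigma>1)" if gt: "\<not> sconst s q \<le> T"
    proof (intro conjI)
      show "rcells (?inc \<sigma>1) rQ 0 = real (Suc q)" using r1(1) by simp
      show "extends \<sigma> (?inc \<sigma>1)" using ext1 by (simp add: extends_def)
      show "labels_ok nNew rNew (s + 2) (?inc \<sigma>1)" using new1 by (simp add: labels_ok_def holds_def)
      show "\<forall>k\<le>C. rcells \<sigma> rNew k \<le> rcells (?inc \<sigma>1) rNew k" using r1(3) by simp
    qed (use gt in blast)
    show "does I \<epsilon> (Cond (RLess RHorizon (RV rConst)) Skip (budget_loop ;; fill_table ;; price_bases ;; collect) ;;
        RSet rQ (RAdd (RV rQ) (RNum 1))) \<sigma>1 (t_table + 2) ?Q"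
    proof (cases "sconst s q \<le> T")
      case True
      have "does I \<epsilon> ((budget_loop ;; fill_table ;; price_bases ;; collect) ;; RSet rQ (RAdd (RV rQ) (RNum 1)))
          \<sigma>1 (t_table + 1) ?Q"
      proof (rule does_Seq[OF main[OF True] _ order_refl])
        fix \<sigma>5 assume "?Rest \<sigma>5"
        thus "does I \<epsilon> (RSet rQ (RAdd (RV rQ) (RNum 1))) \<sigma>5 1 ?Q"
          by (simp add: labels_ok_def holds_def extends_def)
      qed
      thus ?thesis using True c1 by (simp del: does_Seq_assoc)
    next
      case False
      have "1 \<le> t_table" by (simp add: t_table_def)
      thus ?thesis using skip[OF False] False c1 r1(1) by simp
    qed
  qed
qed

text \<open>The interface between program and analysis: within a parity class the program does at
  least as well as any choice of attained pairs, one for each size, that fits the capacity; the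
  analysis supplies good pairs. The first alternative leaves the size empty.\<close>

definition attains :: "nat \<Rightarrow> nat \<Rightarrow> real \<Rightarrow> bool" where
  "attains s k t \<longleftrightarrow> (k = 0 \<and> t = 0) \<or> (live_size I s \<and> (\<exists>q<2 ^ B. sconst s q \<le> T \<and> (\<exists>c.
     (\<forall>j. c j \<noteq> 0 \<longrightarrow> j \<in> bases_of I s) \<and> sum c (bases_of I s) = k \<and>
     (\<Sum>j\<in>bases_of I s. cost s q j (c j)) \<le> sbudget s q \<and> t \<le> (\<Sum>j\<in>bases_of I s. gain s q j (c j)))))"

definition "t_codes = 2 ^ B * (9 * B + 8 + (t_table + 2) + 1) + 1"

text \<open>The values in \<open>rNew\<close> start at least as large as those in
  \<open>rOld\<close>, so leaving the size empty is covered before the first code.\<close>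

lemma codes_correct:
  assumes s: "s \<in> {1..m}" and alive: "live_size I s" and env: "env s \<sigma>" and q: "rcells \<sigma> rQ 0 = 0"
    and old: "labels_ok nOld rOld s \<sigma>" and new: "labels_ok nNew rNew (s + 2) \<sigma>"
    and ge: "\<And>k. k \<le> C \<Longrightarrow> rcells \<sigma> rOld k \<le> rcells \<sigma> rNew k"
  shows "does I \<epsilon> (While (RLess (RV rQ) (RV rCodes)) code_body) \<sigma> t_codes (\<lambda>\<sigma>'. extends \<sigma> \<sigma>' \<and>
    labels_ok nNew rNew (s + 2) \<sigma>' \<and>
    (\<forall>k\<le>C. \<forall>k'\<le>k. \<forall>t. attains s k' t \<longrightarrow> rcells \<sigma> rOld (k - k') + t \<le> rcells \<sigma>' rNew k))"
proof -
  define Inv where "Inv = (\<lambda>q (\<sigma>' :: state). q \<le> 2 ^ B \<and> rcells \<sigma>' rQ 0 = real q \<and> extends \<sigma> \<sigma>' \<and> labels_ok nNew rNew (s + 2) \<sigma>' \<and>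
    (\<forall>k\<le>C. rcells \<sigma> rOld k \<le> rcells \<sigma>' rNew k) \<and>
    (\<forall>q'<q. sconst s q' \<le> T \<longrightarrow> (\<forall>k\<le>C. bounds_partial s q' n (rcells \<sigma> rOld) k (sbudget s q') (rcells \<sigma>' rNew k))))"
  show ?thesis
  proof (rule does_loop[where Inv = Inv and N = "2 ^ B" and c = "9 * B + 8 + (t_table + 2)"])
    show "Inv 0 \<sigma>" using q new ge by (simp add: Inv_def extends_refl)
  next
    fix q \<sigma>1 assume p: "Inv q \<sigma>1" "q \<le> 2 ^ B" "frame code_body \<sigma> \<sigma>1" "bval I \<epsilon> \<sigma>1 (RLess (RV rQ) (RV rCodes))"
    have env1: "env s \<sigma>1" using env_frame[OF p(3)] env by simp
    have qq: "rcells \<sigma>1 rQ 0 = real q" using p(1) by (simp add: Inv_def)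
    have "real q < 2 ^ B" using p(4) qq env1 by (simp add: env_def genv_def)
    hence lt: "q < 2 ^ B" by (metis of_nat_less_iff of_nat_numeral of_nat_power)
    have f1: "ncells \<sigma>1 nOld = ncells \<sigma> nOld" "rcells \<sigma>1 rOld = rcells \<sigma> rOld"
      using frame_ncells[OF p(3), of nOld] frame_rcells[OF p(3), of rOld] by simp_all
    have old1: "labels_ok nOld rOld s \<sigma>1" using labels_ok_extends[OF old _ f1] p(1) by (simp add: Inv_def)
    have new1: "labels_ok nNew rNew (s + 2) \<sigma>1" using p(1) by (simp add: Inv_def)
    have "does I \<epsilon> code_body \<sigma>1 (9 * B + 8 + (t_table + 2)) (Inv (Suc q))"
    proof (rule does_mono[OF code_body_correct[OF s alive env1 lt qq old1 new1] order_refl])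
      fix \<sigma>2 assume 2: "rcells \<sigma>2 rQ 0 = real (Suc q) \<and> extends \<sigma>1 \<sigma>2 \<and> labels_ok nNew rNew (s + 2) \<sigma>2 \<and>
        (\<forall>k\<le>C. rcells \<sigma>1 rNew k \<le> rcells \<sigma>2 rNew k) \<and>
        (sconst s q \<le> T \<longrightarrow> (\<forall>k\<le>C. bounds_partial s q n (rcells \<sigma>1 rOld) k (sbudget s q) (rcells \<sigma>2 rNew k)))"
      have "bounds_partial s q' n (rcells \<sigma> rOld) k (sbudget s q') (rcells \<sigma>2 rNew k)"
        if "q' < Suc q" "sconst s q' \<le> T" "k \<le> C" for q' k
      proof (cases "q' = q")
        case True
        thus ?thesis using 2 that f1 by simp
      next
        case False
        hence "q' < q" using that by simp
        hence "bounds_partial s q' n (rcells \<sigma> rOld) k (sbudget s q') (rcells \<sigma>1 rNew k)"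
          using p(1) that unfolding Inv_def by blast
        moreover have "rcells \<sigma>1 rNew k \<le> rcells \<sigma>2 rNew k" using 2 that by blast
        ultimately show ?thesis unfolding bounds_partial_def by (meson order_trans)
      qed
      moreover have "rcells \<sigma> rOld k \<le> rcells \<sigma>2 rNew k" if "k \<le> C" for k
        using p(1) 2 that unfolding Inv_def by (meson order_trans)
      moreover have "extends \<sigma> \<sigma>2" using extends_trans 2 p(1) unfolding Inv_def by blast
      ultimately show "Inv (Suc q) \<sigma>2" using 2 lt unfolding Inv_def by (simp add: Suc_leI)
    qed
    thus "q < 2 ^ B \<and> does I \<epsilon> code_body \<sigma>1 (9 * B + 8 + (t_table + 2)) (Inv (Suc q))" using lt by simp
  next
    show "2 ^ B * (9 * B + 8 + (t_table + 2) + 1) + 1 \<le> t_codes" by (simp add: t_codes_def)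
  next
    fix q \<sigma>1 assume p: "Inv q \<sigma>1" "q \<le> 2 ^ B" "frame code_body \<sigma> \<sigma>1" "\<not> bval I \<epsilon> \<sigma>1 (RLess (RV rQ) (RV rCodes))"
    have env1: "env s \<sigma>1" using env_frame[OF p(3)] env by simp
    have "\<not> real q < 2 ^ B" using p(1,4) env1 by (simp add: env_def genv_def Inv_def)
    hence "\<not> q < 2 ^ B" by (metis of_nat_less_iff of_nat_numeral of_nat_power)
    hence qB: "q = 2 ^ B" using p(2) by simp
    have "rcells \<sigma> rOld (k - k') + t \<le> rcells \<sigma>1 rNew k" if k: "k \<le> C" "k' \<le> k" and a: "attains s k' t" for k k' t
    proof (cases "k' = 0 \<and> t = 0")
      case True
      thus ?thesis using p(1) k by (simp add: Inv_def)
    next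
      case False
      then obtain q' c where q': "q' < 2 ^ B" "sconst s q' \<le> T" and c: "\<forall>j. c j \<noteq> 0 \<longrightarrow> j \<in> bases_of I s"
        "sum c (bases_of I s) = k'" "(\<Sum>j\<in>bases_of I s. cost s q' j (c j)) \<le> sbudget s q'"
        "t \<le> (\<Sum>j\<in>bases_of I s. gain s q' j (c j))" using a unfolding attains_def by blast
      have "bounds_partial s q' n (rcells \<sigma> rOld) k (sbudget s q') (rcells \<sigma>1 rNew k)"
        using p(1) q' k(1) qB unfolding Inv_def by blast
      moreover have "\<forall>j. c j \<noteq> 0 \<longrightarrow> j \<in> bases_of I s \<and> j \<le> n" using c(1) by (auto simp: bases_of_def)
      ultimately have "rcells \<sigma> rOld (k - k') + (\<Sum>j\<in>bases_of I s. gain s q' j (c j)) \<le> rcells \<sigma>1 rNew k"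
        using c(2,3) k(2) unfolding bounds_partial_def by blast
      thus ?thesis using c(4) by simp
    qed
    thus "extends \<sigma> \<sigma>1 \<and> labels_ok nNew rNew (s + 2) \<sigma>1 \<and>
      (\<forall>k\<le>C. \<forall>k'\<le>k. \<forall>t. attains s k' t \<longrightarrow> rcells \<sigma> rOld (k - k') + t \<le> rcells \<sigma>1 rNew k)"
      using p(1) by (simp add: Inv_def)
  qed
qed

end

section \<open>Processing one size: customer types, labels, search\<close>

definition load_type :: "nat \<Rightarrow> nat \<Rightarrow> nexp \<Rightarrow> direction \<Rightarrow> nat \<Rightarrow> com" where
  "load_type k dev s dir l =
     Cond (BType s dir (NLit l))
       (RStore rA (NLit k) (RMul (RArrival s dir (NLit l)) (RFit (NLit dev) s dir (NLit l))) ;;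
        RStore rB (NLit k) (RFit (NLit dev) s dir (NLit l)))
       (RStore rA (NLit k) (RNum 0) ;; RStore rB (NLit k) (RNum 1))"

definition load_types :: com where
  "load_types =
     load_type 0 0 (NV nS) Up 0 ;; load_type 1 0 (NV nS) Down 0 ;;
     load_type 2 0 (NV nS) Up 1 ;; load_type 3 0 (NV nS) Down 1 ;;
     load_type 4 1 (NSub (NV nS) (NLit 1)) Up 1 ;; load_type 5 1 (NAdd (NV nS) (NLit 1)) Down 1"

lemma writes_load [simp]: "nwrites load_types = {}" "rwrites load_types = {rA, rB}" "\<not> swrites load_types"
  by (auto simp: load_types_def load_type_def)

definition loaded :: "cftc \<Rightarrow> nat \<Rightarrow> nat \<Rightarrow> state \<Rightarrow> bool" where
  "loaded I s K \<sigma> \<longleftrightarrow> ncells \<sigma> nS 0 = s \<and> (\<forall>k<K. rcells \<sigma> rA k = type_a I s k \<and> rcells \<sigma> rB k = type_b I s k)"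

lemma load_type_correct:
  assumes "loaded I s k \<sigma>" "near_type s k = (nval I \<sigma> e, dir, l)" "dev = near_dev k"
  shows "does I \<epsilon> (load_type k dev e dir l) \<sigma> 3 (loaded I s (Suc k))"
proof -
  \<comment> \<open>Index expressions read no real cells, so the first store does not change the
    indices used by the second.\<close>
  have e: "nval I (\<sigma>\<lparr>rcells := x\<rparr>) e = nval I \<sigma> e" for x
    by (induction e) simp_all
  show ?thesis unfolding load_type_def
    using assms by (simp add: loaded_def less_Suc_eq type_a_def type_b_def e)
qed

lemma load_types_correct:
  assumes "ncells \<sigma> nS 0 = s"
  shows "does I \<epsilon> load_types \<sigma> 18 (loaded I s 6)"
  unfolding load_types_def
proof (rule does_Seq[OF load_type_correct[of I s], where j = 15])
  show "loaded I s 0 \<sigma>" using assms by (simp add: loaded_def)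
  fix \<sigma>1 assume 1: "loaded I s (Suc 0) \<sigma>1"
  show "does I \<epsilon> (load_type 1 0 (NV nS) Down 0 ;; load_type 2 0 (NV nS) Up 1 ;; load_type 3 0 (NV nS) Down 1 ;;
     load_type 4 1 (NSub (NV nS) (NLit 1)) Up 1 ;; load_type 5 1 (NAdd (NV nS) (NLit 1)) Down 1) \<sigma>1 15 (loaded I s 6)"
  proof (rule does_Seq[OF load_type_correct[of I s], where j = 12])
    fix \<sigma>2 assume 2: "loaded I s (Suc 1) \<sigma>2"
    show "does I \<epsilon> (load_type 2 0 (NV nS) Up 1 ;; load_type 3 0 (NV nS) Down 1 ;;
       load_type 4 1 (NSub (NV nS) (NLit 1)) Up 1 ;; load_type 5 1 (NAdd (NV nS) (NLit 1)) Down 1) \<sigma>2 12 (loaded I s 6)"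
    proof (rule does_Seq[OF load_type_correct[of I s], where j = 9])
      fix \<sigma>3 assume 3: "loaded I s (Suc 2) \<sigma>3"
      show "does I \<epsilon> (load_type 3 0 (NV nS) Down 1 ;;
         load_type 4 1 (NSub (NV nS) (NLit 1)) Up 1 ;; load_type 5 1 (NAdd (NV nS) (NLit 1)) Down 1) \<sigma>3 9 (loaded I s 6)"
      proof (rule does_Seq[OF load_type_correct[of I s], where j = 6])
        fix \<sigma>4 assume 4: "loaded I s (Suc 3) \<sigma>4"
        show "does I \<epsilon> (load_type 4 1 (NSub (NV nS) (NLit 1)) Up 1 ;; load_type 5 1 (NAdd (NV nS) (NLit 1)) Down 1)
            \<sigma>4 6 (loaded I s 6)"
        proof (rule does_Seq[OF load_type_correct[of I s], where j = 3])
          fix \<sigma>5 assume 5: "loaded I s (Suc 4) \<sigma>5"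
          have "does I \<epsilon> (load_type 5 1 (NAdd (NV nS) (NLit 1)) Down 1) \<sigma>5 3 (loaded I s (Suc 5))"
            by (rule load_type_correct) (use 5 in \<open>auto simp: loaded_def near_type_simps near_dev_def\<close>)
          thus "does I \<epsilon> (load_type 5 1 (NAdd (NV nS) (NLit 1)) Down 1) \<sigma>5 3 (loaded I s 6)" by simp
        qed (use 4 in \<open>auto simp: loaded_def near_type_simps near_dev_def\<close>)
      qed (use 3 in \<open>auto simp: loaded_def near_type_simps near_dev_def\<close>)
    qed (use 2 in \<open>auto simp: loaded_def near_type_def near_dev_def numeral_eq_Suc\<close>)
  qed (use 1 in \<open>auto simp: loaded_def near_type_simps near_dev_def\<close>)
qed (use assms in \<open>auto simp: loaded_def near_type_simps near_dev_def\<close>)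

definition copy_labels :: "nat \<Rightarrow> nat \<Rightarrow> nat \<Rightarrow> nat \<Rightarrow> com" where
  "copy_labels na ra nb rb =
     NSet nK (NLit 0) ;;
     While (NLess (NV nK) (NAdd NCapacity (NLit 1)))
       (RStore rb (NV nK) (RCell ra (NV nK)) ;;
        NStore nb (NV nK) (NCell na (NV nK)) ;;
        NSet nK (NAdd (NV nK) (NLit 1)))"

lemma writes_copy [simp]: "nwrites (copy_labels na ra nb rb) = {nK, nb}" "rwrites (copy_labels na ra nb rb) = {rb}"
  "\<not> swrites (copy_labels na ra nb rb)"
  by (auto simp: copy_labels_def)

lemma copy_labels_correct:
  assumes "na \<noteq> nb" "na \<noteq> nK" "nb \<noteq> nK" "ra \<noteq> rb"
  shows "does I \<epsilon> (copy_labels na ra nb rb) \<sigma> ((capacity I + 1) * 4 + 2)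
    (\<lambda>\<sigma>'. \<forall>k\<le>capacity I. rcells \<sigma>' rb k = rcells \<sigma> ra k \<and> ncells \<sigma>' nb k = ncells \<sigma> na k)"
proof -
  define Inv where "Inv = (\<lambda>k (\<sigma>' :: state). ncells \<sigma>' nK 0 = k \<and>
    (\<forall>k'<k. rcells \<sigma>' rb k' = rcells \<sigma> ra k' \<and> ncells \<sigma>' nb k' = ncells \<sigma> na k'))"
  show ?thesis unfolding copy_labels_def
    apply simp
    apply (rule does_loop[where Inv = Inv and N = "capacity I + 1" and c = 3])
    subgoal by (simp add: Inv_def)
    subgoal premises p for k \<sigma>'
    proof -
      have "ncells \<sigma>' na = ncells \<sigma> na" "rcells \<sigma>' ra = rcells \<sigma> ra"
        using frame_ncells[OF p(3), of na] frame_rcells[OF p(3), of ra] assms by simp_all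
      thus ?thesis using p(1,4) assms by (auto simp: Inv_def less_Suc_eq)
    qed
    subgoal by simp
    subgoal for k \<sigma>' by (auto simp: Inv_def)
    done
qed

definition set_first :: com where
  "set_first =
     Cond (RLess (RDiv (RNum 1) (RV rWmax)) (RMul (RDiv RHorizon (RNum 2)) (rate_exp (RMul (ROfNat NBases) (RV rWmax)))))
       (RSet rFirst (RDiv (RNum 1) (RV rWmax)))
       (RSet rFirst (RMul (RDiv RHorizon (RNum 2)) (rate_exp (RMul (ROfNat NBases) (RV rWmax)))))"

definition search :: com where
  "search = set_first ;; RSet rQ (RNum 0) ;; While (RLess (RV rQ) (RV rCodes)) code_body"

text \<open>When size \<open>s\<close> is processed, \<open>rOld\<close> and \<open>rMid\<close> hold, for every capacity, the best revenue found for the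
  smaller sizes of the same and of the other parity as \<open>s\<close>.\<close>

definition size_body :: com where
  "size_body =
     NSet nS (NAdd (NV nS) (NLit 1)) ;;
     load_types ;;
     copy_labels nOld rOld nNew rNew ;;
     Cond (RLess (RNum 0) (rate_exp (RNum 0))) search Skip ;;
     copy_labels nMid rMid nOld rOld ;;
     copy_labels nNew rNew nMid rMid"

lemma writes_search [simp]: "nwrites search = nwrites code_body" "rwrites search = {rFirst} \<union> rwrites code_body"
  "\<not> swrites search"
  by (auto simp: search_def set_first_def)

lemma writes_size_body [simp]: "nwrites size_body = {nS, nMid, nOld} \<union> nwrites code_body"
  "rwrites size_body = {rA, rB, rFirst, rOld, rMid} \<union> rwrites code_body" "\<not> swrites size_body"
  by (auto simp: size_body_def)

section \<open>Preparation, output, and the whole program\<close>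

definition prepare :: com where
  "prepare =
     RSet rD (RDiv REps (RNum 16)) ;;
     RSet rWmin (RWeight (NLit 1)) ;;
     RSet rWmax (RWeight (NLit 1)) ;;
     NSet nI (NLit 1) ;;
     While (NLess (NV nI) NBases)
       (NSet nI (NAdd (NV nI) (NLit 1)) ;;
        Cond (RLess (RWeight (NV nI)) (RV rWmin)) (RSet rWmin (RWeight (NV nI))) Skip ;;
        Cond (RLess (RV rWmax) (RWeight (NV nI))) (RSet rWmax (RWeight (NV nI))) Skip) ;;
     RSet rUnit (RDiv (RMul (RV rD) RHorizon) (ROfNat NBases)) ;;
     NSet nFree (NLit 1) ;;
     RSet rReach (RNum 1) ;;
     RSet rCodes (RNum 1) ;;
     While (RLess (RV rReach) (RMul (RMul (RMul (RMul (RMul (RNum 4) (ROfNat NBases)) (ROfNat NBases)) (ROfNat NCapacity))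
              (RDiv (RV rWmax) (RV rWmin))) (RDiv (RV rWmax) (RV rWmin))))
       (RSet rReach (RMul (RV rReach) (RAdd (RNum 1) (RV rD))) ;;
        RSet rCodes (RMul (RNum 2) (RV rCodes)))"

definition write_plan :: com where
  "write_plan =
     Cond (RLess (RCell rMid NCapacity) (RCell rOld NCapacity))
       (NSet nPtr (NCell nOld NCapacity)) (NSet nPtr (NCell nMid NCapacity)) ;;
     While (NLess (NLit 0) (NV nPtr))
       (SetStock (NCell nBase (NV nPtr)) (NCell nSize (NV nPtr)) (NCell nAmount (NV nPtr)) ;;
        NSet nPtr (NCell nNext (NV nPtr)))"

definition plan_stock :: com where
  "plan_stock =
     Cond (BAnd (RLess (RMul (RNum 2) REps) (RNum 1)) (BAnd (RLess (RNum 0) RHorizon) (NLess (NLit 0) NCapacity)))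
       (prepare ;; While (NLess (NV nS) NSizes) size_body ;; write_plan)
       Skip"

context algorithm
begin

text \<open>At W = 0 the rate is the sum of the nonnegative \<open>a k\<close>, so a live size is
  recognised by one comparison.\<close>

lemma live_iff_rate: "s \<in> {1..m} \<Longrightarrow> live_size I s \<longleftrightarrow> 0 < size_rate I s 0"
proof
  assume s: "s \<in> {1..m}"
  assume "live_size I s"
  thus "0 < size_rate I s 0" using single_size.rate_pos[OF single_size_live[OF inst s], of 0] by simp
next
  assume s: "s \<in> {1..m}"
  assume "0 < size_rate I s 0"
  hence "\<exists>k\<in>{..<6}. 0 < type_a I s k"
    unfolding choice_rate_def by (metis (no_types, lifting) add_0_right div_by_1 mult_zero_right not_le sum_nonpos)
  thus "live_size I s" by (auto simp: live_size_def)
qed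

lemma search_correct:
  assumes s: "s \<in> {1..m}" and alive: "live_size I s" and g: "genv \<sigma>" and l: "loaded I s 6 \<sigma>"
    and old: "labels_ok nOld rOld s \<sigma>" and new: "labels_ok nNew rNew (s + 2) \<sigma>"
    and ge: "\<And>k. k \<le> C \<Longrightarrow> rcells \<sigma> rOld k \<le> rcells \<sigma> rNew k"
  shows "does I \<epsilon> search \<sigma> (t_codes + 3) (\<lambda>\<sigma>'. extends \<sigma> \<sigma>' \<and> labels_ok nNew rNew (s + 2) \<sigma>' \<and>
    (\<forall>k\<le>C. \<forall>k'\<le>k. \<forall>t. attains s k' t \<longrightarrow> rcells \<sigma> rOld (k - k') + t \<le> rcells \<sigma>' rNew k))"
proof -
  have rate: "choice_rate (rcells \<sigma> rA) (rcells \<sigma> rB) = size_rate I s"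
    using l by (intro walk_cong) (auto simp: loaded_def)
  have wm: "rcells \<sigma> rWmax 0 = wmax" using g by (simp add: genv_def)
  let ?\<sigma>1 = "\<sigma>\<lparr>rcells := (rcells \<sigma>)(rFirst := (rcells \<sigma> rFirst)(0 := first s))\<rparr>"
  let ?\<sigma>2 = "?\<sigma>1\<lparr>rcells := (rcells ?\<sigma>1)(rQ := (rcells ?\<sigma>1 rQ)(0 := 0))\<rparr>"
  have 1: "does I \<epsilon> set_first \<sigma> 2 (\<lambda>\<sigma>'. \<sigma>' = ?\<sigma>1)"
  proof (cases "1 / wmax < T / 2 * size_rate I s (real n * wmax)")
    case True
    hence "first s = 1 / wmax" by (simp add: first_def)
    thus ?thesis using True unfolding set_first_def by (simp add: rate[simplified] wm[simplified])
  next
    case False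
    hence "T * size_rate I s (real n * wmax) = 2 * first s" by (simp add: first_def)
    thus ?thesis using False unfolding set_first_def by (simp add: rate[simplified] wm[simplified])
  qed
  have env2: "env s ?\<sigma>2" using g l by (simp add: env_def genv_def loaded_def)
  have ext2: "extends \<sigma> ?\<sigma>2" by (simp add: extends_def)
  have 2: "does I \<epsilon> (While (RLess (RV rQ) (RV rCodes)) code_body) ?\<sigma>2 t_codes (\<lambda>\<sigma>'. extends ?\<sigma>2 \<sigma>' \<and>
    labels_ok nNew rNew (s + 2) \<sigma>' \<and>
    (\<forall>k\<le>C. \<forall>k'\<le>k. \<forall>t. attains s k' t \<longrightarrow> rcells ?\<sigma>2 rOld (k - k') + t \<le> rcells \<sigma>' rNew k))"
    by (rule codes_correct[OF s alive env2])
       (use labels_ok_extends[OF old ext2] labels_ok_extends[OF new ext2] ge in auto)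
  show ?thesis unfolding search_def
  proof (rule does_exact[OF 1, where j = "t_codes + 1"])
    show "does I \<epsilon> (RSet rQ (RNum 0) ;; While (RLess (RV rQ) (RV rCodes)) code_body) ?\<sigma>1 (t_codes + 1)
      (\<lambda>\<sigma>'. extends \<sigma> \<sigma>' \<and> labels_ok nNew rNew (s + 2) \<sigma>' \<and>
        (\<forall>k\<le>C. \<forall>k'\<le>k. \<forall>t. attains s k' t \<longrightarrow> rcells \<sigma> rOld (k - k') + t \<le> rcells \<sigma>' rNew k))"
    proof (rule does_exact[where \<tau> = ?\<sigma>2 and k = 1])
      show "does I \<epsilon> (While (RLess (RV rQ) (RV rCodes)) code_body) ?\<sigma>2 t_codes
        (\<lambda>\<sigma>'. extends \<sigma> \<sigma>' \<and> labels_ok nNew rNew (s + 2) \<sigma>' \<and>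
          (\<forall>k\<le>C. \<forall>k'\<le>k. \<forall>t. attains s k' t \<longrightarrow> rcells \<sigma> rOld (k - k') + t \<le> rcells \<sigma>' rNew k))"
        by (rule does_mono[OF 2 order_refl]) (use extends_trans[OF ext2] in auto)
    qed auto
  qed simp
qed

lemma labels_ok_copy:
  assumes "labels_ok na ra s \<sigma>" "extends \<sigma> \<sigma>'" "\<forall>k\<le>C. rcells \<sigma>' rb k = rcells \<sigma> ra k \<and> ncells \<sigma>' nb k = ncells \<sigma> na k"
  shows "labels_ok nb rb s \<sigma>'"
  using assms holds_extends unfolding labels_ok_def by metis

lemma labels_ok_later: "labels_ok na ra s \<sigma> \<Longrightarrow> labels_ok na ra (s + 2) \<sigma>"
  using sound_plan_later unfolding labels_ok_def by blast

lemma genv_frame: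
  assumes "frame P \<sigma> \<sigma>'" "rwrites P \<inter> {rD, rWmax, rUnit, rCodes} = {}"
  shows "genv \<sigma>' = genv \<sigma>"
  using assms(2) frame_rcells[OF assms(1), of rD] frame_rcells[OF assms(1), of rWmax]
    frame_rcells[OF assms(1), of rUnit] frame_rcells[OF assms(1), of rCodes]
  by (simp add: genv_def)

definition "t_size = t_codes + 12 * C + 41"

lemma size_body_correct:
  assumes s: "s \<in> {1..m}" and g: "genv \<sigma>" and j: "ncells \<sigma> nS 0 = s - 1"
    and old: "labels_ok nOld rOld s \<sigma>" and mid: "labels_ok nMid rMid (s + 1) \<sigma>"
  shows "does I \<epsilon> size_body \<sigma> t_size (\<lambda>\<sigma>'. ncells \<sigma>' nS 0 = s \<and> genv \<sigma>' \<and>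
    labels_ok nOld rOld (s + 1) \<sigma>' \<and> labels_ok nMid rMid (s + 2) \<sigma>' \<and> (\<forall>k\<le>C. rcells \<sigma>' rOld k = rcells \<sigma> rMid k) \<and>
    (\<forall>k\<le>C. \<forall>k'\<le>k. \<forall>t. attains s k' t \<longrightarrow> rcells \<sigma> rOld (k - k') + t \<le> rcells \<sigma>' rMid k))"
    (is "does _ _ _ _ _ ?Q")
proof -
  define \<sigma>1 where "\<sigma>1 = \<sigma>\<lparr>ncells := (ncells \<sigma>)(nS := (ncells \<sigma> nS)(0 := s))\<rparr>"
  let ?cp = "(C + 1) * 4 + 2"
  have first: "does I \<epsilon> (NSet nS (NAdd (NV nS) (NLit 1))) \<sigma> 1 (\<lambda>\<sigma>'. \<sigma>' = \<sigma>1)"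
    using j s by (simp add: \<sigma>1_def)
  have ext1: "extends \<sigma> \<sigma>1" by (simp add: \<sigma>1_def extends_def)
  show ?thesis unfolding size_body_def
  proof (rule does_exact[OF first, where j = "18 + (?cp + ((t_codes + 4) + (?cp + ?cp)))"])
    show "does I \<epsilon> (load_types ;; copy_labels nOld rOld nNew rNew ;; Cond (RLess (RNum 0) (rate_exp (RNum 0))) search Skip ;;
        copy_labels nMid rMid nOld rOld ;; copy_labels nNew rNew nMid rMid) \<sigma>1
        (18 + (?cp + ((t_codes + 4) + (?cp + ?cp)))) ?Q"
    proof (rule does_Seq[OF load_types_correct[of _ s] _ order_refl])
      show "ncells \<sigma>1 nS 0 = s" by (simp add: \<sigma>1_def)
      fix \<sigma>2 assume f2: "frame load_types \<sigma>1 \<sigma>2" and l2: "loaded I s 6 \<sigma>2"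
      have ext2: "extends \<sigma> \<sigma>2" by (rule extends_trans[OF ext1 extends_frame[OF f2]]) simp
      have n2: "ncells \<sigma>2 = ncells \<sigma>1" using frame_ncells[OF f2] by (auto simp: fun_eq_iff)
      have r2: "rcells \<sigma>2 rOld = rcells \<sigma> rOld" "rcells \<sigma>2 rMid = rcells \<sigma> rMid"
        using frame_rcells[OF f2, of rOld] frame_rcells[OF f2, of rMid] by (simp_all add: \<sigma>1_def)
      have g2: "genv \<sigma>2" using genv_frame[OF f2] g by (simp add: genv_def \<sigma>1_def)
      show "does I \<epsilon> (copy_labels nOld rOld nNew rNew ;; Cond (RLess (RNum 0) (rate_exp (RNum 0))) search Skip ;;
          copy_labels nMid rMid nOld rOld ;; copy_labels nNew rNew nMid rMid) \<sigma>2 (?cp + ((t_codes + 4) + (?cp + ?cp))) ?Q"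
      proof (rule does_Seq[OF copy_labels_correct _ order_refl])
        fix \<sigma>3 assume f3: "frame (copy_labels nOld rOld nNew rNew) \<sigma>2 \<sigma>3"
          and c3: "\<forall>k\<le>C. rcells \<sigma>3 rNew k = rcells \<sigma>2 rOld k \<and> ncells \<sigma>3 nNew k = ncells \<sigma>2 nOld k"
        have ext3: "extends \<sigma> \<sigma>3" by (rule extends_trans[OF ext2 extends_frame[OF f3]]) simp
        have n3: "ncells \<sigma>3 nOld = ncells \<sigma> nOld" "ncells \<sigma>3 nMid = ncells \<sigma> nMid" "ncells \<sigma>3 nS 0 = s"
          using frame_ncells[OF f3, of nOld] frame_ncells[OF f3, of nMid] frame_ncells[OF f3, of nS]
          by (simp_all add: n2 \<sigma>1_def)
        have r3: "rcells \<sigma>3 rOld = rcells \<sigma> rOld" "rcells \<sigma>3 rMid = rcells \<sigma> rMid"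
          "rcells \<sigma>3 rA = rcells \<sigma>2 rA" "rcells \<sigma>3 rB = rcells \<sigma>2 rB"
          using frame_rcells[OF f3, of rOld] frame_rcells[OF f3, of rMid] frame_rcells[OF f3, of rA]
            frame_rcells[OF f3, of rB] r2 by simp_all
        have g3: "genv \<sigma>3" using genv_frame[OF f3] g2 by simp
        have l3: "loaded I s 6 \<sigma>3" using l2 n3 r3 by (simp add: loaded_def)
        have old3: "labels_ok nOld rOld s \<sigma>3" and mid3: "labels_ok nMid rMid (s + 1) \<sigma>3"
          using labels_ok_extends[OF old ext3] labels_ok_extends[OF mid ext3] n3 r3 by auto
        have new3: "labels_ok nNew rNew (s + 2) \<sigma>3"
          by (rule labels_ok_later, rule labels_ok_copy[OF old ext3]) (use c3 r2 n2 in \<open>auto simp: \<sigma>1_def\<close>)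
        have rate: "choice_rate (rcells \<sigma>3 rA) (rcells \<sigma>3 rB) = size_rate I s"
          using l3 by (intro walk_cong) (auto simp: loaded_def)
        let ?R = "\<lambda>\<sigma>'. extends \<sigma> \<sigma>' \<and> labels_ok nNew rNew (s + 2) \<sigma>' \<and>
          (\<forall>k\<le>C. \<forall>k'\<le>k. \<forall>t. attains s k' t \<longrightarrow> rcells \<sigma> rOld (k - k') + t \<le> rcells \<sigma>' rNew k)"
        have cond: "does I \<epsilon> (Cond (RLess (RNum 0) (rate_exp (RNum 0))) search Skip) \<sigma>3 (t_codes + 4) ?R"
        proof (cases "live_size I s")
          case True
          have "does I \<epsilon> search \<sigma>3 (t_codes + 3) ?R"
            by (rule does_mono[OF search_correct[OF s True g3 l3 old3 new3] order_refl])
               (use c3 r3 r2 extends_trans[OF ext3] in auto)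
          thus ?thesis using True live_iff_rate[OF s] rate by (simp add: numeral_eq_Suc)
        next
          case False
          have "?R \<sigma>3" using ext3 new3 c3 r2 False by (auto simp: attains_def)
          thus ?thesis using False live_iff_rate[OF s] rate by (simp add: numeral_eq_Suc)
        qed
        show "does I \<epsilon> (Cond (RLess (RNum 0) (rate_exp (RNum 0))) search Skip ;;
            copy_labels nMid rMid nOld rOld ;; copy_labels nNew rNew nMid rMid) \<sigma>3 ((t_codes + 4) + (?cp + ?cp)) ?Q"
        proof (rule does_Seq[OF cond _ order_refl])
          fix \<sigma>4 assume f4: "frame (Cond (RLess (RNum 0) (rate_exp (RNum 0))) search Skip) \<sigma>3 \<sigma>4" and R4: "?R \<sigma>4"
          have n4: "ncells \<sigma>4 nMid = ncells \<sigma> nMid" "ncells \<sigma>4 nS 0 = s"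
            using frame_ncells[OF f4, of nMid] frame_ncells[OF f4, of nS] n3 by simp_all
          have r4: "rcells \<sigma>4 rMid = rcells \<sigma> rMid" using frame_rcells[OF f4, of rMid] r3 by simp
          have g4: "genv \<sigma>4" using genv_frame[OF f4] g3 by simp
          have mid4: "labels_ok nMid rMid (s + 1) \<sigma>4"
            by (rule labels_ok_extends[OF mid]) (use R4 n4 r4 in auto)
          show "does I \<epsilon> (copy_labels nMid rMid nOld rOld ;; copy_labels nNew rNew nMid rMid) \<sigma>4 (?cp + ?cp) ?Q"
          proof (rule does_Seq[OF copy_labels_correct _ order_refl])
            fix \<sigma>5 assume f5: "frame (copy_labels nMid rMid nOld rOld) \<sigma>4 \<sigma>5"
              and c5: "\<forall>k\<le>C. rcells \<sigma>5 rOld k = rcells \<sigma>4 rMid k \<and> ncells \<sigma>5 nOld k = ncells \<sigma>4 nMid k"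
            have ext5: "extends \<sigma>4 \<sigma>5" by (rule extends_frame[OF f5]) simp
            have g5: "genv \<sigma>5" using genv_frame[OF f5] g4 by simp
            have old5: "labels_ok nOld rOld (s + 1) \<sigma>5" by (rule labels_ok_copy[OF mid4 ext5 c5])
            have n5: "ncells \<sigma>5 nNew = ncells \<sigma>4 nNew" "rcells \<sigma>5 rNew = rcells \<sigma>4 rNew" "ncells \<sigma>5 nS 0 = s"
              using frame_ncells[OF f5, of nNew] frame_rcells[OF f5, of rNew] frame_ncells[OF f5, of nS] n4 by simp_all
            have new5: "labels_ok nNew rNew (s + 2) \<sigma>5"
              by (rule labels_ok_extends[OF _ ext5]) (use R4 n5 in auto)
            show "does I \<epsilon> (copy_labels nNew rNew nMid rMid) \<sigma>5 ?cp ?Q"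
            proof (rule does_mono[OF copy_labels_correct order_refl])
              fix \<sigma>6 assume f6: "frame (copy_labels nNew rNew nMid rMid) \<sigma>5 \<sigma>6"
                and c6: "\<forall>k\<le>C. rcells \<sigma>6 rMid k = rcells \<sigma>5 rNew k \<and> ncells \<sigma>6 nMid k = ncells \<sigma>5 nNew k"
              have ext6: "extends \<sigma>5 \<sigma>6" by (rule extends_frame[OF f6]) simp
              have n6: "ncells \<sigma>6 nOld = ncells \<sigma>5 nOld" "rcells \<sigma>6 rOld = rcells \<sigma>5 rOld" "ncells \<sigma>6 nS 0 = s"
                using frame_ncells[OF f6, of nOld] frame_rcells[OF f6, of rOld] frame_ncells[OF f6, of nS] n5 by simp_all
              show "?Q \<sigma>6"
                using genv_frame[OF f6] g5 n6 labels_ok_extends[OF old5 ext6] labels_ok_copy[OF new5 ext6 c6] c5 c6 r4 n5 R4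
                by simp
            qed auto
          qed auto
        qed
      qed auto
    qed
  qed (simp add: t_size_def)
qed

text \<open>Excluding \<open>s\<close> itself matches \<open>sound_plan\<close>. At the end the
  classes for m + 1 and m + 2 partition all sizes.\<close>

definition targets :: "nat \<Rightarrow> nat set" where
  "targets s = {s' \<in> {1..m}. s' < s \<and> even (s' + s)}"

lemma targets_step:
  assumes "s \<in> {1..m}" shows "targets (s + 2) = insert s (targets s)" "s \<notin> targets s" "finite (targets s)"
proof -
  have "s' < s + 2 \<and> even (s' + s) \<longleftrightarrow> s' = s \<or> s' < s \<and> even (s' + s)" for s'
    by (cases "s' = s + 1") auto
  thus "targets (s + 2) = insert s (targets s)" using assms by (auto simp: targets_def)
qed (auto simp: targets_def)

text \<open>\<open>kk s\<close> units of capacity spent on size \<open>s\<close> earn \<open>tt s\<close>.\<close>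

definition bounds_plans :: "(nat \<Rightarrow> nat) \<Rightarrow> (nat \<Rightarrow> real) \<Rightarrow> nat \<Rightarrow> (nat \<Rightarrow> real) \<Rightarrow> bool" where
  "bounds_plans kk tt s val \<longleftrightarrow> (\<forall>k\<le>C. sum kk (targets s) \<le> k \<longrightarrow> sum tt (targets s) \<le> val k)"

definition ready :: "(nat \<Rightarrow> nat) \<Rightarrow> (nat \<Rightarrow> real) \<Rightarrow> nat \<Rightarrow> state \<Rightarrow> bool" where
  "ready kk tt j \<sigma> \<longleftrightarrow> ncells \<sigma> nS 0 = j \<and> genv \<sigma> \<and> labels_ok nOld rOld (j + 1) \<sigma> \<and> labels_ok nMid rMid (j + 2) \<sigma> \<and>
     bounds_plans kk tt (j + 1) (rcells \<sigma> rOld) \<and> bounds_plans kk tt (j + 2) (rcells \<sigma> rMid)"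

lemma sizes_correct:
  assumes attains: "\<And>s. s \<in> {1..m} \<Longrightarrow> attains s (kk s) (tt s)" and start: "ready kk tt 0 \<sigma>"
  shows "does I \<epsilon> (While (NLess (NV nS) NSizes) size_body) \<sigma> (m * (t_size + 1) + 1) (ready kk tt m)"
proof (rule does_loop[where Inv = "\<lambda>j \<sigma>'. ready kk tt j \<sigma>'" and N = m and c = t_size])
  fix j \<sigma>1 assume p: "ready kk tt j \<sigma>1" "j \<le> m" "frame size_body \<sigma> \<sigma>1" "bval I \<epsilon> \<sigma>1 (NLess (NV nS) NSizes)"
  hence j: "j < m" by (simp add: ready_def)
  have s: "j + 1 \<in> {1..m}" using j by simp
  have "does I \<epsilon> size_body \<sigma>1 t_size (ready kk tt (Suc j))"
  proof (rule does_mono[OF size_body_correct[OF s] order_refl])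
    show "genv \<sigma>1" "ncells \<sigma>1 nS 0 = j + 1 - 1" "labels_ok nOld rOld (j + 1) \<sigma>1" "labels_ok nMid rMid (j + 1 + 1) \<sigma>1"
      using p(1) by (simp_all add: ready_def)
    fix \<sigma>2 assume 2: "ncells \<sigma>2 nS 0 = j + 1 \<and> genv \<sigma>2 \<and> labels_ok nOld rOld (j + 1 + 1) \<sigma>2 \<and>
      labels_ok nMid rMid (j + 1 + 2) \<sigma>2 \<and> (\<forall>k\<le>C. rcells \<sigma>2 rOld k = rcells \<sigma>1 rMid k) \<and>
      (\<forall>k\<le>C. \<forall>k'\<le>k. \<forall>t. attains (j + 1) k' t \<longrightarrow> rcells \<sigma>1 rOld (k - k') + t \<le> rcells \<sigma>2 rMid k)"
    have "bounds_plans kk tt (j + 1 + 2) (rcells \<sigma>2 rMid)"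
      unfolding bounds_plans_def
    proof (intro allI impI)
      fix k assume k: "k \<le> C" "sum kk (targets (j + 1 + 2)) \<le> k"
      have kk: "kk (j + 1) + sum kk (targets (j + 1)) \<le> k" using k(2) targets_step[OF s] by simp
      have "rcells \<sigma>1 rOld (k - kk (j + 1)) + tt (j + 1) \<le> rcells \<sigma>2 rMid k"
        using 2 k(1) kk attains[OF s] by (meson add_leD1)
      moreover have "sum tt (targets (j + 1)) \<le> rcells \<sigma>1 rOld (k - kk (j + 1))"
        using p(1) k(1) kk unfolding ready_def bounds_plans_def by simp
      ultimately show "sum tt (targets (j + 1 + 2)) \<le> rcells \<sigma>2 rMid k" using targets_step[OF s] by simp
    qed
    moreover have "bounds_plans kk tt (j + 2) (rcells \<sigma>2 rOld)"
      using p(1) 2 by (simp add: ready_def bounds_plans_def)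
    ultimately show "ready kk tt (Suc j) \<sigma>2" using 2 unfolding ready_def by (simp add: numeral_eq_Suc)
  qed
  thus "j < m \<and> does I \<epsilon> size_body \<sigma>1 t_size (ready kk tt (Suc j))" using j by simp
next
  fix j \<sigma>1 assume "ready kk tt j \<sigma>1" "j \<le> m" "\<not> bval I \<epsilon> \<sigma>1 (NLess (NV nS) NSizes)"
  thus "ready kk tt m \<sigma>1" by (auto simp: ready_def)
qed (use start in simp_all)

lemma write_plan_correct:
  assumes r: "ready kk tt m \<sigma>" and st: "stock \<sigma> = (\<lambda>_. 0)"
  shows "does I \<epsilon> write_plan \<sigma> (3 * (n * m) + 3) (\<lambda>\<sigma>'. \<exists>s x. sound_plan s C x (stock \<sigma>') \<and>
    (\<forall>s\<in>{m + 1, m + 2}. sum kk (targets s) \<le> C \<longrightarrow> sum tt (targets s) \<le> x))"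
proof -
  obtain f1 f2 where f: "holds \<sigma> (ncells \<sigma> nOld C) f1" "sound_plan (m + 1) C (rcells \<sigma> rOld C) f1"
    "holds \<sigma> (ncells \<sigma> nMid C) f2" "sound_plan (m + 2) C (rcells \<sigma> rMid C) f2"
    using r unfolding ready_def labels_ok_def by blast
  have comp: "sum kk (targets (m + 1)) \<le> C \<longrightarrow> sum tt (targets (m + 1)) \<le> rcells \<sigma> rOld C"
    "sum kk (targets (m + 2)) \<le> C \<longrightarrow> sum tt (targets (m + 2)) \<le> rcells \<sigma> rMid C"
    using r by (auto simp: ready_def bounds_plans_def)
  obtain p f s x where p: "p = (if rcells \<sigma> rMid C < rcells \<sigma> rOld C then ncells \<sigma> nOld C else ncells \<sigma> nMid C)"
    "holds \<sigma> p f" "sound_plan s C x f" "rcells \<sigma> rOld C \<le> x" "rcells \<sigma> rMid C \<le> x"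
  proof (cases "rcells \<sigma> rMid C < rcells \<sigma> rOld C")
    case True
    thus ?thesis using that[of "ncells \<sigma> nOld C" f1 "m + 1" "rcells \<sigma> rOld C"] f by simp
  next
    case False
    thus ?thesis using that[of "ncells \<sigma> nMid C" f2 "m + 2" "rcells \<sigma> rMid C"] f by simp
  qed
  have supp: "{q. f q \<noteq> 0} \<subseteq> universe I" using p(3) by (auto simp: sound_plan_def)
  have fin: "finite {q. f q \<noteq> 0}" by (rule finite_subset[OF supp finite_universe[OF inst]])
  \<comment> \<open>A list without repeated products has at most n m nodes, which bounds the number
    of iterations.\<close>
  have "card {q. f q \<noteq> 0} \<le> card ({1..n} \<times> {1..m})"
  proof (rule card_mono)
    show "{q. f q \<noteq> 0} \<subseteq> {1..n} \<times> {1..m}"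
      using supp universe_size[OF inst] by (fastforce simp: universe_def)
  qed simp
  hence card: "card {q. f q \<noteq> 0} \<le> n * m" by simp
  define \<sigma>1 where "\<sigma>1 = \<sigma>\<lparr>ncells := (ncells \<sigma>)(nPtr := (ncells \<sigma> nPtr)(0 := p))\<rparr>"
  have first: "does I \<epsilon> (Cond (RLess (RCell rMid NCapacity) (RCell rOld NCapacity))
       (NSet nPtr (NCell nOld NCapacity)) (NSet nPtr (NCell nMid NCapacity))) \<sigma> 2 (\<lambda>\<sigma>'. \<sigma>' = \<sigma>1)"
    unfolding \<sigma>1_def p(1) by simp
  let ?pl = "plan (ncells \<sigma> nBase) (ncells \<sigma> nSize) (ncells \<sigma> nAmount) (ncells \<sigma> nNext)"
  \<comment> \<open>\<open>g\<close> is the part of the plan still to be written; laid over the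
    current stock it gives the whole plan.\<close>
  define Inv where "Inv = (\<lambda>j (\<sigma>' :: state). \<exists>g. ?pl (ncells \<sigma>' nPtr 0) g \<and> finite {q. g q \<noteq> 0} \<and>
    j + card {q. g q \<noteq> 0} \<le> n * m \<and> (\<forall>q. f q = (if g q \<noteq> 0 then g q else stock \<sigma>' q)))"
  have loop: "does I \<epsilon> (While (NLess (NLit 0) (NV nPtr))
       (SetStock (NCell nBase (NV nPtr)) (NCell nSize (NV nPtr)) (NCell nAmount (NV nPtr)) ;;
        NSet nPtr (NCell nNext (NV nPtr)))) \<sigma>1 (n * m * 3 + 1) (\<lambda>\<sigma>'. stock \<sigma>' = f)"
  proof (rule does_loop[where Inv = Inv and N = "n * m" and c = 2])
    show "Inv 0 \<sigma>1" using p(2) fin card st unfolding Inv_def \<sigma>1_def holds_def by (intro exI[of _ f]) auto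
  next
    fix j \<sigma>2 assume q: "Inv j \<sigma>2" "j \<le> n * m" "bval I \<epsilon> \<sigma>2 (NLess (NLit 0) (NV nPtr))" and
      fr: "frame (SetStock (NCell nBase (NV nPtr)) (NCell nSize (NV nPtr)) (NCell nAmount (NV nPtr)) ;;
        NSet nPtr (NCell nNext (NV nPtr))) \<sigma>1 \<sigma>2"
    have arr: "ncells \<sigma>2 nBase = ncells \<sigma> nBase" "ncells \<sigma>2 nSize = ncells \<sigma> nSize"
      "ncells \<sigma>2 nAmount = ncells \<sigma> nAmount" "ncells \<sigma>2 nNext = ncells \<sigma> nNext"
      using frame_ncells[OF fr, of nBase] frame_ncells[OF fr, of nSize] frame_ncells[OF fr, of nAmount]
        frame_ncells[OF fr, of nNext] by (simp_all add: \<sigma>1_def)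
    obtain g where g: "?pl (ncells \<sigma>2 nPtr 0) g" "finite {q. g q \<noteq> 0}" "j + card {q. g q \<noteq> 0} \<le> n * m"
      "\<forall>q. f q = (if g q \<noteq> 0 then g q else stock \<sigma>2 q)" using q(1) unfolding Inv_def by blast
    define P where "P = ncells \<sigma>2 nPtr 0"
    have "0 < P" using q(3) by (simp add: P_def)
    with g(1)[folded P_def] obtain g' where g': "?pl (ncells \<sigma> nNext P) g'" "g' (ncells \<sigma> nBase P, ncells \<sigma> nSize P) = 0"
      "0 < ncells \<sigma> nAmount P" "g = g'((ncells \<sigma> nBase P, ncells \<sigma> nSize P) := ncells \<sigma> nAmount P)"
      by (auto elim: plan.cases)
    have set: "{q. g q \<noteq> 0} = insert (ncells \<sigma> nBase P, ncells \<sigma> nSize P) {q. g' q \<noteq> 0}"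
      using g'(2-4) by auto
    hence fin': "finite {q. g' q \<noteq> 0}" using g(2) by simp
    hence "card {q. g q \<noteq> 0} = Suc (card {q. g' q \<noteq> 0})" unfolding set using g'(2) by simp
    hence cd: "Suc j + card {q. g' q \<noteq> 0} \<le> n * m" using g(3) by simp
    have "Inv (Suc j) (\<sigma>2\<lparr>stock := (stock \<sigma>2)((ncells \<sigma> nBase P, ncells \<sigma> nSize P) := ncells \<sigma> nAmount P),
        ncells := (ncells \<sigma>2)(nPtr := (ncells \<sigma>2 nPtr)(0 := ncells \<sigma> nNext P))\<rparr>)"
      unfolding Inv_def using g'(1) fin' cd g(4) g'(2-4) by (intro exI[of _ g']) auto
    moreover have "j < n * m" using cd by simp
    ultimately show "j < n * m \<and> does I \<epsilon> (SetStock (NCell nBase (NV nPtr)) (NCell nSize (NV nPtr)) (NCell nAmount (NV nPtr)) ;;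
        NSet nPtr (NCell nNext (NV nPtr))) \<sigma>2 2 (Inv (Suc j))"
      by (simp add: arr[simplified] P_def)
  next
    fix j \<sigma>2 assume q: "Inv j \<sigma>2" "\<not> bval I \<epsilon> \<sigma>2 (NLess (NLit 0) (NV nPtr))"
    then obtain g where g: "?pl 0 g" "\<forall>q. f q = (if g q \<noteq> 0 then g q else stock \<sigma>2 q)" by (auto simp: Inv_def)
    have "g = (\<lambda>_. 0)" using g(1) by (auto elim: plan.cases)
    thus "stock \<sigma>2 = f" using g(2) by (simp add: fun_eq_iff)
  qed simp
  show ?thesis unfolding write_plan_def
  proof (rule does_exact[OF first does_mono[OF loop order_refl]])
    fix \<sigma>' assume "stock \<sigma>' = f"
    thus "\<exists>s x. sound_plan s C x (stock \<sigma>') \<and>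
      (\<forall>s\<in>{m + 1, m + 2}. sum kk (targets s) \<le> C \<longrightarrow> sum tt (targets s) \<le> x)"
      using p(3-5) comp by (intro exI[of _ s] exI[of _ x]) auto
  qed simp
qed

lemma prepare_correct:
  assumes \<sigma>: "ncells \<sigma> = (\<lambda>_ _. 0)" "rcells \<sigma> = (\<lambda>_ _. 0)"
  shows "does I \<epsilon> prepare \<sigma> (6 * n + 3 * B + 10) (ready kk tt 0)"
proof -
  have targets0: "targets 1 = {}" "targets 2 = {}" by (auto simp: targets_def dest!: less_2_cases)
  have n1: "1 \<le> n" using n_pos by simp
  define Inv where "Inv = (\<lambda>k (\<sigma>' :: state). ncells \<sigma>' nI 0 = k + 1 \<and> k + 1 \<le> n \<and>
    rcells \<sigma>' rWmin 0 = Min (weight I ` {1..k + 1}) \<and> rcells \<sigma>' rWmax 0 = Max (weight I ` {1..k + 1}))"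
  define Inv2 where "Inv2 = (\<lambda>k (\<sigma>' :: state). rcells \<sigma>' rReach 0 = (1 + \<delta>) ^ k \<and> rcells \<sigma>' rCodes 0 = 2 ^ k \<and>
    (\<forall>k'<k. \<not> reach \<le> (1 + \<delta>) ^ k'))"
  define \<sigma>1 where "\<sigma>1 = \<sigma>\<lparr>rcells := (rcells \<sigma>)(rD := (rcells \<sigma> rD)(0 := \<delta>), rWmin := (rcells \<sigma> rWmin)(0 := weight I 1),
      rWmax := (rcells \<sigma> rWmax)(0 := weight I 1)),
    ncells := (ncells \<sigma>)(nI := (ncells \<sigma> nI)(0 := 1))\<rparr>"
  let ?body = "NSet nI (NAdd (NV nI) (NLit 1)) ;;
        Cond (RLess (RWeight (NV nI)) (RV rWmin)) (RSet rWmin (RWeight (NV nI))) Skip ;;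
        Cond (RLess (RV rWmax) (RWeight (NV nI))) (RSet rWmax (RWeight (NV nI))) Skip"
  have loop1: "does I \<epsilon> (While (NLess (NV nI) NBases) ?body) \<sigma>1 (6 * n + 1)
      (\<lambda>\<sigma>'. rcells \<sigma>' rWmin 0 = wmin \<and> rcells \<sigma>' rWmax 0 = wmax)"
  proof (rule does_loop[where Inv = Inv and N = n and c = 5])
    show "Inv 0 \<sigma>1" using n1 by (simp add: Inv_def \<sigma>1_def)
  next
    fix k \<sigma>2 assume p: "Inv k \<sigma>2" "k \<le> n" "frame ?body \<sigma>1 \<sigma>2" "bval I \<epsilon> \<sigma>2 (NLess (NV nI) NBases)"
    have k: "k + 1 < n" "ncells \<sigma>2 nI 0 = k + 1" using p(1,4) by (auto simp: Inv_def)
    have "{1..Suc (k + 1)} = insert (Suc (k + 1)) {1..k + 1}" by auto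
    hence mm: "Min (weight I ` {1..Suc (k + 1)}) = min (weight I (Suc (k + 1))) (Min (weight I ` {1..k + 1}))"
      "Max (weight I ` {1..Suc (k + 1)}) = max (weight I (Suc (k + 1))) (Max (weight I ` {1..k + 1}))"
      by simp_all
    have "does I \<epsilon> ?body \<sigma>2 5 (\<lambda>\<sigma>'. ncells \<sigma>' nI 0 = Suc (k + 1) \<and>
        rcells \<sigma>' rWmin 0 = min (weight I (Suc (k + 1))) (rcells \<sigma>2 rWmin 0) \<and>
        rcells \<sigma>' rWmax 0 = max (weight I (Suc (k + 1))) (rcells \<sigma>2 rWmax 0))"
      using k(2) by auto
    hence "does I \<epsilon> ?body \<sigma>2 5 (Inv (Suc k))"
    proof (rule does_mono[OF _ order_refl])
      fix \<sigma>3 :: state assume *: "ncells \<sigma>3 nI 0 = Suc (k + 1) \<and>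
        rcells \<sigma>3 rWmin 0 = min (weight I (Suc (k + 1))) (rcells \<sigma>2 rWmin 0) \<and>
        rcells \<sigma>3 rWmax 0 = max (weight I (Suc (k + 1))) (rcells \<sigma>2 rWmax 0)"
      have "rcells \<sigma>2 rWmin 0 = Min (weight I ` {1..k + 1})" "rcells \<sigma>2 rWmax 0 = Max (weight I ` {1..k + 1})"
        using p(1) unfolding Inv_def by blast+
      hence "rcells \<sigma>3 rWmin 0 = Min (weight I ` {1..Suc (k + 1)})"
        "rcells \<sigma>3 rWmax 0 = Max (weight I ` {1..Suc (k + 1)})" using * unfolding mm by metis+
      thus "Inv (Suc k) \<sigma>3" unfolding Inv_def using * k(1) by simp
    qed
    moreover have "k < n" using k by simp
    ultimately show "k < n \<and> does I \<epsilon> ?body \<sigma>2 5 (Inv (Suc k))" by blast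
  next
    fix k \<sigma>2 assume p: "Inv k \<sigma>2" "\<not> bval I \<epsilon> \<sigma>2 (NLess (NV nI) NBases)"
    hence "k + 1 = n" by (auto simp: Inv_def)
    thus "rcells \<sigma>2 rWmin 0 = wmin \<and> rcells \<sigma>2 rWmax 0 = wmax"
      using p(1) by (simp add: Inv_def wmin_def wmax_def)
  qed simp
  let ?grow = "RSet rReach (RMul (RV rReach) (RAdd (RNum 1) (RV rD))) ;; RSet rCodes (RMul (RNum 2) (RV rCodes))"
  let ?X = "RMul (RMul (RMul (RMul (RMul (RNum 4) (ROfNat NBases)) (ROfNat NBases)) (ROfNat NCapacity))
              (RDiv (RV rWmax) (RV rWmin))) (RDiv (RV rWmax) (RV rWmin))"
  have rest: "does I \<epsilon> (RSet rUnit (RDiv (RMul (RV rD) RHorizon) (ROfNat NBases)) ;; NSet nFree (NLit 1) ;;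
     RSet rReach (RNum 1) ;; RSet rCodes (RNum 1) ;; While (RLess (RV rReach) ?X) ?grow) \<sigma>2 (3 * B + 5) (ready kk tt 0)"
    if f2: "frame (While (NLess (NV nI) NBases) ?body) \<sigma>1 \<sigma>2"
      and w2: "rcells \<sigma>2 rWmin 0 = wmin \<and> rcells \<sigma>2 rWmax 0 = wmax" for \<sigma>2
  proof -
    have d2: "rcells \<sigma>2 rD 0 = \<delta>" using frame_rcells[OF f2, of rD] by (simp add: \<sigma>1_def)
    define \<sigma>3 where "\<sigma>3 = \<sigma>2\<lparr>ncells := (ncells \<sigma>2)(nFree := (ncells \<sigma>2 nFree)(0 := 1)),
      rcells := (rcells \<sigma>2)(rUnit := (rcells \<sigma>2 rUnit)(0 := tick), rReach := (rcells \<sigma>2 rReach)(0 := 1),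
        rCodes := (rcells \<sigma>2 rCodes)(0 := 1))\<rparr>"
    have z3: "ncells \<sigma>3 a k = 0" if "a \<in> {nS, nOld, nMid}" for a k
      using frame_ncells[OF f2, of a] that \<sigma> by (auto simp: \<sigma>1_def \<sigma>3_def)
    have zr3: "rcells \<sigma>3 a k = 0" if "a \<in> {rOld, rMid}" for a k
      using frame_rcells[OF f2, of a] that \<sigma> by (auto simp: \<sigma>1_def \<sigma>3_def)
    have "does I \<epsilon> (While (RLess (RV rReach) ?X) ?grow) \<sigma>3 (B * 3 + 1) (ready kk tt 0)"
    proof (rule does_loop[where Inv = Inv2 and N = B and c = 2])
      show "Inv2 0 \<sigma>3" by (simp add: Inv2_def \<sigma>3_def)
    next
      fix k \<sigma>4 assume p: "Inv2 k \<sigma>4" "k \<le> B" "frame ?grow \<sigma>3 \<sigma>4" "bval I \<epsilon> \<sigma>4 (RLess (RV rReach) ?X)"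
      have r4: "rcells \<sigma>4 rWmin 0 = wmin" "rcells \<sigma>4 rWmax 0 = wmax" "rcells \<sigma>4 rD 0 = \<delta>"
        using frame_rcells[OF p(3), of rWmin] frame_rcells[OF p(3), of rWmax] frame_rcells[OF p(3), of rD] w2 d2
        by (simp_all add: \<sigma>3_def)
      have lt: "(1 + \<delta>) ^ k < reach" using p(1,4) r4 by (simp add: Inv2_def reach_def)
      have "k \<noteq> B" using lt reach_le by auto
      hence "k < B" using p(2) by simp
      thus "k < B \<and> does I \<epsilon> ?grow \<sigma>4 2 (Inv2 (Suc k))"
        using p(1) r4 lt by (auto simp: Inv2_def less_Suc_eq mult.commute)
    next
      fix k \<sigma>4 assume p: "Inv2 k \<sigma>4" "k \<le> B" "frame ?grow \<sigma>3 \<sigma>4" "\<not> bval I \<epsilon> \<sigma>4 (RLess (RV rReach) ?X)"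
      have r4: "rcells \<sigma>4 rWmin 0 = wmin" "rcells \<sigma>4 rWmax 0 = wmax" "rcells \<sigma>4 rD 0 = \<delta>" "rcells \<sigma>4 rUnit 0 = tick"
        "rcells \<sigma>4 rOld = rcells \<sigma>3 rOld" "rcells \<sigma>4 rMid = rcells \<sigma>3 rMid"
        using frame_rcells[OF p(3), of rWmin] frame_rcells[OF p(3), of rWmax] frame_rcells[OF p(3), of rD]
          frame_rcells[OF p(3), of rUnit] frame_rcells[OF p(3), of rOld] frame_rcells[OF p(3), of rMid] w2 d2
        by (simp_all add: \<sigma>3_def)
      have n4: "ncells \<sigma>4 = ncells \<sigma>3" using frame_ncells[OF p(3)] by (auto simp: fun_eq_iff)
      have "reach \<le> (1 + \<delta>) ^ k" "\<forall>k'<k. \<not> reach \<le> (1 + \<delta>) ^ k'"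
        using p(1,4) r4 by (simp_all add: Inv2_def reach_def)
      hence "B = k" unfolding B_def by (intro Least_equality) (auto simp: not_less[symmetric])
      hence g4: "genv \<sigma>4" using p(1) r4 by (simp add: genv_def Inv2_def)
      have "holds \<sigma>4 0 (\<lambda>_. 0)" by (simp add: holds_def n4 \<sigma>3_def plan.plan_nil)
      thus "ready kk tt 0 \<sigma>4" using g4 z3 zr3 sound_plan_zero targets0 targets0(2)[unfolded numeral_2_eq_2]
        by (auto simp: ready_def labels_ok_def n4 r4 bounds_plans_def)
    qed simp
    thus ?thesis by (simp add: \<sigma>3_def d2[simplified] tick_def mult.commute)
  qed
  show ?thesis unfolding prepare_def
  proof (rule does_Seq_prim(3)[THEN iffD2], intro conjI)
    have "does I \<epsilon> (While (NLess (NV nI) NBases) ?body ;; (RSet rUnit (RDiv (RMul (RV rD) RHorizon) (ROfNat NBases)) ;; NSet nFree (NLit 1) ;;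
     RSet rReach (RNum 1) ;; RSet rCodes (RNum 1) ;; While (RLess (RV rReach) ?X) ?grow)) \<sigma>1 (6 + (6 * n + 3 * B)) (ready kk tt 0)"
      by (rule does_Seq[OF loop1 rest]) auto
    thus "does I \<epsilon> (RSet rWmin (RWeight (NLit 1)) ;; RSet rWmax (RWeight (NLit 1)) ;; NSet nI (NLit 1) ;;
      While (NLess (NV nI) NBases) ?body ;; (RSet rUnit (RDiv (RMul (RV rD) RHorizon) (ROfNat NBases)) ;; NSet nFree (NLit 1) ;;
     RSet rReach (RNum 1) ;; RSet rCodes (RNum 1) ;; While (RLess (RV rReach) ?X) ?grow))
      (\<sigma>\<lparr>rcells := (rcells \<sigma>)(rD := (rcells \<sigma> rD)(nval I \<sigma> (NLit 0) := rval I \<epsilon> \<sigma> (RDiv REps (RNum 16))))\<rparr>)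
      (6 * n + 3 * B + 10 - 1) (ready kk tt 0)"
      by (simp add: \<sigma>1_def \<delta>_def)
  qed simp
qed

definition "t_main = (6 * n + 3 * B + 10) + ((m * (t_size + 1) + 1) + (3 * (n * m) + 3)) + 1"

lemma plan_stock_correct:
  assumes attains: "\<And>s. s \<in> {1..m} \<Longrightarrow> attains s (kk s) (tt s)"
  shows "does I \<epsilon> plan_stock init_state t_main (\<lambda>\<sigma>. \<exists>s x. sound_plan s C x (stock \<sigma>) \<and>
    (\<forall>s\<in>{m + 1, m + 2}. sum kk (targets s) \<le> C \<longrightarrow> sum tt (targets s) \<le> x))"
    (is "does _ _ _ _ _ ?Q")
proof -
  have "does I \<epsilon> (prepare ;; While (NLess (NV nS) NSizes) size_body ;; write_plan) init_state
      ((6 * n + 3 * B + 10) + ((m * (t_size + 1) + 1) + (3 * (n * m) + 3))) ?Q"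
  proof (rule does_Seq[OF prepare_correct[of init_state kk tt] _ order_refl])
    fix \<sigma>1 assume f1: "frame prepare init_state \<sigma>1" and r1: "ready kk tt 0 \<sigma>1"
    have s1: "stock \<sigma>1 = (\<lambda>_. 0)" using frame_stock[OF f1] by (simp add: prepare_def init_state_def)
    show "does I \<epsilon> (While (NLess (NV nS) NSizes) size_body ;; write_plan) \<sigma>1
        ((m * (t_size + 1) + 1) + (3 * (n * m) + 3)) ?Q"
    proof (rule does_Seq[OF sizes_correct[OF attains r1] _ order_refl])
      fix \<sigma>2 assume f2: "frame (While (NLess (NV nS) NSizes) size_body) \<sigma>1 \<sigma>2" and r2: "ready kk tt m \<sigma>2"
      have "stock \<sigma>2 = (\<lambda>_. 0)" using frame_stock[OF f2] s1 by simp
      thus "does I \<epsilon> write_plan \<sigma>2 (3 * (n * m) + 3) ?Q" by (rule write_plan_correct[OF r2])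
    qed
  qed (simp_all add: init_state_def)
  thus ?thesis unfolding plan_stock_def t_main_def using eps horizon_pos capacity_pos by simp
qed

section \<open>The approximation guarantee\<close>

lemma ratio_ge_1: "1 \<le> wmax / wmin"
  using weights_pos by simp

text \<open>Completeness: a stock whose duration leaves a slack of 3 \<delta> T fits the budget of
  some code. The factor (1 + \<delta>)^2 of the staircase uses up to 2 \<delta> T of the slack,
  rounding the prices up the rest. Gains are counted up to \<open>send s q\<close>, which may
  precede the true end by a factor 1 + \<delta>.\<close>

lemma encode_plan:
  fixes c :: "nat \<Rightarrow> nat"
  assumes s: "s \<in> {1..m}" and alive: "live_size I s" and c: "\<And>i. c i \<noteq> 0 \<Longrightarrow> i \<in> bases_of I s"
    and cap: "sum c (bases_of I s) \<le> C" and c0: "sum c (bases_of I s) \<noteq> 0"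
    and \<tau>: "0 \<le> \<tau>" "size_duration I s (\<lambda>i. real (c i)) \<tau> \<le> (1 - 3 * \<delta>) * T"
  shows "\<exists>t. attains s (sum c (bases_of I s)) t \<and> size_value I s c \<tau> \<le> (1 + \<delta>) * t"
proof -
  interpret single_size "bases_of I s" "weight I" "type_a I s" "type_b I s"
    by (rule single_size_live[OF inst s alive])
  let ?X = "bases_of I s" let ?c = "\<lambda>i. real (c i)" let ?w = "weight I"
  have nw: "0 < real n * wmax" using n_pos weights_pos by simp
  have wr: "wmin \<le> ?w i" "?w i \<le> wmax" "0 < ?w i" if "i \<in> ?X" for i
    using weight_range[of i] weight_bases_pos[OF inst that] that by (auto simp: bases_of_def)
  have c_le: "c i \<le> C" if "i \<in> ?X" for i
    using member_le_sum[OF that _ finite_bases_of, of c] cap by simp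
  have lw_le: "lw ?c \<theta> \<le> real n * wmax" for \<theta>
  proof -
    have "lw ?c \<theta> \<le> (\<Sum>i\<in>?X. wmax)"
      unfolding live_weight_def by (rule sum_mono) (use wr weights_pos in auto)
    also have "\<dots> = real (card ?X) * wmax" by simp
    also have "\<dots> \<le> real n * wmax"
    proof (rule mult_right_mono)
      have "card ?X \<le> card {1..n}" by (rule card_mono) (auto simp: bases_of_def)
      thus "real (card ?X) \<le> real n" by simp
    qed (use weights_pos in simp)
    finally show ?thesis .
  qed
  have first: "0 < first s" "first s \<le> 1 / wmax" "first s \<le> T / 2 * rate (real n * wmax)"
    using rate_pos[of "real n * wmax"] nw weights_pos horizon_pos by (auto simp: first_def)
  define D where "D = (\<lambda>i. ?c i / ?w i) ` ?X"
  have finD: "finite D" using finite_bases_of by (simp add: D_def)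
  obtain i0 where i0: "i0 \<in> ?X" "c i0 \<noteq> 0" using c0 by (auto simp: sum_eq_0_iff finite_bases_of)
  have "Max D \<in> D" using finD i0 by (intro Max_in) (auto simp: D_def)
  then obtain j where j: "j \<in> ?X" "Max D = ?c j / ?w j" by (auto simp: D_def)
  have le_Max: "?c i / ?w i \<le> Max D" if "i \<in> ?X" for i
    using finD that by (intro Max_ge) (auto simp: D_def)
  have "1 / wmax \<le> ?c i0 / ?w i0" using wr[OF i0(1)] i0(2) by (intro frac_le) auto
  hence Max_ge: "1 / wmax \<le> Max D" using le_Max[OF i0(1)] by simp
  \<comment> \<open>The end of the path is moved up to the end of the first cell, which takes at
    most half of the horizon, and then back to the last sell-out, because the levels of a staircase
    must stay positive. Neither change loses sales.\<close>
  define \<tau>1 where "\<tau>1 = max \<tau> (first s)"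
  define \<tau>2 where "\<tau>2 = min \<tau>1 (Max D)"
  have \<tau>2: "first s \<le> \<tau>2" "0 < \<tau>2" using first Max_ge by (auto simp: \<tau>2_def \<tau>1_def)
  have dur1: "dur ?c \<tau>1 \<le> (1 - 3 * \<delta>) * T"
  proof (cases "first s \<le> \<tau>")
    case True
    thus ?thesis using \<tau> by (simp add: \<tau>1_def)
  next
    case False
    have "dur ?c (first s) \<le> first s * pace (real n * wmax)"
      by (rule duration_le_const) (use first nw lw_le in auto)
    also have "\<dots> \<le> T / 2 * rate (real n * wmax) * pace (real n * wmax)"
      using first(3) pace_pos[of "real n * wmax"] nw by (intro mult_right_mono) auto
    also have "\<dots> = T / 2" using rate_pos[of "real n * wmax"] nw by simp
    also have "\<dots> \<le> (1 - 3 * \<delta>) * T" using \<delta>_pos horizon_pos by (simp add: mult_right_mono)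
    finally show ?thesis using False by (simp add: \<tau>1_def)
  qed
  have dur2: "dur ?c \<tau>2 \<le> (1 - 3 * \<delta>) * T"
    using duration_mono[of \<tau>2 \<tau>1 ?c] \<tau>2 dur1 by (simp add: \<tau>2_def)
  have val2: "size_value I s c \<tau> \<le> size_value I s c \<tau>2"
    unfolding size_value_def
  proof (intro sum_mono mult_left_mono revenue_bases_nonneg[OF inst])
    fix i assume i: "i \<in> ?X"
    have "?c i \<le> ?w i * Max D" using le_Max[OF i] wr[OF i] by (simp add: divide_simps mult.commute)
    moreover have "?w i * \<tau> \<le> ?w i * \<tau>1" using wr[OF i] by (intro mult_left_mono) (auto simp: \<tau>1_def)
    moreover have "?w i * \<tau>2 = min (?w i * \<tau>1) (?w i * Max D)"
      using wr[OF i] by (simp add: \<tau>2_def min_mult_distrib_left)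
    ultimately show "min (?c i) (?w i * \<tau>) \<le> min (?c i) (?w i * \<tau>2)" by linarith
  qed auto
  \<comment> \<open>The base that sells out last is alive all the time before \<tau>2.\<close>
  have lw_ge: "wmin \<le> lw ?c \<theta>" if "\<theta> < \<tau>2" for \<theta>
  proof -
    have "\<theta> < ?c j / ?w j" using that j by (simp add: \<tau>2_def)
    hence "?w j * \<theta> < ?c j" using wr[OF j(1)] by (simp add: pos_less_divide_eq mult.commute)
    hence "?w j \<le> lw ?c \<theta>" unfolding live_weight_def
      using member_le_sum[OF j(1), of "\<lambda>i. if ?w i * \<theta> < ?c i then ?w i else 0"] wr
      by (auto simp: finite_bases_of less_imp_le split: if_splits)
    thus ?thesis using wr(1)[OF j(1)] by simp
  qed
  \<comment> \<open>A stocked base has at least one unit and is sold at speed at most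
    \<open>wmax\<close>.\<close>
  have flat: "lw ?c 0 \<le> lw ?c \<theta>" if "\<theta> < first s" for \<theta>
  proof (rule lw_mono)
    fix i assume i: "i \<in> ?X" "?w i * 0 < ?c i"
    have "\<theta> < 1 / wmax" using that first by simp
    hence "?w i * \<theta> < ?w i * (1 / wmax)" using wr(3)[OF i(1)] by (rule mult_strict_left_mono)
    also have "\<dots> \<le> 1" using wr[OF i(1)] weights_pos by simp
    also have "1 \<le> ?c i" using i(2) by simp
    finally show "?w i * \<theta> < ?c i" .
  qed
  let ?\<Delta> = "wmax / wmin"
  \<comment> \<open>If the first cell has length 1 / \<open>wmax\<close>, the bound C /
    \<open>wmin\<close> on \<tau>2 suffices. Otherwise its length is proportional to T, and so is a
    bound on \<tau>2: \<tau>2 <= T * \<open>rate wmin\<close>, as the live weight stays above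
    \<open>wmin\<close>, and monotone throughput compares this rate with the one at n *
    \<open>wmax\<close>.\<close>
  have ratio: "\<tau>2 / first s \<le> 2 * real n * real C * ?\<Delta>"
  proof -
    have nC: "1 \<le> real n" "1 \<le> real C" using n_pos capacity_pos by auto
    have \<tau>2_le: "\<tau>2 \<le> real C / wmin"
    proof -
      have "\<tau>2 \<le> ?c j / ?w j" using j by (simp add: \<tau>2_def)
      also have "\<dots> \<le> real C / wmin" using c_le[OF j(1)] wr[OF j(1)] weights_pos by (intro frac_le) auto
      finally show ?thesis .
    qed
    have "\<tau>2 * pace wmin \<le> dur ?c \<tau>2"
      by (rule duration_ge_const) (use \<tau>2 weights_pos lw_ge in auto)
    also note dur2
    also have "(1 - 3 * \<delta>) * T \<le> 1 * T" by (rule mult_right_mono) (use \<delta>_pos horizon_pos in auto)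
    finally have \<tau>2_rate: "\<tau>2 \<le> T * rate wmin" using rate_pos[of wmin] weights_pos by (simp add: divide_simps)
    have thr: "wmin * rate wmin \<le> real n * wmax * rate (real n * wmax)"
    proof (rule throughput_mono)
      have "1 * wmin \<le> real n * wmax" using nC weights_pos by (intro mult_mono) auto
      thus "wmin \<le> real n * wmax" by simp
    qed (use weights_pos in simp)
    show ?thesis
    proof (cases "first s = 1 / wmax")
      case True
      have "\<tau>2 / first s \<le> real C / wmin * wmax"
        using mult_right_mono[OF \<tau>2_le, of wmax] True weights_pos by simp
      also have "\<dots> = 1 * (real C * ?\<Delta>)" by simp
      also have "1 * (real C * ?\<Delta>) \<le> (2 * real n) * (real C * ?\<Delta>)"
        using nC ratio_ge_1 by (intro mult_right_mono mult_nonneg_nonneg) auto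
      finally show ?thesis by (simp add: mult.assoc)
    next
      case False
      hence f: "first s = T / 2 * rate (real n * wmax)" by (auto simp: first_def min_def)
      have "wmin * \<tau>2 \<le> T * (wmin * rate wmin)"
        using mult_left_mono[OF \<tau>2_rate, of wmin] weights_pos by (simp add: mult.left_commute)
      also have "\<dots> \<le> T * (real n * wmax * rate (real n * wmax))"
        using thr horizon_pos by (intro mult_left_mono) auto
      also have "\<dots> = 2 * real n * wmax * first s" by (simp add: f)
      finally have "wmin * \<tau>2 \<le> 2 * real n * wmax * first s" .
      hence "\<tau>2 / first s \<le> 2 * real n * ?\<Delta>"
        using first(1) weights_pos by (simp add: divide_simps mult.commute)
      hence "\<tau>2 / first s \<le> 1 * (2 * real n * ?\<Delta>)" by simp
      also have "\<dots> \<le> real C * (2 * real n * ?\<Delta>)"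
        using nC ratio_ge_1 by (intro mult_right_mono mult_nonneg_nonneg) auto
      finally show ?thesis by (simp add: mult_ac)
    qed
  qed
  \<comment> \<open>The first factor is the range of the levels, the second that of the grid; 1 +
    \<delta> <= 2 and the 2 in \<open>ratio\<close> make up the 4 in \<open>reach\<close>.\<close>
  have reach: "real n * wmax / wmin * ((1 + \<delta>) * \<tau>2 / first s) \<le> (1 + \<delta>) ^ B"
  proof -
    have "real n * wmax / wmin * ((1 + \<delta>) * \<tau>2 / first s) = (1 + \<delta>) * (real n * ?\<Delta> * (\<tau>2 / first s))" by simp
    also have "\<dots> \<le> 2 * (real n * ?\<Delta> * (2 * real n * real C * ?\<Delta>))"
      using \<delta>_pos ratio ratio_ge_1 \<tau>2 first(1) by (intro mult_mono mult_left_mono mult_nonneg_nonneg) auto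
    also have "\<dots> = reach" by (simp add: reach_def mult_ac)
    finally show ?thesis using reach_le by simp
  qed
  obtain bs where bs: "length bs = B" "\<tau>2 \<le> (1 + \<delta>) * walk_end \<delta> bs 0 (first s)"
    "walk_const (type_a I s) (type_b I s) \<delta> bs 0 (first s) (real n * wmax) +
      (\<Sum>i\<in>?X. ?w i * walk_price (type_a I s) (type_b I s) \<delta> bs 0 (first s) (real n * wmax) (?c i / ?w i)) \<le>
     (1 + \<delta>)\<^sup>2 * dur ?c \<tau>2"
    using walk_exists[OF \<delta>_pos(1) weights_pos(1) lw_ge first(1) \<tau>2(1) flat lw_le reach] by blast
  obtain q where q: "q < 2 ^ B" "bits B q = bs" using bits_surj[of bs] bs(1) by auto
  let ?p = "\<lambda>i. ?w i * sprice s q (?c i / ?w i)"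
  have total: "sconst s q + (\<Sum>i\<in>?X. ?p i) \<le> (1 - \<delta>) * T"
  proof -
    have "sconst s q + (\<Sum>i\<in>?X. ?p i) \<le> (1 + \<delta>)\<^sup>2 * dur ?c \<tau>2" using bs(3) by (simp add: sconst_def sprice_def q)
    also have "\<dots> \<le> (1 + \<delta>)\<^sup>2 * ((1 - 3 * \<delta>) * T)" using dur2 by (intro mult_left_mono) auto
    also have "\<dots> = ((1 + \<delta>)\<^sup>2 * (1 - 3 * \<delta>)) * T" by simp
    also have "\<dots> \<le> (1 - \<delta>) * T"
    proof (rule mult_right_mono)
      have "(1 + \<delta>)\<^sup>2 * (1 - 3 * \<delta>) = (1 - \<delta>) - (5 * \<delta>\<^sup>2 + 3 * \<delta> * \<delta>\<^sup>2)"
        by (simp add: power2_eq_square algebra_simps)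
      moreover have "0 \<le> 5 * \<delta>\<^sup>2 + 3 * \<delta> * \<delta>\<^sup>2" using \<delta>_pos by simp
      ultimately show "(1 + \<delta>)\<^sup>2 * (1 - 3 * \<delta>) \<le> 1 - \<delta>" by linarith
    qed (use horizon_pos in simp)
    finally show ?thesis .
  qed
  have p0: "0 \<le> ?p i" if "i \<in> ?X" for i
    unfolding sprice_def using walk_price_nonneg[of 0 "first s" \<delta>] wr[OF that] first \<delta>_pos
    by (intro mult_nonneg_nonneg) auto
  have const_le: "sconst s q \<le> (1 - \<delta>) * T" using total sum_nonneg[of ?X ?p] p0 by simp
  also have "\<dots> \<le> 1 * T" by (rule mult_right_mono) (use \<delta>_pos horizon_pos in simp_all)
  finally have const_T: "sconst s q \<le> T" by simp
  have cost_le: "real (cost s q i (c i)) * tick \<le> ?p i + tick" if i: "i \<in> ?X" for i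
  proof (cases "c i = 0")
    case False
    define e where "e = nat \<lceil>?p i / tick\<rceil>"
    have e: "?p i / tick \<le> real e" "real e \<le> ?p i / tick + 1"
      using p0[OF i] tick_pos unfolding e_def by (simp_all add: of_nat_nat real_nat_ceiling_ge)
    have "?p i \<le> real e * tick" using e(1) tick_pos by (simp add: divide_simps)
    hence "cost s q i (c i) \<le> e" using False units_le by (simp add: cost_def)
    hence "real (cost s q i (c i)) * tick \<le> (?p i / tick + 1) * tick"
      using e(2) tick_pos by (intro mult_right_mono) auto
    thus ?thesis using tick_pos by (simp add: distrib_right)
  qed (use p0[OF i] tick_pos in \<open>simp add: cost_0\<close>)
  have "real (\<Sum>i\<in>?X. cost s q i (c i)) * tick \<le> (\<Sum>i\<in>?X. ?p i + tick)"
    unfolding of_nat_sum sum_distrib_right by (intro sum_mono cost_le)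
  also have "\<dots> \<le> (\<Sum>i\<in>?X. ?p i) + real n * tick"
  proof -
    have "card ?X \<le> card {1..n}" by (rule card_mono) (auto simp: bases_of_def)
    thus ?thesis using tick_pos by (simp add: sum.distrib mult_right_mono)
  qed
  also have "real n * tick = \<delta> * T" using n_pos by (simp add: tick_def)
  also have "(\<Sum>i\<in>?X. ?p i) + \<delta> * T \<le> T - sconst s q" using total by (simp add: algebra_simps)
  also have "\<dots> < (real (sbudget s q) + 1) * tick"
    using sbudget(3)[OF sconst_nonneg[OF s alive] const_T] by simp
  finally have "real (\<Sum>i\<in>?X. cost s q i (c i)) < real (sbudget s q) + 1"
    using tick_pos by (simp only: mult_less_cancel_right_pos)
  hence costs: "(\<Sum>i\<in>?X. cost s q i (c i)) \<le> sbudget s q" by linarith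
  have "size_value I s c \<tau>2 \<le> (1 + \<delta>) * (\<Sum>i\<in>?X. gain s q i (c i))"
    unfolding size_value_def sum_distrib_left
  proof (rule sum_mono)
    fix i assume i: "i \<in> ?X"
    have "?w i * \<tau>2 \<le> (1 + \<delta>) * (?w i * send s q)"
      using mult_left_mono[OF bs(2), of "?w i"] wr[OF i] by (simp add: send_def q mult.left_commute)
    moreover have "?c i \<le> (1 + \<delta>) * ?c i" using \<delta>_pos mult_right_mono[of 1 "1 + \<delta>" "?c i"] by simp
    ultimately have "min (?c i) (?w i * \<tau>2) \<le> (1 + \<delta>) * min (?c i) (?w i * send s q)"
      using \<delta>_pos by (simp add: min_mult_distrib_left min_le_iff_disj)
    from mult_left_mono[OF this revenue_bases_nonneg[OF inst i]]
    show "revenue I i * min (?c i) (?w i * \<tau>2) \<le> (1 + \<delta>) * gain s q i (c i)"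
      by (simp add: gain_def mult_ac)
  qed
  moreover have "attains s (sum c ?X) (\<Sum>i\<in>?X. gain s q i (c i))"
    unfolding attains_def using alive q(1) const_T c costs by blast
  ultimately show ?thesis using val2 by (meson order_trans)
qed

text \<open>Shortening the horizon by the fraction 3 \<delta> creates the slack for
  \<open>encode_plan\<close>; what remains is (1 - 14 \<delta>) / (1 + \<delta>), which is at least
  1 - 32 \<delta> = 1 - 2 \<epsilon>.\<close>

lemma achievable:
  fixes c :: "nat \<Rightarrow> nat"
  assumes s: "s \<in> {1..m}" and alive: "live_size I s" and cap: "sum c (bases_of I s) \<le> C"
    and \<tau>: "0 \<le> \<tau>" "size_duration I s (\<lambda>i. real (c i)) \<tau> \<le> T"
  shows "\<exists>k t. attains s k t \<and> k \<le> sum c (bases_of I s) \<and> (1 - 2 * \<epsilon>) * size_value I s c \<tau> \<le> t"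
proof -
  interpret single_size "bases_of I s" "weight I" "type_a I s" "type_b I s"
    by (rule single_size_live[OF inst s alive])
  let ?X = "bases_of I s"
  define M where "M = (1 - 3 * \<delta>) / (3 * \<delta>)"
  have M: "0 < M" using \<delta>_pos by (simp add: M_def)
  have nonneg: "0 \<le> size_value I s c' \<tau>'" if "0 \<le> \<tau>'" for c' \<tau>'
    unfolding size_value_def
    using revenue_bases_nonneg[OF inst] weight_bases_pos[OF inst] that by (intro sum_nonneg mult_nonneg_nonneg) (auto simp: less_imp_le)
  have small: "4 / M \<le> 14 * \<delta>"
  proof -
    have "14 * \<delta> * (3 * \<delta>) \<le> 14 * \<delta> * (3 / 32)" using \<delta>_pos by (intro mult_left_mono) auto
    hence "12 * \<delta> \<le> 14 * \<delta> * (1 - 3 * \<delta>)" using \<delta>_pos by (simp add: right_diff_distrib)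
    thus ?thesis using \<delta>_pos by (simp add: M_def divide_simps)
  qed
  obtain c' \<tau>' where c': "sum c' ?X \<le> sum c ?X" "0 \<le> \<tau>'" "dur (\<lambda>i. real (c' i)) \<tau>' \<le> (1 - 3 * \<delta>) * T"
    "(1 - 4 / M) * size_value I s c \<tau> \<le> size_value I s c' \<tau>'"
    using shorter_horizon[of "3 * \<delta>" T "revenue I" \<tau> c] \<delta>_pos horizon_pos \<tau> revenue_bases_nonneg[OF inst]
    unfolding M_def size_value_def by auto
  \<comment> \<open>\<open>attains\<close> speaks about stocks that vanish outside the bases of the
    size.\<close>
  define c'' where "c'' = (\<lambda>i. if i \<in> ?X then c' i else 0)"
  have same: "sum c'' ?X = sum c' ?X" "size_value I s c'' \<tau>' = size_value I s c' \<tau>'"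
    by (auto simp: c''_def size_value_def intro!: sum.cong)
  have "lw (\<lambda>i. real (c'' i)) \<theta> = lw (\<lambda>i. real (c' i)) \<theta>" for \<theta>
    by (auto simp: c''_def live_weight_def intro!: sum.cong)
  hence dur'': "dur (\<lambda>i. real (c'' i)) \<tau>' \<le> (1 - 3 * \<delta>) * T" using c'(3) by (simp add: duration_def)
  show ?thesis
  proof (cases "sum c' ?X = 0")
    \<comment> \<open>An empty stock earns 0, which forces the given value to be 0 as well; then the
      trivial pair is good enough.\<close>
    case True
    hence "\<forall>i\<in>?X. c' i = 0" by (simp add: finite_bases_of)
    hence "size_value I s c' \<tau>' = 0"
      using c'(2) weight_bases_pos[OF inst] unfolding size_value_def
      by (intro sum.neutral) (auto simp: min_def less_imp_le not_le mult_less_0_iff)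
    hence "(1 - 4 / M) * size_value I s c \<tau> \<le> 0" using c'(4) by simp
    moreover have "0 < 1 - 4 / M" using small \<delta>_pos by simp
    ultimately have "size_value I s c \<tau> = 0" using nonneg[OF \<tau>(1), of c] by (simp add: mult_le_0_iff)
    thus ?thesis by (intro exI[of _ 0]) (simp add: attains_def)
  next
    case False
    have "\<exists>t. attains s (sum c'' ?X) t \<and> size_value I s c'' \<tau>' \<le> (1 + \<delta>) * t"
      by (rule encode_plan[OF s alive _ _ _ c'(2) dur''])
         (use same False c'(1) cap in \<open>auto simp: c''_def split: if_splits\<close>)
    then obtain t where t: "attains s (sum c' ?X) t" "size_value I s c' \<tau>' \<le> (1 + \<delta>) * t" using same by auto
    have "(1 + \<delta>) * (1 - 2 * \<epsilon>) \<le> 1 - 4 / M"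
    proof -
      have "(1 + \<delta>) * (1 - 32 * \<delta>) = 1 - 31 * \<delta> - 32 * \<delta>\<^sup>2" by (simp add: algebra_simps power2_eq_square)
      hence "(1 + \<delta>) * (1 - 32 * \<delta>) \<le> 1 - 14 * \<delta>" using \<delta>_pos zero_le_power2[of \<delta>] by linarith
      moreover have "32 * \<delta> = 2 * \<epsilon>" by (simp add: \<delta>_def)
      ultimately show ?thesis using small by simp
    qed
    from mult_right_mono[OF this nonneg[OF \<tau>(1), of c]]
    have "(1 + \<delta>) * ((1 - 2 * \<epsilon>) * size_value I s c \<tau>) \<le> (1 + \<delta>) * t" using c'(4) t(2) by simp
    hence "(1 - 2 * \<epsilon>) * size_value I s c \<tau> \<le> t" using \<delta>_pos by (simp only: mult_le_cancel_left_pos)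
    thus ?thesis using t(1) c'(1) by blast
  qed
qed

lemma sound_plan_revenue:
  assumes "sound_plan s C x f" shows "f \<in> feasible I" "x \<le> fluid_revenue I f"
proof -
  obtain v where v: "x = (\<Sum>s'=1..m. v s')" "\<And>s'. s' \<in> {1..m} \<Longrightarrow> v s' = 0 \<or> (s' < s \<and> even (s' + s) \<and> live_size I s' \<and>
       (\<exists>\<tau>\<ge>0. size_duration I s' (\<lambda>i. real (f (i, s'))) \<tau> \<le> T \<and> v s' = size_value I s' (\<lambda>i. f (i, s')) \<tau>))"
    and supp: "\<And>p. f p \<noteq> 0 \<Longrightarrow> p \<in> universe I \<and> snd p < s \<and> even (snd p + s)" and cap: "sum f (universe I) \<le> C"
    using assms unfolding sound_plan_def by blast
  show "f \<in> feasible I" using supp cap unfolding feasible_def by blast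
  show "x \<le> fluid_revenue I f" unfolding v(1)
  proof (rule fluid_revenue_ge[OF inst, where ?s0.0 = s])
    show "even (snd p + s)" if "0 < f p" for p using supp[of p] that by simp
    show "v s' \<le> 0 \<or> even (s' + s) \<and> live_size I s' \<and> (\<exists>\<tau>\<ge>0. size_duration I s' (\<lambda>i. real (f (i, s'))) \<tau> \<le> T \<and>
        v s' \<le> size_value I s' (\<lambda>i. f (i, s')) \<tau>)" if "s' \<in> {1..m}" for s'
      using v(2)[OF that] by (elim disjE) auto
  qed
qed

text \<open>The attained pairs of all sizes earn at least 1 - 2 \<epsilon> times the optimum and use
  no more capacity. One of the two parity classes holds at least half of this, and the program
  outputs the better class.\<close>

lemma plan_stock_approximates:
  "does I \<epsilon> plan_stock init_state t_main (\<lambda>\<sigma>. stock \<sigma> \<in> feasible I \<and>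
     (1 / 2 - \<epsilon>) * Max (fluid_revenue I ` feasible I) \<le> fluid_revenue I (stock \<sigma>))"
proof -
  have "Max (fluid_revenue I ` feasible I) \<in> fluid_revenue I ` feasible I"
    using finite_feasible[OF inst] feasible_nonempty by (intro Max_in) auto
  then obtain c where c: "c \<in> feasible I" "fluid_revenue I c = Max (fluid_revenue I ` feasible I)" by auto
  have cap: "sum c (universe I) \<le> C" using c(1) by (simp add: feasible_def)
  have csum: "sum c (universe I) = (\<Sum>s=1..m. \<Sum>i\<in>bases_of I s. c (i, s))" by (rule sum_universe[OF inst])
  obtain \<tau> where \<tau>: "\<And>s. 0 \<le> \<tau> s"
    "\<And>s. s \<in> {1..m} \<Longrightarrow> live_size I s \<Longrightarrow> size_duration I s (\<lambda>i. real (c (i, s))) (\<tau> s) \<le> T"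
    "fluid_revenue I c \<le> (\<Sum>s=1..m. if live_size I s then size_value I s (\<lambda>i. c (i, s)) (\<tau> s) else 0)"
    by (rule fluid_revenue_le[OF inst, where c = c], rule that)
  define v where "v = (\<lambda>s. if live_size I s then size_value I s (\<lambda>i. c (i, s)) (\<tau> s) else 0)"
  have "\<exists>k t. s \<in> {1..m} \<longrightarrow> attains s k t \<and> k \<le> (\<Sum>i\<in>bases_of I s. c (i, s)) \<and> (1 - 2 * \<epsilon>) * v s \<le> t" for s
  proof (cases "s \<in> {1..m} \<and> live_size I s")
    case True
    have "(\<Sum>i\<in>bases_of I s. c (i, s)) \<le> (\<Sum>s=1..m. \<Sum>i\<in>bases_of I s. c (i, s))"
      by (rule member_le_sum) (use True in auto)
    hence "(\<Sum>i\<in>bases_of I s. c (i, s)) \<le> C" using cap csum by simp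
    thus ?thesis using achievable[of s "\<lambda>i. c (i, s)" "\<tau> s"] True \<tau> by (simp add: v_def)
  next
    case False
    thus ?thesis by (intro exI[of _ 0]) (auto simp: attains_def v_def)
  qed
  then obtain kk tt where kt: "\<And>s. s \<in> {1..m} \<Longrightarrow> attains s (kk s) (tt s)"
    "\<And>s. s \<in> {1..m} \<Longrightarrow> kk s \<le> (\<Sum>i\<in>bases_of I s. c (i, s))"
    "\<And>s. s \<in> {1..m} \<Longrightarrow> (1 - 2 * \<epsilon>) * v s \<le> tt s" by metis
  have sub: "targets s \<subseteq> {1..m}" for s by (auto simp: targets_def)
  have kk: "sum kk (targets s) \<le> C" for s
  proof -
    have "sum kk (targets s) \<le> sum kk {1..m}" by (rule sum_mono2) (use sub in auto)
    also have "\<dots> \<le> (\<Sum>s=1..m. \<Sum>i\<in>bases_of I s. c (i, s))" by (rule sum_mono) (rule kt)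
    finally show ?thesis using cap csum by simp
  qed
  have all: "{1..m} = targets (m + 1) \<union> targets (m + 2)" and "targets (m + 1) \<inter> targets (m + 2) = {}"
    by (auto simp: targets_def)
  hence split: "sum tt {1..m} = sum tt (targets (m + 1)) + sum tt (targets (m + 2))"
    unfolding all by (intro sum.union_disjoint) (simp_all add: targets_def)
  have "(1 - 2 * \<epsilon>) * fluid_revenue I c \<le> (1 - 2 * \<epsilon>) * sum v {1..m}"
    using \<tau>(3) eps by (intro mult_left_mono) (auto simp: v_def)
  also have "\<dots> \<le> sum tt {1..m}" unfolding sum_distrib_left by (rule sum_mono) (rule kt)
  finally have opt: "(1 - 2 * \<epsilon>) * fluid_revenue I c \<le> sum tt (targets (m + 1)) + sum tt (targets (m + 2))"
    using split by simp
  show ?thesis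
  proof (rule does_mono[OF plan_stock_correct[of kk tt] order_refl])
    fix \<sigma> assume "\<exists>s x. sound_plan s C x (stock \<sigma>) \<and>
      (\<forall>s\<in>{m + 1, m + 2}. sum kk (targets s) \<le> C \<longrightarrow> sum tt (targets s) \<le> x)"
    then obtain s x where x: "sound_plan s C x (stock \<sigma>)" "sum tt (targets (m + 1)) \<le> x" "sum tt (targets (m + 2)) \<le> x"
      using kk by auto
    have "(1 / 2 - \<epsilon>) * fluid_revenue I c \<le> x" using opt x(2,3) by (simp add: left_diff_distrib)
    thus "stock \<sigma> \<in> feasible I \<and>
        (1 / 2 - \<epsilon>) * Max (fluid_revenue I ` feasible I) \<le> fluid_revenue I (stock \<sigma>)"
      using sound_plan_revenue[OF x(1)] c(2) by simp
  qed (rule kt)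
qed

end

section \<open>The running time\<close>

lemma weight_ratio_ge_1:
  assumes "cftc_instance I" shows "1 \<le> weight_ratio I"
proof -
  have n: "1 \<in> {1..nbases I}" and pos: "\<And>i. i \<in> {1..nbases I} \<Longrightarrow> 0 < weight I i"
    using assms by (simp_all add: cftc_instance_def)
  have "Min (weight I ` {1..nbases I}) \<in> weight I ` {1..nbases I}" using n by (intro Min_in) auto
  hence "0 < Min (weight I ` {1..nbases I})" using pos by auto
  moreover have "Min (weight I ` {1..nbases I}) \<le> weight I 1" "weight I 1 \<le> Max (weight I ` {1..nbases I})"
    using n by auto
  ultimately show ?thesis by (simp add: weight_ratio_def)
qed

text \<open>For large \<open>\<epsilon>\<close> the base of the power may be smaller than 1.\<close>

lemma time_bound_ge:
  assumes I: "cftc_instance I" and \<epsilon>: "0 < \<epsilon>" and K: "0 \<le> K"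
  shows "exp (- K) \<le> time_bound K I \<epsilon>"
proof -
  define z where "z = real (nbases I) * real (max 1 (capacity I)) * weight_ratio I"
  define u where "u = 1 / \<epsilon>\<^sup>2"
  define c where "c = ln (max 2 (weight_ratio I))"
  note r = weight_ratio_ge_1[OF I]
  have nm: "1 \<le> real (nbases I)" "1 \<le> real (nsizes I)" using I by (simp_all add: cftc_instance_def)
  have "1 * 1 \<le> real (nbases I) * real (max 1 (capacity I))" by (rule mult_mono) (use nm in auto)
  from mult_right_mono[OF this, of "weight_ratio I"] have z: "weight_ratio I \<le> z" using r by (simp add: z_def)
  have u: "0 < u" using \<epsilon> by (simp add: u_def)
  have c0: "0 \<le> c" unfolding c_def by (rule ln_ge_zero) simp
  have "c \<le> max 2 (weight_ratio I) - 1" unfolding c_def by (rule ln_le_minus_one) simp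
  hence cz: "c \<le> z" using r z by simp
  have b: "0 < z * u" using z r u by simp
  \<comment> \<open>If the base y = z u is below 1, the exponent may hurt, but c <= z and y ln y >=
    y - 1 bound the damage by -1.\<close>
  have "- 1 \<le> u * c * ln (z * u)"
  proof (cases "0 \<le> ln (z * u)")
    case True
    hence "0 \<le> u * c * ln (z * u)" using u c0 by simp
    thus ?thesis by simp
  next
    case False
    have "y - 1 \<le> y * ln y" if y: "0 < y" for y :: real
    proof -
      have "- ln y \<le> inverse y - 1" using ln_le_minus_one[of "inverse y"] y by (simp add: ln_inverse)
      from mult_left_mono[OF this, of y] y show ?thesis by (simp add: right_diff_distrib)
    qed
    from this[OF b] have "z * u - 1 \<le> z * u * ln (z * u)" .
    also have "\<dots> = u * (z * ln (z * u))" by simp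
    also have "\<dots> \<le> u * (c * ln (z * u))"
      using False cz u by (intro mult_left_mono mult_right_mono_neg) auto
    finally show ?thesis using b by (simp add: mult.assoc)
  qed
  from mult_left_mono[OF this K] have "- K \<le> K * (u * c) * ln (z * u)" by (simp add: mult.assoc)
  hence "exp (- K) \<le> (z * u) powr (K * (u * c))" using z r u by (auto simp: powr_def)
  also have "\<dots> \<le> real (nsizes I) * (z * u) powr (K * (u * c))"
    using mult_right_mono[OF nm(2), of "(z * u) powr (K * (u * c))"] by simp
  also have "\<dots> = time_bound K I \<epsilon>" by (simp add: time_bound_def z_def u_def c_def)
  finally show ?thesis .
qed

lemma fluid_revenue_nothing:
  assumes I: "cftc_instance I" and c: "c \<in> feasible I" and z: "horizon I = 0 \<or> capacity I = 0"
  shows "fluid_revenue I c \<le> 0"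
proof -
  obtain \<tau> where \<tau>: "\<And>s. 0 \<le> \<tau> s"
    "\<And>s. s \<in> {1..nsizes I} \<Longrightarrow> live_size I s \<Longrightarrow> size_duration I s (\<lambda>i. real (c (i, s))) (\<tau> s) \<le> horizon I"
    "fluid_revenue I c \<le> (\<Sum>s=1..nsizes I. if live_size I s then size_value I s (\<lambda>i. c (i, s)) (\<tau> s) else 0)"
    by (rule fluid_revenue_le[OF I, where c = c], rule that)
  have "size_value I s (\<lambda>i. c (i, s)) (\<tau> s) \<le> 0" if s: "s \<in> {1..nsizes I}" "live_size I s" for s
  proof -
    interpret single_size "bases_of I s" "weight I" "type_a I s" "type_b I s"
      by (rule single_size_live[OF I s])
    have "min (real (c (i, s))) (weight I i * \<tau> s) \<le> 0" if i: "i \<in> bases_of I s" for i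
      using z
    proof
      assume "horizon I = 0"
      hence "\<not> 0 < \<tau> s" using \<tau>(2)[OF s] duration_strict[of 0 "\<tau> s" "\<lambda>i. real (c (i, s))"]
        by (auto simp: duration_def)
      hence "\<tau> s = 0" using \<tau>(1)[of s] by linarith
      thus ?thesis by simp
    next
      assume "capacity I = 0"
      hence "c (i, s) = 0" using c finite_universe[OF I] by (auto simp: feasible_def)
      thus ?thesis by simp
    qed
    thus ?thesis unfolding size_value_def
      by (intro sum_nonpos mult_nonneg_nonpos revenue_bases_nonneg[OF I])
  qed
  hence "(\<Sum>s=1..nsizes I. if live_size I s then size_value I s (\<lambda>i. c (i, s)) (\<tau> s) else 0) \<le> 0"
    by (intro sum_nonpos) auto
  thus ?thesis using \<tau>(3) by simp
qed

text \<open>For \<epsilon> >= 1/2 the guaranteed factor is not positive, and in the other cases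
  nothing can be sold; so the empty stock is good enough. The two steps are the test and
  \<open>Skip\<close>.\<close>

lemma degenerate_instance:
  assumes I: "cftc_instance I" and triv: "1 / 2 \<le> \<epsilon> \<or> horizon I = 0 \<or> capacity I = 0"
  shows "run I \<epsilon> plan_stock init_state 2 init_state" "stock init_state \<in> feasible I"
    "(1 / 2 - \<epsilon>) * Max (fluid_revenue I ` feasible I) \<le> fluid_revenue I (stock init_state)"
proof -
  show f0: "stock init_state \<in> feasible I" by (simp add: init_state_def feasible_def)
  have "run I \<epsilon> plan_stock init_state (Suc 1) init_state"
    unfolding plan_stock_def by (rule run.intros(7)[OF _ run.intros(1)]) (use triv in auto)
  thus "run I \<epsilon> plan_stock init_state 2 init_state" by (simp add: numeral_2_eq_2)
  have "(\<Sum>s=1..nsizes I. 0) \<le> fluid_revenue I (stock init_state)"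
    by (rule fluid_revenue_ge[OF I, where ?s0.0 = 0]) (simp_all add: init_state_def)
  hence ge: "0 \<le> fluid_revenue I (stock init_state)" by simp
  let ?R = "fluid_revenue I ` feasible I"
  have fin: "finite ?R" "?R \<noteq> {}" using finite_feasible[OF I] feasible_nonempty by auto
  have Max0: "0 \<le> Max ?R" using ge Max_ge[OF fin(1) imageI[OF f0, of "fluid_revenue I"]] by simp
  have "(1 / 2 - \<epsilon>) * Max ?R \<le> 0"
  proof (cases "1 / 2 \<le> \<epsilon>")
    case True
    thus ?thesis using Max0 by (intro mult_nonpos_nonneg) auto
  next
    case False
    hence "Max ?R \<le> 0" using fin triv fluid_revenue_nothing[OF I] by simp
    thus ?thesis using False by (intro mult_nonneg_nonpos) auto
  qed
  thus "(1 / 2 - \<epsilon>) * Max ?R \<le> fluid_revenue I (stock init_state)" using ge by simp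
qed

context algorithm
begin

text \<open>For one code the dominant cost is four nested loops, over bases, capacities, budgets and
  amounts, hence w^4; there are 2^B codes for each of the m sizes.\<close>

lemma t_main_le:
  assumes "n \<le> w" "C \<le> w" "nmax \<le> w" "B \<le> w" "1 \<le> w"
  shows "t_main \<le> 252 * (m * (2 ^ B * w ^ 4))"
proof -
  have w4: "1 \<le> w ^ 4" "w \<le> w ^ 4" using assms(5) self_le_power[of w 4] by auto
  have b: "1 \<le> (2::nat) ^ B" by simp
  have m1: "1 \<le> m" using inst by (simp add: cftc_instance_def)
  have "t_table \<le> (2 * w + 2) + (((w + 1) * (4 * w + 9) + 3) +
      ((w * (w * (9 * w + 2 * w + 18) + 2 + ((w + 1) * ((w + 1) * (10 * w + 4) + 4) + 2) + 3) + 2) + ((w + 1) * 6 + 2)))"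
    unfolding t_table_def by (intro add_mono mult_le_mono order_refl) (use assms in auto)
  also have "\<dots> \<le> 150 * w ^ 4"
  proof -
    \<comment> \<open>The coefficients of the polynomial on the left add up to 149. In terms of v =
      w - 1 the claim follows by comparing coefficients.\<close>
    obtain v where v: "w = v + 1" using assms(5) by (metis add.commute le_Suc_ex)
    show ?thesis unfolding v power4_eq_xxxx distrib_left distrib_right mult_1 mult_1_right mult.assoc by linarith
  qed
  finally have table: "t_table \<le> 150 * w ^ 4" .
  have "9 * B + 8 + (t_table + 2) + 1 \<le> 170 * w ^ 4" using table assms(4) w4 by linarith
  hence "t_codes \<le> 2 ^ B * (170 * w ^ 4) + 1" unfolding t_codes_def by (intro add_mono mult_le_mono) auto
  define X where "X = 2 ^ B * w ^ 4"
  have codes: "t_codes \<le> 170 * X + 1" using \<open>t_codes \<le> _\<close> by (simp add: X_def mult.left_commute)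
  have "1 * w ^ 4 \<le> X" unfolding X_def by (rule mult_le_mono1[OF b])
  hence X: "1 \<le> X" "w \<le> X" using w4 by linarith+
  have size: "t_size + 1 \<le> 225 * X" using codes X assms(2) unfolding t_size_def by linarith
  have nm: "n * m \<le> m * X" using assms(1) X by (simp add: mult.commute)
  have mX: "X \<le> m * X" using mult_le_mono1[OF m1, of X] by simp
  have "m * (t_size + 1) \<le> m * (225 * X)" by (rule mult_le_mono2[OF size])
  hence "m * (t_size + 1) \<le> 225 * (m * X)" by simp
  moreover have "6 * n + 3 * B \<le> 9 * X" using assms X by linarith
  ultimately have "t_main \<le> 252 * (m * X)" using nm mX X unfolding t_main_def by linarith
  thus ?thesis by (simp add: X_def)
qed

text \<open>The base of the power in \<open>time_bound\<close>.\<close>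

definition "input_size = real n * real C * (wmax / wmin) / \<epsilon>\<^sup>2"

lemma eps_inverse: "2 \<le> 1 / \<epsilon>" "2 * (1 / \<epsilon>) \<le> 1 / \<epsilon>\<^sup>2" "4 \<le> 1 / \<epsilon>\<^sup>2"
proof -
  show 1: "2 \<le> 1 / \<epsilon>" using eps by (simp add: divide_simps)
  have "2 * (1 / \<epsilon>) \<le> 1 / \<epsilon> * (1 / \<epsilon>)" using 1 eps by (intro mult_right_mono) auto
  thus 2: "2 * (1 / \<epsilon>) \<le> 1 / \<epsilon>\<^sup>2" by (simp add: power2_eq_square)
  show "4 \<le> 1 / \<epsilon>\<^sup>2" using 1 2 by linarith
qed

lemma input_size_ge:
  "real n * (1 / \<epsilon>\<^sup>2) \<le> input_size" "real C * (1 / \<epsilon>\<^sup>2) \<le> input_size" "1 \<le> input_size"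
  "reach \<le> input_size\<^sup>2"
proof -
  have nC: "1 \<le> real n" "1 \<le> real C" using n_pos capacity_pos by simp_all
  note r = ratio_ge_1
  have nCr: "1 * 1 \<le> real C * (wmax / wmin)" "1 * 1 \<le> real n * (wmax / wmin)"
    by (rule mult_mono; use nC r in simp)+
  have eq: "input_size = real n * (real C * (wmax / wmin)) * (1 / \<epsilon>\<^sup>2)"
    "input_size = real C * (real n * (wmax / wmin)) * (1 / \<epsilon>\<^sup>2)"
    by (simp_all add: input_size_def)
  have "real n * 1 \<le> real n * (real C * (wmax / wmin))" by (rule mult_left_mono) (use nCr in simp_all)
  thus 1: "real n * (1 / \<epsilon>\<^sup>2) \<le> input_size" unfolding eq(1) by (intro mult_right_mono) auto
  have "real C * 1 \<le> real C * (real n * (wmax / wmin))" by (rule mult_left_mono) (use nCr in simp_all)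
  thus "real C * (1 / \<epsilon>\<^sup>2) \<le> input_size" unfolding eq(2) by (intro mult_right_mono) auto
  have "1 * 1 \<le> real n * (1 / \<epsilon>\<^sup>2)" by (rule mult_mono) (use nC eps_inverse(3) in simp_all)
  thus "1 \<le> input_size" using 1 by simp
  \<comment> \<open>The constant 4 of \<open>reach\<close> is absorbed by the surplus C /
    \<epsilon>^4 in the square of \<open>input_size\<close>.\<close>
  have "1 * 4 \<le> real C * (1 / \<epsilon>\<^sup>2)\<^sup>2"
  proof (rule mult_mono)
    have "4 * 1 \<le> 1 / \<epsilon>\<^sup>2 * (1 / \<epsilon>\<^sup>2)" by (rule mult_mono) (use eps_inverse(3) in simp_all)
    thus "4 \<le> (1 / \<epsilon>\<^sup>2)\<^sup>2" by (simp add: power2_eq_square)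
  qed (use nC in simp_all)
  hence "(real n)\<^sup>2 * real C * (wmax / wmin)\<^sup>2 * 4 \<le> (real n)\<^sup>2 * real C * (wmax / wmin)\<^sup>2 * (real C * (1 / \<epsilon>\<^sup>2)\<^sup>2)"
    by (intro mult_left_mono) auto
  thus "reach \<le> input_size\<^sup>2"
    unfolding reach_def input_size_def by (simp add: power2_eq_square mult_ac)
qed

text \<open>Minimality of \<open>B\<close> gives (1 + \<delta>)^(B - 1) < \<open>reach\<close> <=
  \<open>input_size\<close>^2, and ln (1 + \<delta>) >= \<delta> / 2 = \<epsilon> / 32 turns this
  into B - 1 <= 64 / \<epsilon> * ln \<open>input_size\<close>. The leading 2 accounts for the last
  bit.\<close>

lemma codes_le: "2 ^ B \<le> 2 * input_size powr (64 * (1 / \<epsilon>))"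
proof (cases B)
  case 0
  have "input_size powr 0 \<le> input_size powr (64 * (1 / \<epsilon>))"
    using input_size_ge(3) eps by (intro powr_mono) auto
  thus ?thesis using 0 input_size_ge(3) by simp
next
  case (Suc b)
  have Y: "0 < input_size" using input_size_ge(3) by simp
  have "\<not> reach \<le> (1 + \<delta>) ^ b" using not_less_Least[of b "\<lambda>B. reach \<le> (1 + \<delta>) ^ B"] Suc by (simp add: B_def)
  hence "(1 + \<delta>) ^ b \<le> input_size\<^sup>2" using input_size_ge(4) by linarith
  hence "ln ((1 + \<delta>) ^ b) \<le> ln (input_size\<^sup>2)" using \<delta>_pos Y by (subst ln_le_cancel_iff) auto
  hence "real b * ln (1 + \<delta>) \<le> 2 * ln input_size" using \<delta>_pos Y by (simp add: ln_realpow)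
  moreover have "\<delta> / 2 \<le> ln (1 + \<delta>)"
  proof -
    have "\<delta> * \<delta> \<le> \<delta> * (1 / 2)" using \<delta>_pos by (intro mult_left_mono) auto
    thus ?thesis using ln_one_plus_pos_lower_bound[of \<delta>] \<delta>_pos unfolding power2_eq_square by linarith
  qed
  hence "real b * (\<delta> / 2) \<le> real b * ln (1 + \<delta>)" by (rule mult_left_mono) simp
  ultimately have "real b * \<delta> \<le> 4 * ln input_size" by simp
  hence "real b * \<epsilon> \<le> 64 * ln input_size" by (simp add: \<delta>_def)
  hence b: "real b \<le> 64 * (1 / \<epsilon>) * ln input_size" using eps by (simp add: divide_simps)
  have "(2::real) ^ b = exp (real b * ln 2)" by (simp add: exp_of_nat_mult)
  also have "real b * ln 2 \<le> real b * 1" using ln_2_less_1 by (intro mult_left_mono) auto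
  hence "exp (real b * ln 2) \<le> exp (64 * (1 / \<epsilon>) * ln input_size)" using b by simp
  also have "\<dots> = input_size powr (64 * (1 / \<epsilon>))" using Y by (simp add: powr_def)
  finally show ?thesis by (simp add: Suc)
qed

lemma t_main_bound: "real t_main \<le> 10 ^ 9 * time_bound 400 I \<epsilon>"
proof -
  \<comment> \<open>Applied with q = 1 / \<epsilon>, u = 1 / \<epsilon>^2 and p = u times the
    logarithm: 320 q <= 160 u and 4 <= u, while 400 p >= 200 u.\<close>
  have lin: "4 + 320 * q \<le> 400 * p" if "2 * q \<le> u" "4 \<le> u" "u * (1 / 2) \<le> p" for p q u :: real
    using that by linarith
  define Y where "Y = input_size"
  define \<beta> :: real where "\<beta> = 2 ^ B"
  \<comment> \<open>16 comes from 1 / \<delta> = 16 / \<epsilon> in the bound on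
    \<open>nmax\<close>; the factor \<beta> admits the simple estimate B <= 2^B.\<close>
  define w where "w = nat \<lceil>16 * Y * \<beta>\<rceil>"
  have Y: "1 \<le> Y" "real n * (1 / \<epsilon>\<^sup>2) \<le> Y" "real C * (1 / \<epsilon>\<^sup>2) \<le> Y" using input_size_ge by (simp_all add: Y_def)
  have \<beta>: "1 \<le> \<beta>" by (simp add: \<beta>_def)
  have Y\<beta>: "Y \<le> Y * \<beta>" "\<beta> \<le> Y * \<beta>" using mult_left_mono[OF \<beta>, of Y] mult_right_mono[OF Y(1), of \<beta>] Y \<beta> by auto
  have Y\<beta>1: "1 \<le> Y * \<beta>" using Y\<beta>(1) Y(1) by linarith
  have w: "16 * Y * \<beta> \<le> real w" "real w \<le> 17 * (Y * \<beta>)"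
  proof -
    show "16 * Y * \<beta> \<le> real w" unfolding w_def by (rule real_nat_ceiling_ge)
    have "real w = of_int \<lceil>16 * Y * \<beta>\<rceil>" using Y\<beta>1 by (simp add: w_def)
    also have "\<dots> \<le> 16 * Y * \<beta> + 1" by (rule of_int_ceiling_le_add_one)
    finally show "real w \<le> 17 * (Y * \<beta>)" using Y\<beta>1 by simp
  qed
  have le_w: "k \<le> w" if "real k \<le> 16 * (Y * \<beta>)" for k
    using that w(1) by simp
  have small: "x \<le> Y" if "x * (1 / \<epsilon>\<^sup>2) \<le> Y" "0 \<le> x" for x
    using that mult_left_mono[OF eps_inverse(3) that(2)] by linarith
  have "1 / \<epsilon> \<le> 1 / \<epsilon>\<^sup>2" using eps_inverse by linarith
  hence "real n * (1 / \<epsilon>) \<le> Y" using Y(2) mult_left_mono[of "1 / \<epsilon>" "1 / \<epsilon>\<^sup>2" "real n"] by linarith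
  moreover have "real nmax \<le> real n / \<delta>" using \<delta>_pos by (simp add: nmax_def)
  hence "real nmax \<le> 16 * (real n * (1 / \<epsilon>))" by (simp add: \<delta>_def mult.commute)
  ultimately have nmax: "nmax \<le> w" using Y\<beta> by (intro le_w) linarith
  have "real B \<le> \<beta>" unfolding \<beta>_def by (rule less_imp_le[OF of_nat_less_two_power])
  hence "B \<le> w" using Y\<beta> by (intro le_w) linarith
  moreover have "n \<le> w" "C \<le> w" using small[OF Y(2)] small[OF Y(3)] Y\<beta> by (intro le_w; linarith)+
  moreover have "1 \<le> w" using Y\<beta>1 by (intro le_w) linarith
  ultimately have "t_main \<le> 252 * (m * (2 ^ B * w ^ 4))" using nmax t_main_le by blast
  hence "real t_main \<le> real (252 * (m * (2 ^ B * w ^ 4)))" by (rule of_nat_mono)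
  also have "\<dots> = 252 * (real m * (\<beta> * real w ^ 4))" by (simp add: \<beta>_def)
  also have "\<dots> \<le> 252 * (real m * (\<beta> * (17 * (Y * \<beta>)) ^ 4))"
    using w(2) \<beta> by (intro mult_left_mono power_mono) auto
  \<comment> \<open>252 * 17^4 = 21047292, and 2^5 times this stays below 10^9. Four of the factors
    \<beta> stem from w^4, the fifth is the number of codes.\<close>
  also have "\<dots> = 21047292 * (real m * (Y ^ 4 * \<beta> ^ 5))" by (simp add: power_mult_distrib power_eq_if)
  also have "\<dots> \<le> 21047292 * (real m * (Y ^ 4 * (2 * Y powr (64 * (1 / \<epsilon>))) ^ 5))"
    using codes_le \<beta> Y by (intro mult_left_mono power_mono) (auto simp: \<beta>_def Y_def)
  also have "\<dots> = 673513344 * (real m * Y powr (4 + 320 * (1 / \<epsilon>)))"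
    using Y by (simp add: power_mult_distrib powr_add powr_power)
  also have "673513344 * (real m * Y powr (4 + 320 * (1 / \<epsilon>))) \<le> 10 ^ 9 * (real m * Y powr (400 * (1 / \<epsilon>\<^sup>2 * ln (max 2 (weight_ratio I)))))"
  proof (intro mult_mono powr_mono)
    have "ln 2 \<le> ln (max 2 (weight_ratio I))" by simp
    hence "1 / 2 \<le> ln (max 2 (weight_ratio I))" using ln2_ge_two_thirds by linarith
    hence "1 / \<epsilon>\<^sup>2 * (1 / 2) \<le> 1 / \<epsilon>\<^sup>2 * ln (max 2 (weight_ratio I))" by (intro mult_left_mono) auto
    thus "4 + 320 * (1 / \<epsilon>) \<le> 400 * (1 / \<epsilon>\<^sup>2 * ln (max 2 (weight_ratio I)))" using eps_inverse lin by blast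
  qed (use Y in auto)
  also have "\<dots> = 10 ^ 9 * time_bound 400 I \<epsilon>"
    using capacity_pos by (simp add: time_bound_def Y_def input_size_def weight_ratio_def wmax_def wmin_def max_def)
  finally show ?thesis .
qed

end

theorem theorem3:
  "\<exists>P K L. 0 < K \<and> 0 < L \<and>
     (\<forall>I \<epsilon>. cftc_instance I \<and> 0 < \<epsilon> \<longrightarrow>
        (\<exists>t \<sigma>. run I \<epsilon> P init_state t \<sigma> \<and>
          stock \<sigma> \<in> feasible I \<and>
          fluid_revenue I (stock \<sigma>) \<ge> (1/2 - \<epsilon>) * Max (fluid_revenue I ` feasible I) \<and>
          real t \<le> L * time_bound K I \<epsilon>))"
proof (rule exI[of _ plan_stock], rule exI[of _ 400], rule exI[of _ "10 ^ 9 + 2 * exp 400"], intro conjI allI impI)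
  \<comment> \<open>The second summand pays for the two steps on degenerate inputs, where
    \<open>time_bound\<close> may be as small as exp (-400).\<close>
  let ?L = "10 ^ 9 + 2 * exp 400 :: real"
  show "0 < (400 :: real)" "0 < ?L" by (simp_all add: add_pos_pos)
  fix I \<epsilon> assume "cftc_instance I \<and> 0 < (\<epsilon> :: real)"
  hence I: "cftc_instance I" and \<epsilon>: "0 < \<epsilon>" by auto
  have tb: "exp (- 400) \<le> time_bound 400 I \<epsilon>" by (rule time_bound_ge[OF I \<epsilon>]) simp
  hence tb0: "0 \<le> time_bound 400 I \<epsilon>" by (rule order_trans[OF exp_ge_zero])
  show "\<exists>t \<sigma>. run I \<epsilon> plan_stock init_state t \<sigma> \<and> stock \<sigma> \<in> feasible I \<and>
      (1/2 - \<epsilon>) * Max (fluid_revenue I ` feasible I) \<le> fluid_revenue I (stock \<sigma>) \<and>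
      real t \<le> ?L * time_bound 400 I \<epsilon>"
  proof (cases "1 / 2 \<le> \<epsilon> \<or> horizon I = 0 \<or> capacity I = 0")
    case True
    have "real 2 = 2 * exp 400 * exp (- 400)" by (simp add: exp_minus)
    also have "\<dots> \<le> 2 * exp 400 * time_bound 400 I \<epsilon>" using tb by (intro mult_left_mono) auto
    also have "\<dots> \<le> ?L * time_bound 400 I \<epsilon>" using tb0 by (intro mult_right_mono) auto
    finally show ?thesis using degenerate_instance[OF I True] by blast
  next
    case False
    interpret algorithm I \<epsilon>
      by standard (use I \<epsilon> False in \<open>auto simp: cftc_instance_def\<close>)
    obtain t \<sigma> where t: "t \<le> t_main" "run I \<epsilon> plan_stock init_state t \<sigma>" "stock \<sigma> \<in> feasible I"
      "(1 / 2 - \<epsilon>) * Max (fluid_revenue I ` feasible I) \<le> fluid_revenue I (stock \<sigma>)"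
      using plan_stock_approximates unfolding does_def by blast
    have "real t \<le> 10 ^ 9 * time_bound 400 I \<epsilon>" using t(1) t_main_bound by linarith
    also have "\<dots> \<le> ?L * time_bound 400 I \<epsilon>" using tb0 by (intro mult_right_mono) auto
    finally show ?thesis using t by blast
  qed
qed

end
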